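(* Let $V\subset\mathbb{R}^n$ be a non-singular irreducible real algebraic variety with coordinate ring $A=\mathbb{R}[V]$. Then the ring $\mathcal{R}^0(V)$ of continuous rational functions on $V$ has the substitution property over $A$ along arcs (both along algebraic formal arcs and along algebraic Puiseux arcs). Moreover, if $B$ is a subring of the field $\mathbb{R}(V)$ of rational functions on $V$, containing $\mathbb{R}[V]$, which has the substitution property over $A$ along arcs, then $B\subset\mathcal{R}^0(V)$.
   Context: $\mathcal{R}^0(V)$: continuous (Euclidean) functions $V\to\mathbb{R}$ whose restriction to some non-empty Zariski open subset is regular; viewed inside $\mathbb{R}(V)$. $\mathbb{R}[[t]]_{\mathrm{alg}}$: formal power series algebraic over $\mathbb{R}[t]$; $\mathbb{R}[[t^*]]_{\mathrm{alg}}$: Puiseux series $\sum_{i\ge0}a_it^{i/m}$ of non-negative order algebraic over $\mathbb{R}[t]$. An $A$-algebra $B$ has the substitution property along algebraic formal (resp. Puiseux) arcs if every $\mathbb{R}$-algebra homomorphism $A\to\mathbb{R}[[t]]_{\mathrm{alg}}$ (resp. $A\to\mathbb{R}[[t^*]]_{\mathrm{alg}}$) admits one and only one extension to a homomorphism from $B$. *)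

theory Defs
  imports "HOL-Analysis.Analysis"
          "HOL-Algebra.Subrings" "HOL-Algebra.RingHom"
          "HOL-Computational_Algebra.Polynomial_FPS"
begin

text \<open>Polynomial functions R^n -> R (R is infinite, so these are exactly the
  polynomials in n variables).\<close>
inductive_set polyfun :: "(real^'n \<Rightarrow> real) set" where
  pf_const: "(\<lambda>_. c) \<in> polyfun"
| pf_coord: "(\<lambda>x. x $ i) \<in> polyfun"
| pf_add: "p \<in> polyfun \<Longrightarrow> q \<in> polyfun \<Longrightarrow> (\<lambda>x. p x + q x) \<in> polyfun"
| pf_mult: "p \<in> polyfun \<Longrightarrow> q \<in> polyfun \<Longrightarrow> (\<lambda>x. p x * q x) \<in> polyfun"

definition zero_set :: "(real^'n \<Rightarrow> real) set \<Rightarrow> (real^'n) set" where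
  "zero_set P = {x. \<forall>p\<in>P. p x = 0}"

definition algebraic_set :: "(real^'n) set \<Rightarrow> bool" where
  "algebraic_set V \<longleftrightarrow> (\<exists>P \<subseteq> polyfun. V = zero_set P)"

definition irreducible_alg :: "(real^'n) set \<Rightarrow> bool" where
  "irreducible_alg V \<longleftrightarrow> algebraic_set V \<and> V \<noteq> {} \<and>
     (\<forall>W1 W2. algebraic_set W1 \<and> algebraic_set W2 \<and> V = W1 \<union> W2 \<longrightarrow> V = W1 \<or> V = W2)"

definition vanishing_ideal :: "(real^'n) set \<Rightarrow> (real^'n \<Rightarrow> real) set" where
  "vanishing_ideal V = {p \<in> polyfun. \<forall>x\<in>V. p x = 0}"

text \<open>Dimension: maximal length of a strictly increasing chain of irreducible
  algebraic subsets ending in V (= Krull dimension of R[V]).\<close>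
definition alg_dim :: "(real^'n) set \<Rightarrow> nat" where
  "alg_dim V = (GREATEST d. \<exists>W :: nat \<Rightarrow> (real^'n) set.
      (\<forall>i\<le>d. irreducible_alg (W i)) \<and> (\<forall>i<d. W i \<subset> W (Suc i)) \<and> W d = V)"

definition ideal_gradients :: "(real^'n) set \<Rightarrow> real^'n \<Rightarrow> (real^'n) set" where
  "ideal_gradients V x = {g. \<exists>p\<in>vanishing_ideal V. (p has_derivative (\<lambda>h. g \<bullet> h)) (at x)}"

text \<open>Non-singular (BCR 3.3): at every point the Jacobian of I(V) has rank n - dim V.\<close>
definition nonsingular_alg :: "(real^'n) set \<Rightarrow> bool" where
  "nonsingular_alg V \<longleftrightarrow>
     (\<forall>x\<in>V. dim (span (ideal_gradients V x)) = CARD('n) - alg_dim V)"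

type_synonym 'n rfrep = "(real^'n \<Rightarrow> real) \<times> (real^'n \<Rightarrow> real)"

definition rf_reps :: "(real^'n) set \<Rightarrow> 'n rfrep set" where
  "rf_reps V = {(p, q). p \<in> polyfun \<and> q \<in> polyfun \<and> (\<exists>x\<in>V. q x \<noteq> 0)}"

definition rf_rel :: "(real^'n) set \<Rightarrow> ('n rfrep \<times> 'n rfrep) set" where
  "rf_rel V = {((p, q), (p', q')). (p, q) \<in> rf_reps V \<and> (p', q') \<in> rf_reps V \<and>
                 (\<forall>x\<in>V. p x * q' x = p' x * q x)}"

definition rf_class :: "(real^'n) set \<Rightarrow> 'n rfrep \<Rightarrow> 'n rfrep set" where
  "rf_class V r = rf_rel V `` {r}"

definition rf_rep :: "'n rfrep set \<Rightarrow> 'n rfrep" where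
  "rf_rep F = (SOME r. r \<in> F)"

definition rf_add :: "(real^'n) set \<Rightarrow> 'n rfrep set \<Rightarrow> 'n rfrep set \<Rightarrow> 'n rfrep set" where
  "rf_add V F G = (case (rf_rep F, rf_rep G) of ((p, q), (p', q')) \<Rightarrow>
      rf_class V (\<lambda>x. p x * q' x + p' x * q x, \<lambda>x. q x * q' x))"

definition rf_mult :: "(real^'n) set \<Rightarrow> 'n rfrep set \<Rightarrow> 'n rfrep set \<Rightarrow> 'n rfrep set" where
  "rf_mult V F G = (case (rf_rep F, rf_rep G) of ((p, q), (p', q')) \<Rightarrow>
      rf_class V (\<lambda>x. p x * p' x, \<lambda>x. q x * q' x))"

text \<open>R(V) as a HOL-Algebra ring (a field when V is irreducible).\<close>
definition ratfun_ring :: "(real^'n) set \<Rightarrow> 'n rfrep set ring" where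
  "ratfun_ring V = \<lparr>carrier = rf_reps V // rf_rel V, monoid.mult = rf_mult V,
      one = rf_class V (\<lambda>_. 1, \<lambda>_. 1), zero = rf_class V (\<lambda>_. 0, \<lambda>_. 1), add = rf_add V\<rparr>"

definition coord_ring :: "(real^'n) set \<Rightarrow> 'n rfrep set set" where
  "coord_ring V = {rf_class V (p, \<lambda>_. 1) | p. p \<in> polyfun}"

definition rf_const :: "(real^'n) set \<Rightarrow> real \<Rightarrow> 'n rfrep set" where
  "rf_const V c = rf_class V (\<lambda>_. c, \<lambda>_. 1)"

text \<open>R^0(V): continuous functions V -> R whose restriction to a non-empty Zariski
  open subset U = V - W is regular (= p/q with q nowhere zero on U), viewed in R(V).\<close>
definition R0 :: "(real^'n) set \<Rightarrow> 'n rfrep set set" where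
  "R0 V = {rf_class V (p, q) | p q. p \<in> polyfun \<and> q \<in> polyfun \<and>
      (\<exists>f W. continuous_on V f \<and> algebraic_set W \<and> V - W \<noteq> {} \<and>
             (\<forall>x\<in>V - W. q x \<noteq> 0 \<and> f x = p x / q x))}"

definition fps_alg :: "real fps set" where
  "fps_alg = {f. \<exists>P :: real poly poly. P \<noteq> 0 \<and> poly (map_poly fps_of_poly P) f = 0}"

definition fps_alg_ring :: "real fps ring" where
  "fps_alg_ring = \<lparr>carrier = fps_alg, monoid.mult = (*), one = 1, zero = 0, add = (+)\<rparr>"

text \<open>Puiseux series of non-negative order: coefficient functions on the rationals
  supported in (1/m)N for some m > 0.\<close>
definition puiseux :: "(rat \<Rightarrow> real) set" where
  "puiseux = {c. \<exists>m::nat. m > 0 \<and>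
      (\<forall>r. c r \<noteq> 0 \<longrightarrow> (\<exists>i::nat. r = of_nat i / of_nat m))}"

definition pu_mult :: "(rat \<Rightarrow> real) \<Rightarrow> (rat \<Rightarrow> real) \<Rightarrow> (rat \<Rightarrow> real)" where
  "pu_mult c d = (\<lambda>r. \<Sum>s\<in>{s. 0 \<le> s \<and> s \<le> r \<and> c s \<noteq> 0}. c s * d (r - s))"

definition pu_const :: "real \<Rightarrow> (rat \<Rightarrow> real)" where
  "pu_const a = (\<lambda>r. if r = 0 then a else 0)"

definition pu_pow :: "(rat \<Rightarrow> real) \<Rightarrow> nat \<Rightarrow> (rat \<Rightarrow> real)" where
  "pu_pow c k = (pu_mult c ^^ k) (pu_const 1)"

definition pu_of_poly :: "real poly \<Rightarrow> (rat \<Rightarrow> real)" where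
  "pu_of_poly a = (\<lambda>r. if (\<exists>i::nat. r = of_nat i) then Polynomial.coeff a (nat \<lfloor>r\<rfloor>) else 0)"

definition puiseux_alg :: "(rat \<Rightarrow> real) set" where
  "puiseux_alg = {c \<in> puiseux. \<exists>(N::nat) (a :: nat \<Rightarrow> real poly). (\<exists>k\<le>N. a k \<noteq> 0) \<and>
      (\<forall>r. (\<Sum>k\<le>N. pu_mult (pu_of_poly (a k)) (pu_pow c k) r) = 0)}"

definition puiseux_alg_ring :: "(rat \<Rightarrow> real) ring" where
  "puiseux_alg_ring = \<lparr>carrier = puiseux_alg, monoid.mult = pu_mult, one = pu_const 1,
      zero = (\<lambda>_. 0), add = (\<lambda>c d r. c r + d r)\<rparr>"

definition subst_property ::
  "(real^'n) set \<Rightarrow> 'n rfrep set set \<Rightarrow> 'b ring \<Rightarrow> (real \<Rightarrow> 'b) \<Rightarrow> bool" where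
  "subst_property V B S \<kappa> \<longleftrightarrow>
     (\<forall>\<phi>. \<phi> \<in> ring_hom ((ratfun_ring V)\<lparr>carrier := coord_ring V\<rparr>) S \<and>
           (\<forall>c. \<phi> (rf_const V c) = \<kappa> c) \<longrightarrow>
        (\<exists>\<psi> \<in> ring_hom ((ratfun_ring V)\<lparr>carrier := B\<rparr>) S.
            (\<forall>a\<in>coord_ring V. \<psi> a = \<phi> a) \<and>
            (\<forall>\<psi>' \<in> ring_hom ((ratfun_ring V)\<lparr>carrier := B\<rparr>) S.
                (\<forall>a\<in>coord_ring V. \<psi>' a = \<phi> a) \<longrightarrow> (\<forall>b\<in>B. \<psi>' b = \<psi> b))))"

definition subst_formal_arcs :: "(real^'n) set \<Rightarrow> 'n rfrep set set \<Rightarrow> bool" where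
  "subst_formal_arcs V B \<longleftrightarrow> subst_property V B fps_alg_ring fps_const"

definition subst_puiseux_arcs :: "(real^'n) set \<Rightarrow> 'n rfrep set set \<Rightarrow> bool" where
  "subst_puiseux_arcs V B \<longleftrightarrow> subst_property V B puiseux_alg_ring pu_const"

end

theory Submission
  imports Defs "HOL-Complex_Analysis.Complex_Analysis" "HOL-Computational_Algebra.Fundamental_Theorem_Algebra"
begin

text \<open>
  A continuous rational function \<open>f = p / q\<close> can be evaluated along an algebraic arc even inside \<open>{q = 0}\<close>:
  since \<open>V\<close> is non-singular there is a polynomial vector field \<open>X\<close> tangent to \<open>V\<close> such that some derivative
  \<open>X\<^sup>k q\<close> is not identically zero along the arc.  If \<open>k\<close> is minimal, comparing Taylor coefficients along the
  integral curves of \<open>X\<close> gives \<open>f \<cdot> X\<^sup>k q = X\<^sup>k p\<close> on the arc, so \<open>f\<close> is there a bounded quotient of algebraic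
  series, hence an algebraic series.  For uniqueness put \<open>F = f \<cdot> X\<^sup>k q - X\<^sup>k p\<close> and
  \<open>h = \<Sum>\<^bsub>i<k\<^esub> (X\<^sup>i q)\<^sup>2\<close>; \<open>F\<close> vanishes where \<open>h\<close> does, so by the Lojasiewicz inequality \<open>F\<^sup>m\<close> is a multiple of
  \<open>h\<close> in the ring of continuous rational functions, and every extension kills \<open>h\<close>, hence \<open>F\<close>.
  Conversely, an element of a ring with the substitution property takes values at points through constant arcs;
  by uniqueness these values agree with the limits along all arcs, and curve selection turns a discontinuity into
  an arc along which this fails.
\<close>

text \<open>Non-singularity enters as one linear-algebra fact, the constant dimension of the
  gradient spaces of the vanishing ideal. It replaces local coordinates: a tangent vector at a point
  is spread by Cramer's rule to a polynomial field tangent everywhere, whose trajectory is a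
  convergent Lie series inside the variety. That some derivative of q survives is a Krull argument:
  if every iterated derivative along every tangent field vanished at w, then q would lie in the
  vanishing ideal plus every power of the maximal ideal of w, hence vanish on the variety because
  the vanishing ideal is prime. The field is chosen at the start of the arc, whereas k is minimal
  for the whole arc, since the lower derivatives must vanish identically along it before Taylor
  coefficients can be compared. Curve selection delivers arcs known to lie in the variety only at a
  null sequence of parameters. This is enough, because algebraic series converge and a convergent
  series vanishing on a null sequence is zero. It also allows Puiseux's theorem to be proved along
  sequences, where passing to a subsequence selects a branch.\<close>

hide_const (open) up_ring.monom up_ring.coeff module.smult
no_notation fps_nth (infixl "$" 75)

section \<open>Semialgebraic predicates and quantifier elimination\<close>

inductive_set pf :: "(('i => real) => real) set" where
  pf_const: "(%_. c) \<in> pf"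
| pf_var: "(%e. e i) \<in> pf"
| pf_add: "p \<in> pf ==> q \<in> pf ==> (%e. p e + q e) \<in> pf"
| pf_mult: "p \<in> pf ==> q \<in> pf ==> (%e. p e * q e) \<in> pf"

lemma pf_minus: "p \<in> pf ==> (%e. - p e) \<in> pf"
  using pf_mult[OF pf_const[of "-1"]] by simp

lemma pf_diff: "p \<in> pf ==> q \<in> pf ==> (%e. p e - q e) \<in> pf"
  using pf_add[OF _ pf_minus[of q], of p] by simp

lemma pf_sum: "(!!k. k \<in> I ==> p k \<in> pf) ==> (%e. \<Sum>k\<in>I. p k e) \<in> pf"
proof (induction I rule: infinite_finite_induct)
  case (insert x F)
  then show ?case using pf_add[of "p x" "%e. \<Sum>k\<in>F. p k e"] by simp
qed (simp_all add: pf_const)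

lemma pf_prod: "(!!k. k \<in> I ==> p k \<in> pf) ==> (%e. \<Prod>k\<in>I. p k e) \<in> pf"
proof (induction I rule: infinite_finite_induct)
  case (insert x F)
  then show ?case using pf_mult[of "p x" "%e. \<Prod>k\<in>F. p k e"] by simp
qed (simp_all add: pf_const)

lemma pf_power: "p \<in> pf ==> (%e. p e ^ n) \<in> pf"
  by (induction n) (auto intro: pf_const pf_mult)

lemmas pf_intros = pf_const pf_var pf_add pf_mult pf_minus pf_diff pf_sum pf_prod pf_power

text \<open>Environments are indexed by an arbitrary type so that substitution needs no renaming:
  sum types keep blocks of variables apart, and an option type adjoins a fresh variable.\<close>

lemma pf_subst:
  assumes "p \<in> pf" and "!!i. r i \<in> pf"
  shows "(%e. p (%i. r i e)) \<in> pf"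
  using assms(1)
proof induction
  case (pf_const c)
  show ?case by (rule pf.pf_const)
next
  case (pf_var i)
  show ?case using assms(2) by simp
next
  case (pf_add p q)
  then show ?case by (intro pf.pf_add)
next
  case (pf_mult p q)
  then show ?case by (intro pf.pf_mult)
qed

text \<open>Quantifier-free formulas given by their truth functions. Being extensional, the class
  may contain a predicate for which no formula has been written down, which
  \<open>SA_finitely_determined\<close> exploits.\<close>

inductive_set SA :: "(('i => real) => bool) set" where
  SA_pos: "p \<in> pf ==> (%e. p e > 0) \<in> SA"
| SA_not: "P \<in> SA ==> (%e. \<not> P e) \<in> SA"
| SA_conj: "P \<in> SA ==> Q \<in> SA ==> (%e. P e & Q e) \<in> SA"

lemma SA_disj: "P \<in> SA ==> Q \<in> SA ==> (%e. P e \<or> Q e) \<in> SA"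
  using SA_not[OF SA_conj[OF SA_not[of P] SA_not[of Q]]] by simp

lemma SA_less: "p \<in> pf ==> q \<in> pf ==> (%e. p e < q e) \<in> SA"
  using SA_pos[OF pf_diff, of q p] by simp

lemma SA_le: "p \<in> pf ==> q \<in> pf ==> (%e. p e \<le> q e) \<in> SA"
  using SA_not[OF SA_less, of q p] by (simp add: not_less)

lemma SA_eq: "p \<in> pf ==> q \<in> pf ==> (%e. p e = q e) \<in> SA"
proof -
  assume "p \<in> pf" "q \<in> pf"
  then have "(%e. p e \<le> q e & q e \<le> p e) \<in> SA" by (intro SA_conj SA_le)
  moreover have "(%e. p e \<le> q e & q e \<le> p e) = (%e. p e = q e)" by force
  ultimately show ?thesis by simp
qed

lemma SA_const: "(%_. b) \<in> SA"
  using SA_less[OF pf_const pf_const, of 0 "if b then 1 else 0"] by (cases b) auto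

lemma SA_ball: "finite I ==> (!!k. k \<in> I ==> P k \<in> SA) ==> (%e. \<forall>k\<in>I. P k e) \<in> SA"
proof (induction I rule: finite_induct)
  case (insert x F)
  then show ?case using SA_conj[of "P x" "%e. \<forall>k\<in>F. P k e"] by simp
qed (simp add: SA_const)

lemma SA_subst:
  assumes "P \<in> SA" and "!!i. r i \<in> pf"
  shows "(%e. P (%i. r i e)) \<in> SA"
  using assms
proof induction
  case (SA_pos p)
  then have "(%e. p (%i. r i e)) \<in> pf" by (rule pf_subst[of p r])
  then show ?case by (rule SA.SA_pos)
next
  case (SA_not P)
  show ?case by (rule SA.SA_not) (rule SA_not.IH[OF SA_not.prems])
next
  case (SA_conj P Q)
  show ?case by (rule SA.SA_conj) (rule SA_conj.IH[OF SA_conj.prems])+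
qed

lemma SA_cong:
  assumes "P \<in> SA" "!!e. Q e = P e"
  shows "Q \<in> SA"
proof -
  have "Q = P" by (rule ext) (rule assms(2))
  then show ?thesis using assms(1) by simp
qed

text \<open>Splitting on one condition at a time, a predicate that only sees finitely many truth
  values is a Boolean combination of them. Quantifier elimination thereby becomes semantic: it
  suffices to name finitely many conditions that decide the projected predicate.\<close>

lemma SA_finitely_determined:
  fixes P :: "('i => real) => bool"
  assumes "finite C" "C \<subseteq> SA"
    and "!!e e'. (!!c. c \<in> C ==> c e = c e') ==> P e = P e'"
  shows "P \<in> SA"
  using assms
proof (induction C arbitrary: P rule: finite_induct)
  case empty
  have "P e = P undefined" for e by (rule empty.prems(2)) simp
  then show ?case by (rule SA_cong[OF SA_const])
next
  case (insert c C)
  \<comment> \<open>The value of \<open>c\<close> is fixed to \<open>b\<close> by moving to some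
    environment that agrees on the other conditions, so that \<open>P1 b\<close> no longer depends
    on \<open>c\<close>.\<close>
  define P1 where "P1 b e = (\<exists>e'. c e' = b & (\<forall>d\<in>C. d e' = d e) & P e')" for b e
  have P1: "P1 b \<in> SA" for b
  proof (rule insert.IH)
    show "C \<subseteq> SA" using insert.prems(1) by auto
    fix e e' assume a: "!!d. d \<in> C ==> d e = d e'"
    have "(\<forall>d\<in>C. d x = d e) = (\<forall>d\<in>C. d x = d e')" for x
      by (rule ball_cong[OF refl]) (drule a, simp)
    then show "P1 b e = P1 b e'" unfolding P1_def by simp
  qed
  have c: "c \<in> SA" using insert.prems(1) by auto
  have "P e = ((c e & P1 True e) \<or> (\<not> c e & P1 False e))" for e
  proof
    assume "P e" then show "(c e & P1 True e) \<or> (\<not> c e & P1 False e)"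
      unfolding P1_def by (cases "c e") auto
  next
    assume "(c e & P1 True e) \<or> (\<not> c e & P1 False e)"
    then obtain e' where e': "c e' = c e" "\<forall>d\<in>C. d e' = d e" "P e'"
      unfolding P1_def by auto
    have "P e' = P e" by (rule insert.prems(2)) (use e' in auto)
    then show "P e" using e'(3) by simp
  qed
  then show ?case
    by (rule SA_cong[OF SA_disj[OF SA_conj[OF c P1] SA_conj[OF SA_not[OF c] P1]]])
qed

section \<open>Polynomials in one distinguished variable with the others as parameters\<close>

definition PP :: "nat => (('i => real) => real poly) set" where
  "PP n = {P. (\<forall>k. (%e. coeff (P e) k) \<in> pf) & (\<forall>e. degree (P e) \<le> n)}"

lemma PP_I: "(!!k. (%e. coeff (P e) k) \<in> pf) ==> (!!e. degree (P e) \<le> n) ==> P \<in> PP n"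
  by (simp add: PP_def)

lemma PP_coeff: "P \<in> PP n ==> (%e. coeff (P e) k) \<in> pf"
  by (simp add: PP_def)

lemma PP_degree: "P \<in> PP n ==> degree (P e) \<le> n"
  by (simp add: PP_def)

lemma PP_mono: "P \<in> PP n ==> n \<le> m ==> P \<in> PP m"
  by (auto simp: PP_def intro: order_trans)

lemma PP_pderiv: "P \<in> PP (Suc n) ==> (%e. pderiv (P e)) \<in> PP n"
proof (rule PP_I)
  assume P: "P \<in> PP (Suc n)"
  show "(%e. coeff (pderiv (P e)) k) \<in> pf" for k
    unfolding coeff_pderiv by (rule pf_mult[OF pf_const PP_coeff[OF P]])
  show "degree (pderiv (P e)) \<le> n" for e
    using PP_degree[OF P, of e] by (simp add: degree_pderiv)
qed

text \<open>The bound \<open>n\<close> is a formal degree, uniform in the environment; the actual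
  degree of \<open>P e\<close> drops where leading coefficients vanish, and this drop is what later
  arguments must control.\<close>

lemma pf_as_poly:
  assumes "p \<in> pf"
  shows "\<exists>n. \<exists>P\<in>PP n. \<forall>e a. p (e(i := a)) = poly (P e) a"
  using assms
proof induction
  case (pf_const c)
  have "(%_. [:c:]) \<in> PP 0" by (auto simp: PP_def coeff_pCons split: nat.splits intro: pf.pf_const)
  then show ?case by (intro exI[of _ 0] bexI[of _ "%_. [:c:]"]) auto
next
  case (pf_var j)
  show ?case
  proof (cases "j = i")
    case True
    have "(%_. [:0,1:]) \<in> PP 1" by (auto simp: PP_def intro: pf.pf_const)
    then show ?thesis using True by (intro exI[of _ 1] bexI[of _ "%_. [:0,1:]"]) auto
  next
    case False
    have "(%e. coeff [:e j:] k) \<in> pf" for k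
      by (cases k) (auto intro: pf_intros)
    then have "(%e. [:e j:]) \<in> PP 0" by (auto simp: PP_def)
    then show ?thesis using False by (intro exI[of _ 0] bexI[of _ "%e. [:e j:]"]) auto
  qed
next
  case (pf_add p q)
  then obtain n m P Q where P: "P \<in> PP n" "\<forall>e a. p (e(i := a)) = poly (P e) a"
    and Q: "Q \<in> PP m" "\<forall>e a. q (e(i := a)) = poly (Q e) a" by blast
  have "(%e. P e + Q e) \<in> PP (max n m)"
    using P Q by (auto simp: PP_def intro!: pf_intros degree_add_le intro: le_max_iff_disj[THEN iffD2])
  moreover have "\<forall>e a. p (e(i := a)) + q (e(i := a)) = poly (P e + Q e) a"
    unfolding P(2)[rule_format] Q(2)[rule_format] by simp
  ultimately show ?case by (intro exI[of _ "max n m"] bexI[of _ "%e. P e + Q e"])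
next
  case (pf_mult p q)
  then obtain n m P Q where P: "P \<in> PP n" "\<forall>e a. p (e(i := a)) = poly (P e) a"
    and Q: "Q \<in> PP m" "\<forall>e a. q (e(i := a)) = poly (Q e) a" by blast
  have "degree (P e * Q e) \<le> n + m" for e
    using P Q by (intro order_trans[OF degree_mult_le] add_mono) (auto simp: PP_def)
  then have "(%e. P e * Q e) \<in> PP (n + m)"
    using P Q by (auto simp: PP_def coeff_mult intro!: pf_intros)
  moreover have "\<forall>e a. p (e(i := a)) * q (e(i := a)) = poly (P e * Q e) a"
    unfolding P(2)[rule_format] Q(2)[rule_format] by simp
  ultimately show ?case by (intro exI[of _ "n + m"] bexI[of _ "%e. P e * Q e"])
qed

text \<open>Comparing two environments and two values at once is what makes it possible to carry a
  witness from the fibre over \<open>e\<close> to the fibre over \<open>e'\<close>.\<close>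

lemma SA_atoms:
  assumes "Q \<in> SA"
  shows "\<exists>n \<A>. finite \<A> & \<A> \<subseteq> PP n &
    (\<forall>e e' a a'. (\<forall>P\<in>\<A>. sgn (poly (P e) a) = sgn (poly (P e') a')) --> Q (e(i := a)) = Q (e'(i := a')))"
  using assms
proof induction
  case (SA_pos p)
  obtain n P where P: "P \<in> PP n" "\<forall>e a. p (e(i := a)) = poly (P e) a"
    using pf_as_poly[OF SA_pos, of i] by auto
  then show ?case
    by (intro exI[of _ n] exI[of _ "{P}"]) (auto simp: sgn_if simp del: fun_upd_apply split: if_splits)
next
  case (SA_not P)
  then show ?case by simp
next
  case (SA_conj P Q)
  from SA_conj.IH obtain n \<A> where A: "finite \<A>" "\<A> \<subseteq> PP n"
    "\<forall>e e' a a'. (\<forall>P\<in>\<A>. sgn (poly (P e) a) = sgn (poly (P e') a')) --> P (e(i := a)) = P (e'(i := a'))"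
    by blast
  from SA_conj.IH obtain m \<B> where B: "finite \<B>" "\<B> \<subseteq> PP m"
    "\<forall>e e' a a'. (\<forall>P\<in>\<B>. sgn (poly (P e) a) = sgn (poly (P e') a')) --> Q (e(i := a)) = Q (e'(i := a'))"
    by blast
  show ?case
  proof (intro exI[of _ "max n m"] exI[of _ "\<A> \<union> \<B>"] conjI allI impI)
    show "\<A> \<union> \<B> \<subseteq> PP (max n m)" using A B PP_mono by (metis (no_types, opaque_lifting) Un_least max.cobounded1 max.cobounded2 subset_iff)
    fix e e' a a' assume "\<forall>P\<in>\<A> \<union> \<B>. sgn (poly (P e) a) = sgn (poly (P e') a')"
    then show "(P (e(i := a)) & Q (e(i := a))) = (P (e'(i := a')) & Q (e'(i := a')))"
      using A(3) B(3) by (metis UnCI)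
  qed (use A B in auto)
qed

text \<open>The pseudo-division multiplies by squares of the leading coefficient, so that the signs at
  the roots of the divisor are preserved.\<close>

primrec prem :: "nat => real poly => nat => real poly => real poly" where
  "prem j q 0 p = p"
| "prem j q (Suc m) p = prem j q m (Polynomial.smult ((coeff q j)\<^sup>2) p
      - Polynomial.smult (coeff q j * coeff p (j + m)) (Polynomial.monom 1 m * q))"

lemma prem_degree:
  assumes "degree q = j" "degree p < j + m" "0 < j"
  shows "degree (prem j q m p) < j"
  using assms
proof (induction m arbitrary: p)
  case (Suc m)
  let ?c = "coeff q j"
  let ?r = "Polynomial.smult (?c\<^sup>2) p - Polynomial.smult (?c * coeff p (j + m)) (Polynomial.monom 1 m * q)"
  have "degree (Polynomial.monom 1 m * q) \<le> m + j"
    using Suc by (metis degree_mult_le degree_monom_eq zero_neq_one)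
  then have le: "degree ?r \<le> j + m"
    using Suc.prems by (intro degree_diff_le order_trans[OF degree_smult_le]) auto
  have "coeff (Polynomial.monom 1 m * q) (j + m) = ?c"
    by (simp add: coeff_monom_mult)
  then have "coeff ?r (j + m) = 0"
    by (simp add: power2_eq_square)
  then have "degree ?r < j + m" using le Suc.prems(3)
    by (metis coeff_0_degree_minus_1 degree_0 eq_zero_or_degree_less le_neq_implies_less leading_coeff_0_iff add_pos_nonneg zero_le)
  then show ?case using Suc.IH[of ?r] Suc.prems by simp
qed simp

lemma prem_sgn:
  assumes "poly q a = 0" "coeff q j ~= 0"
  shows "sgn (poly (prem j q m p) a) = sgn (poly p a)"
  using assms by (induction m arbitrary: p) (simp_all add: sgn_mult power2_eq_square)

lemma prem_coeff_pf:
  assumes "!!k. (%e. coeff (Q e) k) \<in> pf" "!!k. (%e. coeff (P e) k) \<in> pf"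
  shows "(%e. coeff (prem j (Q e) m (P e)) k) \<in> pf"
  using assms
proof (induction m arbitrary: P)
  case (Suc m)
  have sh: "(%e. if k < m then 0 else 1 * coeff (Q e) (k - m)) \<in> pf" for k
    using Suc.prems by (cases "k < m") (auto intro: pf_intros)
  have "(%e. coeff (Polynomial.smult ((coeff (Q e) j)\<^sup>2) (P e)
      - Polynomial.smult (coeff (Q e) j * coeff (P e) (j + m)) (Polynomial.monom 1 m * Q e)) k) \<in> pf" for k
    using Suc.prems sh by (auto simp: coeff_monom_mult intro!: pf_intros)
  then show ?case using Suc.IH Suc.prems by simp
qed simp

text \<open>\<open>poly_cutoff j\<close> forces the degree below \<open>j\<close> also in those
  environments where \<open>Q e\<close> does not have degree \<open>j\<close> and the
  pseudo-division is meaningless. Where it has, \<open>prem_degree\<close> shows that nothing is cut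
  off.\<close>

lemma prem_PP:
  assumes "Q \<in> PP n" "P \<in> PP n" "0 < j" "j \<le> Suc n'"
  shows "(%e. poly_cutoff j (prem j (Q e) m (P e))) \<in> PP n'"
proof (rule PP_I)
  fix k show "(%e. coeff (poly_cutoff j (prem j (Q e) m (P e))) k) \<in> pf"
    using assms by (cases "k < j") (auto simp: coeff_poly_cutoff PP_coeff intro!: prem_coeff_pf pf_intros)
next
  fix e
  show "degree (poly_cutoff j (prem j (Q e) m (P e))) \<le> n'"
    using assms by (intro degree_le) (auto simp: coeff_poly_cutoff)
qed

text \<open>Sign patterns are compared through bijections of the line instead of lists of ordered
  roots. Only the order of finitely many nodes is prescribed; past the previous largest node
  \<open>A\<close> the map is continued by the affine ray through the next value, which keeps it
  strictly increasing and onto.\<close>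

lemma strict_mono_interpolation:
  fixes N :: "real set"
  assumes "finite N" "!!x y. x \<in> N ==> y \<in> N ==> x < y ==> \<rho> x < (\<rho> y :: real)"
  shows "\<exists>\<Phi>. strict_mono \<Phi> & surj \<Phi> & (\<forall>x\<in>N. \<Phi> x = \<rho> x)"
  using assms
proof (induction N rule: finite_linorder_max_induct)
  case empty
  show ?case by (intro exI[of _ id]) (auto simp: strict_mono_def)
next
  case (insert b N)
  show ?case
  proof (cases "N = {}")
    case True
    have "surj (%x. x + (\<rho> b - b))" by (metis diff_add_cancel surj_def)
    then show ?thesis using True by (intro exI[of _ "%x. x + (\<rho> b - b)"]) (auto simp: strict_mono_def)
  next
    case False
    define A where "A = Max N"
    have A: "A \<in> N" "!!x. x \<in> N ==> x \<le> A" using insert False by (auto simp: A_def)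
    from insert obtain \<Phi> where P: "strict_mono \<Phi>" "surj \<Phi>" "\<forall>x\<in>N. \<Phi> x = \<rho> x" by auto
    have Ab: "A < b" using A insert by auto
    have rb: "\<rho> A < \<rho> b" using A insert.prems[of A b] Ab by auto
    define s where "s = (\<rho> b - \<rho> A) / (b - A)"
    have s: "s > 0" using Ab rb by (simp add: s_def)
    define \<Psi> where "\<Psi> x = (if x \<le> A then \<Phi> x else \<rho> A + s * (x - A))" for x
    have "strict_mono \<Psi>"
    proof (rule strict_monoI)
      fix x y :: real assume "x < y"
      consider "y \<le> A" | "x \<le> A" "A < y" | "A < x" by linarith
      then show "\<Psi> x < \<Psi> y"
      proof cases
        case 2
        have "\<Phi> x \<le> \<Phi> A" using 2 P(1) by (simp add: strict_mono_less_eq)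
        moreover have "0 < s * (y - A)" using s 2 by simp
        moreover have "\<Phi> A = \<rho> A" using P(3) A(1) by blast
        ultimately have "\<Phi> x < \<rho> A + s * (y - A)" by linarith
        then show ?thesis using 2 by (simp add: \<Psi>_def)
      qed (use \<open>x < y\<close> P(1) s in \<open>auto simp: \<Psi>_def strict_mono_less\<close>)
    qed
    moreover have "\<exists>x. \<Psi> x = y" for y
    proof (cases "y \<le> \<rho> A")
      case True
      obtain x where x: "\<Phi> x = y" using P(2) by (metis surjD)
      then have "\<Phi> x \<le> \<Phi> A" using True P(3) A by simp
      then have "x \<le> A" using P(1) by (simp add: strict_mono_less_eq)
      then show ?thesis using x by (auto simp: \<Psi>_def)
    next
      case False
      then have "(y - \<rho> A) / s > 0" using s by simp
      then show ?thesis using s by (intro exI[of _ "A + (y - \<rho> A) / s"]) (auto simp: \<Psi>_def)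
    qed
    moreover have "\<Psi> x = \<rho> x" if "x \<in> insert b N" for x
      using that A P(3) Ab by (auto simp: \<Psi>_def s_def)
    ultimately show ?thesis by (intro exI[of _ \<Psi>]) (auto simp: surj_def, metis)
  qed
qed

section \<open>Signs of a polynomial between consecutive zeros of its derivative\<close>

lemma poly_sgn_constant:
  fixes q :: "real poly"
  assumes "!!x. min a b \<le> x ==> x \<le> max a b ==> poly q x ~= 0"
  shows "sgn (poly q a) = sgn (poly q b)"
proof (rule ccontr)
  assume ne: "sgn (poly q a) ~= sgn (poly q b)"
  have *: False if "u < v" "sgn (poly q u) ~= sgn (poly q v)" "!!x. u \<le> x ==> x \<le> v ==> poly q x ~= 0" for u v
  proof -
    have "poly q u ~= 0" "poly q v ~= 0" using that by auto
    then have "poly q u * poly q v < 0" using that(2) by (auto simp: sgn_if mult_less_0_iff split: if_splits)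
    then obtain x where "u < x" "x < v" "poly q x = 0" using poly_IVT[OF \<open>u < v\<close>] by blast
    then show False using that(3)[of x] by simp
  qed
  consider "a < b" | "b < a" | "a = b" by linarith
  then show False by cases (use *[of a b] *[of b a] assms ne in auto)
qed

text \<open>By Rolle's theorem \<open>p\<close> is injective on the closed interval, so it has at
  most one root inside and the signs at the two ends decide everything. In the last claim the sum of
  the end signs picks the non-zero one when one end is itself a root; both cannot be.\<close>

lemma poly_between_sgn:
  fixes p :: "real poly"
  assumes AB: "A < B" and inj: "\<forall>x. A < x & x < B --> poly (pderiv p) x ~= 0"
  shows "poly p A * poly p B < 0 ==> \<exists>r. A < r & r < B & poly p r = 0"
    and "!!r x. A < r ==> r < B ==> poly p r = 0 ==> A \<le> x ==> x < r ==> sgn (poly p x) = sgn (poly p A) & poly p x ~= 0"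
    and "!!r x. A < r ==> r < B ==> poly p r = 0 ==> r < x ==> x \<le> B ==> sgn (poly p x) = sgn (poly p B) & poly p x ~= 0"
    and "!!r. A < r ==> r < B ==> poly p r = 0 ==> poly p A * poly p B < 0"
    and "!!x. \<not> poly p A * poly p B < 0 ==> A < x ==> x < B ==> sgn (poly p x) = sgn (sgn (poly p A) + sgn (poly p B))"
proof -
  have rolle: False if uv: "A \<le> u" "u < v" "v \<le> B" "poly p u = poly p v" for u v
  proof -
    obtain z where z: "u < z" "z < v" "poly p v - poly p u = (v - u) * poly (pderiv p) z"
      using poly_MVT[OF uv(2)] by blast
    then have "poly (pderiv p) z = 0" using uv by auto
    then show False using inj z uv by auto
  qed
  show 1: "poly p A * poly p B < 0 ==> \<exists>r. A < r & r < B & poly p r = 0"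
    using poly_IVT[OF AB] by blast
  show 2: "sgn (poly p x) = sgn (poly p A) & poly p x ~= 0" if "A < r" "r < B" "poly p r = 0" "A \<le> x" "x < r" for r x
  proof -
    have nz: "poly p y ~= 0" if "A \<le> y" "y < r" for y using rolle[of y r] that \<open>r < B\<close> \<open>poly p r = 0\<close> by auto
    have "sgn (poly p x) = sgn (poly p A)" by (rule poly_sgn_constant) (use nz that in auto)
    then show ?thesis using nz that by auto
  qed
  show 3: "sgn (poly p x) = sgn (poly p B) & poly p x ~= 0" if "A < r" "r < B" "poly p r = 0" "r < x" "x \<le> B" for r x
  proof -
    have nz: "poly p y ~= 0" if "r < y" "y \<le> B" for y using rolle[of r y] that \<open>A < r\<close> \<open>poly p r = 0\<close> by auto
    have "sgn (poly p x) = sgn (poly p B)" by (rule poly_sgn_constant) (use nz that in auto)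
    then show ?thesis using nz that by auto
  qed
  show 4: "poly p A * poly p B < 0" if r: "A < r" "r < B" "poly p r = 0" for r
  proof (rule ccontr)
    assume n: "\<not> poly p A * poly p B < 0"
    have nz: "poly p A ~= 0" "poly p B ~= 0" using 2[OF r, of A] 3[OF r, of B] r by auto
    have same: "sgn (poly p A) = sgn (poly p B)" using n nz by (auto simp: sgn_if mult_less_0_iff)
    \<comment> \<open>If both ends had the same sign and \<open>p\<close> vanished at
      \<open>r\<close>, the level \<open>m\<close>, half of the smaller end value in size, would be
      attained on both sides of \<open>r\<close>, against injectivity.\<close>
    define m where "m = min \<bar>poly p A\<bar> \<bar>poly p B\<bar> / 2 * sgn (poly p A)"
    have s: "sgn (poly p A) = 1 \<or> sgn (poly p A) = -1" using nz by (auto simp: sgn_if)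
    have m: "(poly p A - m) * (0 - m) < 0" "(0 - m) * (poly p B - m) < 0"
      using nz same s by (auto simp: m_def sgn_if mult_less_0_iff split: if_splits)
    have q: "poly (p - [:m:]) x = poly p x - m" for x by simp
    obtain u where u: "A < u" "u < r" "poly p u = m"
      using poly_IVT[OF r(1), of "p - [:m:]"] m(1) r by auto
    obtain v where v: "r < v" "v < B" "poly p v = m"
      using poly_IVT[OF r(2), of "p - [:m:]"] m(2) r by auto
    show False using rolle[of u v] u v by auto
  qed
  show "sgn (poly p x) = sgn (sgn (poly p A) + sgn (poly p B))" if n: "\<not> poly p A * poly p B < 0" and x: "A < x" "x < B" for x
  proof -
    have nr: "poly p y ~= 0" if "A < y" "y < B" for y using 4 n that by auto
    have nrA: "poly p y ~= 0" if "poly p A ~= 0" "A \<le> y" "y < B" for y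
      using nr[of y] that by (cases "y = A") auto
    have nrB: "poly p y ~= 0" if "poly p B ~= 0" "A < y" "y \<le> B" for y
      using nr[of y] that by (cases "y = B") auto
    have "\<not> (poly p A = 0 & poly p B = 0)" using rolle[of A B] AB by auto
    then consider "poly p A ~= 0" "poly p B ~= 0" | "poly p A ~= 0" "poly p B = 0" | "poly p A = 0" "poly p B ~= 0" by auto
    then show ?thesis
    proof cases
      case 1
      then have "sgn (poly p A) = sgn (poly p B)" using n by (auto simp: sgn_if mult_less_0_iff)
      moreover have "sgn (poly p x) = sgn (poly p A)"
        using nrA[OF 1(1)] x by (intro poly_sgn_constant) auto
      ultimately show ?thesis by (auto simp: sgn_if)
    next
      case 2
      have "sgn (poly p x) = sgn (poly p A)"
        using nrA[OF 2(1)] x by (intro poly_sgn_constant) auto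
      then show ?thesis using 2 by simp
    next
      case 3
      have "sgn (poly p x) = sgn (poly p B)"
        using nrB[OF 3(2)] x by (intro poly_sgn_constant) auto
      then show ?thesis using 3 by simp
    qed
  qed
qed

lemma poly_sgn_eventually_at_top: "\<forall>\<^sub>F x in at_top. sgn (poly p x) = sgn (lead_coeff (p :: real poly))"
proof (cases "p = 0")
  case False
  have pos: "\<forall>\<^sub>F x in at_top. 0 < poly q x" if q: "lead_coeff q > 0" for q :: "real poly"
    using poly_pinfty_gt_lc[OF q] q unfolding eventually_at_top_linorder
    by (meson less_le_trans)
  have "lead_coeff p > 0 \<or> lead_coeff (- p) > 0" using False leading_coeff_0_iff[of p] by (simp del: leading_coeff_0_iff) linarith
  then show ?thesis
  proof
    assume l: "lead_coeff p > 0"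
    show ?thesis using pos[OF l] by eventually_elim (use l in simp)
  next
    assume l: "lead_coeff (- p) > 0"
    show ?thesis using pos[OF l] by eventually_elim (use l in simp)
  qed
qed simp

text \<open>Since the derivative of \<open>p\<close> belongs to \<open>L\<close>, between
  consecutive roots of \<open>L\<close> the course of \<open>p\<close> is determined by its signs at
  these roots, which \<open>\<phi>\<close> already matches. Hence \<open>p\<close> has a root in a
  gap exactly when \<open>p2\<close> has one in the image gap, and \<open>\<phi>\<close> only has to
  be bent inside the gaps so that roots go to roots. The coefficient signs \<open>cf\<close> settle
  the behaviour at infinity and the zero polynomials.\<close>

lemma sign_conjugation_extend:
  fixes p p2 :: "real poly" and L :: "(real poly \<times> real poly) set"
  assumes L: "finite L" "(pderiv p, pderiv p2) \<in> L"
    and \<phi>: "strict_mono \<phi>" "surj \<phi>"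
    and sg: "!!q q' a. (q, q') \<in> L ==> sgn (poly q a) = sgn (poly q' (\<phi> a))"
    and root: "!!q q' a. (q, q') \<in> L ==> q ~= 0 ==> poly q a = 0 ==> sgn (poly p a) = sgn (poly p2 (\<phi> a))"
    and cf: "!!k. sgn (coeff p k) = sgn (coeff p2 k)"
  shows "\<exists>\<Phi>. strict_mono \<Phi> & surj \<Phi> & (\<forall>a. sgn (poly p a) = sgn (poly p2 (\<Phi> a))) &
     (\<forall>(q, q') \<in> L. \<forall>a. sgn (poly q a) = sgn (poly q' (\<Phi> a)))"
proof (cases "p = 0 \<or> p2 = 0")
  case True
  have "coeff p k = 0 \<longleftrightarrow> coeff p2 k = 0" for k
    using cf[of k] by (metis sgn_zero_iff)
  with True have "p = 0" "p2 = 0" by (auto simp: poly_eq_iff)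
  then show ?thesis using sg \<phi> by (intro exI[of _ \<phi>]) auto
next
  case False
  then have p0: "p ~= 0" "p2 ~= 0" by auto
  have mono: "\<phi> x < \<phi> y \<longleftrightarrow> x < y" "\<phi> x \<le> \<phi> y \<longleftrightarrow> x \<le> y" for x y
    using \<phi>(1) by (auto simp: strict_mono_less strict_mono_less_eq)
  have dz: "pderiv p = 0 \<longleftrightarrow> pderiv p2 = 0"
  proof -
    have "coeff (pderiv p) k = 0 \<longleftrightarrow> coeff (pderiv p2) k = 0" for k
      using cf[of "Suc k"] by (auto simp: coeff_pderiv sgn_if split: if_splits)
    then show ?thesis by (simp add: poly_eq_iff)
  qed
  have q0: "q = 0 \<longleftrightarrow> q' = 0" if "(q, q') \<in> L" for q q'
  proof
    assume "q = 0"
    then have "poly q' (\<phi> a) = 0" for a using sg[OF that, of a] by (simp add: sgn_zero_iff)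
    then have "poly q' y = 0" for y using \<phi>(2) by (metis surjD)
    then show "q' = 0" using poly_all_0_iff_0 by blast
  next
    assume "q' = 0"
    then have "poly q a = 0" for a using sg[OF that, of a] by (simp add: sgn_zero_iff)
    then show "q = 0" using poly_all_0_iff_0 by blast
  qed
  have deg: "degree p = degree p2" "sgn (lead_coeff p) = sgn (lead_coeff p2)"
  proof -
    have z: "coeff p k = 0 \<longleftrightarrow> coeff p2 k = 0" for k
      using cf[of k] by (metis sgn_zero_iff)
    have "degree p \<le> degree p2" using p0 z[of "degree p"] by (intro le_degree) simp
    moreover have "degree p2 \<le> degree p" using p0 z[of "degree p2"] by (intro le_degree) simp
    ultimately show "degree p = degree p2" by simp
    then show "sgn (lead_coeff p) = sgn (lead_coeff p2)" using cf by simp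
  qed
  define Z0 where "Z0 = (\<Union>(q, q')\<in>{x \<in> L. fst x ~= 0}. {a. poly q a = 0})"
  have fZ0: "finite Z0" unfolding Z0_def using L(1) by (auto intro!: finite_UN_I poly_roots_finite)
  have fR: "finite {a. poly p a = 0}" "finite {a. poly p2 a = 0}" using p0 poly_roots_finite by auto
  text \<open>Adding two far away points makes every component between consecutive nodes bounded.\<close>
  have "\<forall>\<^sub>F a in at_bot. (\<forall>x\<in>Z0 \<union> {a. poly p a = 0}. a < x) & (\<forall>x\<in>{a. poly p2 a = 0}. \<phi> a < x)
      & sgn (poly p a) = sgn (poly p2 (\<phi> a))"
  proof (intro eventually_conj)
    show "\<forall>\<^sub>F a in at_bot. \<forall>x\<in>Z0 \<union> {a. poly p a = 0}. a < x"
      using fZ0 fR by (intro eventually_ball_finite) (auto simp: eventually_gt_at_bot eventually_at_bot_dense)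
    have lim: "filterlim \<phi> at_bot at_bot"
      unfolding filterlim_at_bot eventually_at_bot_linorder
      by (metis \<phi>(2) mono(2) surjD)
    have "\<forall>\<^sub>F a in at_bot. \<forall>x\<in>{a. poly p2 a = 0}. a < x"
      using fR by (intro eventually_ball_finite) (auto simp: eventually_gt_at_bot eventually_at_bot_dense)
    then show "\<forall>\<^sub>F a in at_bot. \<forall>x\<in>{a. poly p2 a = 0}. \<phi> a < x"
      by (rule eventually_compose_filterlim[OF _ lim])
    have sb: "\<forall>\<^sub>F a in at_bot. sgn (poly q a) = sgn (lead_coeff q) * (- 1) ^ degree q"
      if "q ~= 0" for q :: "real poly"
    proof -
      let ?q = "pcompose q [:0, -1:]"
      have "lead_coeff ?q = lead_coeff q * (- 1) ^ degree q"
        using lead_coeff_comp[of "[:0,-1::real:]" q] by simp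
      moreover have "\<forall>\<^sub>F x in at_top. sgn (poly ?q x) = sgn (lead_coeff ?q)"
        by (rule poly_sgn_eventually_at_top)
      ultimately have "\<forall>\<^sub>F x in at_top. sgn (poly q (- x)) = sgn (lead_coeff q) * (- 1) ^ degree q"
        by (simp add: poly_pcompose sgn_mult)
      then show ?thesis unfolding at_bot_mirror eventually_filtermap .
    qed
    have 2: "\<forall>\<^sub>F a in at_bot. sgn (poly p2 (\<phi> a)) = sgn (lead_coeff p2) * (- 1) ^ degree p2"
      by (rule eventually_compose_filterlim[OF sb[OF p0(2)] lim])
    show "\<forall>\<^sub>F a in at_bot. sgn (poly p a) = sgn (poly p2 (\<phi> a))"
      using sb[OF p0(1)] 2 by eventually_elim (use deg in simp)
  qed
  from eventually_happens'[OF trivial_limit_at_bot_linorder this] obtain am where am: "\<forall>x\<in>Z0 \<union> {a. poly p a = 0}. am < x" "\<forall>x\<in>{a. poly p2 a = 0}. \<phi> am < x"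
      "sgn (poly p am) = sgn (poly p2 (\<phi> am))"
    by blast
  have "\<forall>\<^sub>F a in at_top. (\<forall>x\<in>Z0 \<union> {a. poly p a = 0} \<union> {am}. x < a) & (\<forall>x\<in>{a. poly p2 a = 0}. x < \<phi> a)
      & sgn (poly p a) = sgn (poly p2 (\<phi> a))"
  proof (intro eventually_conj)
    show "\<forall>\<^sub>F a in at_top. \<forall>x\<in>Z0 \<union> {a. poly p a = 0} \<union> {am}. x < a"
      using fZ0 fR by (intro eventually_ball_finite) (auto simp: eventually_gt_at_top)
    have lim: "filterlim \<phi> at_top at_top"
      unfolding filterlim_at_top eventually_at_top_linorder
      by (metis \<phi>(2) mono(2) surjD)
    have "\<forall>\<^sub>F a in at_top. \<forall>x\<in>{a. poly p2 a = 0}. x < a"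
      using fR by (intro eventually_ball_finite) (auto simp: eventually_gt_at_top)
    then show "\<forall>\<^sub>F a in at_top. \<forall>x\<in>{a. poly p2 a = 0}. x < \<phi> a"
      by (rule eventually_compose_filterlim[OF _ lim])
    have 2: "\<forall>\<^sub>F a in at_top. sgn (poly p2 (\<phi> a)) = sgn (lead_coeff p2)"
      by (rule eventually_compose_filterlim[OF poly_sgn_eventually_at_top lim])
    show "\<forall>\<^sub>F a in at_top. sgn (poly p a) = sgn (poly p2 (\<phi> a))"
      using poly_sgn_eventually_at_top[of p] 2 by eventually_elim (use deg in simp)
  qed
  from eventually_happens'[OF trivial_limit_at_top_linorder this] obtain ap where ap: "\<forall>x\<in>Z0 \<union> {a. poly p a = 0} \<union> {am}. x < ap" "\<forall>x\<in>{a. poly p2 a = 0}. x < \<phi> ap"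
      "sgn (poly p ap) = sgn (poly p2 (\<phi> ap))"
    by blast
  define Z where "Z = Z0 \<union> {am, ap}"
  have fZ: "finite Z" using fZ0 by (simp add: Z_def)
  have Zbd: "am \<le> z" "z \<le> ap" if "z \<in> Z" for z using that am(1) ap(1) by (auto simp: Z_def less_imp_le)
  have Zsg: "sgn (poly p z) = sgn (poly p2 (\<phi> z))" if "z \<in> Z" for z
    using that am(3) ap(3) root by (auto simp: Z_def Z0_def)
  have Zq: "poly q a ~= 0" if "(q, q') \<in> L" "q ~= 0" "a \<notin> Z" for q q' a
    using that by (force simp: Z_def Z0_def)
  define pr where "pr a = Max {z \<in> Z. z < a}" for a
  define su where "su a = Min {z \<in> Z. a < z}" for a
  have prsu: "pr a \<in> Z" "pr a < a" "su a \<in> Z" "a < su a" "!!z. z \<in> Z ==> z < a ==> z \<le> pr a"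
     "!!z. z \<in> Z ==> a < z ==> su a \<le> z" if "am < a" "a < ap" for a
  proof -
    have "am \<in> {z \<in> Z. z < a}" "ap \<in> {z \<in> Z. a < z}" using that by (auto simp: Z_def)
    then have ne: "{z \<in> Z. z < a} ~= {}" "{z \<in> Z. a < z} ~= {}" by blast+
    have fi: "finite {z \<in> Z. z < a}" "finite {z \<in> Z. a < z}" using fZ by simp_all
    have "pr a \<in> {z \<in> Z. z < a}" "su a \<in> {z \<in> Z. a < z}"
      unfolding pr_def su_def by (rule Max_in[OF fi(1) ne(1)], rule Min_in[OF fi(2) ne(2)])
    then show "pr a \<in> Z" "pr a < a" "su a \<in> Z" "a < su a" by auto
    show "!!z. z \<in> Z ==> z < a ==> z \<le> pr a" "!!z. z \<in> Z ==> a < z ==> su a \<le> z"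
      unfolding pr_def su_def using fZ by auto
  qed
  have gap: "x \<notin> Z" if "am < a" "a < ap" "pr a < x" "x < su a" "a \<notin> Z" for a x
    using prsu(5,6)[OF that(1,2), of x] that by (cases x a rule: linorder_cases) auto
  have pd0: "pderiv p ~= 0" if "poly p r = 0" for r
  proof
    assume "pderiv p = 0"
    then have "degree p = 0" by (simp add: pderiv_eq_0_iff)
    then obtain c where "p = [:c:]" by (rule degree_eq_zeroE)
    then show False using that p0 by auto
  qed
  have pd: "poly (pderiv p) x ~= 0" "poly (pderiv p2) (\<phi> x) ~= 0" if "x \<notin> Z" "pderiv p ~= 0" for x
  proof -
    show 1: "poly (pderiv p) x ~= 0" using Zq[OF L(2)] that by auto
    show "poly (pderiv p2) (\<phi> x) ~= 0" using sg[OF L(2), of x] 1 by (metis sgn_zero_iff)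
  qed
  have rin: "am < r" "r < ap" if "poly p r = 0" for r using that am ap by auto
  have rin2: "\<phi> am < r" "r < \<phi> ap" if "poly p2 r = 0" for r using that am ap by auto
  have pd_gap: "poly (pderiv p) x ~= 0" if "pderiv p ~= 0" "am < a" "a < ap" "a \<notin> Z" "pr a < x" "x < su a" for a x
    using pd(1)[OF gap[OF that(2,3,5,6,4)] that(1)] .
  have pd2_gap: "poly (pderiv p2) y ~= 0" if "pderiv p ~= 0" "am < a" "a < ap" "a \<notin> Z" "\<phi> (pr a) < y" "y < \<phi> (su a)" for a y
  proof -
    obtain x where x: "y = \<phi> x" using \<phi>(2) by (metis surjD)
    then have "pr a < x" "x < su a" using that mono by auto
    then show ?thesis using pd(2)[OF gap[OF that(2,3) _ _ that(4)] that(1)] x by blast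
  qed
  have chg: "poly p2 (\<phi> u) * poly p2 (\<phi> v) < 0 \<longleftrightarrow> poly p u * poly p v < 0" if "u \<in> Z" "v \<in> Z" for u v
    using Zsg[OF that(1)] Zsg[OF that(2)] by (auto simp: sgn_if mult_less_0_iff split: if_splits)
  \<comment> \<open>Nodes keep their image under \<open>\<phi>\<close>. A root of \<open>p\<close>
    inside a gap goes to the root of \<open>p2\<close> in the image gap, whose existence is shown in
    \<open>\<rho>R\<close>.\<close>
  define \<rho> where "\<rho> a = (if a \<in> Z then \<phi> a else (SOME y. \<phi> (pr a) < y & y < \<phi> (su a) & poly p2 y = 0))" for a
  have \<rho>Z: "\<rho> a = \<phi> a" if "a \<in> Z" for a using that by (simp add: \<rho>_def)
  have \<rho>R: "\<phi> (pr r) < \<rho> r" "\<rho> r < \<phi> (su r)" "poly p2 (\<rho> r) = 0" if r: "poly p r = 0" "r \<notin> Z" for r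
  proof -
    note ps = prsu[OF rin[OF r(1)]]
    have "poly p (pr r) * poly p (su r) < 0"
      by (rule poly_between_sgn(4)[where r = r]) (use ps r pd_gap[OF pd0[OF r(1)] rin[OF r(1)] r(2)] in auto)
    then have "poly p2 (\<phi> (pr r)) * poly p2 (\<phi> (su r)) < 0" using chg ps by blast
    then have "\<exists>y. \<phi> (pr r) < y & y < \<phi> (su r) & poly p2 y = 0"
      by (intro poly_between_sgn(1)) (use ps mono pd2_gap[OF pd0[OF r(1)] rin[OF r(1)] r(2)] in auto)
    from someI_ex[OF this] show "\<phi> (pr r) < \<rho> r" "\<rho> r < \<phi> (su r)" "poly p2 (\<rho> r) = 0"
      using r by (auto simp: \<rho>_def)
  qed
  define N where "N = Z \<union> {a. poly p a = 0}"
  have "\<rho> x < \<rho> y" if xy: "x \<in> N" "y \<in> N" "x < y" for x y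
  proof -
    consider "x \<in> Z" "y \<in> Z" | "x \<in> Z" "y \<notin> Z" "poly p y = 0" | "x \<notin> Z" "poly p x = 0" "y \<in> Z"
      | "x \<notin> Z" "poly p x = 0" "y \<notin> Z" "poly p y = 0" using xy by (auto simp: N_def)
    then show ?thesis
    proof cases
      case 1 then show ?thesis using \<rho>Z mono xy by simp
    next
      case 2
      then have "x \<le> pr y" using prsu(5)[OF rin[OF 2(3)]] xy by auto
      then have "\<phi> x \<le> \<phi> (pr y)" using mono by simp
      then show ?thesis using \<rho>R(1)[OF 2(3,2)] \<rho>Z[OF 2(1)] by simp
    next
      case 3
      then have "su x \<le> y" using prsu(6)[OF rin[OF 3(2)]] xy by auto
      then have "\<phi> (su x) \<le> \<phi> y" using mono by simp
      then show ?thesis using \<rho>R(2)[OF 3(2,1)] \<rho>Z[OF 3(3)] by simp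
    next
      case 4
      \<comment> \<open>Between two roots of \<open>p\<close> lies a zero of its derivative, hence a
        node, so the two roots sit in different gaps.\<close>
      obtain z where z: "x < z" "z < y" "poly p y - poly p x = (y - x) * poly (pderiv p) z"
        using poly_MVT[OF xy(3)] by blast
      then have "poly (pderiv p) z = 0" using 4 by auto
      then have "z \<in> Z" using pd(1) pd0[OF 4(2)] by blast
      then have "su x \<le> z" "z \<le> pr y" using prsu(6)[OF rin[OF 4(2)]] prsu(5)[OF rin[OF 4(4)]] z by auto
      then have "\<phi> (su x) \<le> \<phi> (pr y)" using mono by simp
      then show ?thesis using \<rho>R(2)[OF 4(2,1)] \<rho>R(1)[OF 4(4,3)] by simp
    qed
  qed
  then obtain \<Phi> where \<Phi>: "strict_mono \<Phi>" "surj \<Phi>" "\<forall>x\<in>N. \<Phi> x = \<rho> x"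
    using strict_mono_interpolation[of N \<rho>] fZ fR by (auto simp: N_def)
  have mono': "\<Phi> x < \<Phi> y \<longleftrightarrow> x < y" for x y using \<Phi>(1) by (auto simp: strict_mono_less)
  have \<Phi>Z: "\<Phi> z = \<phi> z" if "z \<in> Z" for z using that \<Phi>(3) \<rho>Z by (simp add: N_def)
  have amZ: "am \<in> Z" "ap \<in> Z" by (auto simp: Z_def)
  have P: "sgn (poly p a) = sgn (poly p2 (\<Phi> a))" for a
  proof -
    consider "a \<in> Z" | "a < am" | "ap < a" | "am < a" "a < ap" "a \<notin> Z"
      using amZ by (cases a am rule: linorder_cases; cases a ap rule: linorder_cases) auto
    then show ?thesis
    proof cases
      case 1 then show ?thesis using Zsg \<Phi>Z by simp
    next
      case 2
      have "sgn (poly p a) = sgn (poly p am)"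
        by (rule poly_sgn_constant) (use rin(1) 2 in fastforce)
      moreover have lt: "\<Phi> a < \<phi> am" using 2 mono'[of a am] \<Phi>Z[OF amZ(1)] by simp
      moreover have "sgn (poly p2 (\<Phi> a)) = sgn (poly p2 (\<phi> am))"
        by (rule poly_sgn_constant) (use rin2(1) lt in fastforce)
      ultimately show ?thesis using am(3) by simp
    next
      case 3
      have "sgn (poly p a) = sgn (poly p ap)"
        by (rule poly_sgn_constant) (use rin(2) 3 in fastforce)
      moreover have lt: "\<phi> ap < \<Phi> a" using 3 mono'[of ap a] \<Phi>Z[OF amZ(2)] by simp
      moreover have "sgn (poly p2 (\<Phi> a)) = sgn (poly p2 (\<phi> ap))"
        by (rule poly_sgn_constant) (use rin2(2) lt in fastforce)
      ultimately show ?thesis using ap(3) by simp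
    next
      case 4
      note ps = prsu[OF 4(1,2)]
      have lts: "\<phi> (pr a) < \<Phi> a" "\<Phi> a < \<phi> (su a)" using ps(2,4) mono'[of "pr a" a] mono'[of a "su a"] \<Phi>Z[OF ps(1)] \<Phi>Z[OF ps(3)] by simp_all
      show ?thesis
      proof (cases "pderiv p = 0")
        case True
        with dz have d0: "degree p = 0" "degree p2 = 0" by (simp_all add: pderiv_eq_0_iff)
        obtain c where c: "p = [:c:]" using d0(1) by (rule degree_eq_zeroE)
        obtain c' where c': "p2 = [:c':]" using d0(2) by (rule degree_eq_zeroE)
        show ?thesis using cf[of 0] by (simp add: c c')
      next
        case False
        have g1: "\<forall>x. pr a < x & x < su a --> poly (pderiv p) x ~= 0" using pd_gap[OF False 4] by blast
        have g2: "\<forall>x. \<phi> (pr a) < x & x < \<phi> (su a) --> poly (pderiv p2) x ~= 0" using pd2_gap[OF False 4] by blast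
        have AB: "pr a < su a" "\<phi> (pr a) < \<phi> (su a)" using ps mono by auto
        note b1 = poly_between_sgn[OF AB(1) g1] and b2 = poly_between_sgn[OF AB(2) g2]
        show ?thesis
        proof (cases "poly p (pr a) * poly p (su a) < 0")
          case True
          then obtain r where r: "pr a < r" "r < su a" "poly p r = 0" using b1(1) by blast
          have rZ: "r \<notin> Z" using gap[OF 4(1,2) r(1,2) 4(3)] .
          have prr: "pr r = pr a" "su r = su a"
          proof -
            note q = prsu[OF rin[OF r(3)]]
            show "pr r = pr a"
            proof (rule antisym)
              show "pr a \<le> pr r" using q(5)[OF ps(1)] r by simp
              have "\<not> (pr a < pr r)" using gap[OF 4(1,2) _ _ 4(3), of "pr r"] q(1,2) r by fastforce
              then show "pr r \<le> pr a" by simp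
            qed
            show "su r = su a"
            proof (rule antisym)
              show "su r \<le> su a" using q(6)[OF ps(3)] r by simp
              have "\<not> (su r < su a)" using gap[OF 4(1,2) _ _ 4(3), of "su r"] q(3,4) r by fastforce
              then show "su a \<le> su r" by simp
            qed
          qed
          have r2: "\<phi> (pr a) < \<Phi> r" "\<Phi> r < \<phi> (su a)" "poly p2 (\<Phi> r) = 0"
            using \<rho>R[OF r(3) rZ] \<Phi>(3) r(3) by (auto simp: prr N_def)
          consider "a < r" | "a = r" | "r < a" by linarith
          then show ?thesis
          proof cases
            case 1
            then have "\<Phi> a < \<Phi> r" using mono' by simp
            then show ?thesis using b1(2)[OF r, of a] b2(2)[OF r2, of "\<Phi> a"] 1 ps lts Zsg[OF ps(1)] by simp
          next
            case 2
            then show ?thesis using r r2 by simp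
          next
            case 3
            then have "\<Phi> r < \<Phi> a" using mono' by simp
            then show ?thesis using b1(3)[OF r, of a] b2(3)[OF r2, of "\<Phi> a"] 3 ps lts Zsg[OF ps(3)] by simp
          qed
        next
          case F: False
          then have "\<not> poly p2 (\<phi> (pr a)) * poly p2 (\<phi> (su a)) < 0" using chg ps by blast
          then show ?thesis using b1(5)[OF F] b2(5) ps lts Zsg[OF ps(1)] Zsg[OF ps(3)] by simp
        qed
      qed
    qed
  qed
  \<comment> \<open>Replacing \<open>\<phi>\<close> by \<open>\<Phi>\<close> moves points only
    inside gaps: a root of \<open>q'\<close> between \<open>\<phi> a\<close> and
    \<open>\<Phi> a\<close> would be the common image of a node \<open>x\<close>, but both maps put
    the images of \<open>a\<close> and \<open>x\<close> in the same order.\<close>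
  have Q: "sgn (poly q a) = sgn (poly q' (\<Phi> a))" if qL: "(q, q') \<in> L" for q q' a
  proof (cases "q = 0")
    case True then show ?thesis using q0[OF qL] by simp
  next
    case False
    show ?thesis
    proof (cases "a \<in> Z")
      case True then show ?thesis using \<Phi>Z sg[OF qL] by simp
    next
      case a: False
      have "sgn (poly q' (\<Phi> a)) = sgn (poly q' (\<phi> a))"
      proof (rule poly_sgn_constant, rule notI)
        fix y assume y: "min (\<Phi> a) (\<phi> a) \<le> y" "y \<le> max (\<Phi> a) (\<phi> a)" "poly q' y = 0"
        obtain x where x: "y = \<phi> x" using \<phi>(2) by (metis surjD)
        then have "poly q x = 0" using y(3) sg[OF qL, of x] by (simp add: sgn_zero_iff)
        then have xZ: "x \<in> Z" using Zq[OF qL False] by blast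
        then have "\<phi> x = \<Phi> x" using \<Phi>Z by simp
        moreover have "x ~= a" using xZ a by auto
        ultimately show False using y(1,2) x mono[of x a] mono[of a x] mono'[of x a] mono'[of a x]
          by (auto simp: min_def max_def split: if_splits)
      qed
      then show ?thesis using sg[OF qL] by simp
    qed
  qed
  show ?thesis using \<Phi> P Q by blast
qed

section \<open>Sign diagrams and the elimination of a quantifier\<close>

definition sign_conjugate :: "(('i => real) => real poly) set => ('i => real) => ('i => real) => bool" where
  "sign_conjugate \<A> e e' \<longleftrightarrow> (\<exists>\<phi>. strict_mono \<phi> & surj \<phi> &
     (\<forall>P\<in>\<A>. \<forall>a. sgn (poly (P e) a) = sgn (poly (P e') (\<phi> a))))"

text \<open>Finitely many quantifier-free conditions on the parameters decide the whole sign diagram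
  of the family, up to an increasing bijection of the line.\<close>

definition separated :: "(('i => real) => real poly) set => bool" where
  "separated \<A> \<longleftrightarrow> (\<exists>C \<subseteq> SA. finite C & (\<forall>e e'. (\<forall>c\<in>C. c e = c e') --> sign_conjugate \<A> e e'))"

definition coeff_signs :: "nat => (('i => real) => real poly) set => (('i => real) => bool) set" where
  "coeff_signs n \<A> = (\<Union>P\<in>\<A>. \<Union>k\<le>n. {%e. 0 < coeff (P e) k, %e. coeff (P e) k < 0})"

lemma coeff_signs_finite: "finite \<A> ==> finite (coeff_signs n \<A>)"
  by (simp add: coeff_signs_def)

lemma coeff_signs_SA: "\<A> \<subseteq> PP m ==> coeff_signs n \<A> \<subseteq> SA"
  unfolding coeff_signs_def
  by (auto intro!: SA_pos SA_less[where q = "%_. 0"] pf_const dest: subsetD simp: PP_coeff)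

lemma coeff_signs_D:
  assumes "\<forall>c\<in>coeff_signs n \<A>. c e = c e'" "P \<in> \<A>" "\<A> \<subseteq> PP n"
  shows "sgn (coeff (P e) k) = sgn (coeff (P e') k)"
proof (cases "k \<le> n")
  case True
  have "(%e. 0 < coeff (P e) k) \<in> coeff_signs n \<A>" "(%e. coeff (P e) k < 0) \<in> coeff_signs n \<A>"
    using True assms(2) by (auto simp: coeff_signs_def)
  from this[THEN assms(1)[rule_format]] show ?thesis by (auto simp: sgn_if)
next
  case False
  then have "coeff (P e) k = 0" "coeff (P e') k = 0"
    using assms(2,3) by (auto intro!: coeff_eq_0 dest!: subsetD[of \<A>] dest: PP_degree[of P n e] PP_degree[of P n e'] simp: not_le
      intro: le_less_trans)
  then show ?thesis by simp
qed

text \<open>At a root of \<open>Q e\<close> the sign of \<open>P e\<close> is that of its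
  pseudo-remainder, so the remainders supply the hypothesis \<open>root\<close> of
  \<open>sign_conjugation_extend\<close>. Every \<open>j\<close> up to \<open>Suc n\<close> is
  included because the degree of \<open>Q e\<close> varies with \<open>e\<close>;
  \<open>Suc (Suc n)\<close> division steps suffice as \<open>P e\<close> has degree at most
  \<open>Suc n\<close>.\<close>

lemma separated_step:
  fixes \<A> :: "(('i => real) => real poly) set"
  assumes fin: "finite \<A>" and A: "\<A> \<subseteq> PP (Suc n)" and P: "P \<in> PP (Suc n)"
    and dA: "(%e. pderiv (P e)) \<in> \<A>"
    and sep: "separated (\<A> \<union> (%(Q, j) e. poly_cutoff j (prem j (Q e) (Suc (Suc n)) (P e))) ` (\<A> \<times> {1..Suc n}))"
  shows "separated (insert P \<A>)"
proof -
  obtain C where C: "C \<subseteq> SA" "finite C" and sc: "!!e e'. \<forall>c\<in>C. c e = c e' ==>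
      sign_conjugate (\<A> \<union> (%(Q, j) e. poly_cutoff j (prem j (Q e) (Suc (Suc n)) (P e))) ` (\<A> \<times> {1..Suc n})) e e'"
    using sep unfolding separated_def by blast
  let ?C = "C \<union> coeff_signs (Suc n) (insert P \<A>)"
  have iA: "insert P \<A> \<subseteq> PP (Suc n)" using A P by simp
  have "sign_conjugate (insert P \<A>) e e'" if ag: "\<forall>c\<in>?C. c e = c e'" for e e'
  proof -
    have cs: "sgn (coeff (Q e) k) = sgn (coeff (Q e') k)" if "Q \<in> insert P \<A>" for Q k
      using coeff_signs_D[OF _ that iA] ag by blast
    have cz: "coeff (Q e) k = 0 \<longleftrightarrow> coeff (Q e') k = 0" if "Q \<in> insert P \<A>" for Q k
      using cs[OF that, of k] by (metis sgn_zero_iff)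
    let ?S = "%Q j e. poly_cutoff j (prem j (Q e) (Suc (Suc n)) (P e))"
    have S: "?S Q j \<in> (%(Q, j) e. poly_cutoff j (prem j (Q e) (Suc (Suc n)) (P e))) ` (\<A> \<times> {1..Suc n})"
      if "Q \<in> \<A>" "1 \<le> j" "j \<le> Suc n" for Q j
      using that by (intro image_eqI[of _ _ "(Q, j)"]) auto
    have "\<forall>c\<in>C. c e = c e'" using ag by blast
    from sc[OF this] obtain \<phi> where \<phi>: "strict_mono \<phi>" "surj \<phi>" and
      s: "!!T a. T \<in> \<A> \<union> (%(Q, j) e. poly_cutoff j (prem j (Q e) (Suc (Suc n)) (P e))) ` (\<A> \<times> {1..Suc n}) ==>
           sgn (poly (T e) a) = sgn (poly (T e') (\<phi> a))"
      unfolding sign_conjugate_def by blast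
    have s1: "!!Q a. Q \<in> \<A> ==> sgn (poly (Q e) a) = sgn (poly (Q e') (\<phi> a))"
      using s by blast
    have s2: "sgn (poly (poly_cutoff j (prem j (Q e) (Suc (Suc n)) (P e))) a)
           = sgn (poly (poly_cutoff j (prem j (Q e') (Suc (Suc n)) (P e'))) (\<phi> a))"
      if "Q \<in> \<A>" "1 \<le> j" "j \<le> Suc n" for Q j a
      using s[of "?S Q j" a, OF UnI2[OF S[OF that]]] by (simp only:)
    have rt: "sgn (poly (P e) a) = sgn (poly (P e') (\<phi> a))" if Q: "Q \<in> \<A>" "Q e ~= 0" "poly (Q e) a = 0" for Q a
    proof -
      let ?j = "degree (Q e)"
      have cQ: "coeff (Q e) k = 0 \<longleftrightarrow> coeff (Q e') k = 0" for k
        by (rule cz) (use Q in simp)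
      have dQ: "degree (Q e') = ?j"
      proof (rule antisym)
        show "degree (Q e') \<le> ?j" by (intro degree_le) (simp add: coeff_eq_0 flip: cQ)
        show "?j \<le> degree (Q e')" by (intro degree_le) (simp add: coeff_eq_0 cQ)
      qed
      have j: "1 \<le> ?j"
      proof (rule ccontr)
        assume "\<not> 1 \<le> ?j"
        then have "?j = 0" by simp
        then obtain c where "Q e = [:c:]" by (rule degree_eq_zeroE)
        then show False using Q by auto
      qed
      have jn: "?j \<le> Suc n" using Q A PP_degree by blast
      have co: "poly_cutoff ?j (prem ?j (Q x) (Suc (Suc n)) (P x)) = prem ?j (Q x) (Suc (Suc n)) (P x)"
        if "degree (Q x) = ?j" for x
      proof -
        have "degree (prem ?j (Q x) (Suc (Suc n)) (P x)) < ?j"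
          by (rule prem_degree) (use that j PP_degree[OF P, of x] in auto)
        then show ?thesis by (intro poly_eqI) (auto simp del: prem.simps simp: coeff_poly_cutoff coeff_eq_0)
      qed
      have "poly (Q e') (\<phi> a) = 0" using s1[OF Q(1), of a] Q(3) by (simp add: sgn_zero_iff)
      moreover have "coeff (Q e) ?j ~= 0" using Q by simp
      moreover have "coeff (Q e') ?j ~= 0" using Q cQ[of ?j] by simp
      ultimately show ?thesis
        using s2[OF Q(1) j jn, of a] prem_sgn[OF Q(3), of ?j] prem_sgn[of "Q e'" "\<phi> a" ?j]
        by (simp add: co[OF dQ] co[OF refl] del: prem.simps)
    qed
    let ?L = "(%Q. (Q e, Q e')) ` \<A>"
    have "\<exists>\<Phi>. strict_mono \<Phi> & surj \<Phi> & (\<forall>a. sgn (poly (P e) a) = sgn (poly (P e') (\<Phi> a))) &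
       (\<forall>(q, q') \<in> ?L. \<forall>a. sgn (poly q a) = sgn (poly q' (\<Phi> a)))"
    proof (rule sign_conjugation_extend[OF _ _ \<phi>])
      show "finite ?L" using fin by simp
      show "(pderiv (P e), pderiv (P e')) \<in> ?L" using dA by force
    qed (use s1 rt cs in auto)
    then show ?thesis unfolding sign_conjugate_def by auto
  qed
  moreover have "?C \<subseteq> SA & finite ?C" using C coeff_signs_SA[OF iA] coeff_signs_finite[of "insert P \<A>"] fin by auto
  ultimately show ?thesis unfolding separated_def by (intro exI[of _ ?C]) simp
qed

lemma sign_conjugate_mono: "sign_conjugate \<A> e e' ==> \<B> \<subseteq> \<A> ==> sign_conjugate \<B> e e'"
  unfolding sign_conjugate_def by blast

lemma separated_mono: "separated \<A> ==> \<B> \<subseteq> \<A> ==> separated \<B>"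
  unfolding separated_def using sign_conjugate_mono by metis

text \<open>Outer induction on the degree bound, inner induction on the number of polynomials that
  may exceed the smaller bound. Removing such a \<open>P\<close> adds its derivative and the
  remainders, which all satisfy the smaller bound and go into \<open>\<B>\<close>.\<close>

lemma separated_PP:
  fixes \<A> :: "(('i => real) => real poly) set"
  assumes "finite \<A>" "\<A> \<subseteq> PP n"
  shows "separated \<A>"
  using assms
proof (induction n arbitrary: \<A>)
  case 0
  have "sign_conjugate \<A> e e'" if ag: "\<forall>c\<in>coeff_signs 0 \<A>. c e = c e'" for e e'
  proof -
    have "sgn (poly (P e) a) = sgn (poly (P e') a)" if P: "P \<in> \<A>" for P a
    proof -
      have "degree (P x) = 0" for x using PP_degree[OF subsetD[OF 0(2) P], of x] by simp
      then have "poly (P x) a = coeff (P x) 0" for x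
        by (simp add: poly_altdef)
      then show ?thesis using coeff_signs_D[OF ag P 0(2)] by simp
    qed
    then show ?thesis unfolding sign_conjugate_def by (intro exI[of _ id]) (auto simp: strict_mono_def)
  qed
  with coeff_signs_SA[OF 0(2)] coeff_signs_finite[OF 0(1)] show ?case
    unfolding separated_def by (intro exI[of _ "coeff_signs 0 \<A>"] conjI allI impI)
next
  case (Suc n)
  have "separated (\<A> \<union> \<B>)" if "finite \<A>" "\<A> \<subseteq> PP (Suc n)" "finite \<B>" "\<B> \<subseteq> PP n" for \<A> \<B> :: "(('i => real) => real poly) set"
    using that
  proof (induction \<A> arbitrary: \<B> rule: finite_induct)
    case empty
    show ?case unfolding Un_empty_left by (rule Suc.IH[OF empty(2,3)])
  next
    case (insert P \<A>)
    let ?D = "\<A> \<union> \<B> \<union> {%e. pderiv (P e)}"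
    let ?R = "(%(Q, j) e. poly_cutoff j (prem j (Q e) (Suc (Suc n)) (P e))) ` (?D \<times> {1..Suc n})"
    have P: "P \<in> PP (Suc n)" using insert.prems by simp
    have D: "?D \<subseteq> PP (Suc n)" using insert.prems PP_pderiv[OF P] PP_mono[of _ n "Suc n"] by auto
    have "?R \<subseteq> PP n"
    proof
      fix S assume "S \<in> ?R"
      then obtain Q j where S: "S = (%e. poly_cutoff j (prem j (Q e) (Suc (Suc n)) (P e)))" "Q \<in> ?D" "1 \<le> j" "j \<le> Suc n"
        by auto
      have "Q \<in> PP (Suc n)" using S(2) D by blast
      then show "S \<in> PP n" unfolding S(1) by (rule prem_PP) (use P S in auto)
    qed
    then have "separated (\<A> \<union> (\<B> \<union> {%e. pderiv (P e)} \<union> ?R))"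
      by (intro insert.IH) (use insert.prems insert.hyps PP_pderiv[OF P] in \<open>auto simp del: prem.simps\<close>)
    then have s: "separated (?D \<union> ?R)" by (simp only: Un_assoc)
    have "separated (insert P ?D)"
      by (rule separated_step[OF _ D P _ s]) (use insert.hyps insert.prems in auto)
    then show ?case by (rule separated_mono) auto
  qed
  from this[of \<A> "{}"] show ?case using Suc.prems by simp
qed

text \<open>A witness \<open>a\<close> over \<open>e\<close> is carried to \<open>\<phi> a\<close>
  over any \<open>e'\<close> satisfying the same separating conditions, so these conditions decide
  the projection and \<open>SA_finitely_determined\<close> applies.\<close>

theorem SA_ex:
  fixes Q :: "('i => real) => bool"
  assumes "Q \<in> SA"
  shows "(%e. \<exists>a. Q (e(i := a))) \<in> SA"
proof -
  obtain n \<A> where A: "finite \<A>" "\<A> \<subseteq> PP n"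
    and Q: "!!e e' a a'. \<forall>P\<in>\<A>. sgn (poly (P e) a) = sgn (poly (P e') a') ==> Q (e(i := a)) = Q (e'(i := a'))"
    using SA_atoms[OF assms, of i] by auto
  obtain C where C: "C \<subseteq> SA" "finite C" and sc: "!!e e'. \<forall>c\<in>C. c e = c e' ==> sign_conjugate \<A> e e'"
    using separated_PP[OF A] unfolding separated_def by blast
  have imp: "\<exists>a. Q (e'(i := a))" if ag: "\<forall>c\<in>C. c e = c e'" and "\<exists>a. Q (e(i := a))" for e e'
  proof -
    from that(2) obtain a where a: "Q (e(i := a))" ..
    obtain \<phi> where "\<forall>P\<in>\<A>. \<forall>a. sgn (poly (P e) a) = sgn (poly (P e') (\<phi> a))"
      using sc[OF ag] unfolding sign_conjugate_def by blast
    then have "Q (e(i := a)) = Q (e'(i := \<phi> a))" by (intro Q) blast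
    then show ?thesis using a by blast
  qed
  show ?thesis
  proof (rule SA_finitely_determined[OF C(2,1)])
    fix e e' assume a: "!!c. c \<in> C ==> c e = c e'"
    then have "\<forall>c\<in>C. c e = c e'" "\<forall>c\<in>C. c e' = c e" by blast+
    then show "(\<exists>a. Q (e(i := a))) = (\<exists>a. Q (e'(i := a)))" using imp[of e e'] imp[of e' e] by blast
  qed
qed

text \<open>Away from the roots of the polynomials that are not identically zero on the fibre, all
  signs are locally constant. The contrapositive \<open>SA_boundary_root\<close> turns a boundary
  point of a fibre into a root of a polynomial with polynomial coefficients, the tool behind both
  the Lojasiewicz inequality and curve selection.\<close>

lemma SA_fibre_locally_constant:
  fixes Q :: "('i => real) => bool"
  assumes "Q \<in> SA"
  shows "\<exists>n \<A>. finite \<A> & \<A> \<subseteq> PP n & (\<forall>e y. (\<forall>P\<in>\<A>. P e = 0 \<or> poly (P e) y ~= 0) -->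
     (\<forall>\<^sub>F z in nhds y. Q (e(i := z)) = Q (e(i := y))))"
proof -
  obtain n \<A> where A: "finite \<A>" "\<A> \<subseteq> PP n"
    and Q: "!!e e' a a'. \<forall>P\<in>\<A>. sgn (poly (P e) a) = sgn (poly (P e') a') ==> Q (e(i := a)) = Q (e'(i := a'))"
    using SA_atoms[OF assms, of i] by auto
  have "\<forall>\<^sub>F z in nhds y. Q (e(i := z)) = Q (e(i := y))" if h: "\<forall>P\<in>\<A>. P e = 0 \<or> poly (P e) y ~= 0" for e y
  proof -
    have "\<forall>\<^sub>F z in nhds y. sgn (poly (P e) z) = sgn (poly (P e) y)" if P: "P \<in> \<A>" for P
    proof (cases "P e = 0")
      case False
      have lim: "((%z. poly (P e) z) \<longlongrightarrow> poly (P e) y) (nhds y)"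
        using tendsto_poly[OF tendsto_ident_at[of y UNIV], of "P e"] by (simp add: tendsto_at_iff_tendsto_nhds)
      have "poly (P e) y > 0 \<or> poly (P e) y < 0" using h P False by fastforce
      then show ?thesis
      proof
        assume g: "poly (P e) y > 0"
        show ?thesis using order_tendstoD(1)[OF lim g] by eventually_elim (use g in simp)
      next
        assume g: "poly (P e) y < 0"
        show ?thesis using order_tendstoD(2)[OF lim g] by eventually_elim (use g in simp)
      qed
    qed simp
    then have "\<forall>\<^sub>F z in nhds y. \<forall>P\<in>\<A>. sgn (poly (P e) z) = sgn (poly (P e) y)"
      using A(1) by (intro eventually_ball_finite) auto
    then show ?thesis by eventually_elim (rule Q)
  qed
  then show ?thesis using A by blast
qed

section \<open>Algebraic power series\<close>

text \<open>Linear algebra over the fraction field of \<open>K\<close> is done inside the domain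
  itself, by carrying non-zero denominators from \<open>K\<close>. The rings \<open>K\<close> in
  view are the polynomials in a power of the variable, inside the power series.\<close>

locale coeff_ring =
  fixes K :: "'a::idom set"
  assumes zero: "0 \<in> K" and one: "1 \<in> K"
    and add: "a \<in> K ==> b \<in> K ==> a + b \<in> K"
    and mult: "a \<in> K ==> b \<in> K ==> a * b \<in> K"
    and uminus: "a \<in> K ==> - a \<in> K"
begin

lemma diff: "a \<in> K ==> b \<in> K ==> a - b \<in> K"
  using add[of a "- b"] uminus[of b] by simp

lemma sum: "(!!i. i \<in> I ==> f i \<in> K) ==> sum f I \<in> K"
  by (induction I rule: infinite_finite_induct) (auto simp: zero add)

lemma power: "a \<in> K ==> a ^ n \<in> K"
  by (induction n) (auto simp: one mult)

definition algebraic :: "'a => bool" where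
  "algebraic y \<longleftrightarrow> (\<exists>n c. (\<forall>k. c k \<in> K) & (\<exists>k\<le>n. c k ~= 0) & (\<Sum>k\<le>n. c k * y ^ k) = 0)"

text \<open>Fraction-free elimination: a pivot \<open>v j0 i0\<close> clears the equation
  \<open>i0\<close> by cross-multiplication, and the solution of the smaller system is extended to
  \<open>j0\<close>.\<close>

lemma linear_dependence:
  assumes "finite I" "finite J" "card I < card J" "!!j i. v j i \<in> K"
  shows "\<exists>c. (\<forall>j. c j \<in> K) & (\<exists>j\<in>J. c j ~= 0) & (\<forall>i\<in>I. (\<Sum>j\<in>J. c j * v j i) = 0)"
  using assms
proof (induction I arbitrary: J v rule: finite_induct)
  case empty
  then have "J ~= {}" by auto
  then show ?case by (intro exI[of _ "%_. 1"]) (auto simp: one)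
next
  case (insert i0 I)
  show ?case
  proof (cases "\<forall>j\<in>J. v j i0 = 0")
    case True
    have "card I < card J" using insert.prems insert.hyps by simp
    from insert.IH[OF insert.prems(1) this, of v] insert.prems(3) obtain c where
      c: "\<forall>j. c j \<in> K" "\<exists>j\<in>J. c j ~= 0" "\<forall>i\<in>I. (\<Sum>j\<in>J. c j * v j i) = 0" by auto
    moreover have "(\<Sum>j\<in>J. c j * v j i0) = 0" using True by simp
    ultimately show ?thesis by auto
  next
    case False
    then obtain j0 where j0: "j0 \<in> J" "v j0 i0 ~= 0" by blast
    define J' where "J' = J - {j0}"
    define w where "w j i = v j0 i0 * v j i - v j i0 * v j0 i" for j i
    have fJ': "finite J'" using insert.prems by (simp add: J'_def)
    have "card I < card J'" using insert.prems insert.hyps j0 by (simp add: J'_def)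
    from insert.IH[OF fJ' this, of w] obtain c where
      c: "\<forall>j. c j \<in> K" "\<exists>j\<in>J'. c j ~= 0" "\<forall>i\<in>I. (\<Sum>j\<in>J'. c j * w j i) = 0"
      using insert.prems(3) by (auto simp: w_def mult diff)
    define d where "d j = (if j = j0 then - (\<Sum>j\<in>J'. c j * v j i0) else c j * v j0 i0)" for j
    have sJ: "(\<Sum>j\<in>J. d j * v j i) = (\<Sum>j\<in>J'. c j * w j i)" for i
    proof -
      have "(\<Sum>j\<in>J. d j * v j i) = d j0 * v j0 i + (\<Sum>j\<in>J'. d j * v j i)"
        using j0 insert.prems(1) by (simp add: J'_def sum.remove)
      also have "(\<Sum>j\<in>J'. d j * v j i) = (\<Sum>j\<in>J'. c j * v j0 i0 * v j i)"
        by (rule sum.cong) (auto simp: d_def J'_def)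
      also have "d j0 * v j0 i = - (\<Sum>j\<in>J'. c j * v j i0 * v j0 i)"
        by (simp add: d_def sum_distrib_right)
      finally show ?thesis by (simp add: w_def algebra_simps sum_subtractf)
    qed
    have "(\<Sum>j\<in>J'. c j * w j i0) = 0" by (simp add: w_def algebra_simps)
    then have "\<forall>i\<in>insert i0 I. (\<Sum>j\<in>J. d j * v j i) = 0" using c(3) by (simp add: sJ)
    moreover have "\<forall>j. d j \<in> K" using c(1) insert.prems(3) by (auto simp: d_def intro!: uminus sum mult)
    moreover have "\<exists>j\<in>J. d j ~= 0" using c(2) j0 by (auto simp: d_def J'_def)
    ultimately show ?thesis by blast
  qed
qed

text \<open>The elements of the domain that lie in the span of the family over the fraction field of
  \<open>K\<close>. An element of \<open>stab\<close> acts on this finite-dimensional space by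
  multiplication.\<close>

definition spanQ :: "'i set => ('i => 'a) => 'a set" where
  "spanQ I u = {z. \<exists>D a. D \<in> K & D ~= 0 & (\<forall>i. a i \<in> K) & D * z = (\<Sum>i\<in>I. a i * u i)}"

definition stab :: "'i set => ('i => 'a) => 'a set" where
  "stab I u = {y. \<forall>i\<in>I. y * u i \<in> spanQ I u}"

lemma spanQ_base: "finite I ==> i \<in> I ==> u i \<in> spanQ I u"
  unfolding spanQ_def by (intro CollectI exI[of _ 1] exI[of _ "%j. if j = i then 1 else 0"])
    (auto simp: one zero if_distrib[of "%x. x * _"] cong: if_cong)

lemma spanQ_zero: "0 \<in> spanQ I u"
  unfolding spanQ_def by (intro CollectI exI[of _ 1] exI[of _ "%_. 0"]) (auto simp: one zero)

lemma spanQ_add: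
  assumes "x \<in> spanQ I u" "y \<in> spanQ I u" shows "x + y \<in> spanQ I u"
proof -
  obtain D a where D: "D \<in> K" "D ~= 0" "\<forall>i. a i \<in> K" "D * x = (\<Sum>i\<in>I. a i * u i)" using assms(1) by (auto simp: spanQ_def)
  obtain E b where E: "E \<in> K" "E ~= 0" "\<forall>i. b i \<in> K" "E * y = (\<Sum>i\<in>I. b i * u i)" using assms(2) by (auto simp: spanQ_def)
  have "(D * E) * (x + y) = E * (D * x) + D * (E * y)" by (simp add: algebra_simps)
  also have "\<dots> = (\<Sum>i\<in>I. (E * a i + D * b i) * u i)" unfolding D(4) E(4)
    by (simp add: sum_distrib_left sum.distrib algebra_simps)
  finally show ?thesis unfolding spanQ_def using D E
    by (intro CollectI exI[of _ "D * E"] exI[of _ "%i. E * a i + D * b i"]) (auto intro: add mult)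
qed

lemma spanQ_sum: "(!!j. j \<in> J ==> f j \<in> spanQ I u) ==> sum f J \<in> spanQ I u"
  by (induction J rule: infinite_finite_induct) (auto simp: spanQ_zero spanQ_add)

lemma spanQ_scale:
  assumes "x \<in> spanQ I u" "k \<in> K" shows "k * x \<in> spanQ I u"
proof -
  obtain D a where D: "D \<in> K" "D ~= 0" "\<forall>i. a i \<in> K" "D * x = (\<Sum>i\<in>I. a i * u i)" using assms(1) by (auto simp: spanQ_def)
  have "D * (k * x) = k * (D * x)" by (simp add: algebra_simps)
  also have "\<dots> = (\<Sum>i\<in>I. (k * a i) * u i)" unfolding D(4) by (simp add: sum_distrib_left algebra_simps)
  finally show ?thesis unfolding spanQ_def using D assms(2)
    by (intro CollectI exI[of _ D] exI[of _ "%i. k * a i"]) (auto intro: mult)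
qed

lemma spanQ_cancel:
  assumes "k * x \<in> spanQ I u" "k \<in> K" "k ~= 0" shows "x \<in> spanQ I u"
proof -
  obtain D a where D: "D \<in> K" "D ~= 0" "\<forall>i. a i \<in> K" "D * (k * x) = (\<Sum>i\<in>I. a i * u i)" using assms(1) by (auto simp: spanQ_def)
  then show ?thesis unfolding spanQ_def using assms(2,3)
    by (intro CollectI exI[of _ "D * k"] exI[of _ a]) (auto intro: mult simp: mult.assoc)
qed

lemma stab_spanQ:
  assumes "y \<in> stab I u" "z \<in> spanQ I u" shows "y * z \<in> spanQ I u"
proof -
  obtain D a where D: "D \<in> K" "D ~= 0" "\<forall>i. a i \<in> K" "D * z = (\<Sum>i\<in>I. a i * u i)" using assms(2) by (auto simp: spanQ_def)
  have "D * (y * z) = y * (D * z)" by (simp add: algebra_simps)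
  also have "\<dots> = (\<Sum>i\<in>I. a i * (y * u i))" unfolding D(4) by (simp add: sum_distrib_left algebra_simps)
  also have "\<dots> \<in> spanQ I u"
  proof (rule spanQ_sum)
    fix i assume "i \<in> I"
    then have "y * u i \<in> spanQ I u" using assms(1) by (simp add: stab_def)
    then show "a i * (y * u i) \<in> spanQ I u" by (rule spanQ_scale) (use D(3) in auto)
  qed
  finally show ?thesis using spanQ_cancel D by blast
qed

lemma stab_K: "finite I ==> k \<in> K ==> k \<in> stab I u"
  unfolding stab_def by (auto intro: spanQ_scale spanQ_base)

lemma stab_add: "x \<in> stab I u ==> y \<in> stab I u ==> x + y \<in> stab I u"
  unfolding stab_def by (auto simp: algebra_simps intro: spanQ_add)

lemma stab_mult: "x \<in> stab I u ==> y \<in> stab I u ==> x * y \<in> stab I u"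
  using stab_spanQ[of x I u] unfolding stab_def[of I u] by (auto simp: mult.assoc)

lemma stab_power: "finite I ==> x \<in> stab I u ==> x ^ n \<in> stab I u"
  by (induction n) (auto simp: stab_mult intro: stab_K one)

lemma stab_sum: "finite I ==> (!!j. j \<in> J ==> f j \<in> stab I u) ==> sum f J \<in> stab I u"
  by (induction J rule: infinite_finite_induct) (auto simp: stab_add intro: stab_K zero)

text \<open>The powers of \<open>y\<close> applied to one non-zero \<open>u i0\<close> are
  \<open>card I + 1\<close> vectors in a space spanned by \<open>card I\<close> elements. A linear
  dependence among them, divided by \<open>u i0\<close>, is an equation for
  \<open>y\<close>.\<close>

lemma stab_algebraic:
  assumes I: "finite I" "i0 \<in> I" "u i0 ~= 0" and y: "y \<in> stab I u"
  shows "algebraic y"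
proof -
  have "\<exists>D a. D \<in> K & D ~= 0 & (\<forall>i. a i \<in> K) & D * (y ^ k * u i0) = (\<Sum>i\<in>I. a i * u i)" for k
    using stab_spanQ[OF stab_power[OF I(1) y, of k] spanQ_base[OF I(1,2), of u]] by (auto simp: spanQ_def)
  then obtain D a where D: "!!k. D k \<in> K" "!!k. D k ~= 0" "!!k i. a k i \<in> K"
    "!!k. D k * (y ^ k * u i0) = (\<Sum>i\<in>I. a k i * u i)" by metis
  have "card I < card {..card I}" by simp
  from linear_dependence[OF I(1) _ this, of a] D(3) obtain c where
    c: "\<forall>j. c j \<in> K" "\<exists>j\<in>{..card I}. c j ~= 0" "\<forall>i\<in>I. (\<Sum>j\<in>{..card I}. c j * a j i) = 0" by auto
  have "(\<Sum>k\<le>card I. (c k * D k) * y ^ k) * u i0 = (\<Sum>k\<le>card I. c k * (D k * (y ^ k * u i0)))"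
    unfolding sum_distrib_right by (simp add: mult_ac)
  also have "\<dots> = (\<Sum>i\<in>I. (\<Sum>k\<le>card I. c k * a k i) * u i)"
    unfolding D(4) sum_distrib_left sum_distrib_right by (subst sum.swap) (simp add: algebra_simps)
  also have "\<dots> = 0" using c(3) by simp
  finally have "(\<Sum>k\<le>card I. (c k * D k) * y ^ k) = 0" using I(3) by simp
  then show ?thesis unfolding algebraic_def using c D
    by (intro exI[of _ "card I"] exI[of _ "%k. c k * D k"]) (auto intro: mult)
qed

text \<open>A non-zero stabiliser is invertible on the span: in an equation for \<open>l\<close>
  with lowest non-zero coefficient \<open>e m\<close>, the factor \<open>l ^ m\<close> cancels and
  what remains reads \<open>l' * l = - e m\<close> with \<open>l'\<close> in the stabiliser.\<close>

lemma stab_cancel: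
  assumes I: "finite I" "i0 \<in> I" "u i0 ~= 0" and l: "l \<in> stab I u" "l ~= 0" and lz: "l * z \<in> spanQ I u"
  shows "z \<in> spanQ I u"
proof -
  obtain n e where e: "\<forall>k. e k \<in> K" "\<exists>k\<le>n. e k ~= 0" "(\<Sum>k\<le>n. e k * l ^ k) = 0"
    using stab_algebraic[of I i0 u, OF I l(1)] by (auto simp: algebraic_def)
  define m where "m = (LEAST k. e k ~= 0)"
  obtain k0 where k0: "k0 \<le> n" "e k0 ~= 0" using e(2) by blast
  have m1: "e m ~= 0" unfolding m_def by (rule LeastI[of _ k0]) (rule k0)
  have m2: "e k = 0" if "k < m" for k using not_less_Least[of k "%k. e k ~= 0"] that by (auto simp: m_def)
  have m3: "m \<le> n" using Least_le[of "%k. e k ~= 0" k0] k0 by (simp add: m_def)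
  note m = m1 m2 m3
  define l' where "l' = (\<Sum>k\<in>{m<..n}. e k * l ^ (k - Suc m))"
  have l': "l' \<in> stab I u" unfolding l'_def using e(1) l(1) I(1)
    by (intro stab_sum stab_mult[OF stab_K stab_power]) auto
  have sets: "{..n} = {..<m} \<union> {m..n}" "{m..n} = insert m {m<..n}" using m(3) by auto
  have "(\<Sum>k\<le>n. e k * l ^ k) = (\<Sum>k<m. e k * l ^ k) + (\<Sum>k\<in>{m..n}. e k * l ^ k)"
    unfolding sets(1) by (rule sum.union_disjoint) auto
  also have "(\<Sum>k\<in>{m..n}. e k * l ^ k) = e m * l ^ m + (\<Sum>k\<in>{m<..n}. e k * l ^ k)"
    unfolding sets(2) by (rule sum.insert) auto
  also have "(\<Sum>k<m. e k * l ^ k) = 0" using m(2) by simp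
  also have "(\<Sum>k\<in>{m<..n}. e k * l ^ k) = l ^ Suc m * l'" unfolding l'_def sum_distrib_left
  proof (rule sum.cong[OF refl])
    fix k assume "k \<in> {m<..n}"
    then have "l ^ k = l ^ Suc m * l ^ (k - Suc m)" by (simp flip: power_add power_Suc)
    then show "e k * l ^ k = l ^ Suc m * (e k * l ^ (k - Suc m))" by (simp only: mult.left_commute)
  qed
  finally have "l ^ m * (e m + l * l') = 0" using e(3) by (simp add: algebra_simps)
  then have "e m + l * l' = 0" using l(2) by simp
  then have "l' * l = - e m" by (simp add: eq_neg_iff_add_eq_0 add.commute mult.commute)
  then have "(- e m) * z = l' * (l * z)" by (simp flip: mult.assoc)
  moreover have "l' * (l * z) \<in> spanQ I u" by (rule stab_spanQ[OF l' lz])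
  ultimately show ?thesis using spanQ_cancel[of "- e m" z] e(1) m(1) uminus by auto
qed

lemma algebraic_power:
  assumes "algebraic y"
  shows "\<exists>n>0. \<exists>l c. l \<in> K & l ~= 0 & (\<forall>k. c k \<in> K) & l * y ^ n = (\<Sum>k<n. c k * y ^ k)"
proof -
  obtain n e where e: "\<forall>k. e k \<in> K" "\<exists>k\<le>n. e k ~= 0" "(\<Sum>k\<le>n. e k * y ^ k) = 0"
    using assms by (auto simp: algebraic_def)
  define m where "m = Max {k. k \<le> n & e k ~= 0}"
  have fi: "finite {k. k \<le> n & e k ~= 0}" "{k. k \<le> n & e k ~= 0} ~= {}" using e(2) by auto
  have m1: "m \<le> n" "e m ~= 0" using Max_in[OF fi] unfolding m_def by auto
  have m2: "e k = 0" if "k \<le> n" "m < k" for k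
  proof (rule ccontr)
    assume "e k ~= 0"
    then have "k \<le> m" unfolding m_def using that fi(1) by (intro Max_ge) auto
    then show False using that by simp
  qed
  note m = m1 m2
  have "(\<Sum>k\<le>n. e k * y ^ k) = (\<Sum>k\<le>m. e k * y ^ k)"
    by (rule sum.mono_neutral_right) (use m in auto)
  also have "\<dots> = (\<Sum>k<m. e k * y ^ k) + e m * y ^ m" by (simp add: lessThan_Suc_atMost[symmetric])
  finally have "(\<Sum>k<m. e k * y ^ k) + e m * y ^ m = 0" using e(3) by simp
  from minus_unique[OF this] have eq: "e m * y ^ m = (\<Sum>k<m. (- e k) * y ^ k)"
    by (simp add: sum_negf)
  have "m > 0" using eq m(2) by (cases m) auto
  then show ?thesis using eq m e(1)
    by (intro exI[of _ m] exI[of _ "e m"] exI[of _ "%k. - e k"] conjI) (auto intro: uminus)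
qed

text \<open>The monomials \<open>a ^ i * b ^ j\<close> below the two degrees span a space stable
  under both elements; leading coefficients are absorbed as denominators.\<close>

lemma two_algebraic_stab:
  assumes "algebraic a" "algebraic b"
  shows "\<exists>I (u :: nat \<times> nat => 'a) i0. finite I & i0 \<in> I & u i0 ~= 0 & a \<in> stab I u & b \<in> stab I u"
proof -
  obtain m l c where m: "m > 0" "l \<in> K" "l ~= 0" "\<forall>k. c k \<in> K" "l * a ^ m = (\<Sum>k<m. c k * a ^ k)"
    using algebraic_power[OF assms(1)] by blast
  obtain n l' d where n: "n > 0" "l' \<in> K" "l' ~= 0" "\<forall>k. d k \<in> K" "l' * b ^ n = (\<Sum>k<n. d k * b ^ k)"
    using algebraic_power[OF assms(2)] by blast
  define I where "I = {..<m} \<times> {..<n}"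
  define u where "u = (%(i, j). a ^ i * b ^ j)"
  have fI: "finite I" by (simp add: I_def)
  have ub: "a ^ i * b ^ j \<in> spanQ I u" if "i < m" "j < n" for i j
    using spanQ_base[OF fI, of "(i, j)" u] that by (simp add: I_def u_def)
  have "a * (a ^ i * b ^ j) \<in> spanQ I u" if "i < m" "j < n" for i j
  proof (cases "Suc i < m")
    case True then show ?thesis using ub[OF True that(2)] by (simp add: mult.assoc)
  next
    case False
    then have "Suc i = m" using that by simp
    then have "l * (a * (a ^ i * b ^ j)) = (l * a ^ m) * b ^ j" by (auto simp: algebra_simps)
    also have "\<dots> = (\<Sum>k<m. c k * (a ^ k * b ^ j))" by (simp add: m(5) sum_distrib_right mult.assoc)
    also have "\<dots> \<in> spanQ I u" using m(4) that by (intro spanQ_sum spanQ_scale ub) auto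
    finally show ?thesis using spanQ_cancel m by blast
  qed
  then have A: "a \<in> stab I u" by (auto simp: stab_def I_def u_def)
  have "b * (a ^ i * b ^ j) \<in> spanQ I u" if "i < m" "j < n" for i j
  proof (cases "Suc j < n")
    case True then show ?thesis using ub[OF that(1) True] by (simp add: mult_ac)
  next
    case False
    then have "Suc j = n" using that by simp
    then have "l' * (b * (a ^ i * b ^ j)) = (l' * b ^ n) * a ^ i" by (auto simp: algebra_simps)
    also have "\<dots> = (\<Sum>k<n. d k * (a ^ i * b ^ k))" unfolding n(5) sum_distrib_right by (simp add: mult_ac)
    also have "\<dots> \<in> spanQ I u" using n(4) that by (intro spanQ_sum spanQ_scale ub) auto
    finally show ?thesis using spanQ_cancel n by blast
  qed
  then have B: "b \<in> stab I u" by (auto simp: stab_def I_def u_def)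
  show ?thesis using fI A B m(1) n(1)
    by (intro exI[of _ I] exI[of _ u] exI[of _ "(0,0)"]) (auto simp: I_def u_def)
qed

lemma algebraic_add:
  assumes "algebraic a" "algebraic b" shows "algebraic (a + b)"
proof -
  obtain I and u :: "nat \<times> nat => 'a" and i0 where I: "finite I" "i0 \<in> I" "u i0 ~= 0"
    and st: "a \<in> stab I u" "b \<in> stab I u" using two_algebraic_stab[OF assms] by (elim exE conjE) (rule that)
  show ?thesis by (rule stab_algebraic[of I i0 u, OF I stab_add[OF st]])
qed

lemma algebraic_mult:
  assumes "algebraic a" "algebraic b" shows "algebraic (a * b)"
proof -
  obtain I and u :: "nat \<times> nat => 'a" and i0 where I: "finite I" "i0 \<in> I" "u i0 ~= 0"
    and st: "a \<in> stab I u" "b \<in> stab I u" using two_algebraic_stab[OF assms] by (elim exE conjE) (rule that)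
  show ?thesis by (rule stab_algebraic[of I i0 u, OF I stab_mult[OF st]])
qed

lemma algebraic_divide:
  assumes "algebraic c" "algebraic (c * y)" "c ~= 0"
  shows "algebraic y"
proof -
  obtain I and u :: "nat \<times> nat => 'a" and i0 where I: "finite I" "i0 \<in> I" "u i0 ~= 0"
    and st: "c \<in> stab I u" "c * y \<in> stab I u" using two_algebraic_stab[OF assms(1,2)] by (elim exE conjE) (rule that)
  have "y * u i \<in> spanQ I u" if "i \<in> I" for i
    by (rule stab_cancel[of I i0 u, OF I st(1) assms(3)]) (use st(2) that in \<open>auto simp: stab_def mult.assoc\<close>)
  then have "y \<in> stab I u" by (simp add: stab_def)
  then show ?thesis by (rule stab_algebraic[of I i0 u, OF I])
qed

lemma algebraic_K: "k \<in> K ==> algebraic k"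
  unfolding algebraic_def by (intro exI[of _ 1] exI[of _ "%i. if i = 0 then - k else if i = 1 then 1 else 0"])
    (auto simp: uminus one zero)

text \<open>Transitivity in a special shape: the larger ring \<open>K1\<close> acts on every space
  on which \<open>s\<close> acts, and \<open>s\<close> is a root of an element of \<open>K\<close>.
  The stable space is spanned by products of powers of \<open>s\<close> and of
  \<open>F\<close>.\<close>

lemma algebraic_trans:
  assumes sm: "0 < m" "s ^ m \<in> K"
    and K1: "!!I (u :: nat \<times> nat => 'a) k. finite I ==> s \<in> stab I u ==> k \<in> K1 ==> k \<in> stab I u"
    and F: "\<exists>n>0. \<exists>l c. l \<in> K1 & l ~= 0 & (\<forall>k. c k \<in> K1) & l * F ^ n = (\<Sum>k<n. c k * F ^ k)"
  shows "algebraic F"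
proof -
  obtain n l c where n: "n > 0" "l \<in> K1" "l ~= 0" "\<forall>k. c k \<in> K1" "l * F ^ n = (\<Sum>k<n. c k * F ^ k)"
    using F by blast
  define I where "I = {..<m} \<times> {..<n}"
  define u where "u = (%(i, j). s ^ i * F ^ j)"
  have fI: "finite I" and i0: "(0, 0) \<in> I" "u (0, 0) ~= 0" using sm n by (auto simp: I_def u_def)
  have ub: "s ^ i * F ^ j \<in> spanQ I u" if "i < m" "j < n" for i j
    using spanQ_base[OF fI, of "(i, j)" u] that by (simp add: I_def u_def)
  have "s * (s ^ i * F ^ j) \<in> spanQ I u" if "i < m" "j < n" for i j
  proof (cases "Suc i < m")
    case True then show ?thesis using ub[OF True that(2)] by (simp add: mult.assoc)
  next
    case False
    then have "Suc i = m" using that by simp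
    then have eq: "s * (s ^ i * F ^ j) = s ^ m * (s ^ 0 * F ^ j)" by (auto simp: algebra_simps)
    show ?thesis unfolding eq by (rule spanQ_scale[OF ub[OF sm(1) that(2)] sm(2)])
  qed
  then have S: "s \<in> stab I u" by (auto simp: stab_def I_def u_def)
  have "F * (s ^ i * F ^ j) \<in> spanQ I u" if "i < m" "j < n" for i j
  proof (cases "Suc j < n")
    case True then show ?thesis using ub[OF that(1) True] by (simp add: mult_ac)
  next
    case False
    then have "Suc j = n" using that by simp
    then have "l * (F * (s ^ i * F ^ j)) = (l * F ^ n) * s ^ i" by (auto simp: algebra_simps)
    also have "\<dots> = (\<Sum>k<n. c k * (s ^ i * F ^ k))" unfolding n(5) sum_distrib_right by (simp add: mult_ac)
    also have "\<dots> \<in> spanQ I u" using n(4) that by (intro spanQ_sum stab_spanQ[OF K1[OF fI S]] ub) auto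
    finally show ?thesis by (rule stab_cancel[of I "(0,0)" u, OF fI i0 K1[OF fI S n(2)] n(3)])
  qed
  then have "F \<in> stab I u" by (auto simp: stab_def I_def u_def)
  then show ?thesis by (rule stab_algebraic[of I "(0,0)" u, OF fI i0])
qed

end

section \<open>Series algebraic over the polynomials in a power of the variable\<close>

definition pow_polys :: "nat => real fps set" where
  "pow_polys m = range (%p. fps_of_poly (pcompose p (monom 1 m)))"

interpretation pp: coeff_ring "pow_polys m" for m
proof
  show "0 \<in> pow_polys m" "1 \<in> pow_polys m" unfolding pow_polys_def
    by (rule image_eqI[of _ _ 0]; simp) (rule image_eqI[of _ _ 1]; simp add: pcompose_1)
  fix a b assume "a \<in> pow_polys m" "b \<in> pow_polys m"
  then obtain p q where pq: "a = fps_of_poly (pcompose p (monom 1 m))" "b = fps_of_poly (pcompose q (monom 1 m))"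
    by (auto simp: pow_polys_def)
  show "a + b \<in> pow_polys m" "a * b \<in> pow_polys m" unfolding pow_polys_def pq
    by (rule image_eqI[of _ _ "p + q"]; simp add: pcompose_add fps_of_poly_add)
      (rule image_eqI[of _ _ "p * q"]; simp add: pcompose_mult fps_of_poly_mult)
  show "- a \<in> pow_polys m" unfolding pow_polys_def pq
    by (rule image_eqI[of _ _ "- p"]; simp add: pcompose_uminus fps_of_poly_uminus)
qed

lemma pow_polys_1: "pow_polys 1 = range fps_of_poly"
proof -
  have "pcompose p (monom 1 1) = p" for p :: "real poly"
    by (metis One_nat_def monom_Suc monom_0 one_poly_eq_simps(1) pcompose_idR)
  then show ?thesis by (simp add: pow_polys_def)
qed

lemma poly_map_fps_of_poly:
  "poly (map_poly fps_of_poly P) f = (\<Sum>k\<le>degree P. fps_of_poly (coeff P k) * f ^ k)"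
proof -
  have "degree (map_poly fps_of_poly P) = degree P"
    by (rule degree_map_poly) simp
  then show ?thesis by (simp add: poly_altdef coeff_map_poly)
qed

lemma fps_alg_iff: "f \<in> fps_alg \<longleftrightarrow> pp.algebraic 1 f"
proof
  assume "f \<in> fps_alg"
  then obtain P :: "real poly poly" where P: "P ~= 0" "poly (map_poly fps_of_poly P) f = 0" by (auto simp: fps_alg_def)
  then show "pp.algebraic 1 f" unfolding pp.algebraic_def unfolding pow_polys_1 poly_map_fps_of_poly
    by (intro exI[of _ "degree P"] exI[of _ "%k. fps_of_poly (coeff P k)"])
      (auto intro!: exI[of _ "degree P"])
next
  assume "pp.algebraic 1 f"
  then obtain n c where c: "\<forall>k. c k \<in> range fps_of_poly" "\<exists>k\<le>n. c k ~= 0" "(\<Sum>k\<le>n. c k * f ^ k) = 0"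
    unfolding pp.algebraic_def unfolding pow_polys_1 by blast
  from c(1) have "\<forall>k. \<exists>p. c k = fps_of_poly p" by blast
  then obtain p where p: "!!k. c k = fps_of_poly (p k)" by metis
  define P where "P = (\<Sum>k\<le>n. monom (p k) k)"
  have cf: "coeff P k = (if k \<le> n then p k else 0)" for k
    by (simp add: P_def coeff_sum)
  have dP: "degree P \<le> n" by (rule degree_le) (simp add: cf)
  obtain k where k: "k \<le> n" "c k ~= 0" using c(2) by blast
  then have "coeff P k ~= 0" using p by (auto simp: cf)
  then have "P ~= 0" by auto
  moreover have "poly (map_poly fps_of_poly P) f = (\<Sum>k\<le>n. fps_of_poly (coeff P k) * f ^ k)"
    unfolding poly_map_fps_of_poly by (rule sum.mono_neutral_left) (use dP in \<open>auto simp: coeff_eq_0\<close>)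
  moreover have "\<dots> = (\<Sum>k\<le>n. c k * f ^ k)" by (simp add: cf p)
  ultimately show "f \<in> fps_alg" unfolding fps_alg_def using c(3) by auto
qed

lemma pow_polys_subset: "pow_polys m \<subseteq> pow_polys 1"
  unfolding pow_polys_1 by (auto simp: pow_polys_def)

lemma algebraic_pow_polys_1: "pp.algebraic m f ==> pp.algebraic 1 f"
  unfolding pp.algebraic_def using pow_polys_subset by blast

text \<open>A Puiseux series in the m-th root of t is a power series in s with t = s^m, and its
  algebraicity over polynomials in t is algebraicity over polynomials in s^m. As
  \<open>fps_X\<close> is itself an m-th root of \<open>fps_X ^ m\<close>, this is no stronger than
  algebraicity over all polynomials.\<close>

lemma pow_polys_algebraic:
  assumes "pp.algebraic 1 f" "0 < m"
  shows "pp.algebraic m f"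
proof (rule pp.algebraic_trans[of m fps_X m "pow_polys 1"])
  have const: "fps_const c \<in> pow_polys m" for c
    unfolding pow_polys_def by (rule image_eqI[of _ _ "[:c:]"]) (auto simp: fps_of_poly_const)
  show "fps_X ^ m \<in> pow_polys m" unfolding pow_polys_def
    by (rule image_eqI[of _ _ "[:0, 1:]"]) (auto simp: pcompose_pCons fps_of_poly_monom)
  fix I :: "(nat \<times> nat) set" and u k
  assume I: "finite I" "fps_X \<in> pp.stab m I u" "k \<in> pow_polys 1"
  then obtain p where p: "k = fps_of_poly p" unfolding pow_polys_1 by blast
  have "fps_of_poly p \<in> pp.stab m I u"
  proof (induction p)
    case 0
    show ?case using pp.stab_K[OF I(1) pp.zero] by simp
  next
    case (pCons a p)
    then show ?case
      using pp.stab_add[OF pp.stab_K[OF I(1) const[of a]] pp.stab_mult[OF pCons.IH I(2)]]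
      by (simp add: fps_of_poly_pCons)
  qed
  then show "k \<in> pp.stab m I u" using p by simp
qed (use assms pp.algebraic_power in auto)

section \<open>Convergence of algebraic power series\<close>

text \<open>Partial sums of the weighted l1 norm. Truncation makes the quantity finite before
  convergence is known, and it remains subadditive and submultiplicative.\<close>

definition l1 :: "real => real fps => nat => real" where
  "l1 r F m = (\<Sum>i\<le>m. \<bar>fps_nth F i\<bar> * r ^ i)"

lemma l1_nonneg: "0 \<le> r ==> 0 \<le> l1 r F m"
  unfolding l1_def by (intro sum_nonneg) auto

lemma l1_add: "0 \<le> r ==> l1 r (F + G) m \<le> l1 r F m + l1 r G m"
  unfolding l1_def sum.distrib[symmetric]
  by (intro sum_mono) (auto simp: distrib_right[symmetric] intro!: mult_right_mono)

lemma l1_sum: "0 \<le> r ==> l1 r (\<Sum>j\<in>J. F j) m \<le> (\<Sum>j\<in>J. l1 r (F j) m)"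
proof (induction J rule: infinite_finite_induct)
  case (insert x J)
  have "l1 r (\<Sum>j\<in>insert x J. F j) m \<le> l1 r (F x) m + l1 r (\<Sum>j\<in>J. F j) m"
    using insert.hyps l1_add[OF insert.prems] by simp
  then show ?case using insert.IH[OF insert.prems] insert.hyps by simp
qed (auto simp: l1_def)

lemma l1_mult:
  assumes "0 \<le> r"
  shows "l1 r (F * G) m \<le> l1 r F m * l1 r G m"
proof -
  have "l1 r (F * G) m \<le> (\<Sum>k\<le>m. \<Sum>i\<le>k. (\<bar>fps_nth F i\<bar> * r ^ i) * (\<bar>fps_nth G (k - i)\<bar> * r ^ (k - i)))"
    unfolding l1_def
  proof (rule sum_mono)
    fix k
    have "\<bar>fps_nth (F * G) k\<bar> \<le> (\<Sum>i\<le>k. \<bar>fps_nth F i\<bar> * \<bar>fps_nth G (k - i)\<bar>)"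
      unfolding fps_mult_nth atLeast0AtMost by (rule order_trans[OF sum_abs]) (simp add: abs_mult)
    then have "\<bar>fps_nth (F * G) k\<bar> * r ^ k \<le> (\<Sum>i\<le>k. \<bar>fps_nth F i\<bar> * \<bar>fps_nth G (k - i)\<bar>) * r ^ k"
      by (rule mult_right_mono) (use assms in simp)
    also have "\<dots> = (\<Sum>i\<le>k. (\<bar>fps_nth F i\<bar> * r ^ i) * (\<bar>fps_nth G (k - i)\<bar> * r ^ (k - i)))"
      unfolding sum_distrib_right
    proof (rule sum.cong[OF refl])
      fix i assume "i \<in> {..k}"
      then have "r ^ k = r ^ i * r ^ (k - i)" by (simp flip: power_add)
      then show "\<bar>fps_nth F i\<bar> * \<bar>fps_nth G (k - i)\<bar> * r ^ k = \<bar>fps_nth F i\<bar> * r ^ i * (\<bar>fps_nth G (k - i)\<bar> * r ^ (k - i))"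
        by simp
    qed
    finally show "\<bar>fps_nth (F * G) k\<bar> * r ^ k \<le> (\<Sum>i\<le>k. (\<bar>fps_nth F i\<bar> * r ^ i) * (\<bar>fps_nth G (k - i)\<bar> * r ^ (k - i)))" .
  qed
  also have "\<dots> = (\<Sum>(i, j)\<in>{(i, j). i + j \<le> m}. (\<bar>fps_nth F i\<bar> * r ^ i) * (\<bar>fps_nth G j\<bar> * r ^ j))"
    by (rule sum.triangle_reindex_eq[symmetric])
  also have "\<dots> \<le> (\<Sum>(i, j)\<in>{..m} \<times> {..m}. (\<bar>fps_nth F i\<bar> * r ^ i) * (\<bar>fps_nth G j\<bar> * r ^ j))"
    by (rule sum_mono2) (use assms in auto)
  also have "\<dots> = l1 r F m * l1 r G m"
    unfolding l1_def sum_product sum.cartesian_product ..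
  finally show ?thesis .
qed

lemma l1_power: "0 \<le> r ==> l1 r (F ^ n) m \<le> l1 r F m ^ n"
proof (induction n)
  case 0
  have "l1 r 1 m = (\<Sum>i\<le>m. if i = 0 then 1 else 0)" unfolding l1_def by (rule sum.cong) auto
  then show ?case by simp
next
  case (Suc n)
  have "l1 r (F ^ Suc n) m \<le> l1 r F m * l1 r (F ^ n) m" using l1_mult[OF Suc.prems] by simp
  also have "\<dots> \<le> l1 r F m * l1 r F m ^ n"
    by (intro mult_left_mono Suc.IH[OF Suc.prems] l1_nonneg Suc.prems)
  finally show ?case by simp
qed

text \<open>A single constant serves all radii up to 1, and a vanishing constant term gains a factor
  \<open>r\<close>; shrinking \<open>r\<close> will make such terms small.\<close>

lemma entire_l1:
  assumes "fps_conv_radius F = \<infinity>"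
  shows "\<exists>S\<ge>0. \<forall>m r. 0 \<le> r --> r \<le> 1 --> l1 r F m \<le> S & (fps_nth F 0 = 0 --> l1 r F m \<le> r * S)"
proof -
  have "summable (%n. norm (fps_nth F n * 1 ^ n))" by (rule norm_summable_fps) (simp add: assms)
  then have su: "summable (%n. \<bar>fps_nth F n\<bar>)" by simp
  define S where "S = (\<Sum>n. \<bar>fps_nth F n\<bar>)"
  have le: "(\<Sum>i\<le>m. \<bar>fps_nth F i\<bar>) \<le> S" for m
    unfolding S_def by (rule sum_le_suminf[OF su]) auto
  have "l1 r F m \<le> S & (fps_nth F 0 = 0 --> l1 r F m \<le> r * S)" if r: "0 \<le> r" "r \<le> 1" for r m
  proof
    have "l1 r F m \<le> (\<Sum>i\<le>m. \<bar>fps_nth F i\<bar>)" unfolding l1_def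
      by (intro sum_mono mult_right_le_one_le) (use r in \<open>auto simp: power_le_one\<close>)
    then show "l1 r F m \<le> S" using le[of m] by simp
    show "fps_nth F 0 = 0 --> l1 r F m \<le> r * S"
    proof
      assume z: "fps_nth F 0 = 0"
      have "l1 r F m \<le> (\<Sum>i\<le>m. r * \<bar>fps_nth F i\<bar>)" unfolding l1_def
      proof (rule sum_mono)
        fix i show "\<bar>fps_nth F i\<bar> * r ^ i \<le> r * \<bar>fps_nth F i\<bar>"
        proof (cases i)
          case (Suc j)
          have "r ^ i \<le> r" using r Suc power_le_one[of r j] by (simp add: mult_left_le)
          then show ?thesis using mult_left_mono[of "r ^ i" r "\<bar>fps_nth F i\<bar>"] by (simp add: mult.commute)
        qed (simp add: z)
      qed
      also have "\<dots> = r * (\<Sum>i\<le>m. \<bar>fps_nth F i\<bar>)" by (simp add: sum_distrib_left)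
      also have "\<dots> \<le> r * S" by (rule mult_left_mono[OF le r(1)])
      finally show "l1 r F m \<le> r * S" .
    qed
  qed
  moreover have "0 \<le> S" unfolding S_def by (rule suminf_nonneg[OF su]) auto
  ultimately show ?thesis by blast
qed

text \<open>The equation is solved for \<open>fps_nth e 0\<close> times \<open>Z\<close>. Up to
  order \<open>Suc m\<close> the remaining terms only involve \<open>Z\<close> up to order
  \<open>m\<close>, so a bound \<open>\<kappa>\<close> on the truncated norm propagates by
  induction: constant, linear and higher terms each contribute at most a third of
  \<open>E * \<kappa>\<close>.\<close>

lemma fps_root_converges:
  fixes Z :: "real fps"
  assumes Z0: "fps_nth Z 0 = 0" and e0: "fps_nth e 0 ~= 0"
    and ent: "fps_conv_radius e = \<infinity>" "fps_conv_radius c = \<infinity>" "!!j. fps_conv_radius (d j) = \<infinity>"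
    and eq: "c + e * Z + (\<Sum>j\<in>{2..n}. d j * Z ^ j) = 0"
  shows "fps_conv_radius Z > 0"
proof -
  define e' where "e' = e - fps_const (fps_nth e 0)"
  have e'0: "fps_nth e' 0 = 0" by (simp add: e'_def)
  have "min (fps_conv_radius e) (fps_conv_radius (fps_const (fps_nth e 0))) \<le> fps_conv_radius e'"
    unfolding e'_def by (rule fps_conv_radius_diff)
  then have ente': "fps_conv_radius e' = \<infinity>" using ent by simp
  define E where "E = \<bar>fps_nth e 0\<bar>"
  have E: "E > 0" using e0 by (simp add: E_def)
  have Zp0: "fps_nth (Z ^ j) 0 = 0" if "j \<ge> 2" for j using that Z0 by (simp add: fps_power_zeroth)
  have "fps_nth (c + e * Z + (\<Sum>j\<in>{2..n}. d j * Z ^ j)) 0 = 0" by (simp add: eq)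
  moreover have "(\<Sum>j\<in>{2..n}. fps_nth (d j * Z ^ j) 0) = 0" by (rule sum.neutral) (use Zp0 in auto)
  ultimately have c0: "fps_nth c 0 = 0" using Z0 by (simp add: fps_sum_nth)
  obtain Sc where Sc: "Sc \<ge> 0" "!!m r. 0 \<le> r ==> r \<le> 1 ==> l1 r c m \<le> r * Sc"
    using entire_l1[OF ent(2)] c0 by blast
  obtain Se where Se: "Se \<ge> 0" "!!m r. 0 \<le> r ==> r \<le> 1 ==> l1 r e' m \<le> r * Se"
    using entire_l1[OF ente'] e'0 by blast
  have "\<forall>j. \<exists>S\<ge>0. \<forall>m r. 0 \<le> r --> r \<le> 1 --> l1 r (d j) m \<le> S" using entire_l1[OF ent(3)] by blast
  then obtain S where S: "!!j. S j \<ge> 0" "!!j m r. 0 \<le> r ==> r \<le> 1 ==> l1 r (d j) m \<le> S j" by metis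
  define T where "T = (\<Sum>j\<in>{2..n}. S j)"
  have T0: "T \<ge> 0" unfolding T_def by (rule sum_nonneg) (use S in auto)
  \<comment> \<open>So small that the terms of order at least two in \<open>Z\<close>, bounded by
    \<open>T * \<kappa> ^ 2\<close>, stay below a third of \<open>E * \<kappa>\<close>.\<close>
  define \<kappa> where "\<kappa> = min 1 (E / (3 * (T + 1)))"
  have \<kappa>: "0 < \<kappa>" "\<kappa> \<le> 1" "T * \<kappa> \<le> E / 3"
  proof -
    show "0 < \<kappa>" "\<kappa> \<le> 1" using E T0 by (auto simp: \<kappa>_def)
    have "\<kappa> \<le> E / (3 * (T + 1))" by (simp add: \<kappa>_def)
    then have "\<kappa> * (3 * (T + 1)) \<le> E" using T0 by (subst (asm) pos_le_divide_eq) auto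
    then have "3 * (T * \<kappa>) + 3 * \<kappa> \<le> E" by (simp add: algebra_simps)
    then show "T * \<kappa> \<le> E / 3" using \<open>0 < \<kappa>\<close> by linarith
  qed
  \<comment> \<open>With \<open>\<kappa>\<close> fixed, the radius makes the constant term and the
    linear correction \<open>e'\<close> small enough; both carry a factor \<open>r\<close> because
    their constant coefficients vanish.\<close>
  define r where "r = min 1 (\<kappa> * E / (3 * (Sc + Se + 1)))"
  have r: "0 < r" "r \<le> 1" "r * Sc \<le> \<kappa> * E / 3" "r * Se \<le> E / 3"
  proof -
    show r0: "0 < r" "r \<le> 1" using E \<kappa> Sc Se by (auto simp: r_def)
    have b: "r * (Sc + Se + 1) \<le> \<kappa> * E / 3"
    proof -
      have "r \<le> \<kappa> * E / (3 * (Sc + Se + 1))" by (simp add: r_def)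
      then have "r * (3 * (Sc + Se + 1)) \<le> \<kappa> * E" using Sc Se by (subst (asm) pos_le_divide_eq) auto
      then show ?thesis by (simp add: algebra_simps)
    qed
    have "r * Sc \<le> r * (Sc + Se + 1)" "r * Se \<le> r * (Sc + Se + 1)" using r0 Sc Se by (auto intro!: mult_left_mono)
    moreover have "\<kappa> * E / 3 \<le> E / 3" using \<kappa> E by simp
    ultimately show "r * Sc \<le> \<kappa> * E / 3" "r * Se \<le> E / 3" using b by linarith+
  qed
  have step: "E * l1 r Z (Suc m) \<le> r * Sc + r * Se * l1 r Z m + (\<Sum>j\<in>{2..n}. S j * l1 r Z m ^ j)" for m
  proof -
    \<comment> \<open>\<open>W\<close> is \<open>Z\<close> without the coefficients beyond
      \<open>m\<close>. Replacing \<open>Z\<close> by \<open>W\<close> changes nothing up to order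
      \<open>Suc m\<close>: \<open>e'\<close> has no constant term, and neither has the cofactor of
      \<open>Z - W\<close> in \<open>Z ^ j - W ^ j\<close> for \<open>j\<close> at least 2.\<close>
    define W where "W = fps_cutoff (Suc m) Z"
    have W0: "fps_nth W 0 = 0" by (simp add: W_def Z0)
    have lW: "l1 r W (Suc m) = l1 r Z m"
      unfolding l1_def by (simp add: W_def)
    have a1: "fps_nth (e' * Z) i = fps_nth (e' * W) i" if "i \<le> Suc m" for i
      unfolding fps_mult_nth
    proof (rule sum.cong[OF refl])
      fix k assume "k \<in> {0..i}"
      then show "fps_nth e' k * fps_nth Z (i - k) = fps_nth e' k * fps_nth W (i - k)"
        using that e'0 by (cases "k = 0") (auto simp: W_def)
    qed
    have a2: "fps_nth (Z ^ j) i = fps_nth (W ^ j) i" if "i \<le> Suc m" "j \<ge> 2" for i j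
    proof -
      define V where "V = (\<Sum>k<j. W ^ (j - Suc k) * Z ^ k)"
      have V0: "fps_nth V 0 = 0"
        unfolding V_def fps_sum_nth
      proof (rule sum.neutral, rule ballI)
        fix k assume k: "k \<in> {..<j}"
        then have "j - Suc k ~= 0 \<or> k ~= 0" using that by auto
        then show "fps_nth (W ^ (j - Suc k) * Z ^ k) 0 = 0" using W0 Z0 by (auto simp: fps_power_zeroth)
      qed
      have "Z ^ j - W ^ j = (Z - W) * V" unfolding V_def by (rule power_diff_sumr2)
      moreover have "fps_nth ((Z - W) * V) i = 0"
        unfolding fps_mult_nth
      proof (rule sum.neutral, rule ballI)
        fix k assume k: "k \<in> {0..i}"
        show "fps_nth (Z - W) k * fps_nth V (i - k) = 0"
        proof (cases "k < Suc m")
          case True then show ?thesis by (simp add: W_def)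
        next
          case False then have "i - k = 0" using k that by auto
          then show ?thesis using V0 by simp
        qed
      qed
      ultimately have "fps_nth (Z ^ j - W ^ j) i = 0" by simp
      then show ?thesis by simp
    qed
    have a3: "fps_nth (d j * Z ^ j) i = fps_nth (d j * W ^ j) i" if "i \<le> Suc m" "j \<ge> 2" for i j
      unfolding fps_mult_nth by (rule sum.cong[OF refl]) (use a2 that in auto)
    let ?R = "c + e' * W + (\<Sum>j\<in>{2..n}. d j * W ^ j)"
    have nth: "fps_nth e 0 * fps_nth Z i = - fps_nth ?R i" if i: "i \<le> Suc m" for i
    proof -
      have "e * Z = fps_const (fps_nth e 0) * Z + e' * Z" by (simp add: e'_def algebra_simps)
      then have "fps_nth (c + e * Z + (\<Sum>j\<in>{2..n}. d j * Z ^ j)) i =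
         fps_nth c i + (fps_nth e 0 * fps_nth Z i + fps_nth (e' * Z) i) + (\<Sum>j\<in>{2..n}. fps_nth (d j * Z ^ j) i)"
        by (simp add: fps_sum_nth)
      moreover have "(\<Sum>j\<in>{2..n}. fps_nth (d j * Z ^ j) i) = (\<Sum>j\<in>{2..n}. fps_nth (d j * W ^ j) i)"
        by (rule sum.cong[OF refl]) (use a3[OF i] in auto)
      ultimately show ?thesis using eq a1[OF i] by (simp add: fps_sum_nth)
    qed
    have "E * l1 r Z (Suc m) = l1 r ?R (Suc m)"
      unfolding l1_def sum_distrib_left
    proof (rule sum.cong[OF refl])
      fix i assume "i \<in> {..Suc m}"
      then have "E * \<bar>fps_nth Z i\<bar> = \<bar>fps_nth ?R i\<bar>" using nth[of i] unfolding E_def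
        by (metis abs_minus_cancel abs_mult atMost_iff)
      then show "E * (\<bar>fps_nth Z i\<bar> * r ^ i) = \<bar>fps_nth ?R i\<bar> * r ^ i" by (simp only: mult.assoc[symmetric])
    qed
    also have "\<dots> \<le> l1 r c (Suc m) + l1 r (e' * W) (Suc m) + (\<Sum>j\<in>{2..n}. l1 r (d j * W ^ j) (Suc m))"
      by (intro order_trans[OF l1_add] add_mono l1_add l1_sum) (use r in auto)
    also have "\<dots> \<le> r * Sc + r * Se * l1 r Z m + (\<Sum>j\<in>{2..n}. S j * l1 r Z m ^ j)"
    proof (intro add_mono sum_mono)
      show "l1 r c (Suc m) \<le> r * Sc" using Sc r by auto
      have "l1 r (e' * W) (Suc m) \<le> l1 r e' (Suc m) * l1 r W (Suc m)" by (rule l1_mult) (use r in auto)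
      also have "\<dots> \<le> r * Se * l1 r Z m" unfolding lW using Se r by (intro mult_right_mono l1_nonneg) auto
      finally show "l1 r (e' * W) (Suc m) \<le> r * Se * l1 r Z m" .
      fix j
      have "l1 r (d j * W ^ j) (Suc m) \<le> l1 r (d j) (Suc m) * l1 r (W ^ j) (Suc m)" by (rule l1_mult) (use r in auto)
      also have "\<dots> \<le> S j * l1 r W (Suc m) ^ j"
        using S r by (intro mult_mono l1_power l1_nonneg) auto
      finally show "l1 r (d j * W ^ j) (Suc m) \<le> S j * l1 r Z m ^ j" by (simp add: lW)
    qed
    finally show ?thesis .
  qed
  have bd: "l1 r Z m \<le> \<kappa>" for m
  proof (induction m)
    case 0
    show ?case using Z0 \<kappa> by (simp add: l1_def)
  next
    case (Suc m)
    have z0: "0 \<le> l1 r Z m" using r by (intro l1_nonneg) simp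
    have "S j * l1 r Z m ^ j \<le> S j * \<kappa>\<^sup>2" if "j \<in> {2..n}" for j
    proof -
      have "l1 r Z m ^ j \<le> \<kappa> ^ j" by (rule power_mono[OF Suc z0])
      also have "\<dots> \<le> \<kappa>\<^sup>2" using that \<kappa> by (intro power_decreasing) auto
      finally show ?thesis using S(1) by (rule mult_left_mono)
    qed
    then have "(\<Sum>j\<in>{2..n}. S j * l1 r Z m ^ j) \<le> (\<Sum>j\<in>{2..n}. S j * \<kappa>\<^sup>2)" by (rule sum_mono)
    also have "\<dots> = (T * \<kappa>) * \<kappa>" by (simp add: T_def sum_distrib_right power2_eq_square mult.assoc)
    also have "\<dots> \<le> E / 3 * \<kappa>" using \<kappa> by (intro mult_right_mono) auto
    finally have 1: "(\<Sum>j\<in>{2..n}. S j * l1 r Z m ^ j) \<le> E / 3 * \<kappa>" .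
    have 2: "r * Se * l1 r Z m \<le> E / 3 * \<kappa>"
      by (intro mult_mono) (use r Suc z0 E in auto)
    have "E * l1 r Z (Suc m) \<le> \<kappa> * E / 3 + E / 3 * \<kappa> + E / 3 * \<kappa>"
      using step[of m] 1 2 r(3) by linarith
    also have "\<dots> = E * \<kappa>" by simp
    finally show ?case using E by simp
  qed
  have "summable (%i. \<bar>fps_nth Z i\<bar> * r ^ i)"
    by (rule bounded_imp_summable[where B = \<kappa>]) (use bd r in \<open>auto simp: l1_def\<close>)
  then have "summable (%i. norm (fps_nth Z i * r ^ i))" using r by (simp add: abs_mult)
  then have "summable (%i. fps_nth Z i * r ^ i)" by (rule summable_norm_cancel)
  then have "ereal (norm r) \<le> conv_radius (fps_nth Z)" by (rule conv_radius_geI)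
  then show ?thesis unfolding fps_conv_radius_def using r by (auto intro: less_le_trans[rotated])
qed

lemma entire_add: "fps_conv_radius F = \<infinity> ==> fps_conv_radius G = \<infinity> ==> fps_conv_radius (F + G) = \<infinity>"
  using fps_conv_radius_add[of F G] by simp

lemma entire_mult: "fps_conv_radius F = \<infinity> ==> fps_conv_radius (G :: real fps) = \<infinity> ==> fps_conv_radius (F * G) = \<infinity>"
  using fps_conv_radius_mult[of F G] by simp

lemma entire_pcompose:
  fixes A :: "real fps poly"
  assumes "!!j. fps_conv_radius (coeff A j) = \<infinity>" "fps_conv_radius a = \<infinity>"
  shows "fps_conv_radius (coeff (pcompose A [:a, 1:]) j) = \<infinity>"
  using assms(1)
proof (induction A arbitrary: j)
  case (pCons c A)
  have cA: "fps_conv_radius (coeff A j) = \<infinity>" for j using pCons.prems[of "Suc j"] by simp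
  have c: "fps_conv_radius c = \<infinity>" using pCons.prems[of 0] by simp
  note IH = pCons.IH[OF cA]
  have "coeff (pcompose (pCons c A) [:a, 1:]) j = coeff [:c:] j + (a * coeff (pcompose A [:a, 1:]) j + coeff (pCons 0 (pcompose A [:a, 1:])) j)"
    by (simp add: pcompose_pCons)
  moreover have "fps_conv_radius (coeff [:c:] j) = \<infinity>" using c by (cases j) auto
  moreover have "fps_conv_radius (coeff (pCons 0 (pcompose A [:a, 1:])) j) = \<infinity>" using IH by (cases j) auto
  ultimately show ?case by (auto intro!: entire_add entire_mult[OF assms(2) IH])
qed simp

lemma poly_diff_factor: "\<exists>w. poly p x - poly p y = (x - y) * (w :: 'a :: comm_ring_1)"
proof (induction p)
  case (pCons c p)
  then obtain w where w: "poly p x - poly p y = (x - y) * w" by blast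
  have "poly (pCons c p) x - poly (pCons c p) y = x * (poly p x - poly p y) + (x - y) * poly p y"
    by (simp add: algebra_simps)
  also have "\<dots> = (x - y) * (x * w + poly p y)" unfolding w by (simp add: algebra_simps)
  finally show ?case by blast
qed (auto intro: exI[of _ 0])

text \<open>Reduction to a simple root in the manner of Newton and Hensel. For \<open>P\<close> of
  minimal degree the derivative does not vanish at \<open>f\<close>; if \<open>k\<close> is its
  order there, writing \<open>f\<close> as a polynomial of degree at most \<open>k\<close> plus
  \<open>fps_X ^ k * Z\<close> and dividing the equation by \<open>fps_X ^ (2 * k)\<close> leaves a
  linear coefficient with non-zero constant term.\<close>

theorem fps_alg_conv_radius:
  assumes "f \<in> fps_alg"
  shows "fps_conv_radius f > 0"
proof -
  let ?Q = "%P :: real poly poly. P ~= 0 & poly (map_poly fps_of_poly P) f = 0"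
  obtain P0 where "?Q P0" using assms by (auto simp: fps_alg_def)
  from ex_has_least_nat[of ?Q, OF this, of degree] obtain P :: "real poly poly" where
    P: "P ~= 0" "poly (map_poly fps_of_poly P) f = 0" and least: "!!R. ?Q R ==> degree P \<le> degree R" by blast
  define A where "A = map_poly fps_of_poly P"
  have cA: "coeff A j = fps_of_poly (coeff P j)" for j by (simp add: A_def coeff_map_poly)
  have ofn: "fps_of_poly (of_nat k * c) = of_nat k * fps_of_poly c" for k and c :: "real poly"
    by (induction k) (auto simp: algebra_simps fps_of_poly_add)
  have dA: "pderiv A = map_poly fps_of_poly (pderiv P)"
    by (rule poly_eqI) (simp only: coeff_pderiv cA coeff_map_poly fps_of_poly_0 ofn)
  have "degree P ~= 0"
  proof
    assume "degree P = 0"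
    then obtain c where "P = [:c:]" by (rule degree_eq_zeroE)
    then show False using P by (auto simp: map_poly_pCons)
  qed
  then have "pderiv P ~= 0" "degree (pderiv P) < degree P" by (simp_all add: pderiv_eq_0_iff degree_pderiv)
  then have "poly (map_poly fps_of_poly (pderiv P)) f ~= 0" using least[of "pderiv P"] by auto
  then have g0: "poly (pderiv A) f ~= 0" by (simp add: dA)
  define g where "g = poly (pderiv A) f"
  define k where "k = subdegree g"
  \<comment> \<open>Cutting after the coefficient of index \<open>k\<close> agrees with
    \<open>f\<close> far enough to keep the order \<open>k\<close> of the derivative, and gives
    \<open>Z\<close> no constant term.\<close>
  define a where "a = fps_cutoff (Suc k) f"
  have enta: "fps_conv_radius a = \<infinity>" unfolding a_def by (simp flip: fps_of_poly_truncate)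
  define Z where "Z = fps_shift k (f - a)"
  have fa: "fps_nth (f - a) i = 0" if "i \<le> k" for i using that by (simp add: a_def)
  have fZ: "f = a + fps_X ^ k * Z"
  proof (rule fps_ext)
    fix i
    show "fps_nth f i = fps_nth (a + fps_X ^ k * Z) i"
      using fa[of i] by (auto simp: fps_X_power_mult_nth Z_def)
  qed
  have Z0: "fps_nth Z 0 = 0" using fa[of k] by (simp add: Z_def)
  define Q where "Q = pcompose A [:a, 1:]"
  have entQ: "fps_conv_radius (coeff Q j) = \<infinity>" for j
    unfolding Q_def by (rule entire_pcompose[OF _ enta]) (simp add: cA)
  have c1: "coeff Q 1 = poly (pderiv A) a"
  proof -
    have "coeff Q 1 = poly (pderiv Q) 0" by (simp add: poly_0_coeff_0 coeff_pderiv)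
    also have "pderiv Q = pcompose (pderiv A) [:a, 1:]" unfolding Q_def pderiv_pcompose by (simp add: pderiv_pCons)
    finally show ?thesis by (simp add: poly_pcompose)
  qed
  have c1g: "fps_nth (coeff Q 1) i = fps_nth g i" if "i \<le> k" for i
  proof -
    obtain w where "poly (pderiv A) f - poly (pderiv A) a = (f - a) * w" using poly_diff_factor by blast
    moreover have "fps_nth ((f - a) * w) i = 0"
      unfolding fps_mult_nth by (rule sum.neutral) (use fa that in auto)
    ultimately have "fps_nth (poly (pderiv A) f - poly (pderiv A) a) i = 0" by simp
    then show ?thesis unfolding c1 g_def by simp
  qed
  define e where "e = fps_shift k (coeff Q 1)"
  have e0: "fps_nth e 0 ~= 0" using c1g[of k] g0 by (simp add: e_def k_def g_def)
  have c1e: "coeff Q 1 = fps_X ^ k * e"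
  proof (rule fps_ext)
    fix i
    have "i < k ==> fps_nth g i = 0" unfolding k_def by (rule nth_less_subdegree_zero)
    then show "fps_nth (coeff Q 1) i = fps_nth (fps_X ^ k * e) i"
      using c1g[of i] by (auto simp: fps_X_power_mult_nth e_def)
  qed
  define N where "N = degree Q + 1"
  \<comment> \<open>The truncated subtraction is exact for \<open>j\<close> at least 2, the only
    indices used.\<close>
  define d where "d j = coeff Q j * fps_X ^ (k * j - 2 * k)" for j
  have "poly Q (fps_X ^ k * Z) = 0" unfolding Q_def poly_pcompose using P(2) fZ by (simp add: A_def)
  moreover have "poly Q (fps_X ^ k * Z) = (\<Sum>j\<le>N. coeff Q j * (fps_X ^ k * Z) ^ j)"
    unfolding poly_altdef by (rule sum.mono_neutral_left) (auto simp: N_def coeff_eq_0)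
  moreover have "{..N} = insert 0 (insert 1 {2..N})" by (auto simp: N_def)
  ultimately have s0: "coeff Q 0 + (coeff Q 1 * (fps_X ^ k * Z) + (\<Sum>j\<in>{2..N}. coeff Q j * (fps_X ^ k * Z) ^ j)) = 0"
    by simp
  have "(\<Sum>j\<in>{2..N}. coeff Q j * (fps_X ^ k * Z) ^ j) = (\<Sum>j\<in>{2..N}. fps_X ^ (2 * k) * (d j * Z ^ j))"
  proof (rule sum.cong[OF refl])
    fix j assume "j \<in> {2..N}"
    then have "k * j = 2 * k + (k * j - 2 * k)" by (cases j) auto
    then have "(fps_X :: real fps) ^ (k * j) = fps_X ^ (2 * k) * fps_X ^ (k * j - 2 * k)" by (metis power_add)
    then show "coeff Q j * (fps_X ^ k * Z) ^ j = fps_X ^ (2 * k) * (d j * Z ^ j)"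
      by (simp add: d_def power_mult_distrib power_mult[symmetric] mult_ac)
  qed
  moreover have "coeff Q 1 * (fps_X ^ k * Z) = fps_X ^ (2 * k) * (e * Z)"
  proof -
    have "(fps_X :: real fps) ^ (2 * k) = fps_X ^ k * fps_X ^ k" by (simp only: mult_2 power_add)
    then show ?thesis unfolding c1e by (simp only: mult_ac)
  qed
  ultimately have "coeff Q 0 + fps_X ^ (2 * k) * (e * Z + (\<Sum>j\<in>{2..N}. d j * Z ^ j)) = 0"
    using s0 by (simp only: sum_distrib_left[symmetric] distrib_left)
  then have c0: "coeff Q 0 = fps_X ^ (2 * k) * (- (e * Z + (\<Sum>j\<in>{2..N}. d j * Z ^ j)))"
    by (simp only: mult_minus_right eq_neg_iff_add_eq_0)
  define c where "c = fps_shift (2 * k) (coeff Q 0)"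
  have "c = - (e * Z + (\<Sum>j\<in>{2..N}. d j * Z ^ j))"
    unfolding c_def c0 by (rule fps_ext) (simp add: fps_X_power_mult_nth)
  then have "c + e * Z + (\<Sum>j\<in>{2..N}. d j * Z ^ j) = 0" by simp
  then have "fps_conv_radius Z > 0"
    by (rule fps_root_converges[OF Z0 e0, rotated -1])
      (auto simp: e_def c_def d_def entQ intro: entire_mult)
  then have "fps_conv_radius (fps_X ^ k * Z) > 0"
    using fps_conv_radius_mult[of "fps_X ^ k" Z] by (auto intro: less_le_trans[rotated])
  then show ?thesis using fps_conv_radius_add[of a "fps_X ^ k * Z"] enta fZ
    by (auto intro: less_le_trans[rotated])
qed

section \<open>Local branches of polynomial roots\<close>

lemma has_fps_expansion_lim:
  fixes F :: "'a :: {banach, real_normed_field} fps"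
  assumes F: "f has_fps_expansion F" and z: "!!i. i < j ==> fps_nth F i = 0"
  shows "((%s. f s / s ^ j) \<longlongrightarrow> fps_nth F j) (at 0)"
proof (cases "F = 0")
  case True
  have "\<forall>\<^sub>F s in at 0. f s = 0"
    using F True by (auto simp: has_fps_expansion_def eventually_at_filter elim!: eventually_mono)
  then have "\<forall>\<^sub>F s in at 0. f s / s ^ j = fps_nth F j" by eventually_elim (simp add: True)
  then show ?thesis by (rule tendsto_eventually)
next
  case False
  then have j: "j \<le> subdegree F" using z by (intro subdegree_geI) auto
  have r: "fps_conv_radius F > 0" and ev: "\<forall>\<^sub>F s in nhds 0. eval_fps F s = f s"
    using F by (auto simp: has_fps_expansion_def)
  have ev': "\<forall>\<^sub>F s in at 0. eval_fps F s = f s"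
    using ev by (auto simp: eventually_at_filter elim: eventually_mono)
  have "isCont (eval_fps (fps_shift j F)) 0" by (rule continuous_eval_fps) (simp add: r zero_ereal_def[symmetric])
  then have lim: "(eval_fps (fps_shift j F) \<longlongrightarrow> fps_nth F j) (at 0)" by (simp add: isCont_def eval_fps_at_0)
  have "\<forall>\<^sub>F s in at 0. s \<in> eball 0 (fps_conv_radius F)"
    using r by (intro eventually_at_in_open') (auto simp: zero_ereal_def[symmetric])
  then have "\<forall>\<^sub>F s in at 0. eval_fps (fps_shift j F) s = f s / s ^ j"
    using ev' eventually_neq_at_within[of 0 0 UNIV]
    by eventually_elim (subst eval_fps_shift[OF j], auto)
  with lim show ?thesis by (rule Lim_transform_eventually)
qed

text \<open>Boundedness of the quotient along one null sequence already forces the order of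
  \<open>B\<close> to be at least that of \<open>L\<close>: each lower coefficient of
  \<open>B\<close>, read off as a limit, is dominated by one of \<open>L\<close> that is zero. It
  serves for Puiseux branches and for quotients along arcs.\<close>

lemma fps_quotient_of_bounded:
  fixes B L :: "'a :: {banach, real_normed_field} fps" and s :: "nat => 'a"
  assumes b: "b has_fps_expansion B" and l: "l has_fps_expansion L" and L0: "L ~= 0"
    and s: "s \<longlonglongrightarrow> 0" "!!n. s n ~= 0" and le: "!!n. norm (b (s n)) \<le> K * norm (l (s n))"
  shows "\<exists>Y. fps_conv_radius Y > 0 & L * Y = B"
proof -
  define d where "d = subdegree L"
  have Bz: "fps_nth B i = 0" if "i < d" for i
    using that
  proof (induction i rule: less_induct)
    case (less e)
    have sl: "filterlim s (at 0) sequentially" using s by (simp add: filterlim_at)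
    have Lz: "fps_nth L i = 0" if "i \<le> e" for i using that less.prems by (intro nth_less_subdegree_zero) (simp add: d_def)
    have "((%x. b x / x ^ e) \<longlongrightarrow> fps_nth B e) (at 0)" using less by (intro has_fps_expansion_lim[OF b]) auto
    then have 1: "(%n. norm (b (s n) / s n ^ e)) \<longlonglongrightarrow> norm (fps_nth B e)"
      by (intro tendsto_norm filterlim_compose[OF _ sl])
    have "((%x. l x / x ^ e) \<longlongrightarrow> fps_nth L e) (at 0)" using Lz by (intro has_fps_expansion_lim[OF l]) auto
    then have "(%n. K * norm (l (s n) / s n ^ e)) \<longlonglongrightarrow> K * norm (fps_nth L e)"
      by (intro tendsto_intros filterlim_compose[OF _ sl])
    then have 2: "(%n. K * norm (l (s n) / s n ^ e)) \<longlonglongrightarrow> 0" using Lz[of e] by simp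
    have "norm (b (s n) / s n ^ e) \<le> K * norm (l (s n) / s n ^ e)" for n
      using le[of n] s(2)[of n] by (simp add: norm_divide divide_right_mono)
    then have "norm (fps_nth B e) \<le> 0" by (intro LIMSEQ_le[OF 1 2]) auto
    then show ?case by simp
  qed
  have eqs: "X = fps_X ^ d * fps_shift d X" if "!!i. i < d ==> fps_nth X i = 0" for X :: "'a fps"
    by (rule fps_ext) (use that in \<open>auto simp: fps_X_power_mult_nth\<close>)
  define L' where "L' = fps_shift d L"
  have L'0: "fps_nth L' 0 ~= 0" using L0 by (simp add: L'_def d_def)
  define Y where "Y = fps_shift d B * inverse L'"
  have LL: "L = fps_X ^ d * L'" unfolding L'_def by (rule eqs) (auto simp: d_def intro: nth_less_subdegree_zero)
  have "L * Y = fps_X ^ d * fps_shift d B * (L' * inverse L')" unfolding Y_def LL by (simp add: mult_ac)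
  also have "L' * inverse L' = 1" using inverse_mult_eq_1[OF L'0] by (simp add: mult.commute)
  finally have "L * Y = B" using eqs[OF Bz] by simp
  moreover have "fps_conv_radius Y > 0"
  proof -
    have "fps_conv_radius L > 0" "fps_conv_radius B > 0" using b l by (auto simp: has_fps_expansion_def)
    then have "fps_conv_radius (inverse L') > 0" using L'0 by (intro fps_conv_radius_inverse_pos) (auto simp: L'_def)
    then have "0 < min (fps_conv_radius (fps_shift d B)) (fps_conv_radius (inverse L'))"
      using \<open>fps_conv_radius B > 0\<close> by simp
    also have "\<dots> \<le> fps_conv_radius Y" unfolding Y_def by (rule fps_conv_radius_mult)
    finally show ?thesis .
  qed
  ultimately show ?thesis by blast
qed

text \<open>If no root at \<open>z\<close> were within \<open>\<epsilon>\<close> of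
  \<open>y0\<close>, the factored form would bound \<open>F z y0\<close> below by
  \<open>\<epsilon> ^ n\<close> times the leading coefficient, but it tends to zero.\<close>

lemma nearby_root:
  fixes F :: "complex => complex => complex" and R :: "complex => complex set"
  assumes z0: "z0 \<in> H" and H: "open H" and y0: "y0 \<in> R z0" and \<epsilon>: "\<epsilon> > 0"
    and F: "!!z y. z \<in> H ==> F z y = lc z * (\<Prod>r\<in>R z. y - r)"
    and R: "!!z. z \<in> H ==> finite (R z) & card (R z) = n"
    and lc: "!!z. z \<in> H ==> lc z ~= 0" "continuous_on H lc"
    and cF: "continuous_on H (%z. F z y0)"
  shows "\<forall>\<^sub>F z in nhds z0. z \<in> H & (\<exists>r\<in>R z. dist r y0 < \<epsilon>)"
proof -
  have c1: "((%z. F z y0) \<longlongrightarrow> F z0 y0) (nhds z0)" "(lc \<longlongrightarrow> lc z0) (nhds z0)"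
    using cF lc(2) H z0 continuous_on_eq_continuous_at[OF H] 
    by (auto simp: isCont_def tendsto_at_iff_tendsto_nhds)
  have "F z0 y0 = 0" using F[OF z0] y0 R[OF z0] by (auto intro: prod_zero)
  then have "((%z. norm (F z y0) - norm (lc z) * \<epsilon> ^ n) \<longlongrightarrow> 0 - norm (lc z0) * \<epsilon> ^ n) (nhds z0)"
    by (intro tendsto_intros tendsto_norm_zero) (use c1 in auto)
  moreover have "0 - norm (lc z0) * \<epsilon> ^ n < 0" using lc(1)[OF z0] \<epsilon> by simp
  ultimately have "\<forall>\<^sub>F z in nhds z0. norm (F z y0) - norm (lc z) * \<epsilon> ^ n < 0"
    by (rule order_tendstoD(2))
  moreover have "\<forall>\<^sub>F z in nhds z0. z \<in> H" using H z0 by (rule eventually_nhds_in_open)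
  ultimately show ?thesis
  proof eventually_elim
    case (elim z)
    have "\<exists>r\<in>R z. dist r y0 < \<epsilon>"
    proof (rule ccontr)
      assume "\<not> ?thesis"
      then have "\<epsilon> \<le> norm (y0 - r)" if "r \<in> R z" for r using that by (force simp: dist_norm norm_minus_commute)
      then have "(\<Prod>r\<in>R z. \<epsilon>) \<le> (\<Prod>r\<in>R z. norm (y0 - r))" using \<epsilon> by (intro prod_mono) auto
      then have "\<epsilon> ^ n \<le> norm (\<Prod>r\<in>R z. y0 - r)" using R[OF elim(2)] by (simp add: prod_norm)
      then have "norm (lc z) * \<epsilon> ^ n \<le> norm (F z y0)"
        unfolding F[OF elim(2)] norm_mult by (rule mult_left_mono) simp
      then show False using elim by simp
    qed
    then show ?case using elim by simp
  qed
qed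

text \<open>With a constant number of distinct roots and a non-vanishing leading coefficient, the
  root set is a covering space of \<open>H\<close>. A convex base is simply connected, so sections
  through any root exist and are determined by one value.\<close>

lemma root_sections:
  fixes F :: "complex => complex => complex" and R :: "complex => complex set"
  assumes H: "open H" "convex H" "z0 \<in> H"
    and F: "!!z y. z \<in> H ==> F z y = lc z * (\<Prod>r\<in>R z. y - r)"
    and R: "!!z. z \<in> H ==> finite (R z) & card (R z) = n"
    and n: "0 < n"
    and lc: "!!z. z \<in> H ==> lc z ~= 0" "continuous_on H lc"
    and cF: "!!y. continuous_on H (%z. F z y)"
  shows "!!g1 g2 a z. continuous_on H g1 ==> continuous_on H g2 ==> (!!z. z \<in> H ==> g1 z \<in> R z) ==>
      (!!z. z \<in> H ==> g2 z \<in> R z) ==> a \<in> H ==> g1 a = g2 a ==> z \<in> H ==> g1 z = g2 z"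
    and "!!y. y \<in> R z0 ==> \<exists>g. continuous_on H g & (\<forall>z\<in>H. g z \<in> R z) & g z0 = y"
proof -
  define C where "C = (SIGMA z:H. R z)"
  have cov: "covering_space C fst H"
  proof
    show "continuous_on C fst" by (intro continuous_intros)
    have "R z ~= {}" if "z \<in> H" for z using R[OF that] n by auto
    then show "fst ` C = H" unfolding C_def by force
  next
    fix z1 assume z1: "z1 \<in> H"
    have fin: "finite (R z1)" using R[OF z1] by simp
    \<comment> \<open>At most half the smallest distance between roots over \<open>z1\<close>, so
      that the balls around them are disjoint; the inserted 1 covers the case of a single
      root.\<close>
    obtain \<epsilon> where \<epsilon>: "\<epsilon> > 0" "!!y y'. y \<in> R z1 ==> y' \<in> R z1 ==> y ~= y' ==> 2 * \<epsilon> \<le> dist y y'"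
    proof -
      define D where "D = insert 1 ((%(y, y'). dist y y') ` {(y, y') \<in> R z1 \<times> R z1. y ~= y'})"
      have fD: "finite D" unfolding D_def using fin
        by (intro finite.insertI finite_imageI finite_subset[OF _ finite_cartesian_product[OF fin fin]]) auto
      have pos: "Min D > 0" using fD by (subst Min_gr_iff) (auto simp: D_def)
      have "2 * (Min D / 2) \<le> dist y y'" if "y \<in> R z1" "y' \<in> R z1" "y ~= y'" for y y'
      proof -
        have "dist y y' \<in> D" unfolding D_def using that by force
        then have "Min D \<le> dist y y'" by (rule Min_le[OF fD])
        then show ?thesis by simp
      qed
      then show ?thesis using that[of "Min D / 2"] pos by auto
    qed
    have "\<forall>\<^sub>F z in nhds z1. \<forall>y\<in>R z1. z \<in> H & (\<exists>r\<in>R z. dist r y < \<epsilon>)"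
      by (intro eventually_ball_finite[OF fin] ballI nearby_root[OF z1 H(1) _ \<epsilon>(1) F R lc cF])
    then obtain T where T: "open T" "z1 \<in> T" "!!z. z \<in> T ==> \<forall>y\<in>R z1. z \<in> H & (\<exists>r\<in>R z. dist r y < \<epsilon>)"
      unfolding eventually_nhds by blast
    have ne: "R z1 ~= {}" using R[OF z1] n by auto
    have TH: "T \<subseteq> H" using T(3) ne by blast
    \<comment> \<open>Counting: each of the \<open>n\<close> disjoint balls contains a root over
      \<open>z\<close>, and there are exactly \<open>n\<close> roots, so no ball contains
      two.\<close>
    have uniq: "r = r'" if z: "z \<in> T" and r: "r \<in> R z" "r' \<in> R z" "dist r y < \<epsilon>" "dist r' y < \<epsilon>" "y \<in> R z1" for z r r' y
    proof (rule ccontr)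
      assume ne: "r ~= r'"
      have "\<forall>y\<in>R z1. \<exists>r\<in>R z. dist r y < \<epsilon>" using T(3)[OF z] by blast
      then obtain \<rho> where \<rho>: "!!y. y \<in> R z1 ==> \<rho> y \<in> R z & dist (\<rho> y) y < \<epsilon>" by metis
      have inj: "inj_on \<rho> (R z1)"
      proof (rule inj_onI, rule ccontr)
        fix a b assume ab: "a \<in> R z1" "b \<in> R z1" "\<rho> a = \<rho> b" "a ~= b"
        have "dist a b \<le> dist (\<rho> a) a + dist (\<rho> b) b" using ab(3) by (metis dist_triangle2 dist_commute add.commute)
        then show False using \<epsilon>(2)[OF ab(1,2,4)] \<rho>[OF ab(1)] \<rho>[OF ab(2)] by linarith
      qed
      have "\<rho> ` R z1 = R z"
      proof (rule card_subset_eq)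
        show "finite (R z)" using R TH z by blast
        show "\<rho> ` R z1 \<subseteq> R z" using \<rho> by blast
        show "card (\<rho> ` R z1) = card (R z)" using card_image[OF inj] R[OF z1] R[of z] TH z by auto
      qed
      then obtain a b where ab: "a \<in> R z1" "b \<in> R z1" "r = \<rho> a" "r' = \<rho> b" using r by blast
      have "a = y"
      proof (rule ccontr)
        assume "a ~= y"
        have "dist a y \<le> dist r a + dist r y" by (metis dist_triangle3 dist_commute)
        then show False using \<epsilon>(2)[OF ab(1) r(5) \<open>a ~= y\<close>] \<rho>[OF ab(1)] ab r by auto
      qed
      moreover have "b = y"
      proof (rule ccontr)
        assume "b ~= y"
        have "dist b y \<le> dist r' b + dist r' y" by (metis dist_triangle3 dist_commute)
        then show False using \<epsilon>(2)[OF ab(2) r(5) \<open>b ~= y\<close>] \<rho>[OF ab(2)] ab r by auto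
      qed
      ultimately show False using ab ne by simp
    qed
    have all: "\<exists>y\<in>R z1. dist r y < \<epsilon>" if z: "z \<in> T" and r: "r \<in> R z" for z r
    proof -
      have "\<forall>y\<in>R z1. \<exists>r\<in>R z. dist r y < \<epsilon>" using T(3)[OF z] by blast
      then obtain \<rho> where \<rho>: "!!y. y \<in> R z1 ==> \<rho> y \<in> R z & dist (\<rho> y) y < \<epsilon>" by metis
      have inj: "inj_on \<rho> (R z1)"
      proof (rule inj_onI, rule ccontr)
        fix a b assume ab: "a \<in> R z1" "b \<in> R z1" "\<rho> a = \<rho> b" "a ~= b"
        have "dist a b \<le> dist (\<rho> a) a + dist (\<rho> b) b" using ab(3) by (metis dist_triangle2 dist_commute add.commute)
        then show False using \<epsilon>(2)[OF ab(1,2,4)] \<rho>[OF ab(1)] \<rho>[OF ab(2)] by linarith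
      qed
      have "\<rho> ` R z1 = R z"
      proof (rule card_subset_eq)
        show "finite (R z)" using R TH z by blast
        show "\<rho> ` R z1 \<subseteq> R z" using \<rho> by blast
        show "card (\<rho> ` R z1) = card (R z)" using card_image[OF inj] R[OF z1] R[of z] TH z by auto
      qed
      then obtain y where "y \<in> R z1" "r = \<rho> y" using r by blast
      then show ?thesis using \<rho> by auto
    qed
    define u where "u y = C \<inter> (T \<times> ball y \<epsilon>)" for y
    show "\<exists>T. z1 \<in> T & openin (top_of_set H) T &
       (\<exists>v. \<Union>v = C \<inter> fst -` T & (\<forall>u\<in>v. openin (top_of_set C) u) & pairwise disjnt v &
         (\<forall>u\<in>v. \<exists>q. homeomorphism u T fst q))"
    proof (intro exI[of _ T] conjI exI[of _ "u ` R z1"] ballI)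
      show "z1 \<in> T" by fact
      show "openin (top_of_set H) T" using T(1) TH by (auto simp: openin_open)
      show "\<Union> (u ` R z1) = C \<inter> fst -` T"
      proof (intro equalityI subsetI)
        fix x assume "x \<in> C \<inter> fst -` T"
        then obtain z r where x: "x = (z, r)" "z \<in> T" "r \<in> R z" "x \<in> C" by (cases x) (auto simp: C_def)
        obtain y where "y \<in> R z1" "dist r y < \<epsilon>" using all[OF x(2,3)] by blast
        then show "x \<in> \<Union> (u ` R z1)" using x by (auto simp: u_def dist_commute)
      qed (auto simp: u_def)
      show "openin (top_of_set C) w" if w: "w \<in> u ` R z1" for w
      proof -
        obtain y where "w = C \<inter> (T \<times> ball y \<epsilon>)" using w unfolding u_def by blast
        moreover have "open (T \<times> ball y \<epsilon>)" using T(1) by (intro open_Times) auto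
        ultimately show ?thesis by (auto simp: openin_open)
      qed
      show "pairwise disjnt (u ` R z1)"
      proof (rule pairwiseI)
        fix w w' assume "w \<in> u ` R z1" "w' \<in> u ` R z1" "w ~= w'"
        then obtain y y' where y: "y \<in> R z1" "y' \<in> R z1" "w = u y" "w' = u y'" "y ~= y'" by blast
        show "disjnt w w'" unfolding disjnt_def
        proof (rule ccontr)
          assume "w \<inter> w' ~= {}"
          then obtain r where "dist y r < \<epsilon>" "dist y' r < \<epsilon>" unfolding y by (auto simp: u_def)
          moreover have "dist y y' \<le> dist y r + dist y' r" by (rule dist_triangle2)
          ultimately show False using \<epsilon>(2)[OF y(1,2,5)] by linarith
        qed
      qed
      fix w assume "w \<in> u ` R z1"
      then obtain y where y: "y \<in> R z1" "w = u y" by blast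
      have "\<forall>z\<in>T. \<exists>r. r \<in> R z & dist r y < \<epsilon>" using T(3) y(1) by blast
      then obtain \<rho> where \<rho>: "!!z. z \<in> T ==> \<rho> z \<in> R z & dist (\<rho> z) y < \<epsilon>" by metis
      have cont: "continuous_on T \<rho>"
        unfolding continuous_on_eq_continuous_at[OF T(1)]
      proof
        fix z2 assume z2: "z2 \<in> T"
        show "isCont \<rho> z2" unfolding isCont_def tendsto_at_iff_tendsto_nhds
        proof (rule tendstoI)
          fix e :: real assume e: "e > 0"
          define e2 where "e2 = min e (\<epsilon> - dist (\<rho> z2) y)"
          have e2: "e2 > 0" using e \<rho>[OF z2] by (simp add: e2_def)
          have "\<forall>\<^sub>F z in nhds z2. z \<in> H & (\<exists>r\<in>R z. dist r (\<rho> z2) < e2)"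
            by (rule nearby_root[OF _ H(1) _ e2 F R lc cF]) (use z2 TH \<rho> in auto)
          moreover have "\<forall>\<^sub>F z in nhds z2. z \<in> T" using T(1) z2 by (rule eventually_nhds_in_open)
          ultimately show "\<forall>\<^sub>F z in nhds z2. dist (\<rho> z) (\<rho> z2) < e"
          proof eventually_elim
            case (elim z)
            then obtain r where r: "r \<in> R z" "dist r (\<rho> z2) < e2" by blast
            have "dist r y \<le> dist r (\<rho> z2) + dist (\<rho> z2) y" by (rule dist_triangle)
            then have "dist r y < \<epsilon>" using r(2) by (simp add: e2_def)
            then have "r = \<rho> z" using uniq[OF elim(2) r(1) _ _ _ y(1)] \<rho>[OF elim(2)] by blast
            then show ?case using r(2) by (simp add: e2_def)
          qed
        qed
      qed
      show "\<exists>q. homeomorphism w T fst q"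
      proof (intro exI[of _ "%z. (z, \<rho> z)"] homeomorphismI)
        show "continuous_on w fst" by (intro continuous_intros)
        show "continuous_on T (%z. (z, \<rho> z))" using cont by (intro continuous_intros)
        show "fst ` w \<subseteq> T" unfolding y(2) u_def by auto
        show "(%z. (z, \<rho> z)) ` T \<subseteq> w" unfolding y(2) u_def C_def using \<rho> TH by (auto simp: dist_commute)
        show "(fst x, \<rho> (fst x)) = x" if xw: "x \<in> w" for x
        proof -
          obtain z r where x: "x = (z, r)" "z \<in> T" "r \<in> R z" "dist r y < \<epsilon>"
            using xw unfolding y(2) u_def C_def by (auto simp: dist_commute)
          then have "r = \<rho> z" using uniq[OF x(2,3) _ x(4) _ y(1)] \<rho>[OF x(2)] by blast
          then show ?thesis using x by simp
        qed
      qed auto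
    qed
  qed
  have Hc: "H \<in> components H"
    using convex_connected[OF H(2)] H(3) by (metis components_eq_sing_iff empty_iff insertI1)
  show "g1 z = g2 z" if g: "continuous_on H g1" "continuous_on H g2" "!!z. z \<in> H ==> g1 z \<in> R z"
      "!!z. z \<in> H ==> g2 z \<in> R z" "a \<in> H" "g1 a = g2 a" "z \<in> H" for g1 g2 a z
  proof -
    have "(%z. (z, g1 z)) z = (%z. (z, g2 z)) z"
      by (rule covering_space_lift_unique_gen[OF cov, where f = id and T = H and U = H and a = a])
        (use g Hc in \<open>auto simp: C_def intro!: continuous_intros\<close>)
    then show ?thesis by simp
  qed
  fix y assume y: "y \<in> R z0"
  obtain g where g: "continuous_on H g" "g \<in> H \<rightarrow> C" "g z0 = (z0, y)" "!!z. z \<in> H ==> fst (g z) = id z"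
  proof (rule covering_space_lift_strong[OF cov, where f = id and U = H and a = "(z0, y)" and z = z0])
    show "simply_connected H" using H(2) by (rule convex_imp_simply_connected)
    show "locally path_connected H" using H(2) by (rule convex_imp_locally_path_connected)
  qed (use H y in \<open>auto simp: C_def\<close>)
  show "\<exists>g. continuous_on H g & (\<forall>z\<in>H. g z \<in> R z) & g z0 = y"
  proof (intro exI[of _ "%z. snd (g z)"] conjI ballI)
    show "continuous_on H (%z. snd (g z))" using g(1) by (intro continuous_intros)
    show "snd (g z) \<in> R z" if "z \<in> H" for z
    proof -
      have "g z \<in> C" "fst (g z) = z" using g(2,4) that by (auto simp: Pi_iff)
      then show ?thesis by (cases "g z") (auto simp: C_def)
    qed
  qed (simp add: g(3))
qed

section \<open>Bivariate polynomials: separability, size and regularity of roots\<close>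

definition poly2 :: "'a::comm_ring_1 poly poly => 'a => 'a => 'a" where
  "poly2 B t y = poly (poly B [:y:]) t"

lemma poly2_map: "poly2 B t y = poly (map_poly (%c. poly c t) B) y"
  by (induction B) (simp_all add: poly2_def map_poly_pCons)

lemma poly2_simps: "poly2 (A + B) t y = poly2 A t y + poly2 B t y" "poly2 (A * B) t y = poly2 A t y * poly2 B t y"
  "poly2 [:c:] t y = poly c t" "poly2 (Polynomial.smult c B) t y = poly c t * poly2 B t y"
  by (simp_all add: poly2_def)

lemma poly2_pderiv: "poly (pderiv (map_poly (%c. poly c t) B)) y = poly2 (pderiv B) t y"
proof -
  have "pderiv (map_poly (%c. poly c t) B) = map_poly (%c. poly c t) (pderiv B)"
    by (rule poly_eqI) (simp add: coeff_pderiv coeff_map_poly)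
  then show ?thesis by (simp add: poly2_map)
qed

text \<open>By pseudo-division, an element \<open>D\<close> of least degree in the ideal of
  \<open>B\<close> and its derivative divides the product of \<open>B\<close> with a coefficient
  polynomial. Since \<open>min\<close> forbids a proper factor, \<open>D\<close> is itself a
  coefficient polynomial; away from its zeros all roots are simple.\<close>

lemma separable_by_minimality:
  fixes B :: "complex poly poly"
  assumes deg: "degree B > 0"
    and min: "!!D q l. l ~= 0 ==> Polynomial.smult l B = D * q ==> degree D < degree B ==> degree q < degree B ==> False"
  shows "\<exists>A1 A2 r. r ~= 0 & A1 * B + A2 * pderiv B = [:r:]"
proof -
  let ?I = "%D. D ~= 0 & (\<exists>A1 A2. D = A1 * B + A2 * pderiv B)"
  have B0: "B ~= 0" and d0: "pderiv B ~= 0" using deg by (auto simp: pderiv_eq_0_iff)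
  have I0: "?I (pderiv B)" using d0 by (metis add_0 mult_1 mult_zero_left)
  from ex_has_least_nat[of ?I, OF I0, of degree] obtain D where
    D: "?I D" and least: "!!E. ?I E ==> degree D \<le> degree E" by blast
  then obtain A1 A2 where A: "D = A1 * B + A2 * pderiv B" by blast
  have dD: "degree D < degree B" using least[OF I0] deg by (simp add: degree_pderiv)
  have "degree D = 0"
  proof (rule ccontr)
    assume nz: "degree D ~= 0"
    obtain q r where qr: "pseudo_divmod B D = (q, r)" by (cases "pseudo_divmod B D")
    define l where "l = lead_coeff D ^ (Suc (degree B) - degree D)"
    have l: "l ~= 0" using D by (simp add: l_def)
    have e: "Polynomial.smult l B = D * q + r" "r = 0 \<or> degree r < degree D"
      using pseudo_divmod[OF _ qr] D unfolding l_def by auto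
    have "r = [:l:] * B - (A1 * B + A2 * pderiv B) * q" using e(1) by (simp add: A[symmetric] algebra_simps)
    also have "\<dots> = ([:l:] - A1 * q) * B + (- (A2 * q)) * pderiv B" by (simp add: algebra_simps)
    finally have "r = ([:l:] - A1 * q) * B + (- (A2 * q)) * pderiv B" .
    then have r0: "r = 0" using e(2) least[of r] by (metis leD)
    then have eq: "Polynomial.smult l B = D * q" using e by simp
    have q0: "q ~= 0" using eq l B0 by auto
    have "degree B = degree D + degree q" using eq l D q0 by (metis degree_mult_eq degree_smult_eq)
    then show False using min[OF l eq dD] nz by simp
  qed
  then obtain r where "D = [:r:]" by (rule degree_eq_zeroE)
  then show ?thesis using A D by (metis pCons_0_0)
qed

text \<open>The leading coefficient times a root is integral: multiplying the equation by
  \<open>coeff p n ^ (n - 1)\<close> makes it monic in the product. The resulting bound does not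
  degenerate where the leading coefficient is small.\<close>

lemma scaled_root_bound:
  fixes p :: "'a :: real_normed_field poly"
  assumes n: "degree p = n" "0 < n" and y: "poly p y = 0" and K: "!!k. norm (coeff p k) \<le> K" "1 \<le> K"
  shows "norm (coeff p n * y) \<le> 1 + n * K ^ n"
proof (cases "norm (coeff p n * y) \<le> 1")
  case True
  then show ?thesis using K by (smt (verit) mult_nonneg_nonneg of_nat_0_le_iff zero_le_power)
next
  case False
  define c where "c = coeff p n"
  define w where "w = c * y"
  have w1: "norm w > 1" using False by (simp add: w_def c_def)
  have "(\<Sum>k\<le>n. coeff p k * y ^ k) = 0" using y n by (simp add: poly_altdef)
  then have "c * y ^ n = - (\<Sum>k<n. coeff p k * y ^ k)"
    by (simp add: c_def lessThan_Suc_atMost[symmetric] eq_neg_iff_add_eq_0 add.commute)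
  then have "c ^ (n - 1) * (c * y ^ n) = - (\<Sum>k<n. c ^ (n - 1) * (coeff p k * y ^ k))"
    by (simp add: sum_distrib_left)
  also have "(\<Sum>k<n. c ^ (n - 1) * (coeff p k * y ^ k)) = (\<Sum>k<n. coeff p k * c ^ (n - 1 - k) * w ^ k)"
  proof (rule sum.cong[OF refl])
    fix k assume "k \<in> {..<n}"
    then have "c ^ (n - 1) = c ^ (n - 1 - k) * c ^ k" by (simp flip: power_add)
    then show "c ^ (n - 1) * (coeff p k * y ^ k) = coeff p k * c ^ (n - 1 - k) * w ^ k"
      by (simp add: w_def power_mult_distrib mult_ac)
  qed
  also have "c ^ (n - 1) * (c * y ^ n) = w ^ n"
    using n(2) by (cases n) (simp_all add: w_def power_mult_distrib mult_ac)
  finally have "norm (w ^ n) \<le> (\<Sum>k<n. norm (coeff p k * c ^ (n - 1 - k) * w ^ k))"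
    by (simp only: norm_minus_cancel) (rule norm_sum)
  also have "\<dots> \<le> (\<Sum>k<n. K ^ n * norm w ^ (n - 1))"
  proof (rule sum_mono)
    fix k assume k: "k \<in> {..<n}"
    have "norm (coeff p k) * norm c ^ (n - 1 - k) \<le> K * K ^ (n - 1 - k)"
      using K by (intro mult_mono power_mono) (auto simp: c_def)
    also have "\<dots> = K ^ Suc (n - 1 - k)" by simp
    also have "\<dots> \<le> K ^ n" using K(2) k by (intro power_increasing) auto
    finally have 1: "norm (coeff p k) * norm c ^ (n - 1 - k) \<le> K ^ n" .
    have 2: "norm w ^ k \<le> norm w ^ (n - 1)" using w1 k by (intro power_increasing) auto
    show "norm (coeff p k * c ^ (n - 1 - k) * w ^ k) \<le> K ^ n * norm w ^ (n - 1)"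
      unfolding norm_mult norm_power using K(2) by (intro mult_mono 1 2) auto
  qed
  also have "\<dots> = (n * K ^ n) * norm w ^ (n - 1)" by simp
  finally have "norm w * norm w ^ (n - 1) \<le> (n * K ^ n) * norm w ^ (n - 1)"
    using n(2) by (cases n) (simp_all add: norm_power norm_mult)
  moreover have "0 < norm w ^ (n - 1)" using w1 by (intro zero_less_power) linarith
  ultimately have "norm w \<le> n * K ^ n" by (rule mult_right_le_imp_le)
  then show ?thesis by (simp add: w_def c_def)
qed

text \<open>Dividing \<open>B\<close> by the linear factor of the root at \<open>z1\<close> leaves a
  remainder that depends on \<open>z\<close> alone. It expresses the difference quotient of
  \<open>g\<close> through a holomorphic difference quotient and the cofactor \<open>S\<close>,
  whose value at the root is the derivative of \<open>B\<close>.\<close>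

lemma simple_root_holomorphic:
  fixes B :: "complex poly poly"
  assumes H: "open H" and g: "continuous_on H g" and root: "!!z. z \<in> H ==> poly2 B (exp z) (g z) = 0"
    and simple: "!!z. z \<in> H ==> poly2 (pderiv B) (exp z) (g z) ~= 0"
  shows "g holomorphic_on H"
proof -
  have "\<exists>D. (g has_field_derivative D) (at z1)" if z1: "z1 \<in> H" for z1
  proof -
    define y1 where "y1 = g z1"
    define S where "S = synthetic_div B [:y1:]"
    define q where "q = poly B [:y1:]"
    have B: "B = [:- [:y1:], 1:] * S + [:q:]" unfolding S_def q_def by (rule synthetic_div_correct'[symmetric])
    have ev: "poly2 B t y = (y - y1) * poly2 S t y + poly q t" for t y
    proof -
      have "poly2 [:- [:y1:], 1:] t y = y - y1" by (simp add: poly2_def)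
      then show ?thesis by (subst B) (simp only: poly2_simps)
    qed
    have "pderiv B = [:- [:y1:], 1:] * pderiv S + S"
      by (subst B) (simp only: pderiv_add pderiv_mult pderiv_pCons pderiv_0 mult_1_right mult_1 add_0_right pCons_0_0 pderiv_1 pderiv_singleton, simp)
    then have "poly2 (pderiv B) t y1 = poly2 S t y1" for t
      by (simp only: poly2_simps) (simp add: poly2_def)
    then have S1: "poly2 S (exp z1) y1 ~= 0" using simple[OF z1] by (simp add: y1_def)
    have lim: "(g \<longlongrightarrow> y1) (at z1)" using g z1 H by (simp add: continuous_on_eq_continuous_at isCont_def y1_def)
    have "((%z. \<Sum>k\<le>degree S. poly (coeff S k) (exp z) * g z ^ k) \<longlongrightarrow> (\<Sum>k\<le>degree S. poly (coeff S k) (exp z1) * y1 ^ k)) (at z1)"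
      by (intro tendsto_intros lim)
    moreover have "poly2 S t y = (\<Sum>k\<le>degree S. poly (coeff S k) t * y ^ k)" for t y
      by (simp add: poly2_def poly_altdef[of S] poly_sum)
    ultimately have limS: "((%z. poly2 S (exp z) (g z)) \<longlongrightarrow> poly2 S (exp z1) y1) (at z1)" by simp
    define D where "D = poly (pderiv q) (exp z1) * exp z1"
    have "((%z. poly q (exp z)) has_field_derivative D) (at z1)" unfolding D_def
      by (rule DERIV_chain2[OF poly_DERIV]) (rule DERIV_exp)
    moreover have q1: "poly q (exp z1) = 0" using ev[of "exp z1" y1] root[OF z1] by (simp add: y1_def)
    ultimately have "((%z. poly q (exp z) / (z - z1)) \<longlongrightarrow> D) (at z1)"
      by (simp add: has_field_derivative_iff)
    then have l1: "((%z. - (poly q (exp z) / (z - z1)) / poly2 S (exp z) (g z)) \<longlongrightarrow> - D / poly2 S (exp z1) y1) (at z1)"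
      by (intro tendsto_intros limS S1)
    have "\<forall>\<^sub>F z in at z1. poly2 S (exp z) (g z) ~= 0" using limS S1 by (rule tendsto_imp_eventually_ne)
    moreover have "\<forall>\<^sub>F z in at z1. z \<in> H" using H z1 by (rule eventually_at_in_open')
    ultimately have "\<forall>\<^sub>F z in at z1. - (poly q (exp z) / (z - z1)) / poly2 S (exp z) (g z) = (g z - g z1) / (z - z1)"
    proof eventually_elim
      case (elim z)
      have "(g z - y1) * poly2 S (exp z) (g z) = - poly q (exp z)"
        using ev[of "exp z" "g z"] root[OF elim(2)] by (simp add: eq_neg_iff_add_eq_0)
      then have "g z - y1 = - poly q (exp z) / poly2 S (exp z) (g z)" using elim by (simp add: field_simps)
      then show ?case by (simp add: y1_def)
    qed
    then have "((%z. (g z - g z1) / (z - z1)) \<longlongrightarrow> - D / poly2 S (exp z1) y1) (at z1)"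
      using l1 by (rule Lim_transform_eventually[rotated])
    then show ?thesis by (auto simp: has_field_derivative_iff)
  qed
  then show ?thesis using H by (metis field_differentiable_def holomorphic_on_open)
qed

text \<open>The logarithm is cut along the negative axis, its rotated version along the positive
  axis. Where both are defined they differ by a multiple of 2 pi i, which the period absorbs, and
  the two slit discs cover the punctured disc.\<close>

lemma periodic_descends:
  assumes g: "g holomorphic_on {z. Re z < L}" and M: "0 < M"
    and per: "!!z k :: int. Re z < L ==> g (z + of_int k * (of_nat M * (2 * of_real pi * \<i>))) = g z"
  shows "(%s. g (of_nat M * Ln s)) holomorphic_on (ball 0 (exp (L / M)) - {0})"
proof -
  have re: "Re (of_nat M * Ln s) < L" if "s \<in> ball 0 (exp (L / M)) - {0}" for s
  proof -
    have "ln (norm s) < L / M" using that by (metis DiffD1 DiffD2 exp_less_cancel_iff exp_ln mem_ball_0 singletonI zero_less_norm_iff)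
    then show ?thesis using that M by (simp add: field_simps Re_Ln)
  qed
  have re2: "Re (of_nat M * (Ln (- s) + \<i> * pi)) < L" if "(s :: complex) \<in> ball 0 (exp (L / M)) - {0}" for s :: complex
    using re[of "- s"] that by simp
  have "(%s. g (of_nat M * Ln s)) holomorphic_on ((ball 0 (exp (L / M)) - {0}) - \<real>\<^sub>\<le>\<^sub>0)"
    by (intro holomorphic_on_compose_gen[OF _ g, unfolded o_def] holomorphic_intros) (use re in auto)
  moreover have "(%s. g (of_nat M * Ln s)) holomorphic_on ((ball 0 (exp (L / M)) - {0}) - \<real>\<^sub>\<ge>\<^sub>0)"
  proof (rule holomorphic_transform)
    show "(%s. g (of_nat M * (Ln (- s) + \<i> * pi))) holomorphic_on ((ball 0 (exp (L / M)) - {0}) - \<real>\<^sub>\<ge>\<^sub>0)"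
      by (intro holomorphic_on_compose_gen[OF _ g, unfolded o_def] holomorphic_intros)
        (use re2 in \<open>auto simp: complex_nonpos_Reals_iff complex_nonneg_Reals_iff\<close>)
    fix s :: complex assume s: "s \<in> (ball 0 (exp (L / M)) - {0}) - \<real>\<^sub>\<ge>\<^sub>0"
    then have s0: "s ~= 0" by auto
    have "exp (Ln (- s) + \<i> * pi) = exp (Ln s)" using s0 by (simp add: exp_add)
    then obtain k :: int where k: "Ln (- s) + \<i> * pi = Ln s + (of_int (2 * k) * pi) * \<i>" by (auto simp: exp_eq)
    have "of_nat M * (Ln (- s) + \<i> * pi) = of_nat M * Ln s + of_int k * (of_nat M * (2 * of_real pi * \<i>))"
      unfolding k by (simp add: algebra_simps)
    then show "g (of_nat M * (Ln (- s) + \<i> * pi)) = g (of_nat M * Ln s)" using per[OF re[of s], of k] s by auto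
  qed
  ultimately have "(%s. g (of_nat M * Ln s)) holomorphic_on
     (((ball 0 (exp (L / M)) - {0}) - \<real>\<^sub>\<le>\<^sub>0) \<union> ((ball 0 (exp (L / M)) - {0}) - \<real>\<^sub>\<ge>\<^sub>0))"
    by (intro holomorphic_on_Un) (auto intro!: open_Diff)
  moreover have "((ball 0 (exp (L / M)) - {0}) - \<real>\<^sub>\<le>\<^sub>0) \<union> ((ball 0 (exp (L / M)) - {0}) - \<real>\<^sub>\<ge>\<^sub>0)
     = ball 0 (exp (L / M)) - {0 :: complex}"
    by (auto simp: complex_nonpos_Reals_iff complex_nonneg_Reals_iff complex_eq_iff)
  ultimately show ?thesis by simp
qed

section \<open>Puiseux expansions along sequences\<close>

lemma infinite_image_null_sequence:
  fixes t :: "nat => real"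
  assumes "!!n. 0 < t n" "t \<longlonglongrightarrow> 0" "infinite N"
  shows "infinite (t ` N)"
proof
  assume fin: "finite (t ` N)"
  have ne: "t ` N ~= {}" using assms(3) by auto
  have "Min (t ` N) > 0" using fin ne assms(1) by (subst Min_gr_iff) auto
  from order_tendstoD(2)[OF assms(2) this] obtain n0 where n0: "!!n. n \<ge> n0 ==> t n < Min (t ` N)"
    by (auto simp: eventually_sequentially)
  obtain n where "n \<ge> n0" "n \<in> N" using assms(3) by (auto simp: infinite_nat_iff_unbounded_le)
  then show False using n0[of n] Min_le[OF fin, of "t n"] by auto
qed

lemma rsquarefree_card_roots:
  assumes "rsquarefree (p :: complex poly)"
  shows "card {x. poly p x = 0} = degree p"
proof -
  have p0: "p ~= 0" using assms by (auto simp: rsquarefree_def)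
  have "degree (\<Prod>z\<in>A. [:- z, 1:]) = card A" if "finite A" for A :: "complex set"
    using that
  proof induction
    case (insert z A)
    have "(\<Prod>z\<in>A. [:- z, 1:]) ~= 0" using insert.hyps by (simp add: prod_zero_iff)
    then have "degree ([:- z, 1:] * (\<Prod>z\<in>A. [:- z, 1:])) = 1 + degree (\<Prod>z\<in>A. [:- z, 1:])"
      by (subst degree_mult_eq) auto
    then show ?case using insert.hyps insert.IH by simp
  qed simp
  from this[of "{x. poly p x = 0}"] have "degree (\<Prod>z|poly p z = 0. [:- z, 1:]) = card {x. poly p x = 0}"
    using poly_roots_finite[OF p0] by blast
  moreover have "degree p = degree (Polynomial.smult (lead_coeff p) (\<Prod>z|poly p z = 0. [:- z, 1:]))"
    using complex_poly_decompose_rsquarefree[OF assms] by simp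
  moreover have "degree (Polynomial.smult (lead_coeff p) (\<Prod>z|poly p z = 0. [:- z, 1:])) = degree (\<Prod>z|poly p z = 0. [:- z, 1:])"
    using p0 by (intro degree_smult_eq[THEN trans]) simp
  ultimately show ?thesis by (simp only:)
qed

text \<open>Among the \<open>n + 1\<close> translates of \<open>g\<close> by 0 to \<open>n\<close>
  times 2 pi i two agree at \<open>z0\<close>, hence everywhere, so \<open>g\<close> has a period of
  at most \<open>n\<close> turns. The factorial is a common multiple of all such periods.\<close>

lemma section_periodic:
  fixes g :: "complex => complex"
  assumes uniq: "!!g1 g2 a z. continuous_on {z. Re z < L} g1 ==> continuous_on {z. Re z < L} g2 ==>
      (!!z. Re z < L ==> g1 z \<in> R (exp z)) ==> (!!z. Re z < L ==> g2 z \<in> R (exp z)) ==> Re a < L ==> g1 a = g2 a ==>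
      Re z < L ==> g1 z = g2 z"
    and g: "continuous_on {z. Re z < L} g" "!!z. Re z < L ==> g z \<in> R (exp z)"
    and fin: "finite (R (exp z0))" "card (R (exp z0)) = n" "Re z0 < L"
    and z: "Re z < L"
  shows "g (z + of_int k * (of_nat (fact n) * (2 * of_real pi * \<i>))) = g z"
proof -
  define T where "T = 2 * of_real pi * \<i>"
  have Re_T: "Re T = 0" by (simp add: T_def)
  have exp_T: "exp (z + of_nat j * T) = exp z" for z and j :: nat
  proof -
    have "exp T = 1" unfolding T_def by (rule exp_two_pi_i)
    then show ?thesis by (simp add: exp_add exp_of_nat_mult)
  qed
  define s where "s j z = g (z + of_nat j * T)" for j :: nat and z
  have s: "continuous_on {z. Re z < L} (s j)" "!!z. Re z < L ==> s j z \<in> R (exp z)" for j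
  proof -
    have "continuous_on {z. Re z < L} (g \<circ> (%z. z + of_nat j * T))"
      by (intro continuous_on_compose continuous_intros continuous_on_subset[OF g(1)]) (auto simp: T_def)
    then show "continuous_on {z. Re z < L} (s j)" by (simp add: s_def[abs_def] o_def)
    show "s j z \<in> R (exp z)" if "Re z < L" for z
      using g(2)[of "z + of_nat j * T"] that Re_T exp_T[of z j] by (simp add: s_def)
  qed
  have "\<not> inj_on (%j. s j z0) {..n}"
  proof
    assume "inj_on (%j. s j z0) {..n}"
    then have "card {..n} \<le> card (R (exp z0))" using s(2)[OF fin(3)] by (intro card_inj_on_le[OF _ _ fin(1)]) auto
    then show False using fin(2) by simp
  qed
  then obtain i j where ij: "i \<le> n" "j \<le> n" "i ~= j" "s i z0 = s j z0" by (auto simp: inj_on_def)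
  define k1 where "k1 = min i j"
  define m where "m = max i j - k1"
  have m: "1 \<le> m" "m \<le> n" "s k1 z0 = s (k1 + m) z0"
    using ij by (auto simp: k1_def m_def min_def max_def)
  have per: "g (z + of_nat m * T) = g z" if z: "Re z < L" for z
  proof -
    let ?z = "z + of_int (- int k1) * T"
    have "s k1 ?z = s (k1 + m) ?z"
      by (rule uniq[OF s(1) s(1) s(2) s(2) fin(3) m(3)]) (use z Re_T in auto)
    then show ?thesis by (simp add: s_def algebra_simps)
  qed
  have pern: "g (z + of_nat j * (of_nat m * T)) = g z" if z: "Re z < L" for z and j :: nat
  proof (induction j)
    case (Suc j)
    have "Re (z + of_nat j * (of_nat m * T)) < L" using z by (simp add: T_def)
    from per[OF this] Suc show ?case by (simp add: algebra_simps)
  qed simp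
  have peri: "g (z + of_int j * (of_nat m * T)) = g z" if z: "Re z < L" for z and j :: int
  proof (cases "j \<ge> 0")
    case True
    then show ?thesis using pern[OF z, of "nat j"] by simp
  next
    case False
    let ?z = "z + of_int j * (of_nat m * T)"
    have "Re ?z < L" using z by (simp add: T_def)
    from pern[OF this, of "nat (- j)"] False show ?thesis by (simp add: algebra_simps)
  qed
  have "m dvd fact n" using m by (intro dvd_fact) auto
  then obtain c where c: "fact n = m * c" by (elim dvdE)
  have eq: "of_int k * (of_nat (fact n) * T) = of_int (k * int c) * (of_nat m * T)"
    unfolding c by simp
  show ?thesis unfolding T_def[symmetric] eq by (rule peri[OF z])
qed

text \<open>The coordinate z with t = exp z unwinds the punctured disc into a half-plane, on which
  the roots form single-valued branches. Infinitely many \<open>y n\<close> lie on the same branch.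
  It becomes single-valued again in the M-th root of t, and after multiplication by the leading
  coefficient it is bounded, hence extends over 0; the bound on \<open>y\<close> allows this
  coefficient to be divided out.\<close>

theorem puiseux_sequence_complex:
  fixes B0 :: "complex poly poly" and t :: "nat => real" and y :: "nat => complex"
  assumes B0: "B0 ~= 0" and t: "!!n. 0 < t n" "t \<longlonglongrightarrow> 0" and yb: "!!n. norm (y n) \<le> Ky"
    and N0: "infinite N0" "!!n. n \<in> N0 ==> poly2 B0 (of_real (t n)) (y n) = 0"
  shows "\<exists>M>0. \<exists>N\<subseteq>N0. infinite N & (\<exists>Y. fps_conv_radius Y > 0 &
     (\<forall>n\<in>N. ereal (root M (t n)) < fps_conv_radius Y & y n = eval_fps Y (of_real (root M (t n)))))"
proof -
  \<comment> \<open>Minimising the degree over pairs of an equation and an infinite index set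
    replaces a factorisation into irreducibles: in a proper product, one factor would vanish for
    infinitely many indices and have smaller degree.\<close>
  let ?Q = "%(B :: complex poly poly, N). B ~= 0 & N \<subseteq> N0 & infinite N & (\<forall>n\<in>N. poly2 B (of_real (t n)) (y n) = 0)"
  have "?Q (B0, N0)" using B0 N0 by auto
  from ex_has_least_nat[of ?Q, OF this, of "%p. degree (fst p)"] obtain BN
    where BN: "?Q BN" "!!BN'. ?Q BN' ==> degree (fst BN) \<le> degree (fst BN')" by blast
  obtain B N where BNe: "BN = (B, N)" by (cases BN)
  have B: "B ~= 0" "N \<subseteq> N0" "infinite N" "!!n. n \<in> N ==> poly2 B (of_real (t n)) (y n) = 0"
    using BN(1) by (auto simp: BNe)
  have least: "degree B \<le> degree D" if "D ~= 0" "N' \<subseteq> N0" "infinite N'" "\<forall>n\<in>N'. poly2 D (of_real (t n)) (y n) = 0" for D N'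
    using BN(2)[of "(D, N')"] that by (simp add: BNe)
  define n where "n = degree B"
  define lc where "lc = lead_coeff B"
  have lc0: "lc ~= 0" using B(1) by (simp add: lc_def)
  have n0: "n > 0"
  proof (rule ccontr)
    assume "\<not> n > 0"
    then have "degree B = 0" by (simp add: n_def)
    then obtain c where c: "B = [:c:]" by (rule degree_eq_zeroE)
    have "(%n. complex_of_real (t n)) ` N \<subseteq> {x. poly c x = 0}" using B(4) by (auto simp: c poly2_simps)
    moreover have "finite {x. poly c x = 0}" using B(1) c by (intro poly_roots_finite) auto
    ultimately have "finite (complex_of_real ` (t ` N))" unfolding image_image by (rule finite_subset)
    then have "finite (t ` N)" by (rule finite_imageD) (auto simp: inj_on_def)
    then show False using infinite_image_null_sequence[OF t B(3)] by blast
  qed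
  obtain A1 A2 r where r: "r ~= 0" "A1 * B + A2 * pderiv B = [:r:]"
  proof -
    have "\<exists>A1 A2 r. r ~= 0 & A1 * B + A2 * pderiv B = [:r:]"
    proof (rule separable_by_minimality)
      show "degree B > 0" using n0 by (simp add: n_def)
      fix D q l assume a: "l ~= 0" "Polynomial.smult l B = D * q" "degree D < degree B" "degree q < degree B"
      have Dq: "D ~= 0" "q ~= 0" using a(1,2) B(1) by auto
      have z: "poly2 D (of_real (t n)) (y n) = 0 \<or> poly2 q (of_real (t n)) (y n) = 0" if "n \<in> N" for n
      proof -
        have "poly2 (Polynomial.smult l B) (of_real (t n)) (y n) = 0" using B(4)[OF that] by (simp only: poly2_simps mult_zero_right)
        then show ?thesis unfolding a(2) poly2_simps by simp
      qed
      define N1 where "N1 = {n \<in> N. poly2 D (of_real (t n)) (y n) = 0}"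
      define N2 where "N2 = {n \<in> N. poly2 q (of_real (t n)) (y n) = 0}"
      have "N = N1 \<union> N2" using z by (auto simp: N1_def N2_def)
      then have "infinite N1 \<or> infinite N2" using B(3) by (metis finite_UnI)
      then show False
      proof
        assume "infinite N1"
        then have "degree B \<le> degree D" by (intro least[OF Dq(1), of N1]) (use B(2) in \<open>auto simp: N1_def\<close>)
        then show False using a by simp
      next
        assume "infinite N2"
        then have "degree B \<le> degree q" by (intro least[OF Dq(2), of N2]) (use B(2) in \<open>auto simp: N2_def\<close>)
        then show False using a by simp
      qed
    qed
    then show ?thesis using that by blast
  qed
  \<comment> \<open>Within a radius free of non-zero roots of \<open>r * lc\<close>, and away from
    0, the roots in \<open>y\<close> are simple and constant in number.\<close>
  have "finite {x. poly (r * lc) x = 0}" using r lc0 by (intro poly_roots_finite) auto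
  from finite_set_avoid[OF this, of 0] obtain \<epsilon>0 where \<epsilon>0: "\<epsilon>0 > 0" "!!x. poly (r * lc) x = 0 ==> x ~= 0 ==> \<epsilon>0 \<le> dist 0 x"
    by blast
  define \<epsilon> where "\<epsilon> = min \<epsilon>0 1"
  have \<epsilon>: "0 < \<epsilon>" "\<epsilon> \<le> 1" using \<epsilon>0 by (auto simp: \<epsilon>_def)
  have good: "poly r x ~= 0" "poly lc x ~= 0" if "x ~= 0" "norm x < \<epsilon>" for x
    using \<epsilon>0(2)[of x] that by (auto simp: \<epsilon>_def)
  define pt where "pt x = map_poly (%c. poly c x) B" for x
  define R where "R x = {y. poly2 B x y = 0}" for x
  have R_pt: "R x = {y. poly (pt x) y = 0}" for x by (simp add: R_def pt_def poly2_map)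
  have cpt: "coeff (pt x) k = poly (coeff B k) x" for x k by (simp add: pt_def coeff_map_poly)
  have dpt: "degree (pt x) = n" if "poly lc x ~= 0" for x
  proof (rule antisym)
    show "degree (pt x) \<le> n" by (rule degree_le) (auto simp: cpt n_def coeff_eq_0)
    show "n \<le> degree (pt x)" by (rule le_degree) (use that in \<open>simp add: cpt n_def lc_def\<close>)
  qed
  have simple: "poly2 (pderiv B) x v ~= 0" if "poly r x ~= 0" "poly2 B x v = 0" for x v
  proof
    assume "poly2 (pderiv B) x v = 0"
    then have "poly2 (A1 * B + A2 * pderiv B) x v = 0" using that(2) by (simp add: poly2_simps)
    then show False using that(1) by (simp add: r(2) poly2_simps)
  qed
  have sqf: "rsquarefree (pt x)" if "x ~= 0" "norm x < \<epsilon>" for x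
    unfolding rsquarefree_roots using simple[OF good(1)[OF that]]
    by (auto simp: pt_def poly2_pderiv poly2_map[symmetric])
  have ptn0: "pt x ~= 0" if "x ~= 0" "norm x < \<epsilon>" for x using dpt[OF good(2)[OF that]] n0 by auto
  have Rfin: "finite (R x) & card (R x) = n" if "x ~= 0" "norm x < \<epsilon>" for x
    using rsquarefree_card_roots[OF sqf[OF that]] dpt[OF good(2)[OF that]] poly_roots_finite[OF ptn0[OF that]]
    by (simp add: R_pt)
  have fac: "poly2 B x v = poly lc x * (\<Prod>\<rho>\<in>R x. v - \<rho>)" if "x ~= 0" "norm x < \<epsilon>" for x v
  proof -
    have "poly (pt x) v = poly (Polynomial.smult (lead_coeff (pt x)) (\<Prod>z\<in>R x. [:- z, 1:])) v"
      using complex_poly_decompose_rsquarefree[OF sqf[OF that]] by (simp add: R_pt)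
    also have "lead_coeff (pt x) = poly lc x" using dpt[OF good(2)[OF that]] by (simp add: cpt n_def lc_def)
    finally show ?thesis by (simp add: poly_prod pt_def poly2_map)
  qed
  define L where "L = ln \<epsilon>"
  have ex: "exp z ~= 0" "norm (exp z) < \<epsilon>" if "Re z < L" for z
  proof -
    show "exp z ~= 0" by simp
    have "exp (Re z) < exp L" using that by simp
    then show "norm (exp z) < \<epsilon>" using \<epsilon> by (simp add: L_def norm_exp_eq_Re)
  qed
  define H where "H = {z. Re z < L}"
  define z0 where "z0 = complex_of_real (L - 1)"
  have H: "open H" "convex H" "z0 \<in> H"
    by (auto simp: H_def z0_def open_halfspace_Re_lt convex_halfspace_Re_lt)
  have ctsF: "continuous_on H (%z. poly2 B (exp z) v)" for v unfolding poly2_def by (intro continuous_intros)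
  have ctsl: "continuous_on H (%z. poly lc (exp z))" by (intro continuous_intros)
  have facH: "poly2 B (exp z) v = poly lc (exp z) * (\<Prod>\<rho>\<in>R (exp z). v - \<rho>)" if "z \<in> H" for z v
    using that by (intro fac ex) (auto simp: H_def)
  have RH: "finite (R (exp z)) & card (R (exp z)) = n" if "z \<in> H" for z
    using that by (intro Rfin ex) (auto simp: H_def)
  have lcH: "poly lc (exp z) ~= 0" if "z \<in> H" for z
    using that by (intro good ex) (auto simp: H_def)
  note rs = root_sections[OF H, of "%z v. poly2 B (exp z) v" "%z. poly lc (exp z)" "%z. R (exp z)" n]
  have uniq: "g1 z = g2 z" if "continuous_on H g1" "continuous_on H g2" "!!z. z \<in> H ==> g1 z \<in> R (exp z)"
     "!!z. z \<in> H ==> g2 z \<in> R (exp z)" "a \<in> H" "g1 a = g2 a" "z \<in> H" for g1 g2 a z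
    by (rule rs(1)[OF facH RH n0 lcH ctsl ctsF that])
  have "\<exists>g. continuous_on H g & (\<forall>z\<in>H. g z \<in> R (exp z)) & g z0 = v" if "v \<in> R (exp z0)" for v
    by (rule rs(2)[OF facH RH n0 lcH ctsl ctsF that])
  then obtain g where g: "!!v. v \<in> R (exp z0) ==> continuous_on H (g v)"
     "!!v z. v \<in> R (exp z0) ==> z \<in> H ==> g v z \<in> R (exp z)" "!!v. v \<in> R (exp z0) ==> g v z0 = v"
    by metis
  have z0L: "Re z0 < L" by (simp add: z0_def)
  note R0 = Rfin[OF ex[OF z0L]]
  \<comment> \<open>Sections that differ at \<open>z0\<close> differ everywhere, so the
    \<open>n\<close> of them exhaust the \<open>n\<close> roots over each point.\<close>
  have surj: "\<exists>v\<in>R (exp z0). g v z = x" if "z \<in> H" "x \<in> R (exp z)" for z x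
  proof -
    have "inj_on (%v. g v z) (R (exp z0))"
    proof (rule inj_onI)
      fix v v' assume v: "v \<in> R (exp z0)" "v' \<in> R (exp z0)" "g v z = g v' z"
      have "g v z0 = g v' z0" by (rule uniq[of _ _ z]) (use v g that H in auto)
      then show "v = v'" using g(3) v by simp
    qed
    then have "(%v. g v z) ` R (exp z0) = R (exp z)"
      using R0 Rfin[OF ex[of z]] that g(2) by (intro card_subset_eq) (auto simp: card_image H_def)
    then have "x \<in> (%v. g v z) ` R (exp z0)" using that(2) by simp
    then show ?thesis by auto
  qed
  have tN: "\<forall>\<^sub>F n in sequentially. t n < \<epsilon>" using order_tendstoD(2)[OF t(2) \<epsilon>(1)] .
  define N1 where "N1 = {n \<in> N. t n < \<epsilon>}"
  have "infinite N1"
  proof -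
    obtain n0 where "!!n. n \<ge> n0 ==> t n < \<epsilon>" using tN by (auto simp: eventually_sequentially)
    then have "N \<subseteq> N1 \<union> {..<n0}" by (auto simp: N1_def not_le[symmetric])
    then show ?thesis using B(3) by (meson finite_Un finite_lessThan finite_subset)
  qed
  have lnH: "of_real (ln (t n)) \<in> H" "exp (complex_of_real (ln (t n))) = of_real (t n)" if "n \<in> N1" for n
  proof -
    have "ln (t n) < L" using that t(1)[of n] \<epsilon> by (simp add: L_def N1_def)
    then show "of_real (ln (t n)) \<in> H" by (simp add: H_def)
    show "exp (complex_of_real (ln (t n))) = of_real (t n)" using t(1)[of n] by (simp add: exp_of_real)
  qed
  have "\<forall>n\<in>N1. \<exists>v\<in>R (exp z0). g v (of_real (ln (t n))) = y n"
    using surj[OF lnH(1)] B(4) lnH(2) by (auto simp: N1_def R_def)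
  then obtain br where br: "!!n. n \<in> N1 ==> br n \<in> R (exp z0)" "!!n. n \<in> N1 ==> g (br n) (of_real (ln (t n))) = y n" by metis
  have "finite (br ` N1)" using br(1) R0 by (meson finite_subset image_subsetI)
  from pigeonhole_infinite[OF \<open>infinite N1\<close> this] obtain n1 where n1: "n1 \<in> N1" "infinite {a \<in> N1. br a = br n1}" by blast
  define v where "v = br n1"
  define N2 where "N2 = {a \<in> N1. br a = br n1}"
  have vR: "v \<in> R (exp z0)" using br n1 by (simp add: v_def)
  have yN2: "y n = g v (of_real (ln (t n)))" if "n \<in> N2" for n using that br(2)[of n] by (auto simp: N2_def v_def)
  have hol: "g v holomorphic_on H"
    by (rule simple_root_holomorphic[OF H(1) g(1)[OF vR]])
      (use g(2)[OF vR] simple[OF good(1)[OF ex]] in \<open>auto simp: R_def H_def\<close>)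
  define M :: nat where "M = fact n"
  have M: "0 < M" by (simp add: M_def)
  have per: "g v (z + of_int k * (of_nat M * (2 * of_real pi * \<i>))) = g v z" if "Re z < L" for z k
    unfolding M_def by (rule section_periodic[of L R "g v" z0 n z k])
      (use g(1,2)[OF vR] R0 z0L that in \<open>auto simp: H_def intro: uniq[unfolded H_def mem_Collect_eq]\<close>)
  define \<delta> where "\<delta> = exp (L / M)"
  have \<delta>: "\<delta> > 0" by (simp add: \<delta>_def)
  define q where "q s = g v (of_nat M * Ln s)" for s
  have qhol: "q holomorphic_on (ball 0 \<delta> - {0})" unfolding q_def \<delta>_def
    by (rule periodic_descends[OF hol[unfolded H_def] M per])
  have qr: "q s \<in> R (s ^ M)" "s ^ M ~= 0" "norm (s ^ M) < \<epsilon>" if "s \<in> ball 0 \<delta> - {0}" for s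
  proof -
    have "ln (norm s) < L / M" using that unfolding \<delta>_def
      by (metis DiffD1 DiffD2 exp_less_cancel_iff exp_ln mem_ball_0 singletonI zero_less_norm_iff)
    then have re: "Re (of_nat M * Ln s) < L" using that M by (simp add: field_simps Re_Ln)
    have "exp (of_nat M * Ln s) = s ^ M" using that by (simp add: exp_of_nat_mult)
    then show "q s \<in> R (s ^ M)" "s ^ M ~= 0" "norm (s ^ M) < \<epsilon>"
      using g(2)[OF vR, of "of_nat M * Ln s"] ex[OF re] re by (auto simp: q_def H_def)
  qed
  define l where "l s = poly lc (s ^ M)" for s
  define S where "S p = (\<Sum>i\<le>degree p. norm (coeff p i))" for p :: "complex poly"
  have Sb: "norm (poly p x) \<le> S p" if "norm x \<le> 1" for p x
    unfolding poly_altdef S_def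
    by (rule order_trans[OF norm_sum]) (intro sum_mono, use that in \<open>auto simp: norm_mult norm_power intro!: mult_left_le power_le_one\<close>)
  define K where "K = 1 + (\<Sum>k\<le>n. S (coeff B k))"
  have S0: "0 \<le> S p" for p unfolding S_def by (intro sum_nonneg) auto
  have K: "1 \<le> K" "norm (coeff (pt x) k) \<le> K" if "norm x \<le> 1" for x k
  proof -
    show "1 \<le> K" unfolding K_def using S0 by (simp add: sum_nonneg)
    show "norm (coeff (pt x) k) \<le> K"
    proof (cases "k \<le> n")
      case True
      have "norm (coeff (pt x) k) \<le> S (coeff B k)" unfolding cpt by (rule Sb[OF that])
      also have "\<dots> \<le> (\<Sum>k\<le>n. S (coeff B k))" by (rule member_le_sum) (use True S0 in auto)
      finally show ?thesis by (simp add: K_def)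
    next
      case False
      then have "coeff B k = 0" by (simp add: n_def coeff_eq_0)
      then show ?thesis using \<open>1 \<le> K\<close> by (simp add: cpt)
    qed
  qed
  have lqb: "norm (l s * q s) \<le> 1 + n * K ^ n" if "s \<in> ball 0 \<delta> - {0}" for s
  proof -
    note q3 = qr[OF that]
    have le1: "norm (s ^ M) \<le> 1" using q3(3) \<epsilon> by linarith
    have "norm (coeff (pt (s ^ M)) n * q s) \<le> 1 + n * K ^ n"
      by (rule scaled_root_bound) (use dpt[OF good(2)[OF q3(2,3)]] n0 q3(1) K[OF le1] in \<open>auto simp: R_pt\<close>)
    then show ?thesis by (simp add: l_def cpt n_def lc_def)
  qed
  have lhol: "(%s. l s * q s) holomorphic_on (ball 0 \<delta> - {0})"
    unfolding l_def by (intro holomorphic_intros qhol)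
  have "\<forall>\<^sub>F s in at 0. norm (l s * q s) \<le> 1 + n * K ^ n"
  proof -
    have "\<forall>\<^sub>F s in at 0. s \<in> ball 0 \<delta> - {0}" using \<delta> by (intro eventually_at_in_open) auto
    then show ?thesis by eventually_elim (rule lqb)
  qed
  then obtain h where h: "h holomorphic_on ball 0 \<delta>" "!!s. s \<in> ball 0 \<delta> - {0} ==> h s = l s * q s"
    using holomorphic_on_extend_bounded[OF lhol] \<delta> by auto
  have "h analytic_on {0}" using h(1) \<delta> by (auto simp: analytic_at intro: exI[of _ "ball 0 \<delta>"])
  then have hexp: "h has_fps_expansion fps_expansion h 0" by (rule analytic_at_imp_has_fps_expansion_0)
  define L' where "L' = fps_of_poly (pcompose lc (monom 1 M))"
  have evL: "eval_fps L' s = l s" for s by (simp add: L'_def l_def poly_pcompose poly_monom)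
  have lexp: "l has_fps_expansion L'" by (simp add: has_fps_expansion_def evL) (simp add: L'_def)
  define s where "s n = complex_of_real (root M (t n))" for n
  have spos: "root M (t n) > 0" for n using t M by simp
  have s0: "s n ~= 0" for n using spos[of n] by (simp add: s_def)
  have slim: "s \<longlonglongrightarrow> 0"
  proof -
    have "(%n. root M (t n)) \<longlonglongrightarrow> root M 0" by (intro tendsto_intros t)
    then show ?thesis using tendsto_of_real[of "%n. root M (t n)" 0] M by (simp add: s_def[abs_def])
  qed
  have sM: "s n ^ M = of_real (t n)" for n using t(1)[of n] M by (simp add: s_def flip: of_real_power)
  have sball: "s n \<in> ball 0 \<delta> - {0}" if "n \<in> N2" for n
  proof -
    have "t n < \<epsilon>" using that by (simp add: N2_def N1_def)
    then have "ln (t n) < L" using t(1)[of n] \<epsilon> by (simp add: L_def)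
    moreover have "ln (root M (t n)) = ln (t n) / M" using t(1)[of n] M by (simp add: ln_root)
    ultimately have "ln (root M (t n)) < L / M" using M by (simp add: divide_strict_right_mono)
    then have "root M (t n) < \<delta>" unfolding \<delta>_def using spos[of n] by (metis exp_less_cancel_iff exp_ln)
    then show ?thesis using spos[of n] s0[of n] by (simp add: s_def)
  qed
  have hy: "h (s n) = l (s n) * y n" if "n \<in> N2" for n
  proof -
    have "of_nat M * Ln (s n) = of_real (ln (t n))"
      using spos[of n] t(1)[of n] M by (simp add: s_def Ln_of_real ln_root)
    then show ?thesis using h(2)[OF sball[OF that]] yN2[OF that] by (simp add: q_def)
  qed
  have l0: "l (s n) ~= 0" if "n \<in> N2" for n using good(2)[of "s n ^ M"] qr[OF sball[OF that]] by (simp add: l_def)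
  have infN2: "infinite N2" using n1(2) by (simp add: N2_def)
  then have "N2 ~= {}" by auto
  then obtain m where "m \<in> N2" by blast
  then have L'0: "L' ~= 0" using l0[of m] evL[of "s m"] by auto
  define e where "e = enumerate N2"
  have e: "e j \<in> N2" for j unfolding e_def by (rule enumerate_in_set[OF infN2])
  have "strict_mono e" unfolding e_def by (rule strict_mono_enumerate[OF infN2])
  then have "(%j. s (e j)) \<longlonglongrightarrow> 0" using LIMSEQ_subseq_LIMSEQ[OF slim] by (simp add: o_def)
  \<comment> \<open>Here the boundedness of the given values enters: the quotient by
    \<open>l\<close> is bounded on this subsequence, so it has no pole.\<close>
  moreover have "norm (h (s (e j))) \<le> Ky * norm (l (s (e j)))" for j
    unfolding hy[OF e] norm_mult by (subst mult.commute) (rule mult_right_mono[OF yb], simp)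
  ultimately obtain Y where Y: "fps_conv_radius Y > 0" "L' * Y = fps_expansion h 0"
    using fps_quotient_of_bounded[OF hexp lexp L'0, of "%j. s (e j)" Ky] s0 by blast
  have "\<forall>\<^sub>F s in nhds 0. eval_fps (fps_expansion h 0) s = h s" using hexp by (simp add: has_fps_expansion_def)
  moreover have "\<forall>\<^sub>F s in nhds 0. s \<in> eball 0 (fps_conv_radius Y)"
    using Y(1) by (intro eventually_nhds_in_open) (auto simp: zero_ereal_def[symmetric])
  ultimately have "\<forall>\<^sub>F s in nhds 0. ereal (norm s) < fps_conv_radius Y & h s = l s * eval_fps Y s"
  proof eventually_elim
    case (elim s)
    have "eval_fps (L' * Y) s = eval_fps L' s * eval_fps Y s"
      by (rule eval_fps_mult) (use elim in \<open>auto simp: L'_def\<close>)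
    then show ?case using elim by (simp add: Y(2) evL)
  qed
  then have "\<forall>\<^sub>F n in sequentially. ereal (norm (s n)) < fps_conv_radius Y & h (s n) = l (s n) * eval_fps Y (s n)"
    using slim by (rule eventually_compose_filterlim)
  then obtain m0 where m0: "!!n. n \<ge> m0 ==> ereal (norm (s n)) < fps_conv_radius Y & h (s n) = l (s n) * eval_fps Y (s n)"
    by (auto simp: eventually_sequentially)
  define N3 where "N3 = {n \<in> N2. n \<ge> m0}"
  have "infinite N3"
  proof -
    have "N2 \<subseteq> N3 \<union> {..<m0}" by (auto simp: N3_def)
    then show ?thesis using infN2 by (meson finite_Un finite_lessThan finite_subset)
  qed
  moreover have "N3 \<subseteq> N0" using B(2) by (auto simp: N3_def N2_def N1_def)
  moreover have "ereal (root M (t n)) < fps_conv_radius Y & y n = eval_fps Y (of_real (root M (t n)))" if "n \<in> N3" for n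
  proof -
    have n: "n \<in> N2" "n \<ge> m0" using that by (auto simp: N3_def)
    have "l (s n) * y n = l (s n) * eval_fps Y (s n)" using m0[OF n(2)] hy[OF n(1)] by simp
    then have "y n = eval_fps Y (s n)" using l0[OF n(1)] by simp
    moreover have "norm (s n) = root M (t n)" using spos[of n] by (simp add: s_def)
    ultimately show ?thesis using m0[OF n(2)] by (simp add: s_def)
  qed
  ultimately show ?thesis using M Y(1) by blast
qed

text \<open>The points and values are real, so the series with the real parts of the coefficients
  takes the same values at them.\<close>

theorem puiseux_sequence:
  fixes B :: "real poly poly" and t y :: "nat => real"
  assumes B: "B ~= 0" and t: "!!n. 0 < t n" "t \<longlonglongrightarrow> 0" and yb: "!!n. \<bar>y n\<bar> \<le> Ky"
    and N0: "infinite N0" "!!n. n \<in> N0 ==> poly2 B (t n) (y n) = 0"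
  shows "\<exists>M>0. \<exists>N\<subseteq>N0. infinite N & (\<exists>Y. fps_conv_radius Y > 0 &
     (\<forall>n\<in>N. ereal (root M (t n)) < fps_conv_radius Y & y n = eval_fps Y (root M (t n))))"
proof -
  define B' :: "complex poly poly" where "B' = map_poly (map_poly complex_of_real) B"
  have re: "poly (map_poly complex_of_real p) (of_real x) = of_real (poly p x)" for p x
    by (induction p) (simp_all add: map_poly_pCons)
  have ev: "poly2 B' (of_real x) (of_real v) = of_real (poly2 B x v)" for x v
    unfolding B'_def poly2_def
    by (induction B) (simp_all add: map_poly_pCons re)
  have "coeff B' (degree B) = map_poly complex_of_real (lead_coeff B)" by (simp add: B'_def coeff_map_poly)
  then have "coeff (coeff B' (degree B)) (degree (lead_coeff B)) = of_real (lead_coeff (lead_coeff B))"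
    by (simp add: coeff_map_poly)
  then have "B' ~= 0" using B by auto
  from puiseux_sequence_complex[OF this t, of "%n. of_real (y n)" Ky N0] yb N0 ev
  obtain M N Y where M: "M > 0" "N \<subseteq> N0" "infinite N" and Y: "fps_conv_radius Y > 0"
    "!!n. n \<in> N ==> ereal (root M (t n)) < fps_conv_radius Y & complex_of_real (y n) = eval_fps Y (of_real (root M (t n)))"
    by auto
  define Z where "Z = Abs_fps (%k. Re (fps_nth Y k))"
  have "conv_radius (fps_nth Y) \<le> conv_radius (fps_nth Z)"
  proof (rule conv_radius_geI_ex)
    fix r :: real assume r: "0 < r" "ereal r < conv_radius (fps_nth Y)"
    have "summable (%k. fps_nth Y k * of_real r ^ k)"
      by (rule summable_fps) (use r in \<open>simp add: fps_conv_radius_def\<close>)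
    from summable_Re[OF this] have "summable (%k. fps_nth Z k * r ^ k)" by (simp add: Z_def flip: of_real_power)
    then show "\<exists>z. norm z = r & summable (%n. fps_nth Z n * z ^ n)" using r by (intro exI[of _ r]) auto
  qed
  then have rad: "fps_conv_radius Y \<le> fps_conv_radius Z" by (simp add: fps_conv_radius_def)
  have "y n = eval_fps Z (root M (t n))" if "n \<in> N" for n
  proof -
    have pos: "root M (t n) > 0" using t(1)[of n] M by simp
    have "(%k. fps_nth Y k * of_real (root M (t n)) ^ k) sums of_real (y n)"
      using sums_eval_fps[of "of_real (root M (t n))" Y] Y(2)[OF that] pos by simp
    from sums_Re[OF this] have "(%k. fps_nth Z k * root M (t n) ^ k) sums y n"
      by (simp add: Z_def flip: of_real_power)
    moreover have "(%k. fps_nth Z k * root M (t n) ^ k) sums eval_fps Z (root M (t n))"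
      by (rule sums_eval_fps) (use Y(2)[OF that] rad pos in \<open>auto intro: less_le_trans\<close>)
    ultimately show ?thesis by (rule sums_unique2)
  qed
  then show ?thesis using M Y rad
    by (intro exI[of _ M] conjI exI[of _ N] exI[of _ Z]) (auto intro: less_le_trans)
qed

section \<open>Noetherianity and Krull intersection\<close>

text \<open>Restricting the variables to a set \<open>S\<close> allows induction on the number of
  variables within a fixed type of environments.\<close>

inductive_set pfs :: "'i set => (('i => real) => real) set" for S where
  pfs_const: "(%_. c) \<in> pfs S"
| pfs_var: "i \<in> S ==> (%e. e i) \<in> pfs S"
| pfs_add: "p \<in> pfs S ==> q \<in> pfs S ==> (%e. p e + q e) \<in> pfs S"
| pfs_mult: "p \<in> pfs S ==> q \<in> pfs S ==> (%e. p e * q e) \<in> pfs S"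

lemma pfs_mono: "p \<in> pfs S ==> S \<subseteq> T ==> p \<in> pfs T"
  by (induction rule: pfs.induct) (auto intro: pfs.intros)

lemma pfs_sum: "(!!k. k \<in> I ==> p k \<in> pfs S) ==> (%e. \<Sum>k\<in>I. p k e) \<in> pfs S"
proof (induction I rule: infinite_finite_induct)
  case (insert x F)
  have "(%e. p x e + (\<Sum>k\<in>F. p k e)) \<in> pfs S"
    by (rule pfs_add) (use insert.prems insert.IH in auto)
  then show ?case using insert.hyps by simp
qed (simp_all add: pfs_const)

lemma pfs_power_var: "i \<in> S ==> (%e. e i ^ n) \<in> pfs S"
proof (induction n)
  case (Suc n)
  then show ?case using pfs_mult[OF pfs_var[of i S] Suc.IH] by simp
qed (simp add: pfs_const)

lemma pf_eq_pfs: "p \<in> pf \<longleftrightarrow> p \<in> pfs UNIV"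
proof
  show "p \<in> pf ==> p \<in> pfs UNIV" by (induction rule: pf.induct) (auto intro: pfs.intros)
  show "p \<in> pfs UNIV ==> p \<in> pf" by (induction rule: pfs.induct) (auto intro: pf.intros)
qed

lemma pfs_expand:
  assumes "f \<in> pfs (insert i S)"
  shows "\<exists>n c. (\<forall>k. c k \<in> pfs S) & (\<forall>k>n. c k = (%_. 0)) & (\<forall>e. f e = (\<Sum>k\<le>n. c k e * e i ^ k))"
  using assms
proof induction
  case (pfs_const a)
  show ?case by (intro exI[of _ 0] exI[of _ "%k. if k = 0 then (%_. a) else (%_. 0)"]) (auto intro: pfs.pfs_const)
next
  case (pfs_var j)
  show ?case
  proof (cases "j = i")
    case True
    then show ?thesis by (intro exI[of _ 1] exI[of _ "%k. if k = 1 then (%_. 1) else (%_. 0)"]) (auto intro: pfs.pfs_const)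
  next
    case False
    then have "j \<in> S" using pfs_var by simp
    then show ?thesis by (intro exI[of _ 0] exI[of _ "%k. if k = 0 then (%e. e j) else (%_. 0)"]) (auto intro: pfs.intros)
  qed
next
  case (pfs_add p q)
  then obtain n c m d where c: "\<forall>k. c k \<in> pfs S" "\<forall>k>n. c k = (%_. 0)" "\<forall>e. p e = (\<Sum>k\<le>n. c k e * e i ^ k)"
    and d: "\<forall>k. d k \<in> pfs S" "\<forall>k>m. d k = (%_. 0)" "\<forall>e. q e = (\<Sum>k\<le>m. d k e * e i ^ k)" by blast
  have 1: "p e = (\<Sum>k\<le>max n m. c k e * e i ^ k)" for e
    unfolding c(3)[rule_format] by (rule sum.mono_neutral_left) (use c(2) in auto)
  have 2: "q e = (\<Sum>k\<le>max n m. d k e * e i ^ k)" for e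
    unfolding d(3)[rule_format] by (rule sum.mono_neutral_left) (use d(2) in auto)
  show ?case
  proof (intro exI[of _ "max n m"] exI[of _ "%k e. c k e + d k e"] conjI allI impI)
    fix k show "(%e. c k e + d k e) \<in> pfs S" using c d by (intro pfs.pfs_add) auto
    show "k > max n m ==> (%e. c k e + d k e) = (%_. 0)" using c d by auto
  next
    fix e show "p e + q e = (\<Sum>k\<le>max n m. (c k e + d k e) * e i ^ k)"
      unfolding 1 2 by (simp add: sum.distrib distrib_right)
  qed
next
  case (pfs_mult p q)
  then obtain n c m d where c: "\<forall>k. c k \<in> pfs S" "\<forall>k>n. c k = (%_. 0)" "\<forall>e. p e = (\<Sum>k\<le>n. c k e * e i ^ k)"
    and d: "\<forall>k. d k \<in> pfs S" "\<forall>k>m. d k = (%_. 0)" "\<forall>e. q e = (\<Sum>k\<le>m. d k e * e i ^ k)" by blast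
  show ?case
  proof (intro exI[of _ "n + m"] exI[of _ "%k e. \<Sum>j\<le>k. c j e * d (k - j) e"] conjI allI impI)
    fix k show "(%e. \<Sum>j\<le>k. c j e * d (k - j) e) \<in> pfs S" using c d by (intro pfs_sum pfs.pfs_mult) auto
    assume k: "k > n + m"
    have "c j e * d (k - j) e = 0" if "j \<le> k" for j e
    proof (cases "j > n")
      case True then show ?thesis using c(2) by simp
    next
      case False then have "k - j > m" using k by simp
      then show ?thesis using d(2) by simp
    qed
    then show "(%e. \<Sum>j\<le>k. c j e * d (k - j) e) = (%_. 0)" by (intro ext sum.neutral) simp
  next
    fix e
    show "p e * q e = (\<Sum>k\<le>n + m. (\<Sum>j\<le>k. c j e * d (k - j) e) * e i ^ k)"
      unfolding c(3)[rule_format] d(3)[rule_format]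
      by (rule polynomial_product) (use c(2) d(2) in auto)
  qed
qed

section \<open>Ideals of polynomial functions and the basis theorem\<close>

inductive_set idl :: "'i set => (('i => real) => real) set => (('i => real) => real) set" for S F where
  idl_zero: "(%_. 0) \<in> idl S F"
| idl_gen: "g \<in> F ==> a \<in> pfs S ==> (%e. a e * g e) \<in> idl S F"
| idl_add: "p \<in> idl S F ==> q \<in> idl S F ==> (%e. p e + q e) \<in> idl S F"

lemma idl_base: "g \<in> F ==> g \<in> idl S F"
  using idl_gen[of g F "%_. 1" S] pfs_const by fastforce

lemma idl_mult: "p \<in> idl S F ==> a \<in> pfs S ==> (%e. a e * p e) \<in> idl S F"
proof (induction rule: idl.induct)
  case (idl_gen g b)
  then show ?case using idl.idl_gen[of g F "%e. a e * b e" S] pfs_mult[of a S b] by (simp add: mult.assoc)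
next
  case (idl_add p q)
  then show ?case using idl.idl_add[of "%e. a e * p e" S F "%e. a e * q e"] by (simp add: distrib_left)
qed (simp add: idl_zero)

lemma idl_sum: "(!!k. k \<in> I ==> p k \<in> idl S F) ==> (%e. \<Sum>k\<in>I. p k e) \<in> idl S F"
proof (induction I rule: infinite_finite_induct)
  case (insert x I)
  have "(%e. p x e + (\<Sum>k\<in>I. p k e)) \<in> idl S F"
    by (rule idl_add) (use insert.prems insert.IH in auto)
  then show ?case using insert.hyps by simp
qed (simp_all add: idl_zero)

lemma idl_mono: "p \<in> idl S F ==> F \<subseteq> G ==> p \<in> idl S G"
  by (induction rule: idl.induct) (auto intro: idl.intros)

lemma idl_trans: "p \<in> idl S F ==> F \<subseteq> idl S G ==> p \<in> idl S G"
  by (induction rule: idl.induct) (auto intro: idl_zero idl_add idl_mult)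

lemma idl_diff: "p \<in> idl S F ==> q \<in> idl S F ==> (%e. p e - q e) \<in> idl S F"
  using idl_add[of p S F "%e. - 1 * q e"] idl_mult[of q S F "%_. - 1"] pfs_const[of "-1" S] by simp

text \<open>The ascending chain condition for sequences. This form passes directly to leading
  coefficients and to the intersection theorem, where the predecessors have lower degree.\<close>

definition seq_noetherian :: "'i set => bool" where
  "seq_noetherian S \<longleftrightarrow> (\<forall>G :: nat => _. (\<forall>n. G n \<in> pfs S) --> (\<exists>N. G N \<in> idl S (G ` {..<N})))"

lemma idl_image_sum:
  assumes "p \<in> idl S (G ` {..<N})"
  shows "\<exists>a. (\<forall>i. a i \<in> pfs S) & (\<forall>e. p e = (\<Sum>i<(N::nat). a i e * G i e))"
  using assms
proof induction
  case idl_zero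
  show ?case by (intro exI[of _ "%_ _. 0"]) (auto intro: pfs_const)
next
  case (idl_gen g a)
  then obtain j where j: "j < N" "g = G j" by auto
  have "(\<Sum>i<N. (if i = j then a else (%_. 0)) e * G i e) = (\<Sum>i<N. if i = j then a e * G j e else 0)" for e
    by (rule sum.cong) auto
  then show ?case using j idl_gen
    by (intro exI[of _ "%i. if i = j then a else (%_. 0)"]) (auto intro: pfs_const)
next
  case (idl_add p q)
  then obtain a b where "\<forall>i. a i \<in> pfs S" "\<forall>e. p e = (\<Sum>i<N. a i e * G i e)"
    "\<forall>i. b i \<in> pfs S" "\<forall>e. q e = (\<Sum>i<N. b i e * G i e)" by blast
  then show ?case by (intro exI[of _ "%i e. a i e + b i e"]) (auto intro: pfs_add simp: sum.distrib distrib_right)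
qed

lemma seq_noetherian_empty: "seq_noetherian {}"
  unfolding seq_noetherian_def
proof (intro allI impI)
  fix G :: "nat => ('a => real) => real" assume G: "\<forall>n. G n \<in> pfs {}"
  have "\<exists>c. p = (%_. c)" if "p \<in> pfs {}" for p :: "('a => real) => real"
    using that by induction auto
  then have "\<forall>n. \<exists>c. G n = (%_. c)" using G by blast
  then obtain c where c: "!!n. G n = (%_. c n)" by metis
  show "\<exists>N. G N \<in> idl {} (G ` {..<N})"
  proof (cases "c 0 = 0")
    case True
    then have "G 0 \<in> idl {} (G ` {..<0})" using c idl_zero by simp
    then show ?thesis ..
  next
    case False
    have "(%e. (c 1 / c 0) * G 0 e) \<in> idl {} (G ` {..<1})" by (rule idl_gen) (auto intro: pfs_const)
    then have "G 1 \<in> idl {} (G ` {..<1})" using False c by simp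
    then show ?thesis ..
  qed
qed

text \<open>Hilbert's basis theorem: pick generators of minimal degree in the new variable and use the
  induction hypothesis for their leading coefficients.\<close>

lemma seq_noetherian_insert:
  assumes S: "seq_noetherian S"
  shows "seq_noetherian (insert i S)"
  unfolding seq_noetherian_def
proof (intro allI impI, rule ccontr)
  fix G :: "nat => ('a => real) => real"
  let ?T = "insert i S"
  assume G: "\<forall>n. G n \<in> pfs ?T" and none: "\<not> (\<exists>N. G N \<in> idl ?T (G ` {..<N}))"
  define J where "J = idl ?T (range G)"
  define rep where "rep f n c \<longleftrightarrow> (\<forall>k. c k \<in> pfs S) & (\<forall>e. f e = (\<Sum>k\<le>n. c k e * e i ^ k))" for f n c
  have fin: "\<exists>N. p \<in> idl ?T (G ` {..<N})" if "p \<in> J" for p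
    using that unfolding J_def
  proof induction
    case idl_zero show ?case using idl.idl_zero by blast
  next
    case (idl_gen g a)
    then obtain j where "g = G j" by auto
    then show ?case using idl.idl_gen[of g "G ` {..<Suc j}" a] idl_gen by blast
  next
    case (idl_add p q)
    then obtain N M where "p \<in> idl ?T (G ` {..<N})" "q \<in> idl ?T (G ` {..<M})" by blast
    then have "p \<in> idl ?T (G ` {..<max N M})" "q \<in> idl ?T (G ` {..<max N M})" by (auto elim: idl_mono)
    then show ?case using idl.idl_add by blast
  qed
  have notfg: "\<exists>p\<in>J. p \<notin> idl ?T F" if F: "finite F" "F \<subseteq> J" for F
  proof (rule ccontr)
    assume "\<not> ?thesis"
    then have sub: "J \<subseteq> idl ?T F" by blast
    have "\<forall>g\<in>F. \<exists>N. g \<in> idl ?T (G ` {..<N})" using F fin by blast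
    then obtain N where N: "!!g. g \<in> F ==> g \<in> idl ?T (G ` {..<N g})" by metis
    define M where "M = Max (insert 0 (N ` F))"
    have "g \<in> idl ?T (G ` {..<M})" if "g \<in> F" for g
    proof -
      have "N g \<le> M" unfolding M_def using F that by (intro Max_ge) auto
      then show ?thesis using N[OF that] by (auto elim: idl_mono)
    qed
    then have "F \<subseteq> idl ?T (G ` {..<M})" by blast
    moreover have "G M \<in> idl ?T F" using sub idl_base[of "G M" "range G" ?T] by (auto simp: J_def)
    ultimately have "G M \<in> idl ?T (G ` {..<M})" using idl_trans by blast
    then show False using none by blast
  qed
  have Jpf: "p \<in> pfs ?T" if "p \<in> J" for p
    using that unfolding J_def by induction (use G in \<open>auto intro: pfs.intros\<close>)
  define cand where "cand F n p \<longleftrightarrow> p \<in> J & p \<notin> idl ?T F & (\<exists>c. rep p n c)" for F n p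
  have ex: "\<exists>n p. cand F n p" if F: "finite F" "F \<subseteq> J" for F
  proof -
    obtain p where p: "p \<in> J" "p \<notin> idl ?T F" using notfg[OF F] by blast
    obtain n c where "(\<forall>k. c k \<in> pfs S) & (\<forall>e. p e = (\<Sum>k\<le>n. c k e * e i ^ k))"
      using pfs_expand[OF Jpf[OF p(1)]] by blast
    then show ?thesis using p unfolding cand_def rep_def by blast
  qed
  define dg where "dg F = (LEAST n. \<exists>p. cand F n p)" for F
  define pk where "pk F = (SOME p. cand F (dg F) p)" for F
  have pk: "cand F (dg F) (pk F)" if "finite F" "F \<subseteq> J" for F
  proof -
    have "\<exists>p. cand F (dg F) p" unfolding dg_def using ex[OF that] by (rule LeastI_ex)
    then show ?thesis unfolding pk_def by (rule someI_ex)
  qed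
  have dgle: "dg F \<le> n" if "cand F n p" for F n p unfolding dg_def by (rule Least_le) (use that in blast)
  define Fs where "Fs = rec_nat {} (%_ F. insert (pk F) F)"
  have Fs0: "Fs 0 = {}" and FsS: "Fs (Suc n) = insert (pk (Fs n)) (Fs n)" for n by (simp_all add: Fs_def)
  have FsJ: "finite (Fs n) & Fs n \<subseteq> J" for n
  proof (induction n)
    case (Suc n)
    then have "pk (Fs n) \<in> J" using pk[of "Fs n"] by (simp add: cand_def)
    then show ?case using Suc by (simp add: FsS)
  qed (simp add: Fs0)
  define f where "f n = pk (Fs n)" for n
  define d where "d n = dg (Fs n)" for n
  have Fsf: "Fs n = f ` {..<n}" for n
    by (induction n) (simp_all add: Fs0 FsS f_def lessThan_Suc)
  have cd: "cand (Fs n) (d n) (f n)" for n using pk FsJ by (simp add: f_def d_def)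
  have mono: "d m \<le> d n" if "m \<le> n" for m n
  proof -
    have "f ` {..<m} \<subseteq> f ` {..<n}" using that by auto
    then have "f n \<notin> idl ?T (Fs m)" using cd[of n] idl_mono[of "f n" ?T "f ` {..<m}" "f ` {..<n}"] unfolding cand_def Fsf by blast
    then have "cand (Fs m) (d n) (f n)" using cd[of n] by (simp add: cand_def)
    then show ?thesis using dgle by (simp add: d_def)
  qed
  have "\<forall>n. \<exists>c. rep (f n) (d n) c" using cd by (simp add: cand_def)
  then obtain c where c: "!!n. rep (f n) (d n) (c n)" by metis
  have "\<forall>n. c n (d n) \<in> pfs S" using c by (simp add: rep_def)
  then obtain N where "c N (d N) \<in> idl S ((%n. c n (d n)) ` {..<N})"
    using S[unfolded seq_noetherian_def, THEN spec[of _ "%n. c n (d n)"]] by auto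
  from idl_image_sum[OF this] obtain a where a: "\<forall>j. a j \<in> pfs S" "!!e. c N (d N) e = (\<Sum>j<N. a j e * c j (d j) e)" by blast
  \<comment> \<open>The combination of earlier generators, raised to the common degree, that has the
    same leading coefficient as \<open>f N\<close>. The exponents are exact because the degrees
    \<open>d\<close> never decrease.\<close>
  define h where "h e = (\<Sum>j<N. (a j e * e i ^ (d N - d j)) * f j e)" for e
  have h: "h \<in> idl ?T (Fs N)"
    unfolding h_def
  proof (rule idl_sum, rule idl_mult)
    fix j assume "j \<in> {..<N}"
    then show "f j \<in> idl ?T (Fs N)" by (intro idl_base) (auto simp: Fsf)
    have "a j \<in> pfs ?T" using a(1) pfs_mono[of "a j" S ?T] by blast
    then show "(%e. a j e * e i ^ (d N - d j)) \<in> pfs ?T" by (intro pfs_mult pfs_power_var) auto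
  qed
  define g where "g e = f N e - h e" for e
  have g1: "g \<notin> idl ?T (Fs N)"
  proof
    assume "g \<in> idl ?T (Fs N)"
    from idl_add[OF this h] have "f N \<in> idl ?T (Fs N)" by (simp add: g_def)
    then show False using cd[of N] by (simp add: cand_def)
  qed
  have "Fs N \<subseteq> J" using FsJ by blast
  then have "h \<in> J" using idl_trans[OF h] unfolding J_def by blast
  moreover have "f N \<in> J" using cd[of N] by (simp add: cand_def)
  ultimately have g2: "g \<in> J" unfolding J_def g_def by (rule idl_diff[rotated])
  define D where "D = d N"
  define b where "b j k = (if D - d j \<le> k then c j (k - (D - d j)) else (%_. 0))" for j k
  have fj: "e i ^ (D - d j) * f j e = (\<Sum>k\<le>D. b j k e * e i ^ k)" if "j \<le> N" for j e
  proof -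
    have dj: "d j \<le> D" using mono[OF that] by (simp add: D_def)
    have "f j e = (\<Sum>k\<le>d j. c j k e * e i ^ k)" using c[of j] by (simp add: rep_def)
    then have "e i ^ (D - d j) * f j e = (\<Sum>k\<le>d j. c j k e * e i ^ (k + (D - d j)))"
      by (simp add: sum_distrib_left power_add mult_ac)
    also have "\<dots> = (\<Sum>k\<in>{D - d j..D}. c j (k - (D - d j)) e * e i ^ k)"
      by (rule sum.reindex_bij_witness[of _ "%k. k - (D - d j)" "%k. k + (D - d j)"]) (use dj in auto)
    also have "\<dots> = (\<Sum>k\<in>{D - d j..D}. b j k e * e i ^ k)" by (rule sum.cong) (auto simp: b_def)
    also have "\<dots> = (\<Sum>k\<le>D. b j k e * e i ^ k)" by (rule sum.mono_neutral_left) (auto simp: b_def)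
    finally show ?thesis .
  qed
  define r where "r k e = c N k e - (\<Sum>j<N. a j e * b j k e)" for k e
  have ge: "g e = (\<Sum>k\<le>D. r k e * e i ^ k)" for e
  proof -
    have "h e = (\<Sum>j<N. a j e * (\<Sum>k\<le>D. b j k e * e i ^ k))"
      unfolding h_def
    proof (rule sum.cong[OF refl])
      fix j assume "j \<in> {..<N}"
      then have "a j e * e i ^ (d N - d j) * f j e = a j e * (e i ^ (D - d j) * f j e)" by (simp add: D_def)
      also have "e i ^ (D - d j) * f j e = (\<Sum>k\<le>D. b j k e * e i ^ k)" using \<open>j \<in> {..<N}\<close> by (intro fj) simp
      finally show "a j e * e i ^ (d N - d j) * f j e = a j e * (\<Sum>k\<le>D. b j k e * e i ^ k)" .
    qed
    also have "\<dots> = (\<Sum>k\<le>D. (\<Sum>j<N. a j e * b j k e) * e i ^ k)"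
      unfolding sum_distrib_left sum_distrib_right by (subst sum.swap) (simp add: mult_ac)
    finally have "h e = (\<Sum>k\<le>D. (\<Sum>j<N. a j e * b j k e) * e i ^ k)" .
    moreover have "f N e = (\<Sum>k\<le>D. c N k e * e i ^ k)" using c[of N] by (simp add: rep_def D_def)
    ultimately show ?thesis by (simp add: g_def r_def sum_subtractf left_diff_distrib)
  qed
  have rD: "r D e = 0" for e
  proof -
    have "b j D = c j (d j)" if "j < N" for j using mono[of j N] that by (simp add: b_def D_def)
    then have "(\<Sum>j<N. a j e * b j D e) = (\<Sum>j<N. a j e * c j (d j) e)" by (intro sum.cong) auto
    then show ?thesis using a(2)[of e] by (simp add: r_def D_def)
  qed
  have rS: "r k \<in> pfs S" for k
  proof -
    have bS: "b j k \<in> pfs S" for j using c[of j] by (auto simp: b_def rep_def intro: pfs_const)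
    have "(%e. c N k e + (- 1) * (\<Sum>j<N. a j e * b j k e)) \<in> pfs S"
      using c[of N] a(1) bS by (intro pfs_add pfs_mult[OF pfs_const] pfs_sum pfs_mult) (auto simp: rep_def)
    then show ?thesis by (simp add: r_def[abs_def])
  qed
  \<comment> \<open>The difference \<open>g\<close> is still outside the ideal of the chosen
    generators but has smaller formal degree, against the choice of \<open>f N\<close>; at degree 0
    it would be zero.\<close>
  show False
  proof (cases D)
    case 0
    then have "g = (%_. 0)" using ge rD by auto
    then show False using g1 idl_zero[of ?T "Fs N"] by simp
  next
    case (Suc D')
    have "g e = (\<Sum>k\<le>D'. r k e * e i ^ k)" for e using ge[of e] rD[of e] Suc by simp
    then have "rep g D' r" using rS by (simp add: rep_def)
    then have "cand (Fs N) D' g" using g1 g2 unfolding cand_def by blast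
    then have "dg (Fs N) \<le> D'" by (rule dgle)
    then show False using Suc by (simp add: D_def d_def)
  qed
qed

theorem pf_sequence_noetherian:
  fixes G :: "nat => ('i::finite => real) => real"
  assumes "!!n. G n \<in> pf"
  shows "\<exists>N a. (\<forall>i. a i \<in> pf) & (\<forall>e. G N e = (\<Sum>i<N. a i e * G i e))"
proof -
  have "seq_noetherian S" if "finite S" for S :: "'i set"
    using that by (induction S rule: finite_induct) (auto intro: seq_noetherian_empty seq_noetherian_insert)
  then have "seq_noetherian (UNIV :: 'i set)" by simp
  then obtain N where "G N \<in> idl UNIV (G ` {..<N})"
    unfolding seq_noetherian_def using assms pf_eq_pfs by blast
  from idl_image_sum[OF this] show ?thesis using pf_eq_pfs by blast
qed

section \<open>Gradings and Krull's intersection theorem\<close>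

definition scale2 :: "real => ('m + 'n => real) => ('m + 'n => real)" where
  "scale2 \<theta> e = case_sum (%i. e (Inl i)) (%i. \<theta> * e (Inr i))"

lemma scale2_scale2: "scale2 \<theta> (scale2 \<eta> e) = scale2 (\<theta> * \<eta>) e"
  by (auto simp: scale2_def split: sum.splits)

text \<open>The second block of variables is graded by scaling. Making the scaling factor a genuine
  variable, the index \<open>None\<close>, turns the homogeneous parts of \<open>a\<close> into
  coefficients of a polynomial in it.\<close>

lemma homogeneous_parts:
  fixes a :: "('m + 'n => real) => real"
  assumes "a \<in> pf"
  shows "\<exists>P. (\<forall>k. (%e. coeff (P e) k) \<in> pf) & (\<forall>e \<theta>. a (scale2 \<theta> e) = poly (P e) \<theta>) &
     (\<forall>e \<theta> k. coeff (P (scale2 \<theta> e)) k = \<theta> ^ k * coeff (P e) k)"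
proof -
  define r where "r i E = (case i of Inl j => E (Some (Inl j)) | Inr j => E None * E (Some (Inr j)))"
    for i :: "'m + 'n" and E :: "('m + 'n) option => real"
  have r: "r i \<in> pf" for i unfolding r_def by (cases i) (auto intro: pf_intros)
  have "(%E. a (%i. r i E)) \<in> pf" by (rule pf_subst[OF assms r])
  from pf_as_poly[OF this, of None] obtain n P' where P': "P' \<in> PP n"
    "!!E \<theta>. a (%i. r i (E(None := \<theta>))) = poly (P' E) \<theta>" by auto
  define ext where "ext e o' = (case o' of None => 0 | Some i => e i)" for e :: "'m + 'n => real" and o'
  define P where "P e = P' (ext e)" for e
  have c: "(%e. coeff (P e) k) \<in> pf" for k
  proof -
    have x: "(%e. ext e o') \<in> pf" for o' unfolding ext_def by (cases o') (auto intro: pf_intros)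
    show ?thesis using pf_subst[OF PP_coeff[OF P'(1), of k], of "%o' e. ext e o'", OF x] by (simp add: P_def)
  qed
  have v: "a (scale2 \<theta> e) = poly (P e) \<theta>" for e \<theta>
  proof -
    have "(%i. r i ((ext e)(None := \<theta>))) = scale2 \<theta> e"
      by (auto simp: r_def scale2_def ext_def fun_eq_iff split: sum.splits)
    then show ?thesis using P'(2)[of "ext e" \<theta>] by (simp add: P_def)
  qed
  have h: "coeff (P (scale2 \<theta> e)) k = \<theta> ^ k * coeff (P e) k" for e \<theta> k
  proof -
    have "poly (P (scale2 \<theta> e)) x = poly (pcompose (P e) [:0, \<theta>:]) x" for x
      using v[of x "scale2 \<theta> e"] v[of "x * \<theta>" e] by (simp add: scale2_scale2 poly_pcompose)
    then have "P (scale2 \<theta> e) = pcompose (P e) [:0, \<theta>:]" by (simp add: poly_eq_poly_eq_iff[symmetric] fun_eq_iff)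
    then show ?thesis by (simp add: coeff_pcompose_linear)
  qed
  show ?thesis using c v h by blast
qed

text \<open>Krull's intersection theorem, following Perdry: express one of the homogeneous
  representatives through its predecessors.\<close>

lemma krull_intersection:
  fixes w :: "'n::finite => real" and A :: "(('n => real) => real) set"
  assumes A0: "(%_. 0) \<in> A" and Aadd: "!!f g. f \<in> A ==> g \<in> A ==> (%x. f x + g x) \<in> A"
    and Amult: "!!f g. f \<in> pf ==> g \<in> A ==> (%x. f x * g x) \<in> A"
    and G: "!!N :: nat. G N \<in> pf" "!!N \<theta> e. G N (scale2 \<theta> e) = \<theta> ^ N * G N e"
    and q: "!!N. (%x. q x - G N (case_sum x (%i. x i - w i))) \<in> A"
  shows "\<exists>u\<in>pf. u w = 0 & (%x. q x - u x * q x) \<in> A"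
proof -
  obtain N a where a: "\<forall>i. a i \<in> pf" "!!e. G N e = (\<Sum>i<N. a i e * G i e)"
    using pf_sequence_noetherian[of G] G(1) by blast
  have "\<forall>i. \<exists>P. (\<forall>k. (%e. coeff (P e) k) \<in> pf) & (\<forall>e \<theta>. a i (scale2 \<theta> e) = poly (P e) \<theta>) &
     (\<forall>e \<theta> k. coeff (P (scale2 \<theta> e)) k = \<theta> ^ k * coeff (P e) k)"
    using homogeneous_parts a(1) by blast
  then obtain P where P: "!!i k. (%e. coeff (P i e) k) \<in> pf" "!!i e \<theta>. a i (scale2 \<theta> e) = poly (P i e) \<theta>"
    "!!i e \<theta> k. coeff (P i (scale2 \<theta> e)) k = \<theta> ^ k * coeff (P i e) k" by metis
  \<comment> \<open>Comparing the coefficients of \<open>\<theta> ^ N\<close> replaces each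
    multiplier \<open>a i\<close> by its part of degree \<open>N - i\<close>.\<close>
  have GN: "G N e = (\<Sum>i<N. coeff (P i e) (N - i) * G i e)" for e
  proof -
    have "poly (monom (G N e) N) \<theta> = poly (\<Sum>i<N. monom (G i e) i * P i e) \<theta>" for \<theta>
    proof -
      have "\<theta> ^ N * G N e = (\<Sum>i<N. poly (P i e) \<theta> * (\<theta> ^ i * G i e))"
        using a(2)[of "scale2 \<theta> e"] by (simp add: G(2) P(2))
      then show ?thesis by (simp add: poly_sum poly_monom mult_ac)
    qed
    then have "monom (G N e) N = (\<Sum>i<N. monom (G i e) i * P i e)" by (simp add: poly_eq_poly_eq_iff[symmetric] fun_eq_iff)
    then have "coeff (monom (G N e) N) N = coeff (\<Sum>i<N. monom (G i e) i * P i e) N" by simp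
    also have "\<dots> = (\<Sum>i<N. coeff (P i e) (N - i) * G i e)"
      unfolding coeff_sum coeff_monom_mult by (rule sum.cong) auto
    finally show ?thesis by simp
  qed
  let ?c = "%x. case_sum x (%i. x i - w i)"
  have cpf: "(%x. ?c x j) \<in> pf" for j :: "'n + 'n" by (cases j) (auto intro: pf_intros)
  \<comment> \<open>Each summand is homogeneous of positive degree \<open>N - i\<close> in the
    differences \<open>x i - w i\<close>, so \<open>u\<close> vanishes at \<open>w\<close>.\<close>
  define u where "u x = (\<Sum>i<N. coeff (P i (?c x)) (N - i))" for x
  have upf: "(%x. coeff (P i (?c x)) k) \<in> pf" for i k
    using pf_subst[OF P(1)[of i k], of "%j x. ?c x j", OF cpf] by simp
  have "u \<in> pf" unfolding u_def by (intro pf_sum upf)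
  moreover have "u w = 0"
    unfolding u_def
  proof (rule sum.neutral, rule ballI)
    fix i assume "i \<in> {..<N}"
    have "scale2 0 (?c w) = ?c w" by (auto simp: scale2_def split: sum.splits)
    then have "coeff (P i (?c w)) (N - i) = 0 ^ (N - i) * coeff (P i (?c w)) (N - i)" using P(3)[of i 0 "?c w"] by simp
    moreover have "(0 :: real) ^ (N - i) = 0" using \<open>i \<in> {..<N}\<close> by simp
    ultimately show "coeff (P i (?c w)) (N - i) = 0" by (metis mult_zero_left)
  qed
  moreover have "(%x. q x - u x * q x) \<in> A"
  proof -
    \<comment> \<open>Modulo \<open>A\<close> every \<open>G i\<close> equals \<open>q\<close>, so
      the relation for \<open>G N\<close> says that \<open>q\<close> equals \<open>u\<close> times
      \<open>q\<close>.\<close>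
    have "(%x. \<Sum>i\<in>{..<N}. - coeff (P i (?c x)) (N - i) * (q x - G i (?c x))) \<in> A"
    proof -
      have "(%x. \<Sum>i\<in>I. - coeff (P i (?c x)) (N - i) * (q x - G i (?c x))) \<in> A" if "finite I" for I
        using that
      proof induction
        case (insert j I)
        have "(%x. - coeff (P j (?c x)) (N - j) * (q x - G j (?c x))) \<in> A"
          by (rule Amult[OF pf_minus[OF upf] q])
        from Aadd[OF this insert.IH] show ?case using insert.hyps by simp
      qed (simp add: A0)
      then show ?thesis by simp
    qed
    from Aadd[OF q[of N] this] show ?thesis
      by (rule back_subst[of "%f. f \<in> A"])
        (auto simp: fun_eq_iff GN u_def sum_distrib_right sum_distrib_left sum_subtractf algebra_simps sum_negf)
  qed
  ultimately show ?thesis by blast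
qed

section \<open>Tangent vector fields and their trajectories\<close>

lemma polyfun_minus: "p \<in> polyfun ==> (%x. - p x) \<in> polyfun"
  using polyfun.pf_mult[OF polyfun.pf_const[of "-1"], of p] by simp

lemma polyfun_diff: "p \<in> polyfun ==> q \<in> polyfun ==> (%x. p x - q x) \<in> polyfun"
  using polyfun.pf_add[OF _ polyfun_minus[of q], of p] by simp

lemma polyfun_sum: "(!!k. k \<in> I ==> p k \<in> polyfun) ==> (%x. \<Sum>k\<in>I. p k x) \<in> polyfun"
proof (induction I rule: infinite_finite_induct)
  case (insert i F)
  have "(%x. p i x + (\<Sum>k\<in>F. p k x)) \<in> polyfun"
    by (rule polyfun.pf_add) (use insert.prems insert.IH in auto)
  then show ?case using insert.hyps by simp
qed (simp_all add: polyfun.pf_const)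

lemma polyfun_prod: "(!!k. k \<in> I ==> p k \<in> polyfun) ==> (%x. \<Prod>k\<in>I. p k x) \<in> polyfun"
proof (induction I rule: infinite_finite_induct)
  case (insert i F)
  have "(%x. p i x * (\<Prod>k\<in>F. p k x)) \<in> polyfun"
    by (rule polyfun.pf_mult) (use insert.prems insert.IH in auto)
  then show ?case using insert.hyps by simp
qed (simp_all add: polyfun.pf_const)

lemma polyfun_power: "p \<in> polyfun ==> (%x. p x ^ n) \<in> polyfun"
proof (induction n)
  case (Suc n)
  show ?case using polyfun.pf_mult[OF Suc.prems Suc.IH[OF Suc.prems]] by simp
qed (simp add: polyfun.pf_const)

lemma polyfun_det:
  assumes "!!i j. (%x. A x $ i $ j) \<in> polyfun"
  shows "(%x. det (A x)) \<in> polyfun"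
  unfolding det_def by (intro polyfun_sum polyfun.pf_mult polyfun_prod assms polyfun.pf_const)

lemma polyfun_continuous: "p \<in> polyfun ==> continuous_on S p"
  by (induction rule: polyfun.induct) (auto intro: continuous_intros)

lemma polyfun_gradient_ex:
  assumes "p \<in> polyfun"
  shows "\<exists>g. (\<forall>i. (%x. g x $ i) \<in> polyfun) & (\<forall>x. (p has_derivative (%h. g x \<bullet> h)) (at x))"
  using assms
proof induction
  case (pf_const c)
  show ?case by (intro exI[of _ "%_. 0"]) (auto intro: polyfun.pf_const)
next
  case (pf_coord i)
  have "(%x. x $ i) = (%x. axis i 1 \<bullet> x)" by (auto simp: inner_axis' fun_eq_iff)
  moreover have "((%x. x $ i) has_derivative (%h. h $ i)) (at x)" for x :: "real^'a"
    by (rule bounded_linear_imp_has_derivative[OF bounded_linear_vec_nth])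
  ultimately show ?case
    by (intro exI[of _ "%_. axis i 1"]) (auto intro: polyfun.pf_const simp: inner_axis')
next
  case (pf_add p q)
  then obtain g h where "\<forall>i. (%x. g x $ i) \<in> polyfun" "\<forall>x. (p has_derivative (%h. g x \<bullet> h)) (at x)"
    "\<forall>i. (%x. h x $ i) \<in> polyfun" "\<forall>x. (q has_derivative (%v. h x \<bullet> v)) (at x)" by blast
  then show ?case
    by (intro exI[of _ "%x. g x + h x"]) (auto intro!: polyfun.pf_add derivative_eq_intros simp: inner_add_left)
next
  case (pf_mult p q)
  then obtain g h where gh: "\<forall>i. (%x. g x $ i) \<in> polyfun" "\<forall>x. (p has_derivative (%h. g x \<bullet> h)) (at x)"
    "\<forall>i. (%x. h x $ i) \<in> polyfun" "\<forall>x. (q has_derivative (%v. h x \<bullet> v)) (at x)" by blast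
  show ?case
  proof (intro exI[of _ "%x. p x *\<^sub>R h x + q x *\<^sub>R g x"] conjI allI)
    fix i show "(%x. (p x *\<^sub>R h x + q x *\<^sub>R g x) $ i) \<in> polyfun"
      using gh pf_mult.hyps by (auto intro!: polyfun.pf_add polyfun.pf_mult)
    fix x
    have "((%x. p x * q x) has_derivative (%v. p x * (h x \<bullet> v) + (g x \<bullet> v) * q x)) (at x)"
      by (rule has_derivative_mult) (use gh in auto)
    then show "((%x. p x * q x) has_derivative (%v. (p x *\<^sub>R h x + q x *\<^sub>R g x) \<bullet> v)) (at x)"
      by (simp add: inner_add_left mult.commute)
  qed
qed

definition pgrad :: "(real^'n => real) => real^'n => real^'n" where
  "pgrad p x = (\<chi> i. frechet_derivative p (at x) (axis i 1))"

lemma pgrad_eqI: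
  assumes "(p has_derivative (%h. g \<bullet> h)) (at x)" shows "pgrad p x = g"
proof -
  have "frechet_derivative p (at x) = (%h. g \<bullet> h)" using frechet_derivative_at[OF assms] by simp
  then show ?thesis by (simp add: pgrad_def vec_eq_iff inner_axis)
qed

lemma pgrad:
  assumes "p \<in> polyfun"
  shows "(p has_derivative (%h. pgrad p x \<bullet> h)) (at x)" "(%x. pgrad p x $ i) \<in> polyfun"
proof -
  obtain g where g: "\<forall>i. (%x. g x $ i) \<in> polyfun" "\<forall>x. (p has_derivative (%h. g x \<bullet> h)) (at x)"
    using polyfun_gradient_ex[OF assms] by blast
  then have "pgrad p x = g x" for x by (intro pgrad_eqI) auto
  then show "(p has_derivative (%h. pgrad p x \<bullet> h)) (at x)" "(%x. pgrad p x $ i) \<in> polyfun" using g by auto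
qed

lemma pgrad_add: "p \<in> polyfun ==> q \<in> polyfun ==> pgrad (%x. p x + q x) x = pgrad p x + pgrad q x"
  by (intro pgrad_eqI) (auto intro!: derivative_eq_intros pgrad(1) simp: inner_add_left)

lemma pgrad_mult: "p \<in> polyfun ==> q \<in> polyfun ==> pgrad (%x. p x * q x) x = p x *\<^sub>R pgrad q x + q x *\<^sub>R pgrad p x"
proof (intro pgrad_eqI)
  assume p: "p \<in> polyfun" "q \<in> polyfun"
  have "((%x. p x * q x) has_derivative (%v. p x * (pgrad q x \<bullet> v) + (pgrad p x \<bullet> v) * q x)) (at x)"
    by (rule has_derivative_mult) (use p pgrad(1) in auto)
  then show "((%x. p x * q x) has_derivative (%v. (p x *\<^sub>R pgrad q x + q x *\<^sub>R pgrad p x) \<bullet> v)) (at x)"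
    by (simp add: inner_add_left mult.commute)
qed

lemma pgrad_const: "pgrad (%_. c) x = 0"
  by (intro pgrad_eqI) auto

lemma pgrad_coord: "pgrad (%x. x $ i) x = axis i 1"
proof (intro pgrad_eqI)
  have "((%x. x $ i) has_derivative (%h. h $ i)) (at x)"
    by (rule bounded_linear_imp_has_derivative[OF bounded_linear_vec_nth])
  then show "((%x. x $ i) has_derivative (%h. axis i 1 \<bullet> h)) (at x)" by (simp add: inner_axis')
qed

lemma vanishing_ideal_add: "p \<in> vanishing_ideal V ==> q \<in> vanishing_ideal V ==> (%x. p x + q x) \<in> vanishing_ideal V"
  by (auto simp: vanishing_ideal_def intro: polyfun.pf_add)

lemma vanishing_ideal_mult: "p \<in> polyfun ==> q \<in> vanishing_ideal V ==> (%x. p x * q x) \<in> vanishing_ideal V"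
  by (auto simp: vanishing_ideal_def intro: polyfun.pf_mult)

lemma ideal_gradients_eq: "ideal_gradients V x = (%p. pgrad p x) ` vanishing_ideal V"
proof (intro equalityI subsetI)
  fix g assume "g \<in> ideal_gradients V x"
  then obtain p where "p \<in> vanishing_ideal V" "(p has_derivative (%h. g \<bullet> h)) (at x)" by (auto simp: ideal_gradients_def)
  then show "g \<in> (%p. pgrad p x) ` vanishing_ideal V" using pgrad_eqI by blast
next
  fix g assume "g \<in> (%p. pgrad p x) ` vanishing_ideal V"
  then obtain p where p: "p \<in> vanishing_ideal V" "g = pgrad p x" by blast
  then have "p \<in> polyfun" by (simp add: vanishing_ideal_def)
  then show "g \<in> ideal_gradients V x" using pgrad(1)[of p x] p by (auto simp: ideal_gradients_def)
qed

text \<open>Because the gradients at a point form a subspace before any span is taken, an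
  orthonormal basis of it consists of gradients of actual ideal elements.\<close>

lemma subspace_ideal_gradients: "subspace (ideal_gradients V x)"
  unfolding subspace_def
proof (intro conjI ballI allI)
  have z: "(%_. 0) \<in> vanishing_ideal V" by (auto simp: vanishing_ideal_def intro: polyfun.pf_const)
  then show "0 \<in> ideal_gradients V x" unfolding ideal_gradients_eq by (rule image_eqI[rotated]) (simp add: pgrad_const)
  fix a b c assume "a \<in> ideal_gradients V x"
  then obtain p where p: "p \<in> vanishing_ideal V" "a = pgrad p x" by (auto simp: ideal_gradients_eq)
  have pp: "p \<in> polyfun" using p by (simp add: vanishing_ideal_def)
  show "c *\<^sub>R a \<in> ideal_gradients V x" unfolding ideal_gradients_eq
    by (rule image_eqI[OF _ vanishing_ideal_mult[OF polyfun.pf_const p(1), of c]])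
      (simp add: pgrad_mult pgrad_const pp polyfun.pf_const p)
  assume "b \<in> ideal_gradients V x"
  then obtain q where q: "q \<in> vanishing_ideal V" "b = pgrad q x" by (auto simp: ideal_gradients_eq)
  have qq: "q \<in> polyfun" using q by (simp add: vanishing_ideal_def)
  show "a + b \<in> ideal_gradients V x" unfolding ideal_gradients_eq
    by (rule image_eqI[OF _ vanishing_ideal_add[OF p(1) q(1)]]) (simp add: pgrad_add pp qq p q)
qed

section \<open>Polynomial derivations tangent to the variety\<close>

definition dv :: "(real^'n => real^'n) => (real^'n => real) => real^'n => real" where
  "dv X p x = pgrad p x \<bullet> X x"

definition tangent_field :: "(real^'n) set => (real^'n => real^'n) => bool" where
  "tangent_field V X \<longleftrightarrow> (\<forall>i. (%x. X x $ i) \<in> polyfun) & (\<forall>p\<in>vanishing_ideal V. dv X p \<in> vanishing_ideal V)"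

lemma dv_polyfun:
  assumes "!!i. (%x. X x $ i) \<in> polyfun" "p \<in> polyfun" shows "dv X p \<in> polyfun"
proof -
  have "(%x. \<Sum>i\<in>UNIV. pgrad p x $ i * X x $ i) \<in> polyfun"
    by (intro polyfun_sum polyfun.pf_mult assms pgrad)
  then show ?thesis by (simp add: dv_def[abs_def] inner_vec_def)
qed

lemma dv_add: "p \<in> polyfun ==> q \<in> polyfun ==> dv X (%x. p x + q x) = (%x. dv X p x + dv X q x)"
  by (auto simp: dv_def pgrad_add inner_add_left)

lemma dv_mult: "p \<in> polyfun ==> q \<in> polyfun ==> dv X (%x. p x * q x) = (%x. dv X p x * q x + p x * dv X q x)"
  by (auto simp: dv_def pgrad_mult inner_add_left)

lemma dv_const: "dv X (%_. c) = (%_. 0)"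
  by (auto simp: dv_def pgrad_const)

lemma dv_coord: "dv X (%x. x $ i) = (%x. X x $ i)"
  by (auto simp: dv_def pgrad_coord inner_axis')

text \<open>Cramer's rule turns a tangent vector at one point into a polynomial vector field that is
  tangent at every point; the constancy of the rank makes it orthogonal to all gradients.\<close>

lemma tangent_field_through:
  fixes V :: "(real^'n) set"
  assumes rank: "!!x. x \<in> V ==> dim (ideal_gradients V x) = k"
    and w: "w \<in> V" and v: "!!g. g \<in> ideal_gradients V w ==> g \<bullet> v = 0"
  shows "\<exists>X. tangent_field V X & X w = v"
proof -
  obtain B where B: "B \<subseteq> ideal_gradients V w" "pairwise orthogonal B" "!!b. b \<in> B ==> norm b = 1"
      "independent B" "card B = dim (ideal_gradients V w)" "span B = ideal_gradients V w"
    using orthonormal_basis_subspace[OF subspace_ideal_gradients[of V w]] by metis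
  have fB: "finite B" using B(4) independent_imp_finite by blast
  have ortho: "b \<bullet> b' = (if b = b' then 1 else 0)" if "b \<in> B" "b' \<in> B" for b b'
    using B(2,3) that by (auto simp: pairwise_def orthogonal_def dot_square_norm)
  have "\<forall>b\<in>B. \<exists>p\<in>vanishing_ideal V. pgrad p w = b" using B(1) by (auto simp: ideal_gradients_eq)
  then obtain P where P: "!!b. b \<in> B ==> P b \<in> vanishing_ideal V" "!!b. b \<in> B ==> pgrad (P b) w = b" by metis
  have Ppf: "P b \<in> polyfun" if "b \<in> B" for b using P(1)[OF that] by (simp add: vanishing_ideal_def)
  \<comment> \<open>The component of \<open>M x *v h\<close> along \<open>b\<close> is the
    derivative of \<open>P b\<close> at \<open>x\<close> in the direction \<open>h\<close>, and the
    component orthogonal to \<open>B\<close> is that of \<open>h\<close>. Thus \<open>M w\<close> is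
    the identity, and a solution of \<open>M x *v y = v\<close> is orthogonal to all gradients
    \<open>pgrad (P b) x\<close>.\<close>
  define M :: "real^'n => real^'n^'n" where
    "M x = (\<chi> i j. (if i = j then 1 else 0) + (\<Sum>b\<in>B. (pgrad (P b) x - b) $ j * b $ i))" for x
  have Mv: "M x *v h = h + (\<Sum>b\<in>B. ((pgrad (P b) x - b) \<bullet> h) *\<^sub>R b)" for x h
  proof -
    have "(\<Sum>j\<in>UNIV. (\<Sum>b\<in>B. (pgrad (P b) x - b) $ j * b $ i) * h $ j) = (\<Sum>b\<in>B. ((pgrad (P b) x - b) \<bullet> h) * b $ i)" for i
      unfolding inner_vec_def sum_distrib_right by (subst sum.swap) (simp add: mult_ac)
    moreover have "(\<Sum>j\<in>UNIV. (if i = j then 1 else 0) * h $ j) = h $ i" for i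
      by (simp add: if_distrib[of "%c. c * _"] cong: if_cong)
    ultimately show ?thesis
      by (simp add: vec_eq_iff matrix_vector_mult_def M_def distrib_right sum.distrib)
  qed
  have Mw: "M w = mat 1" by (simp add: M_def mat_def vec_eq_iff P(2))
  have Mpf: "(%x. M x $ i $ j) \<in> polyfun" for i j
    unfolding M_def using pgrad(2)[OF Ppf]
    by (auto intro!: polyfun.pf_add polyfun.pf_const polyfun_sum polyfun.pf_mult polyfun_diff)
  define C :: "real^'n => 'n => real^'n^'n" where "C x k = (\<chi> i j. if j = k then v $ i else M x $ i $ j)" for x k
  have Cpf: "(%x. C x k $ i $ j) \<in> polyfun" for k i j
    unfolding C_def using Mpf by (cases "j = k") (auto intro: polyfun.pf_const)
  \<comment> \<open>\<open>det (C x k)\<close> is the Cramer solution times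
    \<open>det (M x)\<close>. The additional determinant makes the field vanish where
    \<open>M x\<close> is singular and Cramer's rule says nothing.\<close>
  define X where "X x = (\<chi> k. det (M x) * det (C x k))" for x
  have Xpf: "(%x. X x $ i) \<in> polyfun" for i
    unfolding X_def by (auto intro!: polyfun.pf_mult polyfun_det Mpf Cpf)
  have "X w = v"
  proof -
    have "det (C w k) = v $ k" for k
      using cramer_lemma[of k "mat 1" v] unfolding C_def Mw matrix_vector_mul_lid det_I by simp
    then show ?thesis by (simp add: X_def Mw vec_eq_iff)
  qed
  moreover have "dv X p x = 0" if p: "p \<in> vanishing_ideal V" and x: "x \<in> V" for p x
  proof (cases "det (M x) = 0")
    case True
    then have "X x = 0" by (simp add: X_def vec_eq_iff)
    then show ?thesis by (simp add: dv_def)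
  next
    case False
    define y where "y = (\<chi> k. det (C x k) / det (M x))"
    have My: "M x *v y = v" using cramer[OF False, of y v] by (simp add: y_def C_def)
    have Xy: "X x = (det (M x))\<^sup>2 *\<^sub>R y" using False by (simp add: X_def y_def vec_eq_iff power2_eq_square)
    have orth: "pgrad (P b) x \<bullet> y = 0" if b: "b \<in> B" for b
    proof -
      have "b \<bullet> v = 0" using v B(1) b by blast
      then have "b \<bullet> (M x *v y) = 0" by (simp add: My)
      moreover have "b \<bullet> (M x *v y) = b \<bullet> y + (\<Sum>b'\<in>B. ((pgrad (P b') x - b') \<bullet> y) * (b \<bullet> b'))"
        by (simp add: Mv inner_add_right inner_sum_right)
      moreover have "(\<Sum>b'\<in>B. ((pgrad (P b') x - b') \<bullet> y) * (b \<bullet> b')) = (\<Sum>b'\<in>B. if b' = b then (pgrad (P b) x - b) \<bullet> y else 0)"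
        by (rule sum.cong) (auto simp: ortho b)
      ultimately show ?thesis using b fB by (simp add: inner_diff_left)
    qed
    define f where "f c = (\<Sum>b\<in>B. (c \<bullet> b) *\<^sub>R pgrad (P b) x)" for c
    have lf: "linear f" unfolding f_def
      by (intro linear_compose_sum ballI linearI) (simp_all add: inner_add_left scaleR_add_left)
    have "invertible (M x)" using False by (simp add: invertible_det_nz)
    then obtain M' where M': "M x ** M' = mat 1" by (auto simp: invertible_def)
    have surj: "\<exists>h. M x *v h = u" for u
      by (rule exI[of _ "M' *v u"]) (simp add: matrix_vector_mul_assoc M')
    \<comment> \<open>Where \<open>M x\<close> is invertible the gradients of the \<open>P b\<close>
      are independent. As the gradient space has the same dimension at \<open>x\<close> and
      \<open>w\<close>, they span it, so orthogonality to them is orthogonality to all gradients at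
      \<open>x\<close>.\<close>
    have inj: "inj_on f (span B)"
    proof (rule inj_onI)
      fix a c assume ac: "a \<in> span B" "c \<in> span B" "f a = f c"
      define u where "u = a - c"
      have u: "u \<in> span B" using ac by (simp add: u_def span_diff)
      have fu: "f u = 0" using ac(3) lf by (simp add: u_def linear_diff)
      have us: "u = (\<Sum>b\<in>B. (u \<bullet> b) *\<^sub>R b)"
      proof -
        obtain r where r: "u = (\<Sum>b\<in>B. r b *\<^sub>R b)" using u span_finite[OF fB] by auto
        have "u \<bullet> b = r b" if "b \<in> B" for b
        proof -
          have "u \<bullet> b = (\<Sum>b'\<in>B. r b' * (b' \<bullet> b))" by (simp add: r inner_sum_left)
          also have "\<dots> = (\<Sum>b'\<in>B. if b' = b then r b else 0)" by (rule sum.cong) (auto simp: ortho that)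
          finally show ?thesis using that fB by simp
        qed
        then have "(\<Sum>b\<in>B. (u \<bullet> b) *\<^sub>R b) = (\<Sum>b\<in>B. r b *\<^sub>R b)" by (intro sum.cong) auto
        then show ?thesis using r by simp
      qed
      obtain h where h: "M x *v h = u" using surj by blast
      have "u \<bullet> u = u \<bullet> (M x *v h)" by (simp add: h)
      also have "\<dots> = u \<bullet> h + (\<Sum>b\<in>B. ((pgrad (P b) x - b) \<bullet> h) * (u \<bullet> b))"
        by (simp add: Mv inner_add_right inner_sum_right)
      also have "\<dots> = u \<bullet> h + (\<Sum>b\<in>B. (u \<bullet> b) * (pgrad (P b) x \<bullet> h)) - (\<Sum>b\<in>B. (u \<bullet> b) * (b \<bullet> h))"
        by (simp add: inner_diff_left algebra_simps sum_subtractf)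
      also have "(\<Sum>b\<in>B. (u \<bullet> b) * (b \<bullet> h)) = (\<Sum>b\<in>B. (u \<bullet> b) *\<^sub>R b) \<bullet> h" by (simp add: inner_sum_left)
      also have "\<dots> = u \<bullet> h" by (simp only: us[symmetric])
      also have "(\<Sum>b\<in>B. (u \<bullet> b) * (pgrad (P b) x \<bullet> h)) = f u \<bullet> h" by (simp add: f_def inner_sum_left)
      finally have "u \<bullet> u = 0" using fu by simp
      then show "a = c" by (simp add: u_def)
    qed
    have sub: "f ` span B \<subseteq> ideal_gradients V x"
    proof
      fix z assume "z \<in> f ` span B"
      then obtain c where "z = f c" by blast
      moreover have "pgrad (P b) x \<in> ideal_gradients V x" if "b \<in> B" for b
        using P(1)[OF that] by (auto simp: ideal_gradients_eq)
      ultimately show "z \<in> ideal_gradients V x" unfolding f_def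
        by (auto intro!: subspace_sum[OF subspace_ideal_gradients] subspace_scale[OF subspace_ideal_gradients])
    qed
    have "dim (f ` span B) = dim (span B)" by (rule dim_image_eq[OF lf]) (simp only: span_span inj)
    then have "dim (f ` span B) = dim (ideal_gradients V x)" using rank[OF x] rank[OF w] B(6) by simp
    moreover have "subspace (f ` span B)" by (rule linear_subspace_image[OF lf subspace_span])
    ultimately have "f ` span B = ideal_gradients V x"
      by (intro subspace_dim_equal sub subspace_ideal_gradients) auto
    moreover have "pgrad p x \<in> ideal_gradients V x" using p by (auto simp: ideal_gradients_eq)
    ultimately obtain c where "pgrad p x = f c" by blast
    then have "pgrad p x \<bullet> y = 0" by (simp add: f_def inner_sum_left orth)
    then show ?thesis by (simp add: dv_def Xy)
  qed
  ultimately show ?thesis unfolding tangent_field_def using Xpf dv_polyfun[OF Xpf]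
    by (intro exI[of _ X]) (auto simp: vanishing_ideal_def)
qed

section \<open>Growth of iterated derivatives and convergence of the Lie series\<close>

inductive poly_bound :: "nat => real => (real^'n => real) => bool" where
  pb_const: "poly_bound 0 \<bar>c\<bar> (%_. c)"
| pb_coord: "poly_bound 1 1 (%x. x $ i)"
| pb_add: "poly_bound m A p ==> poly_bound m B q ==> poly_bound m (A + B) (%x. p x + q x)"
| pb_mult: "poly_bound m A p ==> poly_bound n B q ==> poly_bound (m + n) (A * B) (%x. p x * q x)"
| pb_weaken: "poly_bound m A p ==> m \<le> n ==> A \<le> B ==> poly_bound n B p"

lemma poly_bound_polyfun: "poly_bound m A p ==> p \<in> polyfun & 0 \<le> A"
  by (induction rule: poly_bound.induct) (auto intro: polyfun.intros)

lemma polyfun_poly_bound: "p \<in> polyfun ==> \<exists>m A. poly_bound m A p"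
proof (induction rule: polyfun.induct)
  case (pf_add p q)
  then obtain m A n B where 1: "poly_bound m A p" "poly_bound n B q" by blast
  have "poly_bound (max m n) A p" "poly_bound (max m n) B q"
    by (rule pb_weaken[OF 1(1)]; simp) (rule pb_weaken[OF 1(2)]; simp)
  then show ?case using pb_add by blast
next
  case (pf_mult p q)
  then obtain m A n B where "poly_bound m A p" "poly_bound n B q" by blast
  from pb_mult[OF this] show ?case by blast
qed (use pb_const pb_coord in blast)+

lemma poly_bound_value:
  assumes "poly_bound m A p" "!!i. \<bar>x $ i\<bar> \<le> R" "1 \<le> R"
  shows "\<bar>p x\<bar> \<le> A * R ^ m"
  using assms(1)
proof (induction rule: poly_bound.induct)
  case (pb_add m A p B q)
  then show ?case by (auto simp: distrib_right intro: order_trans[OF abs_triangle_ineq])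
next
  case (pb_mult m A p n B q)
  have "\<bar>p x * q x\<bar> \<le> (A * R ^ m) * (B * R ^ n)"
    unfolding abs_mult using pb_mult.IH by (intro mult_mono) (auto intro: order_trans[OF abs_ge_zero])
  then show ?case by (simp add: power_add mult_ac)
next
  case (pb_weaken m A p n B)
  have "0 \<le> A" using poly_bound_polyfun[OF pb_weaken.hyps(1)] by simp
  then have "A * R ^ m \<le> B * R ^ n" using pb_weaken.hyps assms(3) by (intro mult_mono power_increasing) auto
  then show ?case using pb_weaken.IH by linarith
qed (use assms in auto)

text \<open>\<open>poly_bound m A p\<close> certifies a degree bound \<open>m\<close> and a size
  \<open>A\<close> along one way of building \<open>p\<close>. Deriving costs the degree of the
  field and a factor \<open>m * K\<close>, because each of at most \<open>m\<close> coordinate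
  factors is differentiated once.\<close>

lemma poly_bound_dv:
  assumes X: "!!i. poly_bound e K (%x. X x $ i)" and "poly_bound m A p"
  shows "poly_bound (m + e) (m * K * A) (dv X p)"
  using assms(2)
proof (induction rule: poly_bound.induct)
  case (pb_const c)
  have "poly_bound 0 0 (%_ :: real^'a. 0)" using poly_bound.pb_const[of 0] by simp
  then have "poly_bound e 0 (%_ :: real^'a. 0)" by (rule pb_weaken) auto
  then show ?case by (simp add: dv_const)
next
  case (pb_coord i)
  have "poly_bound (1 + e) K (%x. X x $ i)" by (rule pb_weaken[OF X]) auto
  then show ?case by (simp add: dv_coord)
next
  case (pb_add m A p B q)
  then show ?case
    using poly_bound.pb_add[OF pb_add.IH] poly_bound_polyfun[OF pb_add.hyps(1)] poly_bound_polyfun[OF pb_add.hyps(2)]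
    by (simp add: dv_add algebra_simps)
next
  case (pb_mult m A p n B q)
  have 1: "poly_bound (m + n + e) (m * K * A * B) (%x. dv X p x * q x)"
    using poly_bound.pb_mult[OF pb_mult.IH(1) pb_mult.hyps(2)] by (simp add: ac_simps)
  have 2: "poly_bound (m + n + e) (A * (n * K * B)) (%x. p x * dv X q x)"
    using poly_bound.pb_mult[OF pb_mult.hyps(1) pb_mult.IH(2)] by (simp add: ac_simps)
  show ?case using poly_bound.pb_add[OF 1 2] poly_bound_polyfun[OF pb_mult.hyps(1)] poly_bound_polyfun[OF pb_mult.hyps(2)]
    by (simp add: dv_mult algebra_simps)
next
  case (pb_weaken m A p n B)
  have "0 \<le> K" "0 \<le> A" using poly_bound_polyfun[OF X] poly_bound_polyfun[OF pb_weaken.hyps(1)] by auto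
  then have "m * K * A \<le> n * K * B" using pb_weaken.hyps by (intro mult_mono) auto
  then show ?case using pb_weaken.hyps by (intro poly_bound.pb_weaken[OF pb_weaken.IH]) auto
qed

text \<open>The Lie series of \<open>X\<close> at \<open>w\<close>: formally \<open>p\<close>
  evaluated along the flow of \<open>X\<close> starting at \<open>w\<close>, with no differential
  equation solved.\<close>

definition taylor :: "(real^'n => real^'n) => real^'n => (real^'n => real) => real fps" where
  "taylor X w p = Abs_fps (%k. (dv X ^^ k) p w / fact k)"

context
  fixes X :: "real^'n => real^'n"
  assumes Xpf: "!!i. (%x. X x $ i) \<in> polyfun"
begin

lemma dv_pow_polyfun: "p \<in> polyfun ==> (dv X ^^ k) p \<in> polyfun"
  by (induction k) (auto intro: dv_polyfun Xpf)

lemma taylor_nth_Suc: "of_nat (Suc k) * fps_nth (taylor X w p) (Suc k) = fps_nth (taylor X w (dv X p)) k"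
  unfolding taylor_def by (simp add: funpow_swap1 field_simps del: of_nat_Suc)

lemma dv_pow_add: "p \<in> polyfun ==> q \<in> polyfun ==> (dv X ^^ k) (%x. p x + q x) = (%x. (dv X ^^ k) p x + (dv X ^^ k) q x)"
  by (induction k) (auto simp: dv_add dv_pow_polyfun)

lemma taylor_add: "p \<in> polyfun ==> q \<in> polyfun ==> taylor X w (%x. p x + q x) = taylor X w p + taylor X w q"
  by (rule fps_ext) (simp add: taylor_def dv_pow_add add_divide_distrib)

text \<open>Both sides have the same formal derivative by the Leibniz rule, so the coefficients
  agree by induction on the index, for all \<open>p\<close> and \<open>q\<close> at once.\<close>

lemma taylor_mult:
  assumes "p \<in> polyfun" "q \<in> polyfun"
  shows "taylor X w (%x. p x * q x) = taylor X w p * taylor X w q"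
proof (rule fps_ext)
  fix k show "fps_nth (taylor X w (%x. p x * q x)) k = fps_nth (taylor X w p * taylor X w q) k"
    using assms
  proof (induction k arbitrary: p q)
    case 0
    show ?case by (simp add: taylor_def)
  next
    case (Suc k)
    note d = dv_polyfun[OF Xpf Suc.prems(1)] dv_polyfun[OF Xpf Suc.prems(2)]
    have dt: "fps_deriv (taylor X w r) = taylor X w (dv X r)" for r
      by (rule fps_ext) (use taylor_nth_Suc[of _ w r] in \<open>simp add: fps_deriv_def\<close>)
    have "of_nat (Suc k) * fps_nth (taylor X w (%x. p x * q x)) (Suc k) =
        fps_nth (taylor X w (%x. dv X p x * q x + p x * dv X q x)) k"
      unfolding taylor_nth_Suc by (simp add: dv_mult Suc.prems)
    also have "\<dots> = fps_nth (taylor X w (dv X p) * taylor X w q + taylor X w p * taylor X w (dv X q)) k"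
      using Suc.IH[OF d(1) Suc.prems(2)] Suc.IH[OF Suc.prems(1) d(2)]
      by (subst taylor_add) (auto intro: polyfun.pf_mult d Suc.prems)
    also have "\<dots> = fps_nth (fps_deriv (taylor X w p * taylor X w q)) k"
      unfolding fps_deriv_mult dt by (simp add: add.commute)
    also have "\<dots> = of_nat (Suc k) * fps_nth (taylor X w p * taylor X w q) (Suc k)"
      by (simp add: fps_deriv_def)
    finally show ?case by (simp del: of_nat_Suc)
  qed
qed

lemma taylor_const: "taylor X w (%_. c) = fps_const c"
proof (rule fps_ext)
  fix k show "fps_nth (taylor X w (%_. c)) k = fps_nth (fps_const c) k"
  proof (cases k)
    case (Suc j)
    have "(dv X ^^ i) (%_. 0) = (%_. 0)" for i by (induction i) (auto simp: dv_const)
    then have "(dv X ^^ Suc j) (%_. c) = (%_. 0)" by (simp only: funpow_Suc_right o_apply dv_const)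
    then show ?thesis using Suc by (simp add: taylor_def)
  qed (simp add: taylor_def)
qed

text \<open>The k-th derivative of a coordinate has degree at most \<open>1 + k * e\<close> and size
  at most \<open>E ^ k * fact k * K ^ k\<close>; the factorial cancels against that of the Taylor
  coefficient, leaving geometric growth.\<close>

lemma taylor_coord_converges: "fps_conv_radius (taylor X w (%x. x $ i)) > 0"
proof -
  have "\<forall>i. \<exists>m A. poly_bound m A (%x. X x $ i)" using polyfun_poly_bound[OF Xpf] by blast
  then obtain m A where mA: "!!i. poly_bound (m i) (A i) (%x. X x $ i)" by metis
  define e where "e = (\<Sum>i\<in>UNIV. m i)"
  define K where "K = (\<Sum>i\<in>UNIV. A i)"
  have A0: "0 \<le> A i" for i using poly_bound_polyfun[OF mA] by simp
  have Xb: "poly_bound e K (%x. X x $ i)" for i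
    by (rule pb_weaken[OF mA]) (use A0 in \<open>auto simp: e_def K_def intro: member_le_sum\<close>)
  have K0: "0 \<le> K" using A0 by (simp add: K_def sum_nonneg)
  \<comment> \<open>Chosen so that the degree \<open>1 + k * e\<close> before the next derivation is
    at most \<open>E * (k + 1)\<close>, which produces the factorial.\<close>
  define E where "E = 1 + real e"
  have b: "poly_bound (1 + k * e) (E ^ k * fact k * K ^ k) ((dv X ^^ k) (%x. x $ i))" for k
  proof (induction k)
    case 0
    then show ?case using pb_coord by simp
  next
    case (Suc k)
    define Q where "Q = E ^ k * fact k * K ^ k"
    have b1: "poly_bound (1 + k * e + e) (real (1 + k * e) * K * Q) (dv X ((dv X ^^ k) (%x. x $ i)))"
      using poly_bound_dv[OF Xb Suc] by (simp only: Q_def)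
    have b2: "real (1 + k * e) * K * Q \<le> E ^ Suc k * fact (Suc k) * K ^ Suc k"
    proof -
      have E0: "0 \<le> E" by (simp add: E_def)
      have Q0: "0 \<le> K * Q" unfolding Q_def using K0 E0 by (intro mult_nonneg_nonneg) auto
      have "real (1 + k * e) \<le> E * real (Suc k)" by (simp add: E_def algebra_simps)
      then have "real (1 + k * e) * (K * Q) \<le> (E * real (Suc k)) * (K * Q)" using Q0 by (rule mult_right_mono)
      also have "\<dots> = E ^ Suc k * fact (Suc k) * K ^ Suc k"
        unfolding Q_def power_Suc fact_Suc by (simp only: mult_ac)
      finally show ?thesis by (simp only: mult.assoc)
    qed
    have b3: "1 + k * e + e \<le> 1 + Suc k * e" by simp
    show ?case unfolding funpow.simps o_apply by (rule pb_weaken[OF b1 b3 b2])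
  qed
  define R where "R = 1 + norm w"
  have R: "1 \<le> R" "!!i. \<bar>w $ i\<bar> \<le> R" unfolding R_def using component_le_norm_cart[of w] by (auto intro: add_increasing)
  define D where "D = E * K * R ^ e"
  have D0: "0 \<le> D" using K0 R by (simp add: D_def E_def)
  have cb: "\<bar>fps_nth (taylor X w (%x. x $ i)) k\<bar> \<le> R * D ^ k" for k
  proof -
    have "\<bar>(dv X ^^ k) (%x. x $ i) w\<bar> \<le> (E ^ k * fact k * K ^ k) * R ^ (1 + k * e)"
      by (rule poly_bound_value[OF b R(2,1)])
    also have "\<dots> = fact k * (R * D ^ k)"
      by (simp add: D_def power_mult_distrib power_mult[symmetric] power_add mult_ac)
    finally show ?thesis by (simp add: taylor_def field_simps)
  qed
  define z where "z = 1 / (2 * (D + 1))"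
  have z: "0 < z" "D * z \<le> 1 / 2" using D0 by (auto simp: z_def field_simps)
  have "summable (%k. fps_nth (taylor X w (%x. x $ i)) k * z ^ k)"
  proof (rule summable_comparison_test')
    show "summable (%k. R * (1 / 2) ^ k)" by (intro summable_mult summable_geometric) simp
    fix k
    have "norm (fps_nth (taylor X w (%x. x $ i)) k * z ^ k) \<le> (R * D ^ k) * z ^ k"
      unfolding norm_mult using cb[of k] z by (intro mult_mono) (auto simp: norm_power)
    also have "\<dots> = R * (D * z) ^ k" by (simp add: power_mult_distrib)
    also have "\<dots> \<le> R * (1 / 2) ^ k" using R z D0 by (intro mult_left_mono power_mono) auto
    finally show "norm (fps_nth (taylor X w (%x. x $ i)) k * z ^ k) \<le> R * (1 / 2) ^ k" .
  qed
  then have "ereal (norm z) \<le> conv_radius (fps_nth (taylor X w (%x. x $ i)))" by (rule conv_radius_geI)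
  moreover have "0 < ereal (norm z)" using z(1) by simp
  ultimately show ?thesis unfolding fps_conv_radius_def by (rule less_le_trans[rotated])
qed

text \<open>The integral curve is the exponential of the derivation.\<close>

lemma trajectory:
  "\<exists>\<rho>>0. \<exists>c. continuous_on (ball 0 \<rho>) c & c 0 = w &
     (\<forall>p\<in>polyfun. fps_conv_radius (taylor X w p) \<ge> ereal \<rho> & (\<forall>s. \<bar>s\<bar> < \<rho> --> p (c s) = eval_fps (taylor X w p) s))"
proof -
  let ?T = "%i. taylor X w (%x. x $ i)"
  have "\<exists>r>0. ereal r \<le> fps_conv_radius (?T i)" for i
    using ereal_dense2[OF taylor_coord_converges[of w i]] by (auto intro: less_imp_le)
  then obtain r where r: "!!i. r i > 0" "!!i. ereal (r i) \<le> fps_conv_radius (?T i)" by metis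
  define \<rho> where "\<rho> = Min (range r)"
  have \<rho>: "\<rho> > 0" "!!i. \<rho> \<le> r i" using r(1) by (auto simp: \<rho>_def)
  have \<rho>T: "ereal \<rho> \<le> fps_conv_radius (?T i)" for i
    by (rule order_trans[OF _ r(2)[of i]]) (simp add: \<rho>(2))
  define c where "c s = (\<chi> i. eval_fps (?T i) s)" for s
  have main: "fps_conv_radius (taylor X w p) \<ge> ereal \<rho> & (\<forall>s. \<bar>s\<bar> < \<rho> --> p (c s) = eval_fps (taylor X w p) s)"
    if "p \<in> polyfun" for p
    using that
  proof induction
    case (pf_const a)
    then show ?case by (simp add: taylor_const)
  next
    case (pf_coord i)
    then show ?case using \<rho>T by (simp add: c_def)
  next
    case (pf_add p q)
    have s: "ereal (norm s) < fps_conv_radius (taylor X w p) & ereal (norm s) < fps_conv_radius (taylor X w q)" if "\<bar>s\<bar> < \<rho>" for s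
    proof -
      have "ereal (norm s) < ereal \<rho>" using that by simp
      then show ?thesis using pf_add.IH less_le_trans by blast
    qed
    have min: "ereal \<rho> \<le> min (fps_conv_radius (taylor X w p)) (fps_conv_radius (taylor X w q))"
      using pf_add.IH by simp
    show ?case unfolding taylor_add[OF pf_add.hyps]
      using pf_add.IH s order_trans[OF min fps_conv_radius_add] by (simp add: eval_fps_add)
  next
    case (pf_mult p q)
    have s: "ereal (norm s) < fps_conv_radius (taylor X w p) & ereal (norm s) < fps_conv_radius (taylor X w q)" if "\<bar>s\<bar> < \<rho>" for s
    proof -
      have "ereal (norm s) < ereal \<rho>" using that by simp
      then show ?thesis using pf_mult.IH less_le_trans by blast
    qed
    have min: "ereal \<rho> \<le> min (fps_conv_radius (taylor X w p)) (fps_conv_radius (taylor X w q))"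
      using pf_mult.IH by simp
    show ?case unfolding taylor_mult[OF pf_mult.hyps]
      using pf_mult.IH s order_trans[OF min fps_conv_radius_mult] by (simp add: eval_fps_mult)
  qed
  moreover have "continuous_on (ball 0 \<rho>) c" unfolding c_def
  proof (rule continuous_on_vec_lambda)
    fix i show "continuous_on (ball 0 \<rho>) (%s. eval_fps (?T i) s)"
      by (rule continuous_on_subset[OF continuous_on_eval_fps]) (use \<rho>T[of i] in \<open>auto simp: dist_norm intro!: less_le_trans[OF _ \<rho>T[of i]]\<close>)
  qed
  moreover have "c 0 = w" by (simp add: c_def vec_eq_iff eval_fps_at_0 taylor_def)
  ultimately show ?thesis using \<rho>(1) by blast
qed

end

section \<open>Nondegenerate directions\<close>

lemma polyfun_pf:
  fixes p :: "real^'n => real"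
  assumes "p \<in> polyfun" shows "(%e. p (\<chi> i. e i)) \<in> pf"
  using assms by induction (auto intro: pf_intros)

lemma pf_polyfun:
  assumes "q \<in> pf" "!!i. (%x. r i x) \<in> polyfun"
  shows "(%x. q (%i. r i x)) \<in> polyfun"
  using assms(1)
proof induction
  case (pf_var i)
  then show ?case using assms(2) by simp
qed (auto intro: polyfun.intros)

section \<open>Powers of the maximal ideal of a point\<close>

lemma polyfun_shift: "(%x. x $ i - w $ i) \<in> polyfun"
  by (intro polyfun_diff polyfun.pf_coord polyfun.pf_const)

text \<open>The \<open>N\<close>-th power of the maximal ideal at \<open>w\<close>. Lists of indices
  stand for monomials, so that products are concatenations.\<close>

inductive_set vanishing_order :: "real^'n => nat => (real^'n => real) set" for w N where
  vo_zero: "(%_. 0) \<in> vanishing_order w N"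
| vo_gen: "g \<in> polyfun ==> length is = N ==> (%x. g x * prod_list (map (%i. x $ i - w $ i) is)) \<in> vanishing_order w N"
| vo_add: "f \<in> vanishing_order w N ==> g \<in> vanishing_order w N ==> (%x. f x + g x) \<in> vanishing_order w N"

lemma polyfun_prod_list: "(!!i. i \<in> set is ==> r i \<in> polyfun) ==> (%x. prod_list (map (%i. r i x) is)) \<in> polyfun"
  by (induction "is") (auto intro: polyfun.intros)

lemma vo_polyfun: "f \<in> vanishing_order w N ==> f \<in> polyfun"
  by (induction rule: vanishing_order.induct)
    (auto intro!: polyfun.pf_add polyfun.pf_mult polyfun_prod_list polyfun_shift intro: polyfun.pf_const)

lemma vo_mult:
  assumes "f \<in> vanishing_order w M" "g \<in> vanishing_order w N"
  shows "(%x. f x * g x) \<in> vanishing_order w (M + N)"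
  using assms(1)
proof induction
  case (vo_gen a "is")
  show ?case using assms(2)
  proof induction
    case (vo_gen b js)
    have "(%x. (a x * b x) * prod_list (map (%i. x $ i - w $ i) (is @ js))) \<in> vanishing_order w (M + N)"
      by (rule vanishing_order.vo_gen) (use vo_gen \<open>a \<in> polyfun\<close> \<open>length is = M\<close> in \<open>auto intro: polyfun.pf_mult\<close>)
    then show ?case by (simp add: mult_ac)
  next
    case (vo_add f g)
    from vanishing_order.vo_add[OF vo_add.IH] show ?case by (simp add: distrib_left)
  qed (simp add: vo_zero)
next
  case (vo_add f h)
  from vanishing_order.vo_add[OF vo_add.IH] show ?case by (simp add: distrib_right)
qed (simp add: vo_zero)

lemma vo_0: "g \<in> polyfun ==> g \<in> vanishing_order w 0"
  using vo_gen[of g "[]" 0 w] by simp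

lemma vo_scale: "g \<in> polyfun ==> f \<in> vanishing_order w N ==> (%x. g x * f x) \<in> vanishing_order w N"
  using vo_mult[OF vo_0[of g w], of f N] by simp

lemma vo_minus: "f \<in> vanishing_order w N ==> (%x. - f x) \<in> vanishing_order w N"
  using vo_scale[OF polyfun.pf_const[of "-1"], of f w N] by simp

lemma vo_taylor1:
  assumes "g \<in> polyfun" shows "(%x. g x - g w) \<in> vanishing_order w 1"
  using assms
proof induction
  case (pf_coord i)
  have "(%x. 1 * prod_list (map (%i. x $ i - w $ i) [i])) \<in> vanishing_order w 1"
    by (rule vo_gen) (auto intro: polyfun.pf_const)
  then show ?case by simp
next
  case (pf_add p q)
  from vo_add[OF pf_add.IH] show ?case by (simp add: algebra_simps)
next
  case (pf_mult p q)
  have "(%x. q x * (p x - p w) + p w * (q x - q w)) \<in> vanishing_order w 1"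
    by (intro vo_add vo_scale polyfun.pf_const pf_mult)
  then show ?case by (simp add: algebra_simps)
qed (simp add: vo_zero)

lemma vo_taylor2:
  assumes "g \<in> polyfun" shows "(%x. g x - g w - pgrad g w \<bullet> (x - w)) \<in> vanishing_order w 2"
  using assms
proof induction
  case (pf_const c)
  then show ?case by (simp add: pgrad_const vo_zero)
next
  case (pf_coord i)
  then show ?case by (simp add: pgrad_coord inner_axis' vo_zero)
next
  case (pf_add p q)
  from vo_add[OF pf_add.IH] show ?case by (simp add: pgrad_add pf_add.hyps inner_add_left algebra_simps)
next
  case (pf_mult p q)
  have "(%x. (p x - p w) * (q x - q w)) \<in> vanishing_order w (1 + 1)"
    by (intro vo_mult vo_taylor1 pf_mult.hyps)
  then have "(%x. (p x - p w) * (q x - q w)) \<in> vanishing_order w 2" by (simp only: one_add_one)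
  then have "(%x. ((p x - p w) * (q x - q w) + p w * (q x - q w - pgrad q w \<bullet> (x - w)))
      + q w * (p x - p w - pgrad p w \<bullet> (x - w))) \<in> vanishing_order w 2"
    by (intro vo_add vo_scale[OF polyfun.pf_const] pf_mult.IH)
  then show ?case by (simp add: pgrad_mult pf_mult.hyps inner_add_left algebra_simps)
qed

definition ideal_plus_order :: "(real^'n) set => real^'n => nat => (real^'n => real) set" where
  "ideal_plus_order V w N = {f. \<exists>a\<in>vanishing_ideal V. (%x. f x - a x) \<in> vanishing_order w N}"

lemma vanishing_ideal_zero: "(%_. 0) \<in> vanishing_ideal V"
  by (simp add: vanishing_ideal_def polyfun.pf_const)

lemma ipo_order: "f \<in> vanishing_order w N ==> f \<in> ideal_plus_order V w N"
  unfolding ideal_plus_order_def using vanishing_ideal_zero by (intro CollectI bexI[of _ "%_. 0"]) auto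

lemma ipo_add:
  assumes "f \<in> ideal_plus_order V w N" "g \<in> ideal_plus_order V w N"
  shows "(%x. f x + g x) \<in> ideal_plus_order V w N"
proof -
  obtain a b where ab: "a \<in> vanishing_ideal V" "(%x. f x - a x) \<in> vanishing_order w N"
    "b \<in> vanishing_ideal V" "(%x. g x - b x) \<in> vanishing_order w N" using assms by (auto simp: ideal_plus_order_def)
  from vo_add[OF ab(2,4)] have "(%x. (f x + g x) - (a x + b x)) \<in> vanishing_order w N" by (simp add: algebra_simps)
  then show ?thesis using vanishing_ideal_add[OF ab(1,3)] unfolding ideal_plus_order_def
    by (intro CollectI bexI[of _ "%x. a x + b x"])
qed

lemma ipo_mult:
  assumes "f \<in> ideal_plus_order V w M" "g \<in> vanishing_order w N"
  shows "(%x. g x * f x) \<in> ideal_plus_order V w (N + M)"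
proof -
  obtain a where a: "a \<in> vanishing_ideal V" "(%x. f x - a x) \<in> vanishing_order w M" using assms by (auto simp: ideal_plus_order_def)
  from vo_mult[OF assms(2) a(2)] have "(%x. g x * f x - g x * a x) \<in> vanishing_order w (N + M)" by (simp add: algebra_simps)
  then show ?thesis using vanishing_ideal_mult[OF vo_polyfun[OF assms(2)] a(1)] unfolding ideal_plus_order_def
    by (intro CollectI bexI[of _ "%x. g x * a x"])
qed

lemma ipo_scale: "g \<in> polyfun ==> f \<in> ideal_plus_order V w M ==> (%x. g x * f x) \<in> ideal_plus_order V w M"
  using ipo_mult[OF _ vo_0[of g w], of f V M] by simp

lemma ipo_sum: "(!!k. k \<in> I ==> f k \<in> ideal_plus_order V w M) ==> (%x. \<Sum>k\<in>I. f k x) \<in> ideal_plus_order V w M"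
proof (induction I rule: infinite_finite_induct)
  case (insert i F)
  have "(%x. f i x + (\<Sum>k\<in>F. f k x)) \<in> ideal_plus_order V w M"
    by (rule ipo_add) (use insert.prems insert.IH in auto)
  then show ?case using insert.hyps by simp
qed (simp_all add: ipo_order vo_zero)

text \<open>\<open>T\<close> projects orthogonally onto the tangent space. If \<open>b\<close> is
  the gradient at \<open>w\<close> of an element \<open>p\<close> of the ideal, then the normal
  coordinate \<open>b \<bullet> (x - w)\<close> agrees with \<open>p\<close> up to second order, so
  modulo the ideal only tangential coordinates matter to first order.\<close>

lemma tangent_projection:
  fixes V :: "(real^'n) set"
  assumes w: "w \<in> V"
  shows "\<exists>T :: real^'n => real^'n. linear T & (\<forall>g\<in>ideal_gradients V w. \<forall>h. g \<bullet> T h = 0) &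
     (\<forall>v. (\<forall>g\<in>ideal_gradients V w. g \<bullet> v = 0) --> T v = v) &
     (\<forall>i. (%x. (x $ i - w $ i) - T (x - w) $ i) \<in> ideal_plus_order V w 2) &
     (\<forall>i. (%x. T (x - w) $ i) \<in> polyfun)"
proof -
  obtain B where B: "B \<subseteq> ideal_gradients V w" "pairwise orthogonal B" "!!b. b \<in> B ==> norm b = 1"
      "independent B" "card B = dim (ideal_gradients V w)" "span B = ideal_gradients V w"
    using orthonormal_basis_subspace[OF subspace_ideal_gradients[of V w]] by metis
  have fB: "finite B" using B(4) independent_imp_finite by blast
  have ortho: "b \<bullet> b' = (if b = b' then 1 else 0)" if "b \<in> B" "b' \<in> B" for b b'
    using B(2,3) that by (auto simp: pairwise_def orthogonal_def dot_square_norm)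
  define T where "T h = h - (\<Sum>b\<in>B. (b \<bullet> h) *\<^sub>R b)" for h
  have "linear T" unfolding T_def
    by (intro linear_compose_sub linear_compose_sum ballI linear_id[unfolded id_def] linearI)
      (simp_all add: inner_add_right scaleR_add_left)
  moreover have "g \<bullet> T h = 0" if "g \<in> ideal_gradients V w" for g h
  proof -
    have *: "b \<bullet> T h = 0" if "b \<in> B" for b
    proof -
      have "(\<Sum>b'\<in>B. (b' \<bullet> h) * (b \<bullet> b')) = (\<Sum>b'\<in>B. if b' = b then b \<bullet> h else 0)"
        by (rule sum.cong) (auto simp: ortho that)
      then show ?thesis using that fB by (simp add: T_def inner_diff_right inner_sum_right)
    qed
    have "g \<in> span B" using that B(6) by simp
    then obtain r where "g = (\<Sum>b\<in>B. r b *\<^sub>R b)" using span_finite[OF fB] by auto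
    then show ?thesis using * by (simp add: inner_sum_left)
  qed
  moreover have "T v = v" if "\<forall>g\<in>ideal_gradients V w. g \<bullet> v = 0" for v
    using that B(1) by (auto simp: T_def intro!: sum.neutral)
  moreover have "(%x. (x $ i - w $ i) - T (x - w) $ i) \<in> ideal_plus_order V w 2" for i
  proof -
    have "(%x. b $ i * (b \<bullet> (x - w))) \<in> ideal_plus_order V w 2" if b: "b \<in> B" for b
    proof (rule ipo_scale[OF polyfun.pf_const])
      obtain p where p: "p \<in> vanishing_ideal V" "pgrad p w = b" using b B(1) by (auto simp: ideal_gradients_eq)
      then have pp: "p \<in> polyfun" "p w = 0" using w by (auto simp: vanishing_ideal_def)
      have "(%x. - (p x - p w - b \<bullet> (x - w))) \<in> vanishing_order w 2"
        using vo_minus[OF vo_taylor2[OF pp(1), of w]] p by simp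
      then have "(%x. b \<bullet> (x - w) - p x) \<in> vanishing_order w 2" using pp by simp
      then show "(%x. b \<bullet> (x - w)) \<in> ideal_plus_order V w 2" using p unfolding ideal_plus_order_def by blast
    qed
    then have "(%x. \<Sum>b\<in>B. b $ i * (b \<bullet> (x - w))) \<in> ideal_plus_order V w 2" by (rule ipo_sum)
    then show ?thesis by (simp add: T_def mult.commute)
  qed
  moreover have "(%x. T (x - w) $ i) \<in> polyfun" for i
  proof -
    have "(%x. b \<bullet> (x - w)) \<in> polyfun" for b
    proof -
      have "(%x. \<Sum>i\<in>UNIV. b $ i * (x $ i - w $ i)) \<in> polyfun"
        by (intro polyfun_sum polyfun.pf_mult polyfun.pf_const polyfun_shift)
      then show ?thesis by (simp add: inner_vec_def)
    qed
    then have "(%x. (x $ i - w $ i) - (\<Sum>b\<in>B. (b \<bullet> (x - w)) * b $ i)) \<in> polyfun"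
      by (intro polyfun_diff[OF polyfun_shift] polyfun_sum polyfun.pf_mult polyfun.pf_const)
    then show ?thesis by (simp add: T_def)
  qed
  ultimately show ?thesis by blast
qed

text \<open>Replacing each factor by its tangential part changes a product of \<open>N\<close>
  differences only in order \<open>N + 1\<close> modulo the ideal. The point of \<open>h\<close> is
  that it is a form to be evaluated on tangent vectors.\<close>

lemma leading_form:
  fixes V :: "(real^'n) set" and T :: "real^'n => real^'n"
  assumes T: "!!i. (%x. (x $ i - w $ i) - T (x - w) $ i) \<in> ideal_plus_order V w 2"
      "!!i. (%x. T (x - w) $ i) \<in> polyfun" "linear T"
    and f: "f \<in> vanishing_order w N"
  shows "\<exists>h\<in>polyfun. (\<forall>\<theta> y. h (\<theta> *\<^sub>R y) = \<theta> ^ N * h y) & (%x. f x - h (T (x - w))) \<in> ideal_plus_order V w (Suc N)"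
  using f
proof induction
  case vo_zero
  show ?case by (intro bexI[of _ "%_. 0"]) (auto intro: polyfun.pf_const ipo_order vanishing_order.vo_zero)
next
  case (vo_gen g "is")
  have T1: "(%x. T (x - w) $ i) \<in> vanishing_order w 1" for i
    using vo_taylor1[OF T(2)[of i], of w] linear_0[OF T(3)] by simp
  have mon: "(%x. prod_list (map (%i. x $ i - w $ i) js) - prod_list (map (%i. T (x - w) $ i) js)) \<in> ideal_plus_order V w (Suc (length js))" for js
  proof (induction js)
    case Nil
    show ?case by (simp add: ipo_order vo_zero)
  next
    case (Cons i js)
    have "(%x. 1 * prod_list (map (%i. x $ i - w $ i) js)) \<in> vanishing_order w (length js)"
      by (rule vanishing_order.vo_gen) (auto intro: polyfun.pf_const)
    then have "(%x. prod_list (map (%i. x $ i - w $ i) js)) \<in> vanishing_order w (length js)" by simp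
    from ipo_mult[OF T(1)[of i] this]
    have 1: "(%x. prod_list (map (%i. x $ i - w $ i) js) * (x $ i - w $ i - T (x - w) $ i)) \<in> ideal_plus_order V w (Suc (Suc (length js)))"
      by simp
    from ipo_mult[OF Cons T1[of i]]
    have 2: "(%x. T (x - w) $ i * (prod_list (map (%i. x $ i - w $ i) js) - prod_list (map (%i. T (x - w) $ i) js)))
       \<in> ideal_plus_order V w (Suc (Suc (length js)))" by simp
    from ipo_add[OF 1 2] show ?case by (simp add: algebra_simps)
  qed
  let ?h = "%y. g w * prod_list (map (%i. y $ i) is)"
  have "?h \<in> polyfun" by (intro polyfun.pf_mult polyfun.pf_const polyfun_prod_list polyfun.pf_coord)
  moreover have "prod_list (map (%i. (\<theta> *\<^sub>R y) $ i) js) = \<theta> ^ length js * prod_list (map (%i. y $ i) js)" for \<theta> js and y :: "real^'n"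
    by (induction js) auto
  then have "\<forall>\<theta> y. ?h (\<theta> *\<^sub>R y) = \<theta> ^ N * ?h y" using vo_gen by (metis mult.left_commute)
  moreover have "(%x. g x * prod_list (map (%i. x $ i - w $ i) is) - ?h (T (x - w))) \<in> ideal_plus_order V w (Suc N)"
  proof -
    have "(%x. 1 * prod_list (map (%i. x $ i - w $ i) is)) \<in> vanishing_order w N"
      by (rule vanishing_order.vo_gen) (use vo_gen in \<open>auto intro: polyfun.pf_const\<close>)
    then have "(%x. (g x - g w) * prod_list (map (%i. x $ i - w $ i) is)) \<in> vanishing_order w (1 + N)"
      by (intro vo_mult vo_taylor1 vo_gen(1)) simp
    then have 1: "(%x. (g x - g w) * prod_list (map (%i. x $ i - w $ i) is)) \<in> ideal_plus_order V w (Suc N)"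
      by (intro ipo_order) simp
    have 2: "(%x. g w * (prod_list (map (%i. x $ i - w $ i) is) - prod_list (map (%i. T (x - w) $ i) is))) \<in> ideal_plus_order V w (Suc N)"
      using mon[of "is"] vo_gen by (intro ipo_scale polyfun.pf_const) simp
    from ipo_add[OF 1 2] show ?thesis by (simp add: algebra_simps)
  qed
  ultimately show ?case by (intro bexI[of _ ?h] conjI)
next
  case (vo_add f g)
  obtain h where h: "h \<in> polyfun" "\<forall>\<theta> y. h (\<theta> *\<^sub>R y) = \<theta> ^ N * h y" "(%x. f x - h (T (x - w))) \<in> ideal_plus_order V w (Suc N)"
    using vo_add.IH(1) by blast
  obtain k where k: "k \<in> polyfun" "\<forall>\<theta> y. k (\<theta> *\<^sub>R y) = \<theta> ^ N * k y" "(%x. g x - k (T (x - w))) \<in> ideal_plus_order V w (Suc N)"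
    using vo_add.IH(2) by blast
  from ipo_add[OF h(3) k(3)] have "(%x. f x + g x - (h (T (x - w)) + k (T (x - w)))) \<in> ideal_plus_order V w (Suc N)"
    by (simp add: algebra_simps)
  then show ?case using h k by (intro bexI[of _ "%y. h y + k y"]) (auto simp: distrib_left intro: polyfun.pf_add)
qed

section \<open>Trajectories and the order of vanishing\<close>

lemma polyfun_tendsto:
  assumes "p \<in> polyfun" "(c \<longlongrightarrow> w) F" shows "((%s. p (c s)) \<longlongrightarrow> p w) F"
proof -
  have "isCont p w" using polyfun_continuous[OF assms(1), of UNIV] by (simp add: continuous_on_eq_continuous_at)
  then show ?thesis using assms(2) by (rule isCont_tendsto_compose)
qed

lemma vo_limit:
  assumes "f \<in> vanishing_order w N" and c: "(c \<longlongrightarrow> w) (at (0::real))"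
    and v: "((%s. (1 / s) *\<^sub>R (c s - w)) \<longlongrightarrow> v) (at 0)"
  shows "\<exists>L. ((%s. f (c s) / s ^ N) \<longlongrightarrow> L) (at 0)"
  using assms(1)
proof induction
  case vo_zero
  show ?case by (intro exI[of _ 0]) simp
next
  case (vo_gen g "is")
  have comp: "((%s. (c s $ i - w $ i) / s) \<longlongrightarrow> v $ i) (at 0)" for i
    using tendsto_vec_nth[OF v, of i] by simp
  have "((%s. prod_list (map (%i. c s $ i - w $ i) js) / s ^ length js) \<longlongrightarrow> prod_list (map (%i. v $ i) js)) (at 0)" for js
  proof (induction js)
    case (Cons i js)
    from tendsto_mult[OF comp[of i] Cons] show ?case by simp
  qed simp
  from tendsto_mult[OF polyfun_tendsto[OF vo_gen(1) c] this[of "is"]] show ?case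
    using vo_gen by auto
next
  case (vo_add f g)
  then obtain L M where "((%s. f (c s) / s ^ N) \<longlongrightarrow> L) (at 0)" "((%s. g (c s) / s ^ N) \<longlongrightarrow> M) (at 0)" by blast
  from tendsto_add[OF this] show ?case by (auto simp: add_divide_distrib)
qed

lemma dv_pow_ideal: "tangent_field V X ==> p \<in> vanishing_ideal V ==> (dv X ^^ k) p \<in> vanishing_ideal V"
  by (induction k) (auto simp: tangent_field_def)

lemma taylor_ideal: "tangent_field V X ==> w \<in> V ==> p \<in> vanishing_ideal V ==> taylor X w p = 0"
  using dv_pow_ideal[of V X p] by (intro fps_ext) (auto simp: taylor_def vanishing_ideal_def)

lemma trajectory_in:
  fixes V :: "(real^'n) set"
  assumes V: "algebraic_set V" and X: "tangent_field V X" and w: "w \<in> V"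
  shows "\<exists>\<rho>>0. \<exists>c. continuous_on (ball 0 \<rho>) c & c 0 = w & (\<forall>s. \<bar>s\<bar> < \<rho> --> c s \<in> V) &
     (\<forall>p\<in>polyfun. (%s. p (c s)) has_fps_expansion taylor X w p)"
proof -
  have Xpf: "!!i. (%x. X x $ i) \<in> polyfun" using X by (simp add: tangent_field_def)
  obtain \<rho> c where c: "\<rho> > 0" "continuous_on (ball 0 \<rho>) c" "c 0 = w"
    "!!p. p \<in> polyfun ==> fps_conv_radius (taylor X w p) \<ge> ereal \<rho>"
    "!!p s. p \<in> polyfun ==> \<bar>s\<bar> < \<rho> ==> p (c s) = eval_fps (taylor X w p) s"
    using trajectory[OF Xpf, of w] by auto
  obtain P where P: "P \<subseteq> polyfun" "V = zero_set P" using V by (auto simp: algebraic_set_def)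
  have "c s \<in> V" if "\<bar>s\<bar> < \<rho>" for s
  proof -
    have "p (c s) = 0" if "p \<in> P" for p
    proof -
      have "p \<in> vanishing_ideal V" using that P by (auto simp: vanishing_ideal_def zero_set_def)
      then have "taylor X w p = 0" by (rule taylor_ideal[OF X w])
      then show ?thesis using c(5)[of p s] that P \<open>\<bar>s\<bar> < \<rho>\<close> by auto
    qed
    then show ?thesis by (simp add: P(2) zero_set_def)
  qed
  moreover have "(%s. p (c s)) has_fps_expansion taylor X w p" if p: "p \<in> polyfun" for p
    unfolding has_fps_expansion_def
  proof
    show "0 < fps_conv_radius (taylor X w p)" using c(1) by (intro less_le_trans[OF _ c(4)[OF p]]) simp
    have "\<forall>\<^sub>F s in nhds (0::real). s \<in> ball 0 \<rho>" using c(1) by (intro eventually_nhds_in_open) auto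
    then show "\<forall>\<^sub>F s in nhds 0. eval_fps (taylor X w p) s = p (c s)"
      by eventually_elim (use c(5)[OF p] in auto)
  qed
  ultimately show ?thesis using c by blast
qed

text \<open>Along the trajectory through a tangent vector \<open>v\<close> the function
  \<open>q\<close> vanishes near the start, and so do the ideal elements \<open>a\<close> and
  \<open>b\<close>. Rescaling by \<open>s ^ N\<close> leaves the leading form at \<open>v\<close>,
  up to terms tending to zero, so the form vanishes on the tangent space and the order of
  \<open>q\<close> modulo the ideal goes up.\<close>

lemma order_step:
  fixes V :: "(real^'n) set"
  assumes V: "algebraic_set V" and rank: "!!x. x \<in> V ==> dim (ideal_gradients V x) = r" and w: "w \<in> V" and q: "q \<in> polyfun"
    and flat: "!!X k. tangent_field V X ==> (dv X ^^ k) q w = 0"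
    and qN: "q \<in> ideal_plus_order V w N"
  shows "q \<in> ideal_plus_order V w (Suc N)"
proof -
  from tangent_projection[OF w] obtain T :: "real^'n => real^'n" where T0: "linear T"
     "\<forall>g\<in>ideal_gradients V w. \<forall>h. g \<bullet> T h = 0"
     "\<forall>v. (\<forall>g\<in>ideal_gradients V w. g \<bullet> v = 0) --> T v = v"
     "\<forall>i. (%x. (x $ i - w $ i) - T (x - w) $ i) \<in> ideal_plus_order V w 2"
     "\<forall>i. (%x. T (x - w) $ i) \<in> polyfun"
    by (elim exE conjE) (rule that; assumption)
  note T = T0(1) T0(2)[THEN bspec, THEN spec] T0(3)[THEN spec, THEN mp] T0(4)[THEN spec] T0(5)[THEN spec]
  obtain a where a: "a \<in> vanishing_ideal V" "(%x. q x - a x) \<in> vanishing_order w N"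
    using qN by (auto simp: ideal_plus_order_def)
  obtain h where h: "h \<in> polyfun" "!!\<theta> y. h (\<theta> *\<^sub>R y) = \<theta> ^ N * h y"
      "(%x. q x - a x - h (T (x - w))) \<in> ideal_plus_order V w (Suc N)"
    using leading_form[OF T(4,5,1) a(2)] by blast
  obtain b where b: "b \<in> vanishing_ideal V" "(%x. q x - a x - h (T (x - w)) - b x) \<in> vanishing_order w (Suc N)"
    using h(3) by (auto simp: ideal_plus_order_def)
  have hv: "h v = 0" if v: "\<forall>g\<in>ideal_gradients V w. g \<bullet> v = 0" for v
  proof -
    have "\<exists>X. tangent_field V X & X w = v" by (rule tangent_field_through[OF rank w]) (use v in blast)+
    then obtain X where X: "tangent_field V X" "X w = v" by blast
    obtain \<rho> c where c: "\<rho> > 0" "continuous_on (ball 0 \<rho>) c" "c 0 = w" "!!s. \<bar>s\<bar> < \<rho> ==> c s \<in> V"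
      "!!p. p \<in> polyfun ==> (%s. p (c s)) has_fps_expansion taylor X w p"
      using trajectory_in[OF V X(1) w] by auto
    have clim: "(c \<longlongrightarrow> w) (at 0)"
      using c(1-3) by (auto simp: continuous_on_eq_continuous_at isCont_def dest: bspec[of _ _ 0])
    have "((%s. (c s $ i - w $ i) / s ^ 1) \<longlongrightarrow> v $ i) (at 0)" for i
    proof -
      have "(%s. c s $ i - w $ i) has_fps_expansion (taylor X w (%x. x $ i) - fps_const (w $ i))"
        by (intro has_fps_expansion_diff c(5) polyfun.pf_coord has_fps_expansion_const)
      from has_fps_expansion_lim[OF this, of 1] show ?thesis
        by (simp add: taylor_def dv_coord X(2))
    qed
    then have vlim: "((%s. (1 / s) *\<^sub>R (c s - w)) \<longlongrightarrow> v) (at 0)" by (intro vec_tendstoI) simp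
    have "taylor X w q = 0" using flat[OF X(1)] by (intro fps_ext) (simp add: taylor_def)
    then have "\<forall>\<^sub>F s in nhds 0. q (c s) = 0" using c(5)[OF q] by (auto simp: has_fps_expansion_def elim: eventually_mono)
    then have "\<forall>\<^sub>F s in at 0. q (c s) = 0" by (auto simp: eventually_at_filter elim: eventually_mono)
    moreover have "\<forall>\<^sub>F s in at (0::real). s \<in> ball 0 \<rho>" using c(1) by (intro eventually_at_in_open') auto
    ultimately have ev: "\<forall>\<^sub>F s in at 0. h (T ((1 / s) *\<^sub>R (c s - w))) =
        - s * ((q (c s) - a (c s) - h (T (c s - w)) - b (c s)) / s ^ Suc N) * (-1) * (-1)"
      using eventually_neq_at_within[of 0 0 UNIV]
    proof eventually_elim
      case (elim s)
      have "a (c s) = 0" "b (c s) = 0" using a(1) b(1) c(4)[of s] elim by (auto simp: vanishing_ideal_def dist_norm)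
      moreover have "h (T ((1 / s) *\<^sub>R (c s - w))) = (1 / s) ^ N * h (T (c s - w))"
        by (simp only: linear_scale[OF T(1)] h(2))
      ultimately show ?case using elim by (simp add: power_divide)
    qed
    obtain L where L: "((%s. (q (c s) - a (c s) - h (T (c s - w)) - b (c s)) / s ^ Suc N) \<longlongrightarrow> L) (at 0)"
      using vo_limit[OF b(2) clim vlim] by blast
    have "((%s. - s * ((q (c s) - a (c s) - h (T (c s - w)) - b (c s)) / s ^ Suc N) * (-1) * (-1)) \<longlongrightarrow> - 0 * L * (-1) * (-1)) (at 0)"
      by (intro tendsto_intros L)
    then have l0: "((%s. h (T ((1 / s) *\<^sub>R (c s - w)))) \<longlongrightarrow> 0) (at 0)"
      using ev by (simp add: tendsto_cong)
    have "((%s. T ((1 / s) *\<^sub>R (c s - w))) \<longlongrightarrow> T v) (at 0)"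
      by (rule isCont_tendsto_compose[OF linear_continuous_at[OF linear_conv_bounded_linear[THEN iffD1, OF T(1)]] vlim])
    from polyfun_tendsto[OF h(1) this] have "((%s. h (T ((1 / s) *\<^sub>R (c s - w)))) \<longlongrightarrow> h (T v)) (at 0)" .
    then have "h (T v) = 0" using l0 tendsto_unique trivial_limit_at by blast
    then show ?thesis using T(3)[OF v] by simp
  qed
  have "h (T y) = 0" for y by (rule hv) (use T(2) in blast)
  then have "(%x. q x - (a x + b x)) \<in> vanishing_order w (Suc N)" using b(2) by (simp add: algebra_simps)
  then show ?thesis unfolding ideal_plus_order_def using vanishing_ideal_add[OF a(1) b(1)]
    by (intro CollectI bexI[of _ "%x. a x + b x"])
qed

lemma irreducible_prime:
  assumes V: "irreducible_alg V" and pq: "p \<in> polyfun" "q \<in> polyfun" and z: "!!x. x \<in> V ==> p x * q x = 0"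
  shows "(\<forall>x\<in>V. p x = 0) \<or> (\<forall>x\<in>V. q x = 0)"
proof -
  obtain P where P: "P \<subseteq> polyfun" "V = zero_set P" using V by (auto simp: irreducible_alg_def algebraic_set_def)
  have alg: "algebraic_set (zero_set (insert r P))" if "r \<in> polyfun" for r
    unfolding algebraic_set_def using P(1) that by (intro exI[of _ "insert r P"]) auto
  have "V = zero_set (insert p P) \<union> zero_set (insert q P)" using z P(2) by (auto simp: zero_set_def)
  then have "V = zero_set (insert p P) \<or> V = zero_set (insert q P)"
    using V alg[OF pq(1)] alg[OF pq(2)] unfolding irreducible_alg_def by blast
  then show ?thesis by (auto simp: zero_set_def)
qed

theorem nondegenerate_direction:
  fixes V :: "(real^'n) set"
  assumes V: "irreducible_alg V" and rank: "!!x. x \<in> V ==> dim (ideal_gradients V x) = r"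
    and w: "w \<in> V" and q: "q \<in> polyfun" "\<exists>x\<in>V. q x ~= 0"
  shows "\<exists>X k. tangent_field V X & (dv X ^^ k) q w ~= 0"
proof (rule ccontr)
  assume "\<not> ?thesis"
  then have flat: "!!X k. tangent_field V X ==> (dv X ^^ k) q w = 0" by blast
  have alg: "algebraic_set V" using V by (simp add: irreducible_alg_def)
  have ipo: "q \<in> ideal_plus_order V w N" for N
  proof (induction N)
    case 0
    show ?case by (intro ipo_order vo_0 q)
  next
    case (Suc N)
    show ?case by (rule order_step[OF alg rank w q(1) flat Suc])
  qed
  \<comment> \<open>A function of order \<open>N\<close> at \<open>w\<close> becomes a form of
    degree \<open>N\<close> in a second block of variables, into which the differences
    \<open>x $ i - w $ i\<close> are substituted: the shape required by
    \<open>krull_intersection\<close>.\<close>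
  have hom: "\<exists>G :: ('n + 'n => real) => real. G \<in> pf & (\<forall>\<theta> e. G (scale2 \<theta> e) = \<theta> ^ N * G e) &
      (\<forall>x. f x = G (case_sum (vec_nth x) (%i. x $ i - w $ i)))" if "f \<in> vanishing_order w N" for f N
    using that
  proof induction
    case vo_zero
    show ?case by (intro exI[of _ "%_. 0"]) (auto intro: pf_const)
  next
    case (vo_gen g "is")
    let ?G = "%e :: 'n + 'n => real. g (\<chi> i. e (Inl i)) * prod_list (map (%i. e (Inr i)) is)"
    have pl: "(%e :: 'n + 'n => real. prod_list (map (%i. e (Inr i)) js)) \<in> pf" for js
      by (induction js) (auto intro: pf_intros)
    have "(%e :: 'n + 'n => real. g (\<chi> i. e (Inl i))) \<in> pf"
      using pf_subst[OF polyfun_pf[OF vo_gen(1)], of "%i e. e (Inl i)", OF pf_var] .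
    then have "?G \<in> pf" by (intro pf_mult pl)
    moreover have "prod_list (map (%i. scale2 \<theta> e (Inr i)) js) = \<theta> ^ length js * prod_list (map (%i. e (Inr i)) js)"
      for \<theta> js and e :: "'n + 'n => real" by (induction js) (auto simp: scale2_def)
    then have "?G (scale2 \<theta> e) = \<theta> ^ N * ?G e" for \<theta> e using vo_gen(2) by (simp add: scale2_def)
    moreover have "g x * prod_list (map (%i. x $ i - w $ i) is) = ?G (case_sum (vec_nth x) (%i. x $ i - w $ i))" for x by simp
    ultimately show ?case by blast
  next
    case (vo_add f g)
    then obtain G H :: "('n + 'n => real) => real" where "G \<in> pf" "\<forall>\<theta> e. G (scale2 \<theta> e) = \<theta> ^ N * G e"
      "\<forall>x. f x = G (case_sum (vec_nth x) (%i. x $ i - w $ i))" "H \<in> pf" "\<forall>\<theta> e. H (scale2 \<theta> e) = \<theta> ^ N * H e"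
      "\<forall>x. g x = H (case_sum (vec_nth x) (%i. x $ i - w $ i))" by blast
    then show ?case by (intro exI[of _ "%e. G e + H e"]) (auto simp: distrib_left intro: pf_add)
  qed
  have "\<forall>N. \<exists>G :: ('n + 'n => real) => real. G \<in> pf & (\<forall>\<theta> e. G (scale2 \<theta> e) = \<theta> ^ N * G e) &
      (%x. q x - G (case_sum (vec_nth x) (%i. x $ i - w $ i))) \<in> vanishing_ideal V"
  proof
    fix N
    obtain a where a: "a \<in> vanishing_ideal V" "(%x. q x - a x) \<in> vanishing_order w N"
      using ipo[of N] by (auto simp: ideal_plus_order_def)
    obtain G :: "('n + 'n => real) => real" where G: "G \<in> pf" "\<forall>\<theta> e. G (scale2 \<theta> e) = \<theta> ^ N * G e"
      "!!x. q x - a x = G (case_sum (vec_nth x) (%i. x $ i - w $ i))" using hom[OF a(2)] by blast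
    have "(%x. q x - G (case_sum (vec_nth x) (%i. x $ i - w $ i))) = a" by (rule ext) (simp add: G(3)[symmetric])
    then show "\<exists>G :: ('n + 'n => real) => real. G \<in> pf & (\<forall>\<theta> e. G (scale2 \<theta> e) = \<theta> ^ N * G e) &
      (%x. q x - G (case_sum (vec_nth x) (%i. x $ i - w $ i))) \<in> vanishing_ideal V" using G a by (intro exI[of _ G] conjI) simp_all
  qed
  from choice[OF this] obtain G :: "nat => ('n + 'n => real) => real" where
    G0: "\<forall>N. G N \<in> pf & (\<forall>\<theta> e. G N (scale2 \<theta> e) = \<theta> ^ N * G N e) &
      (%x. q x - G N (case_sum (vec_nth x) (%i. x $ i - w $ i))) \<in> vanishing_ideal V" ..
  have G: "G N \<in> pf" "G N (scale2 \<theta> e) = \<theta> ^ N * G N e"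
      "(%x. q x - G N (case_sum (vec_nth x) (%i. x $ i - w $ i))) \<in> vanishing_ideal V" for N \<theta> e
    using G0[THEN spec, of N] by blast+
  define A :: "(('n => real) => real) set" where "A = {f. (%x. f (vec_nth x)) \<in> vanishing_ideal V}"
  have "\<exists>u\<in>pf. u (vec_nth w) = 0 & (%x. q (\<chi> i. x i) - u x * q (\<chi> i. x i)) \<in> A"
  proof (rule krull_intersection[of A G "%x. q (\<chi> i. x i)"])
    show "(%_. 0) \<in> A" by (simp add: A_def vanishing_ideal_zero)
    show "(%x. f x + g x) \<in> A" if "f \<in> A" "g \<in> A" for f g using that vanishing_ideal_add by (auto simp: A_def)
    show "(%x. f x * g x) \<in> A" if f: "f \<in> pf" and g: "g \<in> A" for f g
    proof -
      have "(%x. f (vec_nth x)) \<in> polyfun" by (rule pf_polyfun[OF f]) (rule polyfun.pf_coord)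
      then show ?thesis using vanishing_ideal_mult g by (auto simp: A_def)
    qed
    show "(%x. q (\<chi> i. x i) - G N (case_sum x (%i. x i - w $ i))) \<in> A" for N using G(3)[of N] by (simp add: A_def)
  qed (use G in auto)
  then obtain u where u: "u \<in> pf" "u (vec_nth w) = 0" "(%x. q x - u (vec_nth x) * q x) \<in> vanishing_ideal V"
    by (auto simp: A_def)
  have upf: "(%x. 1 - u (vec_nth x)) \<in> polyfun"
    by (intro polyfun_diff polyfun.pf_const pf_polyfun[OF u(1)] polyfun.pf_coord)
  have "(\<forall>x\<in>V. 1 - u (vec_nth x) = 0) \<or> (\<forall>x\<in>V. q x = 0)"
    by (rule irreducible_prime[OF V upf q(1)]) (use u(3) in \<open>auto simp: vanishing_ideal_def algebra_simps\<close>)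
  then show False using u(2) w q(2) by auto
qed

text \<open>Euclidean density holds because \<open>q\<close> has a non-zero Taylor series along some
  trajectory through any given point. On singular varieties this fails, as on the stick of Whitney's
  umbrella.\<close>

lemma polyfun_nonvanishing_dense:
  fixes V :: "(real^'n) set"
  assumes V: "irreducible_alg V" and rank: "!!x. x \<in> V ==> dim (ideal_gradients V x) = r"
    and w: "w \<in> V" and q: "q \<in> polyfun" "\<exists>x\<in>V. q x ~= 0" and \<epsilon>: "0 < \<epsilon>"
  shows "\<exists>x\<in>V. dist x w < \<epsilon> & q x ~= 0"
proof -
  obtain X k where X: "tangent_field V X" "(dv X ^^ k) q w ~= 0" using nondegenerate_direction[OF V rank w q] by blast
  have alg: "algebraic_set V" using V by (simp add: irreducible_alg_def)
  obtain \<rho> c where c: "\<rho> > 0" "continuous_on (ball 0 \<rho>) c" "c 0 = w" "!!s. \<bar>s\<bar> < \<rho> ==> c s \<in> V"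
    "!!p. p \<in> polyfun ==> (%s. p (c s)) has_fps_expansion taylor X w p"
    using trajectory_in[OF alg X(1) w] by auto
  have T0: "taylor X w q ~= 0"
  proof
    assume "taylor X w q = 0"
    then have "fps_nth (taylor X w q) k = 0" by simp
    then show False using X(2) by (simp add: taylor_def)
  qed
  define d where "d = subdegree (taylor X w q)"
  have lt: "fps_nth (taylor X w q) i = 0" if "i < d" for i using that unfolding d_def by (rule nth_less_subdegree_zero)
  have "((%s. q (c s) / s ^ d) \<longlongrightarrow> fps_nth (taylor X w q) d) (at 0)"
    by (rule has_fps_expansion_lim[OF c(5)[OF q(1)] lt])
  moreover have "fps_nth (taylor X w q) d ~= 0" using T0 by (simp add: d_def)
  ultimately have 1: "\<forall>\<^sub>F s in at 0. q (c s) / s ^ d ~= 0" by (rule tendsto_imp_eventually_ne)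
  have "(c \<longlongrightarrow> w) (at 0)" using c(1-3) by (auto simp: continuous_on_eq_continuous_at isCont_def dest: bspec[of _ _ 0])
  then have 2: "\<forall>\<^sub>F s in at 0. dist (c s) w < \<epsilon>" using \<epsilon> by (rule tendstoD)
  have 3: "\<forall>\<^sub>F s in at (0::real). s \<in> ball 0 \<rho>" using c(1) by (intro eventually_at_in_open') auto
  have "\<forall>\<^sub>F s in at 0. c s \<in> V & dist (c s) w < \<epsilon> & q (c s) ~= 0"
    using 1 2 3 by eventually_elim (use c(4) in auto)
  then obtain s where "c s \<in> V & dist (c s) w < \<epsilon> & q (c s) ~= 0" using eventually_happens'[OF trivial_limit_at] by blast
  then show ?thesis by blast
qed

text \<open>After division of \<open>f * q = p\<close> by \<open>s ^ k\<close> along the trajectory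
  the left side converges; hence the lower Taylor coefficients of \<open>p\<close> vanish as well,
  and the k-th ones satisfy the same relation. The factorials cancel.\<close>

lemma quotient_along_trajectory:
  fixes V :: "(real^'n) set"
  assumes alg: "algebraic_set V" and X: "tangent_field V X" and w: "w \<in> V" and p: "p \<in> polyfun" and q: "q \<in> polyfun"
    and f: "continuous_on V f" "!!x. x \<in> V ==> f x * q x = p x"
    and z: "!!i. i < k ==> (dv X ^^ i) q w = 0"
  shows "f w * (dv X ^^ k) q w = (dv X ^^ k) p w"
proof -
  obtain \<rho> c where c: "\<rho> > 0" "continuous_on (ball 0 \<rho>) c" "c 0 = w" "!!s. \<bar>s\<bar> < \<rho> ==> c s \<in> V"
    "!!p. p \<in> polyfun ==> (%s. p (c s)) has_fps_expansion taylor X w p"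
    using trajectory_in[OF alg X w] by auto
  have 3: "\<forall>\<^sub>F s in at (0::real). s \<in> ball 0 \<rho>" using c(1) by (intro eventually_at_in_open') auto
  have "continuous_on (ball 0 \<rho>) (f \<circ> c)"
    by (rule continuous_on_compose[OF c(2)]) (rule continuous_on_subset[OF f(1)], use c(4) in auto)
  then have flim: "((%s. f (c s)) \<longlongrightarrow> f w) (at 0)"
    using c(1,3) by (auto simp: continuous_on_eq_continuous_at isCont_def dest: bspec[of _ _ 0])
  have qlim: "((%s. q (c s) / s ^ k) \<longlongrightarrow> fps_nth (taylor X w q) k) (at 0)"
    by (rule has_fps_expansion_lim[OF c(5)[OF q]]) (simp add: taylor_def z)
  have "\<forall>\<^sub>F s in at 0. f (c s) * (q (c s) / s ^ k) = p (c s) / s ^ k"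
    using 3 by eventually_elim (use c(4) f(2) in auto)
  with tendsto_mult[OF flim qlim] have plim: "((%s. p (c s) / s ^ k) \<longlongrightarrow> f w * fps_nth (taylor X w q) k) (at 0)"
    by (rule Lim_transform_eventually)
  have pz: "fps_nth (taylor X w p) i = 0" if "i < k" for i
    using that
  proof (induction i rule: less_induct)
    case (less i)
    have l1: "((%s. p (c s) / s ^ i) \<longlongrightarrow> fps_nth (taylor X w p) i) (at 0)"
      by (rule has_fps_expansion_lim[OF c(5)[OF p]]) (use less in auto)
    have "((%s::real. s ^ (k - i) * (p (c s) / s ^ k)) \<longlongrightarrow> 0 ^ (k - i) * (f w * fps_nth (taylor X w q) k)) (at 0)"
      by (intro tendsto_mult tendsto_power tendsto_ident_at plim)
    moreover have "\<forall>\<^sub>F s :: real in at 0. s ^ (k - i) * (p (c s) / s ^ k) = p (c s) / s ^ i"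
      using eventually_neq_at_within[of 0 0 UNIV]
    proof eventually_elim
      case (elim s)
      have "s ^ k = s ^ (k - i) * s ^ i" using less.prems by (simp flip: power_add)
      then show ?case using elim by simp
    qed
    ultimately have "((%s. p (c s) / s ^ i) \<longlongrightarrow> 0 ^ (k - i) * (f w * fps_nth (taylor X w q) k)) (at 0)"
      by (rule Lim_transform_eventually)
    then have "fps_nth (taylor X w p) i = 0 ^ (k - i) * (f w * fps_nth (taylor X w q) k)"
      using l1 tendsto_unique[OF trivial_limit_at] by blast
    then show ?case using less.prems by simp
  qed
  have "((%s. p (c s) / s ^ k) \<longlongrightarrow> fps_nth (taylor X w p) k) (at 0)"
    by (rule has_fps_expansion_lim[OF c(5)[OF p]]) (rule pz)
  then have "fps_nth (taylor X w p) k = f w * fps_nth (taylor X w q) k"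
    using plim tendsto_unique[OF trivial_limit_at] by blast
  then show ?thesis by (simp add: taylor_def)
qed

section \<open>The Lojasiewicz inequality\<close>

lemma polyfun_pf_subst:
  fixes p :: "real^'n => real"
  assumes "p \<in> polyfun" "!!i. r i \<in> pf" shows "(%e. p (\<chi> i. r i e)) \<in> pf"
  using assms(1) by induction (auto intro: pf_const pf_add pf_mult assms(2))

text \<open>Needed because a semialgebraic predicate expresses membership through finitely many
  equations. If none sufficed, equations could be picked one by one, each not vanishing on the zero
  set of its predecessors, against the chain condition.\<close>

lemma algebraic_set_finite:
  fixes V :: "(real^'n) set"
  assumes "algebraic_set V"
  shows "\<exists>F. finite F & F \<subseteq> polyfun & V = zero_set F"
proof (rule ccontr)
  assume no: "\<not> ?thesis"
  obtain P where P: "P \<subseteq> polyfun" "V = zero_set P" using assms by (auto simp: algebraic_set_def)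
  have "\<exists>g\<in>P. \<exists>x\<in>zero_set F. g x ~= 0" if F: "finite F" "F \<subseteq> P" for F
  proof (rule ccontr)
    assume neg: "\<not> (\<exists>g\<in>P. \<exists>x\<in>zero_set F. g x ~= 0)"
    have "x \<in> zero_set P" if "x \<in> zero_set F" for x unfolding zero_set_def using that neg by blast
    moreover have "zero_set P \<subseteq> zero_set F" using F by (auto simp: zero_set_def)
    ultimately have "V = zero_set F" using P by blast
    then show False using no F P by blast
  qed
  then obtain pick where pick: "!!F. finite F ==> F \<subseteq> P ==> pick F \<in> P & (\<exists>x\<in>zero_set F. pick F x ~= 0)" by metis
  define F where "F = rec_nat {} (%n S. insert (pick S) S)"
  have Fs: "F 0 = {}" "F (Suc n) = insert (pick (F n)) (F n)" for n by (simp_all add: F_def)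
  have F1: "finite (F n) & F n \<subseteq> P" for n by (induction n) (use pick in \<open>auto simp: Fs\<close>)
  have F2: "F n = (%n. pick (F n)) ` {..<n}" for n by (induction n) (auto simp: Fs lessThan_Suc)
  have "(%e. pick (F n) (\<chi> i. e i)) \<in> pf" for n
    using pick[of "F n"] F1[of n] P(1) by (intro polyfun_pf_subst pf_var) auto
  from pf_sequence_noetherian[of "%n e. pick (F n) (\<chi> i. e i)", OF this]
  obtain N a where a: "!!e. pick (F N) (\<chi> i. e i) = (\<Sum>i<N. a i e * pick (F i) (\<chi> i. e i))" by blast
  obtain x where x: "x \<in> zero_set (F N)" "pick (F N) x ~= 0" using pick[of "F N"] F1[of N] by blast
  have "pick (F i) x = 0" if "i < N" for i using x(1) that F2[of N] by (auto simp: zero_set_def)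
  then have "pick (F N) x = 0" using a[of "vec_nth x"] by simp
  then show False using x by simp
qed

lemma algebraic_set_closed:
  fixes V :: "(real^'n) set"
  assumes "algebraic_set V" shows "closed V"
proof -
  obtain P where P: "P \<subseteq> polyfun" "V = zero_set P" using assms by (auto simp: algebraic_set_def)
  have "V = (\<Inter>p\<in>P. {x. p x = 0})" by (auto simp: P zero_set_def)
  moreover have "closed {x. p x = 0}" if "p \<in> P" for p
    using polyfun_continuous[of p UNIV] that P by (intro closed_Collect_eq continuous_on_const) auto
  ultimately show ?thesis by auto
qed

lemma SA_in_algebraic_set:
  fixes V :: "(real^'n) set"
  assumes "algebraic_set V" "!!i. r i \<in> pf"
  shows "(%e. (\<chi> i. r i e) \<in> V) \<in> SA"
proof -
  obtain F where F: "finite F" "F \<subseteq> polyfun" "V = zero_set F" using algebraic_set_finite[OF assms(1)] by blast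
  have "(%e. \<forall>p\<in>F. p (\<chi> i. r i e) = 0) \<in> SA"
    by (rule SA_ball[OF F(1)]) (intro SA_eq pf_const polyfun_pf_subst assms(2), use F(2) in auto)
  then show ?thesis by (rule SA_cong) (simp add: F(3) zero_set_def)
qed

lemma SA_ex_vec:
  fixes S :: "real^'n => ('k => real) => bool"
  assumes "(%E. S (\<chi> i. E (Inl i)) (%k. E (Inr k))) \<in> SA"
  shows "(%e. \<exists>x. S x e) \<in> SA"
proof -
  define Q where "Q = (%E :: 'n + 'k => real. S (\<chi> i. E (Inl i)) (%k. E (Inr k)))"
  have step: "(%E. \<exists>a. Q (case_sum (%i. if i \<in> T then a i else E (Inl i)) (%k. E (Inr k)))) \<in> SA" if "finite T" for T :: "'n set"
    using that
  proof induction
    case empty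
    have "(%E. Q E) \<in> SA" using assms by (simp add: Q_def)
    then show ?case by (rule SA_cong) (simp add: Q_def)
  next
    case (insert i T)
    show ?case
    proof (rule SA_cong[OF SA_ex[OF insert.IH, of "Inl i"]])
      fix E :: "'n + 'k => real"
      define f where "f a = case_sum (%j. if j \<in> insert i T then a j else E (Inl j)) (%k. E (Inr k))" for a
      define g where "g b a = case_sum (%j. if j \<in> T then a j else (E(Inl i := b)) (Inl j)) (%k. (E(Inl i := b)) (Inr k))" for b a
      have "f a = g (a i) a" for a by (auto simp: f_def g_def fun_eq_iff split: sum.splits)
      moreover have "g b a = f (a(i := b))" for a b
        using insert.hyps by (auto simp: f_def g_def fun_eq_iff split: sum.splits)
      ultimately have "(\<exists>a. Q (f a)) = (\<exists>b a. Q (g b a))" by metis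
      then show "(\<exists>a. Q (case_sum (%j. if j \<in> insert i T then a j else E (Inl j)) (%k. E (Inr k)))) =
        (\<exists>b a. Q (case_sum (%j. if j \<in> T then a j else (E(Inl i := b)) (Inl j)) (%k. (E(Inl i := b)) (Inr k))))"
        unfolding f_def g_def .
    qed
  qed
  let ?r = "%(j :: 'n + 'k) (e :: 'k => real). case j of Inl _ => 0 | Inr k => e k"
  have "?r j \<in> pf" for j by (cases j) (simp_all add: pf_const pf_var)
  from SA_subst[OF step[OF finite, of UNIV], of ?r, OF this]
  show ?thesis
  proof (rule SA_cong)
    fix e
    have "(\<exists>x. S x e) = (\<exists>a. S (\<chi> i. a i) e)" by (metis vec_nth_inverse)
    then show "(\<exists>x. S x e) = (\<exists>a. Q (case_sum (%i. if i \<in> UNIV then a i else ?r (Inl i) e) (%k. ?r (Inr k) e)))"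
      by (simp add: Q_def)
  qed
qed

lemma SA_boundary_root:
  assumes "Q \<in> SA"
  shows "\<exists>n \<A>. finite \<A> & \<A> \<subseteq> PP n & (\<forall>e y. (\<forall>d>0. \<exists>z. \<bar>z - y\<bar> < d & Q (e(i := z)) ~= Q (e(i := y))) -->
     (\<exists>P\<in>\<A>. P e ~= 0 & poly (P e) y = 0))"
proof -
  obtain n \<A> where A: "finite \<A>" "\<A> \<subseteq> PP n" "!!e y. \<forall>P\<in>\<A>. P e = 0 \<or> poly (P e) y ~= 0 ==>
     \<forall>\<^sub>F z in nhds y. Q (e(i := z)) = Q (e(i := y))"
    using SA_fibre_locally_constant[OF assms, of i] by auto
  have "\<exists>P\<in>\<A>. P e ~= 0 & poly (P e) y = 0" if b: "\<forall>d>0. \<exists>z. \<bar>z - y\<bar> < d & Q (e(i := z)) ~= Q (e(i := y))" for e y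
  proof (rule ccontr)
    assume "\<not> ?thesis"
    then have "\<forall>\<^sub>F z in nhds y. Q (e(i := z)) = Q (e(i := y))" by (intro A(3)) auto
    then obtain d where d: "d > 0" "\<forall>z. dist z y < d --> Q (e(i := z)) = Q (e(i := y))" unfolding eventually_nhds_metric by blast
    obtain z where z: "\<bar>z - y\<bar> < d" "Q (e(i := z)) ~= Q (e(i := y))" using b d(1) by blast
    then show False using d(2)[THEN spec, of z] by (simp add: dist_real_def)
  qed
  then show ?thesis using A by blast
qed

lemma poly_le_power:
  fixes c :: "real poly"
  assumes "degree c \<le> D" "1 \<le> u"
  shows "\<bar>poly c u\<bar> \<le> (\<Sum>i\<le>D. \<bar>coeff c i\<bar>) * u ^ D"
proof -
  have "poly c u = (\<Sum>i\<le>D. coeff c i * u ^ i)" unfolding poly_altdef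
    by (rule sum.mono_neutral_left) (use assms(1) in \<open>auto simp: coeff_eq_0\<close>)
  also have "\<bar>\<dots>\<bar> \<le> (\<Sum>i\<le>D. \<bar>coeff c i * u ^ i\<bar>)" by (rule sum_abs)
  also have "\<dots> \<le> (\<Sum>i\<le>D. \<bar>coeff c i\<bar> * u ^ D)"
    using assms(2) by (intro sum_mono) (auto simp: abs_mult intro!: mult_left_mono power_increasing)
  finally show ?thesis by (simp add: sum_distrib_right)
qed

text \<open>For large \<open>u\<close> the topmost coefficient that is not identically zero stays
  away from zero, and the leading coefficient times a root grows at most polynomially by
  \<open>scaled_root_bound\<close>.\<close>

lemma root_family_bound:
  fixes c :: "nat => real poly"
  assumes deg: "!!k. k \<le> n ==> degree (c k) \<le> D"
  shows "\<exists>B\<ge>0. \<exists>u0\<ge>1. \<forall>u\<ge>u0. \<forall>p y. degree p \<le> n & p ~= 0 & (\<forall>k\<le>n. coeff p k = poly (c k) u) & poly p y = 0 --> \<bar>y\<bar> \<le> B * u ^ (D * n)"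
proof (cases "\<exists>k\<le>n. c k ~= 0")
  case False
  have "p = 0" if "degree p \<le> n" "\<forall>k\<le>n. coeff p k = poly (c k) u" for p :: "real poly" and u
  proof (rule poly_eqI)
    fix k show "coeff p k = coeff 0 k" using that False by (cases "k \<le> n") (auto simp: coeff_eq_0)
  qed
  then show ?thesis by (intro exI[of _ 0] exI[of _ 1] conjI) auto
next
  case True
  define K where "K = {k. k \<le> n & c k ~= 0}"
  define m where "m = Max K"
  have K: "finite K" "K ~= {}" using True by (auto simp: K_def)
  have m: "m \<le> n" "c m ~= 0" using Max_in[OF K] by (auto simp: m_def K_def)
  have m2: "c k = 0" if "m < k" "k \<le> n" for k 
  proof (rule ccontr)
    assume "c k ~= 0"
    then have "k \<in> K" using that by (simp add: K_def)
    then show False using Max_ge[OF K(1), of k] that by (simp add: m_def)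
  qed
  obtain v \<delta> where v: "\<delta> > 0" "!!u. v \<le> u ==> \<delta> \<le> \<bar>poly (c m) u\<bar>"
  proof (cases "lead_coeff (c m) > 0")
    case True
    then show ?thesis using poly_pinfty_gt_lc[OF True] that[of "lead_coeff (c m)"] by (meson abs_ge_self order_trans)
  next
    case False
    then have *: "lead_coeff (- c m) > 0" using m(2) leading_coeff_0_iff[of "c m"] by (simp add: not_less order.not_eq_order_implies_strict)
    obtain v where v: "\<forall>x\<ge>v. lead_coeff (- c m) \<le> poly (- c m) x" using poly_pinfty_gt_lc[OF *] by blast
    have "lead_coeff (- c m) \<le> \<bar>poly (c m) u\<bar>" if "v \<le> u" for u
      using v[rule_format, OF that] by (simp only: poly_minus)
    then show ?thesis by (rule that[OF *])
  qed
  define A where "A = 1 + (\<Sum>k\<le>n. \<Sum>i\<le>D. \<bar>coeff (c k) i\<bar>)"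
  have A: "1 \<le> A" by (simp add: A_def sum_nonneg)
  have Ak: "(\<Sum>i\<le>D. \<bar>coeff (c k) i\<bar>) \<le> A" if "k \<le> n" for k
  proof -
    have "(\<Sum>i\<le>D. \<bar>coeff (c k) i\<bar>) \<le> (\<Sum>k\<le>n. \<Sum>i\<le>D. \<bar>coeff (c k) i\<bar>)"
      using that by (intro member_le_sum) (auto intro: sum_nonneg)
    then show ?thesis by (simp add: A_def)
  qed
  have pos: "0 \<le> (1 + n * A ^ n) / \<delta>" using v(1) A by simp
  have main: "\<forall>u\<ge>max 1 v. \<forall>p y. degree p \<le> n & p ~= 0 & (\<forall>k\<le>n. coeff p k = poly (c k) u) & poly p y = 0 --> \<bar>y\<bar> \<le> (1 + n * A ^ n) / \<delta> * u ^ (D * n)"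
  proof (intro allI impI)
    fix u p y assume u: "max 1 v \<le> u" and p: "degree p \<le> n & p ~= 0 & (\<forall>k\<le>n. coeff p k = poly (c k) u) & poly p y = 0"
    have u1: "1 \<le> u" "v \<le> u" using u by auto
    have cm: "coeff p m = poly (c m) u" using p m by simp
    have "coeff p m ~= 0" using v(1) v(2)[OF u1(2)] cm by auto
    moreover have "coeff p k = 0" if "m < k" for k using that p m2 by (cases "k \<le> n") (auto simp: coeff_eq_0)
    ultimately have dp: "degree p = m" by (intro antisym degree_le le_degree) auto
    have m0: "0 < m"
    proof (rule ccontr)
      assume "\<not> 0 < m"
      then obtain b where "p = [:b:]" using dp degree_eq_zeroE by blast
      then show False using p by auto
    qed
    have U: "1 \<le> A * u ^ D" using A u1 by (simp add: mult_ge1_I)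
    have "norm (coeff p k) \<le> A * u ^ D" for k
    proof (cases "k \<le> n")
      case True
      have "\<bar>poly (c k) u\<bar> \<le> (\<Sum>i\<le>D. \<bar>coeff (c k) i\<bar>) * u ^ D" by (rule poly_le_power[OF deg[OF True] u1(1)])
      also have "\<dots> \<le> A * u ^ D" using Ak[OF True] u1 by (intro mult_right_mono) auto
      finally show ?thesis using p True by simp
    next
      case False
      then show ?thesis using p U by (simp add: coeff_eq_0)
    qed
    then have "norm (coeff p m * y) \<le> 1 + m * (A * u ^ D) ^ m"
      using scaled_root_bound[OF dp m0, of y "A * u ^ D"] p U by blast
    also have "\<dots> \<le> 1 + n * (A * u ^ D) ^ n"
      using m(1) U by (intro add_left_mono mult_mono power_increasing) auto
    also have "\<dots> \<le> (1 + n * A ^ n) * u ^ (D * n)"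
      using u1 by (simp add: power_mult_distrib power_mult distrib_right)
    finally have "\<bar>coeff p m\<bar> * \<bar>y\<bar> \<le> (1 + n * A ^ n) * u ^ (D * n)" by (simp add: abs_mult)
    moreover have "\<delta> * \<bar>y\<bar> \<le> \<bar>coeff p m\<bar> * \<bar>y\<bar>" using v(2)[OF u1(2)] cm by (intro mult_right_mono) auto
    ultimately have "\<delta> * \<bar>y\<bar> \<le> (1 + n * A ^ n) * u ^ (D * n)" by linarith
    then show "\<bar>y\<bar> \<le> (1 + n * A ^ n) / \<delta> * u ^ (D * n)" using v(1) by (simp add: field_simps)
  qed
  have "1 \<le> max 1 v" by simp
  with main have ex: "\<exists>u0\<ge>1. \<forall>u\<ge>u0. \<forall>p y. degree p \<le> n & p ~= 0 & (\<forall>k\<le>n. coeff p k = poly (c k) u) & poly p y = 0 --> \<bar>y\<bar> \<le> (1 + n * A ^ n) / \<delta> * u ^ (D * n)"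
    by (intro exI[of _ "max 1 v"] conjI)
  show ?thesis by (rule exI[of _ "(1 + n * A ^ n) / \<delta>"], rule conjI, rule pos, rule ex)
qed

text \<open>Consider the values of 1 / h on the part of a ball where |F| = 1 / u. Their supremum is
  a boundary point of a semialgebraic fibre, hence a root of one of finitely many polynomials with
  coefficients polynomial in u, and so grows at most like a power of u. The exponent does not depend
  on \<open>w\<close>, because the radius of the ball is a parameter of the family.\<close>

lemma lojasiewicz_inequality:
  fixes V :: "(real^'n) set"
  assumes V: "algebraic_set V" and pf: "a \<in> polyfun" "q \<in> polyfun" "h \<in> polyfun"
    and F: "continuous_on V F" "!!x. x \<in> V ==> F x * q x = a x"
    and dense: "!!x \<epsilon>. x \<in> V ==> 0 < \<epsilon> ==> \<exists>z\<in>V. dist z x < \<epsilon> & q z ~= 0"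
    and h: "!!x. x \<in> V ==> 0 \<le> h x" "!!x. x \<in> V ==> h x = 0 ==> F x = 0"
  shows "\<exists>D\<ge>1. \<forall>w\<in>V. F w = 0 --> (\<exists>C \<epsilon>. 0 < \<epsilon> & 0 \<le> C & (\<forall>x\<in>V. dist x w < \<epsilon> --> \<bar>F x\<bar> ^ D \<le> C * h x))"
proof -
  \<comment> \<open>Slots 0, 1 and 2 of the environment are the squared radius, the inverse level u
    and the value 1 / h. Since \<open>F\<close> is not polynomial, its level set is written through
    \<open>a\<close> and \<open>q\<close> on the part where \<open>q\<close> does not
    vanish.\<close>
  define S where "S x e \<longleftrightarrow> x \<in> V & q x ~= 0 & (\<Sum>i\<in>UNIV. x $ i * x $ i) \<le> e 0 & e 1 * e 1 * (a x * a x) = q x * q x & e 2 * h x = 1"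
    for x :: "real^'n" and e :: "nat => real"
  have c: "(%E :: 'n + nat => real. p (\<chi> i. E (Inl i))) \<in> pf" if "p \<in> polyfun" for p
    using that by (rule polyfun_pf_subst) (rule pf_var)
  have inV: "(%E :: 'n + nat => real. (\<chi> i. E (Inl i)) \<in> V) \<in> SA"
    by (rule SA_in_algebraic_set[OF V pf_var])
  have "(%E :: 'n + nat => real. S (\<chi> i. E (Inl i)) (%k. E (Inr k))) \<in> SA"
    unfolding S_def vec_lambda_beta
    by (intro SA_conj SA_not inV SA_eq SA_le pf_mult pf_sum c[OF pf(1)] c[OF pf(2)] c[OF pf(3)] pf_var pf_const)
  from SA_boundary_root[OF SA_ex_vec[OF this], of 2]
  obtain n \<A> where A: "finite \<A>" "\<A> \<subseteq> PP n" and bd0: "\<forall>e y. (\<forall>d>0. \<exists>z. \<bar>z - y\<bar> < d & (\<exists>x. S x (e(2 := z))) ~= (\<exists>x. S x (e(2 := y)))) -->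
     (\<exists>P\<in>\<A>. P e ~= 0 & poly (P e) y = 0)" by (elim exE conjE) (rule that; assumption)
  note bd = bd0[THEN spec, THEN spec, THEN mp]
  have "\<forall>Pk. \<exists>DR. fst Pk \<in> \<A> --> snd DR \<in> PP (fst DR) & (\<forall>e u. coeff (fst Pk (e(1 := u))) (snd Pk) = poly (snd DR e) u)"
  proof
    fix Pk :: "((nat => real) => real poly) \<times> nat"
    show "\<exists>DR. fst Pk \<in> \<A> --> snd DR \<in> PP (fst DR) & (\<forall>e u. coeff (fst Pk (e(1 := u))) (snd Pk) = poly (snd DR e) u)"
    proof (cases "fst Pk \<in> \<A>")
      case True
      then have "(%e. coeff (fst Pk e) (snd Pk)) \<in> pf" using A(2) by (intro PP_coeff[of _ n]) blast
      from pf_as_poly[OF this, of 1] obtain D R where "R \<in> PP D" "\<forall>e u. coeff (fst Pk (e(1 := u))) (snd Pk) = poly (R e) u" by blast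
      then show ?thesis by (intro exI[of _ "(D, R)"]) simp
    qed simp
  qed
  from choice[OF this] obtain f where f: "\<forall>Pk. fst Pk \<in> \<A> --> snd (f Pk) \<in> PP (fst (f Pk)) &
      (\<forall>e u. coeff (fst Pk (e(1 := u))) (snd Pk) = poly (snd (f Pk) e) u)" ..
  define d where "d P k = fst (f (P, k))" for P k
  define R where "R P k = snd (f (P, k))" for P k
  have R: "R P k \<in> PP (d P k)" "coeff (P (e(1 := u))) k = poly (R P k e) u" if "P \<in> \<A>" for P k e u
    using f[THEN spec, of "(P, k)"] that by (auto simp: d_def R_def)
  define D where "D = (\<Sum>P\<in>\<A>. \<Sum>k\<le>n. d P k)"
  have dD: "d P k \<le> D" if "P \<in> \<A>" "k \<le> n" for P k
  proof -
    have "d P k \<le> (\<Sum>k\<le>n. d P k)" using that by (intro member_le_sum) auto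
    also have "\<dots> \<le> D" unfolding D_def using that A(1) by (intro member_le_sum) auto
    finally show ?thesis .
  qed
  have main: "\<exists>C \<epsilon>. 0 < \<epsilon> & 0 \<le> C & (\<forall>x\<in>V. dist x w < \<epsilon> --> \<bar>F x\<bar> ^ Suc (D * n) \<le> C * h x)" if w: "w \<in> V" "F w = 0" for w
  proof -
    \<comment> \<open>The ball about the origin of radius \<open>norm w + 1\<close> contains the
      unit ball about \<open>w\<close>.\<close>
    define \<rho> where "\<rho> = (norm w + 1)\<^sup>2"
    have rho: "(\<Sum>i\<in>UNIV. x $ i * x $ i) = x \<bullet> x" for x :: "real^'n" by (simp add: inner_vec_def)
    define e where "e u = (%_::nat. \<rho>)(1 := u)" for u
    have "\<forall>P\<in>\<A>. \<exists>Bu. 0 \<le> fst Bu & 1 \<le> snd Bu &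
       (\<forall>u\<ge>snd Bu. \<forall>y. P (e u) ~= 0 & poly (P (e u)) y = 0 --> \<bar>y\<bar> \<le> fst Bu * u ^ (D * n))"
    proof
      fix P assume P: "P \<in> \<A>"
      have dg: "degree (R P k (%_. \<rho>)) \<le> D" if "k \<le> n" for k by (rule order_trans[OF PP_degree[OF R(1)[OF P]] dD[OF P that]])
      have "\<exists>B\<ge>0. \<exists>u0\<ge>1. \<forall>u\<ge>u0. \<forall>p y. degree p \<le> n & p ~= 0 & (\<forall>k\<le>n. coeff p k = poly (R P k (%_. \<rho>)) u) & poly p y = 0 --> \<bar>y\<bar> \<le> B * u ^ (D * n)"
        by (rule root_family_bound) (rule dg)
      then obtain B u0 where B: "B \<ge> 0" "u0 \<ge> 1" "\<forall>u\<ge>u0. \<forall>p y. degree p \<le> n & p ~= 0 & (\<forall>k\<le>n. coeff p k = poly (R P k (%_. \<rho>)) u) & poly p y = 0 --> \<bar>y\<bar> \<le> B * u ^ (D * n)"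
        by (elim exE conjE) (rule that; assumption)
      have "\<bar>y\<bar> \<le> B * u ^ (D * n)" if u: "u0 \<le> u" and p: "P (e u) ~= 0" "poly (P (e u)) y = 0" for u y
      proof (rule B(3)[rule_format, OF u], intro conjI p)
        show "degree (P (e u)) \<le> n" using PP_degree[of P n "e u"] A(2) P by blast
        show "\<forall>k\<le>n. coeff (P (e u)) k = poly (R P k (%_. \<rho>)) u" unfolding e_def by (intro allI impI R(2)[OF P])
      qed (use p in simp_all)
      then show "\<exists>Bu. 0 \<le> fst Bu & 1 \<le> snd Bu &
       (\<forall>u\<ge>snd Bu. \<forall>y. P (e u) ~= 0 & poly (P (e u)) y = 0 --> \<bar>y\<bar> \<le> fst Bu * u ^ (D * n))"
        using B(1,2) by (intro exI[of _ "(B, u0)"]) simp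
    qed
    from bchoice[OF this] obtain g where g: "\<forall>P\<in>\<A>. 0 \<le> fst (g P) & 1 \<le> snd (g P) &
       (\<forall>u\<ge>snd (g P). \<forall>y. P (e u) ~= 0 & poly (P (e u)) y = 0 --> \<bar>y\<bar> \<le> fst (g P) * u ^ (D * n))" ..
    define B where "B P = fst (g P)" for P
    define u0 where "u0 P = snd (g P)" for P
    have B: "0 \<le> B P" "1 \<le> u0 P" "u0 P \<le> u ==> P (e u) ~= 0 ==> poly (P (e u)) y = 0 ==> \<bar>y\<bar> \<le> B P * u ^ (D * n)"
      if "P \<in> \<A>" for P u y using g[THEN bspec, OF that] by (simp_all add: B_def u0_def)
    define BB where "BB = (\<Sum>P\<in>\<A>. B P)"
    define uu where "uu = 1 + (\<Sum>P\<in>\<A>. u0 P)"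
    have BB: "B P \<le> BB" if "P \<in> \<A>" for P unfolding BB_def using that A(1) B(1) by (intro member_le_sum) auto
    have uu: "u0 P \<le> uu" if "P \<in> \<A>" for P
    proof -
      have "u0 P \<le> (\<Sum>P\<in>\<A>. u0 P)" using that A(1) by (intro member_le_sum) (auto intro: order_trans[OF zero_le_one B(2)])
      then show ?thesis by (simp add: uu_def)
    qed
    have uu1: "1 \<le> uu" by (simp add: uu_def sum_nonneg order_trans[OF zero_le_one B(2)])
    have BB0: "0 \<le> BB" unfolding BB_def by (intro sum_nonneg B(1))
    have bound: "1 / h x \<le> BB * (1 / \<bar>F x\<bar>) ^ (D * n)" if x: "x \<in> V" "x \<bullet> x \<le> \<rho>" "q x ~= 0" "F x ~= 0" "uu \<le> 1 / \<bar>F x\<bar>" for x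
    proof -
      define u where "u = 1 / \<bar>F x\<bar>"
      have u: "0 < u" "uu \<le> u" "u ~= 0" using x by (auto simp: u_def)
      define Y where "Y = {y. \<exists>z. S z ((e u)(2 := y))}"
      have Seq: "S z ((e u)(2 := y)) \<longleftrightarrow> z \<in> V & q z ~= 0 & z \<bullet> z \<le> \<rho> & \<bar>F z\<bar> = 1 / u & y * h z = 1" for z y
      proof (cases "z \<in> V & q z ~= 0")
        case True
        then have "u * u * (a z * a z) = q z * q z \<longleftrightarrow> (u * F z) * (u * F z) * (q z * q z) = q z * q z" by (simp add: F(2)[symmetric] mult_ac)
        also have "\<dots> \<longleftrightarrow> (u * F z) * (u * F z) = 1" using True by simp
        also have "\<dots> \<longleftrightarrow> \<bar>u * F z\<bar> = 1" using abs_square_eq_1[of "u * F z"] by (simp add: power2_eq_square)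
        also have "\<dots> \<longleftrightarrow> \<bar>F z\<bar> = 1 / u" using u(1) by (simp add: abs_mult field_simps)
        finally show ?thesis by (simp add: S_def e_def rho)
      qed (auto simp: S_def)
      define Z where "Z = {z \<in> V. z \<bullet> z \<le> \<rho> & \<bar>F z\<bar> = 1 / u}"
      have xZ: "x \<in> Z" using x by (simp add: Z_def u_def)
      have hpos: "0 < h z" if "z \<in> Z" for z using that h[of z] u(3) by (cases "h z = 0") (auto simp: Z_def)
      have clV: "closed V" by (rule algebraic_set_closed[OF V])
      have cp: "compact Z"
      proof -
        have "compact (V \<inter> cball 0 (norm w + 1))" using clV by (simp add: closed_Int_compact)
        moreover have "closed {z \<in> V \<inter> cball 0 (norm w + 1). \<bar>F z\<bar> = 1 / u}"
          by (rule continuous_closed_preimage_constant[where f = "%z. \<bar>F z\<bar>"])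
             (auto intro!: continuous_intros continuous_on_subset[OF F(1)] closed_Int clV)
        moreover have "Z = (V \<inter> cball 0 (norm w + 1)) \<inter> {z \<in> V \<inter> cball 0 (norm w + 1). \<bar>F z\<bar> = 1 / u}"
        proof -
          have "z \<bullet> z \<le> \<rho> \<longleftrightarrow> norm z \<le> norm w + 1" for z :: "real^'n"
            unfolding \<rho>_def dot_square_norm by (rule power_mono_iff) auto
          then show ?thesis by (auto simp: Z_def)
        qed
        ultimately show ?thesis using compact_Int_closed by simp
      qed
      have "continuous_on Z h" by (rule polyfun_continuous[OF pf(3)])
      \<comment> \<open>\<open>h\<close> is positive on the level set, because \<open>F\<close> does
        not vanish there; its minimum bounds \<open>Y\<close> from above.\<close>
      then obtain z0 where z0: "z0 \<in> Z" "!!z. z \<in> Z ==> h z0 \<le> h z"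
        using continuous_attains_inf[OF cp, of h] xZ by blast
      have Yb: "y \<le> 1 / h z0" if y: "y \<in> Y" for y
      proof -
        obtain z where z: "z \<in> Z" "y * h z = 1" using y by (auto simp: Y_def Seq Z_def)
        then have "y = 1 / h z" using hpos[of z] by (simp add: field_simps)
        then show ?thesis using z0(2)[OF z(1)] hpos[OF z0(1)] hpos[OF z(1)] by (simp add: frac_le)
      qed
      have xY: "1 / h x \<in> Y" unfolding Y_def mem_Collect_eq Seq
        by (intro exI[of _ x]) (use x xZ hpos[OF xZ] in \<open>auto simp: Z_def\<close>)
      have bY: "bdd_above Y" using Yb by (intro bdd_aboveI)
      define ys where "ys = Sup Y"
      \<comment> \<open>A supremum is a boundary point: either it is attained and the points above
        it fail, or it is missed and approached from below.\<close>
      have "\<exists>P\<in>\<A>. P (e u) ~= 0 & poly (P (e u)) ys = 0"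
      proof (rule bd, intro allI impI)
        fix d :: real assume d: "0 < d"
        show "\<exists>z. \<bar>z - ys\<bar> < d & (\<exists>x. S x ((e u)(2 := z))) ~= (\<exists>x. S x ((e u)(2 := ys)))"
        proof (cases "ys \<in> Y")
          case True
          have "ys + d / 2 \<notin> Y" using cSup_upper[OF _ bY, of "ys + d/2"] d by (auto simp: ys_def)
          then show ?thesis using True d by (intro exI[of _ "ys + d / 2"]) (simp add: Y_def)
        next
          case False
          obtain y where y: "y \<in> Y" "ys - d < y" using less_cSup_iff[of Y "ys - d"] xY bY d by (auto simp: ys_def)
          have "y \<le> ys" unfolding ys_def by (rule cSup_upper[OF y(1) bY])
          then show ?thesis using False y by (intro exI[of _ y]) (auto simp: Y_def)
        qed
      qed
      then obtain P where P: "P \<in> \<A>" "P (e u) ~= 0" "poly (P (e u)) ys = 0" by blast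
      have "\<bar>ys\<bar> \<le> B P * u ^ (D * n)" using B(3)[OF P(1) _ P(2,3)] uu[OF P(1)] u(2) by linarith
      also have "\<dots> \<le> BB * u ^ (D * n)" using BB[OF P(1)] u(1) by (intro mult_right_mono) auto
      finally have "ys \<le> BB * u ^ (D * n)" by linarith
      moreover have "1 / h x \<le> ys" unfolding ys_def by (rule cSup_upper[OF xY bY])
      ultimately show ?thesis unfolding u_def by linarith
    qed
    have "0 < 1 / uu" using uu1 by simp
    then obtain \<epsilon>0 where e0: "\<epsilon>0 > 0" "!!x. x \<in> V ==> dist x w < \<epsilon>0 ==> dist (F x) (F w) < 1 / uu"
      using F(1) w(1) unfolding continuous_on_iff by meson
    define \<epsilon> where "\<epsilon> = min 1 \<epsilon>0"
    have good: "\<bar>F x\<bar> ^ Suc (D * n) \<le> BB * h x" if x: "x \<in> V" "dist x w < \<epsilon>" "q x ~= 0" for x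
    proof (cases "F x = 0")
      case True
      then show ?thesis using BB0 h(1)[OF x(1)] by simp
    next
      case False
      have "\<bar>F x\<bar> < 1 / uu" using e0(2)[OF x(1)] x(2) w by (simp add: \<epsilon>_def dist_real_def)
      then have f1: "uu \<le> 1 / \<bar>F x\<bar>" "\<bar>F x\<bar> \<le> 1" using False uu1 by (auto simp: field_simps) (smt (verit) mult_le_cancel_left1 mult_left_le)
      have "norm x \<le> norm w + 1" using x(2) norm_triangle_ineq2[of x w] by (simp add: \<epsilon>_def dist_norm)
      then have "x \<bullet> x \<le> \<rho>" unfolding \<rho>_def dot_square_norm by (intro power_mono) auto
      from bound[OF x(1) this x(3) False f1(1)] have b: "1 / h x \<le> BB * (1 / \<bar>F x\<bar>) ^ (D * n)" .
      have hx: "0 < h x" using h[OF x(1)] False by (cases "h x = 0") auto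
      have "\<bar>F x\<bar> ^ Suc (D * n) \<le> \<bar>F x\<bar> ^ (D * n)" using f1(2) by (intro power_decreasing) auto
      also have "\<dots> \<le> BB * h x" using b hx False by (simp add: field_simps power_divide)
      finally show ?thesis .
    qed
    \<comment> \<open>The points with \<open>q x = 0\<close>, excluded from \<open>S\<close>, are
      reached by density and continuity; \<open>\<eta>\<close> keeps the approximants inside the
      neighbourhood of \<open>w\<close>.\<close>
    have "\<bar>F x\<bar> ^ Suc (D * n) \<le> BB * h x" if x: "x \<in> V" "dist x w < \<epsilon>" for x
    proof -
      define \<eta> where "\<eta> k = min ((\<epsilon> - dist x w)) (1 / Suc k)" for k :: nat
      have "\<exists>z\<in>V. dist z x < \<eta> k & q z ~= 0" for k using x by (intro dense) (auto simp: \<eta>_def)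
      then obtain z where z: "!!k. z k \<in> V" "!!k. dist (z k) x < \<eta> k" "!!k. q (z k) ~= 0" by metis
      have zx: "z \<longlonglongrightarrow> x"
      proof (rule metric_LIMSEQ_I)
        fix r :: real assume "0 < r"
        then obtain N where N: "inverse (real (Suc N)) < r" using reals_Archimedean by blast
        have "dist (z k) x < r" if "N \<le> k" for k
        proof -
          have "dist (z k) x < 1 / Suc k" using z(2)[of k] by (simp add: \<eta>_def)
          also have "\<dots> \<le> 1 / Suc N" using that by (intro divide_left_mono) auto
          finally show ?thesis using N by (simp add: inverse_eq_divide)
        qed
        then show "\<exists>N. \<forall>k\<ge>N. dist (z k) x < r" by blast
      qed
      have "dist (z k) w < \<epsilon>" for k using z(2)[of k] dist_triangle[of "z k" w x] by (simp add: \<eta>_def)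
      then have le: "\<bar>F (z k)\<bar> ^ Suc (D * n) \<le> BB * h (z k)" for k by (intro good z)
      have "(%k. F (z k)) \<longlonglongrightarrow> F x" using F(1) zx z(1) x(1) unfolding continuous_on_sequentially by (auto simp: o_def)
      then have l1: "(%k. \<bar>F (z k)\<bar> ^ Suc (D * n)) \<longlonglongrightarrow> \<bar>F x\<bar> ^ Suc (D * n)" by (intro tendsto_intros)
      have "(%k. h (z k)) \<longlonglongrightarrow> h x" using polyfun_continuous[OF pf(3), of V] zx z(1) x(1) unfolding continuous_on_sequentially by (auto simp: o_def)
      then have "(%k. BB * h (z k)) \<longlonglongrightarrow> BB * h x" by (intro tendsto_intros)
      with l1 show ?thesis by (rule LIMSEQ_le) (use le in blast)
    qed
    moreover have "0 < \<epsilon>" using e0 by (simp add: \<epsilon>_def)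
    ultimately show ?thesis using BB0 by blast
  qed
  show ?thesis using main by (intro exI[of _ "Suc (D * n)"]) auto
qed

section \<open>Curve selection\<close>

text \<open>The series F(s^k), used to bring expansions in different roots of the parameter to a
  common root.\<close>

definition fps_stretch :: "nat => real fps => real fps" where
  "fps_stretch k F = Abs_fps (%n. if k dvd n then fps_nth F (n div k) else 0)"

lemma fps_stretch_sums:
  assumes k: "0 < k" and s: "ereal (norm (s ^ k)) < fps_conv_radius F"
  shows "(%n. fps_nth (fps_stretch k F) n * s ^ n) sums eval_fps F (s ^ k)"
proof -
  have "(%n. fps_nth F n * (s ^ k) ^ n) sums eval_fps F (s ^ k)" by (rule sums_eval_fps[OF s])
  also have "(%n. fps_nth F n * (s ^ k) ^ n) = (%n. fps_nth (fps_stretch k F) (k * n) * s ^ (k * n))"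
    using k by (simp add: fps_stretch_def power_mult)
  finally have *: "(%n. fps_nth (fps_stretch k F) (k * n) * s ^ (k * n)) sums eval_fps F (s ^ k)" .
  have sm: "strict_mono (%n. k * n)" using k by (simp add: strict_mono_def)
  have z: "fps_nth (fps_stretch k F) n * s ^ n = 0" if "n \<notin> range (%n. k * n)" for n
  proof -
    have "\<not> k dvd n" using that by (auto elim!: dvdE)
    then show ?thesis by (simp add: fps_stretch_def)
  qed
  have "(%n. fps_nth (fps_stretch k F) (k * n) * s ^ (k * n)) sums eval_fps F (s ^ k) \<longleftrightarrow>
      (%n. fps_nth (fps_stretch k F) n * s ^ n) sums eval_fps F (s ^ k)"
    by (rule sums_mono_reindex[OF sm]) (rule z)
  with * show ?thesis by blast
qed

lemma fps_stretch_eval: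
  "0 < k ==> ereal (norm (s ^ k)) < fps_conv_radius F ==> eval_fps (fps_stretch k F) s = eval_fps F (s ^ k)"
  using fps_stretch_sums[of k s F] by (simp add: eval_fps_def sums_iff)

lemma fps_stretch_radius:
  assumes k: "0 < k" and F: "0 < fps_conv_radius F"
  shows "0 < fps_conv_radius (fps_stretch k F)"
proof -
  obtain r where r: "0 < ereal r" "ereal r < fps_conv_radius F" using ereal_dense2[OF F] by blast
  define s where "s = root k r"
  have s: "0 < s" "s ^ k = r" using r k by (auto simp: s_def)
  have "(%n. fps_nth (fps_stretch k F) n * s ^ n) sums eval_fps F (s ^ k)" by (rule fps_stretch_sums[OF k]) (use s r in simp)
  then have "ereal (norm s) \<le> conv_radius (fps_nth (fps_stretch k F))" by (intro conv_radius_geI) (rule sums_summable)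
  moreover have "0 < ereal (norm s)" using s by simp
  ultimately show ?thesis unfolding fps_conv_radius_def by (rule less_le_trans[rotated])
qed

lemma fps_zero_of_sequence:
  fixes G :: "real fps"
  assumes f: "f has_fps_expansion G" and s: "s \<longlonglongrightarrow> 0" "!!n. s n ~= 0" "!!n. f (s n) = 0"
  shows "G = 0"
proof (rule ccontr)
  assume G: "G ~= 0"
  have lt: "fps_nth G i = 0" if "i < subdegree G" for i using that by (rule nth_less_subdegree_zero)
  have "((%x. f x / x ^ subdegree G) \<longlongrightarrow> fps_nth G (subdegree G)) (at 0)" by (rule has_fps_expansion_lim[OF f lt])
  moreover have "filterlim s (at 0) sequentially" using s(1,2) by (simp add: filterlim_at)
  ultimately have "(%n. f (s n) / s n ^ subdegree G) \<longlonglongrightarrow> fps_nth G (subdegree G)" by (rule filterlim_compose)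
  then have "fps_nth G (subdegree G) = 0" using s(3) by (simp add: LIMSEQ_const_iff)
  then show False using G by simp
qed

text \<open>An equation along a null sequence is an identity of series; its coefficients are
  polynomials in \<open>s ^ M\<close>, and a non-zero polynomial stays non-zero under this
  substitution.\<close>

lemma fps_alg_of_sequence:
  fixes B :: "real poly poly"
  assumes B: "B ~= 0" and M: "0 < M" and Y: "0 < fps_conv_radius Y" and s: "s \<longlonglongrightarrow> 0" "!!n. s n ~= 0"
    and z: "!!n. poly2 B (s n ^ M) (eval_fps Y (s n)) = 0"
  shows "Y \<in> fps_alg"
proof -
  define c where "c k = fps_of_poly (pcompose (coeff B k) (monom 1 M))" for k
  have ev: "poly2 B t y = (\<Sum>k\<le>degree B. poly (coeff B k) t * y ^ k)" for t y
  proof -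
    have "poly2 B t y = (\<Sum>k\<le>degree (map_poly (%c. poly c t) B). coeff (map_poly (%c. poly c t) B) k * y ^ k)"
      unfolding poly2_map poly_altdef ..
    also have "\<dots> = (\<Sum>k\<le>degree B. coeff (map_poly (%c. poly c t) B) k * y ^ k)"
    proof (rule sum.mono_neutral_left)
      have "degree (map_poly (%c. poly c t) B) \<le> degree B" by (rule degree_le) (simp add: coeff_map_poly coeff_eq_0)
      then show "{..degree (map_poly (%c. poly c t) B)} \<subseteq> {..degree B}" by simp
    qed (auto simp: coeff_eq_0)
    finally show ?thesis by (simp add: coeff_map_poly)
  qed
  have Yexp: "eval_fps Y has_fps_expansion Y" using Y by (rule eval_fps_has_fps_expansion)
  have pw: "(%s. eval_fps Y s ^ k) has_fps_expansion Y ^ k" for k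
    by (induction k) (auto intro: has_fps_expansion_mult Yexp)
  have cexp: "(%s. poly (coeff B k) (s ^ M)) has_fps_expansion c k" for k
  proof -
    have "eval_fps (c k) has_fps_expansion c k" by (rule eval_fps_has_fps_expansion) (simp add: c_def)
    moreover have "eval_fps (c k) = (%s. poly (coeff B k) (s ^ M))" by (simp add: c_def poly_pcompose poly_monom fun_eq_iff)
    ultimately show ?thesis by simp
  qed
  have "(%s. \<Sum>k\<le>degree B. poly (coeff B k) (s ^ M) * eval_fps Y s ^ k) has_fps_expansion (\<Sum>k\<le>degree B. c k * Y ^ k)"
    by (intro has_fps_expansion_sum has_fps_expansion_mult cexp pw)
  then have "(\<Sum>k\<le>degree B. c k * Y ^ k) = 0"
    by (rule fps_zero_of_sequence[OF _ s]) (use z ev in simp)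
  moreover have "c (degree B) ~= 0"
  proof
    assume "c (degree B) = 0"
    then have "pcompose (lead_coeff B) (monom 1 M) = 0" by (simp add: c_def)
    moreover have "0 < degree (monom (1::real) M)" using M by (simp add: degree_monom_eq)
    ultimately have "lead_coeff B = 0" by (metis pcompose_eq_0)
    then show False using B by simp
  qed
  moreover have "c k \<in> pow_polys M" for k by (simp add: c_def pow_polys_def)
  ultimately have "pp.algebraic M Y" unfolding pp.algebraic_def
    by (intro exI[of _ "degree B"] exI[of _ c] conjI allI) auto
  then show ?thesis using algebraic_pow_polys_1 fps_alg_iff by blast
qed

section \<open>Definable families and selection by maximisation\<close>

definition definable_family :: "(real^'n => real => bool) => bool" where
  "definable_family K \<longleftrightarrow> (%E :: 'n + nat => real. K (\<chi> i. E (Inl i)) (E (Inr 0))) \<in> SA"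

text \<open>A definable choice by compactness: maximising a polynomial keeps compact non-empty
  fibres definable, compact and non-empty, and maximising a coordinate makes that coordinate
  single-valued.\<close>

definition maximizers :: "(real^'n => real) => (real^'n => real => bool) => real^'n => real => bool" where
  "maximizers r K x t \<longleftrightarrow> K x t & (\<forall>z. K z t --> r z \<le> r x)"

lemma definable_maximizers:
  fixes K :: "real^'n => real => bool"
  assumes K: "definable_family K" and r: "r \<in> polyfun"
  shows "definable_family (maximizers r K)"
proof -
  let ?sub = "%(j :: 'n + nat) (E :: 'n + ('n + nat) => real). case j of Inl i => E (Inl i) | Inr m => E (Inr (Inr m))"
  have "?sub j \<in> pf" for j by (cases j) (simp_all add: pf_var)
  from SA_subst[OF K[unfolded definable_family_def], of ?sub, OF this]
  have 1: "(%E :: 'n + ('n + nat) => real. K (\<chi> i. E (Inl i)) (E (Inr (Inr 0)))) \<in> SA" by simp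
  have 2: "(%E :: 'n + ('n + nat) => real. r (\<chi> i. E (Inl i)) \<le> r (\<chi> i. E (Inr (Inl i)))) \<in> SA"
    by (intro SA_le; rule polyfun_pf_subst[OF r pf_var])
  have "(%E :: 'n + nat => real. \<exists>z. K z (E (Inr 0)) & \<not> r z \<le> r (\<chi> i. E (Inl i))) \<in> SA"
    by (rule SA_ex_vec) (rule SA_conj[OF 1 SA_not[OF 2]])
  from SA_conj[OF K[unfolded definable_family_def] SA_not[OF this]]
  show ?thesis unfolding definable_family_def by (rule SA_cong) (auto simp: maximizers_def)
qed

lemma maximizers_compact:
  fixes K :: "real^'n => real => bool"
  assumes K: "compact {x. K x t}" "\<exists>x. K x t" and r: "r \<in> polyfun"
  shows "compact {x. maximizers r K x t}" "\<exists>x. maximizers r K x t"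
proof -
  have "{x. maximizers r K x t} = {x. K x t} \<inter> (\<Inter>z\<in>{z. K z t}. {x. r z \<le> r x})" by (auto simp: maximizers_def)
  moreover have "closed {x. r z \<le> r x}" for z
    by (intro closed_Collect_le continuous_on_const polyfun_continuous[OF r])
  ultimately show "compact {x. maximizers r K x t}" using K(1) by (auto intro!: compact_Int_closed)
  have "continuous_on {x. K x t} r" by (rule polyfun_continuous[OF r])
  then show "\<exists>x. maximizers r K x t" using continuous_attains_sup[OF K(1), of r] K(2) by (auto simp: maximizers_def)
qed

lemma pf_diagonal: "p \<in> pf ==> \<exists>P :: real poly. \<forall>t. p (%_. t) = poly P t"
proof (induction rule: pf.induct)
  case (pf_const c)
  show ?case by (intro exI[of _ "[:c:]"]) simp
next
  case (pf_var i)
  show ?case by (intro exI[of _ "[:0, 1:]"]) simp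
next
  case (pf_add p q)
  then obtain P Q where "\<forall>t. p (%_. t) = poly P t" "\<forall>t. q (%_. t) = poly Q t" by blast
  then show ?case by (intro exI[of _ "P + Q"]) simp
next
  case (pf_mult p q)
  then obtain P Q where "\<forall>t. p (%_. t) = poly P t" "\<forall>t. q (%_. t) = poly Q t" by blast
  then show ?case by (intro exI[of _ "P * Q"]) simp
qed

text \<open>A single-valued coordinate fills one point of its fibre over \<open>t\<close>, and a
  point alone is a boundary point, so it is a root of one of finitely many polynomials. Their
  product, without the zero polynomials, serves all \<open>t\<close> at once.\<close>

lemma definable_coordinate_algebraic:
  fixes K :: "real^'n => real => bool"
  assumes K: "definable_family K" and uniq: "!!t x z. 0 < t ==> K x t ==> K z t ==> x $ i = z $ i"
  shows "\<exists>B :: real poly poly. B ~= 0 & (\<forall>t>0. \<forall>x. K x t --> poly2 B t (x $ i) = 0)"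
proof -
  let ?sub = "%(j :: 'n + nat) (E :: 'n + nat => real). E j"
  have "(%E :: 'n + nat => real. K (\<chi> i. E (Inl i)) (E (Inr 0)) & E (Inl i) = E (Inr 1)) \<in> SA"
    by (intro SA_conj SA_eq pf_var) (use K in \<open>simp add: definable_family_def\<close>)
  then have "(%E :: 'n + nat => real. K (\<chi> i. E (Inl i)) (E (Inr 0)) & (\<chi> i. E (Inl i)) $ i = E (Inr 1)) \<in> SA" by simp
  then have "(%e :: nat => real. \<exists>x. K x (e 0) & x $ i = e 1) \<in> SA" by (rule SA_ex_vec)
  from SA_boundary_root[OF this, of 1] obtain n \<A> where A: "finite \<A>" "\<A> \<subseteq> PP n" and
    bd: "\<forall>(e :: nat => real) y. (\<forall>d>0. \<exists>z. \<bar>z - y\<bar> < d & (\<exists>x. K x ((e(1 := z)) 0) & x $ i = (e(1 := z)) 1) ~= (\<exists>x. K x ((e(1 := y)) 0) & x $ i = (e(1 := y)) 1)) -->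
     (\<exists>P\<in>\<A>. P e ~= 0 & poly (P e) y = 0)" by (elim exE conjE) (rule that; assumption)
  have root: "\<exists>P\<in>\<A>. P (%_::nat. t) ~= 0 & poly (P (%_::nat. t)) (x $ i) = 0" if t: "0 < t" "K x t" for t x
  proof (rule bd[rule_format])
    fix d :: real assume d: "0 < d"
    have "\<not> (\<exists>z. K z t & z $ i = x $ i + d / 2)" using uniq[OF t(1,2)] d by fastforce
    then show "\<exists>z. \<bar>z - x $ i\<bar> < d & (\<exists>x. K x (((%_::nat. t)(1 := z)) 0) & x $ i = ((%_::nat. t)(1 := z)) 1) ~=
        (\<exists>xa. K xa (((%_::nat. t)(1 := x $ i)) 0) & xa $ i = ((%_::nat. t)(1 := x $ i)) 1)"
      using t d by (intro exI[of _ "x $ i + d / 2"]) auto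
  qed
  have "\<forall>P\<in>\<A>. \<exists>B :: real poly poly. \<forall>t. map_poly (%c. poly c t) B = P (%_. t)"
  proof
    fix P assume P: "P \<in> \<A>"
    have "\<forall>k. \<exists>c :: real poly. \<forall>t. coeff (P (%_. t)) k = poly c t"
    proof
      fix k
      have "(%e. coeff (P e) k) \<in> pf" using A(2) P by (intro PP_coeff[of _ n]) blast
      then show "\<exists>c :: real poly. \<forall>t. coeff (P (%_. t)) k = poly c t" by (rule pf_diagonal)
    qed
    from choice[OF this] obtain c :: "nat => real poly" where c: "\<forall>k t. coeff (P (%_. t)) k = poly (c k) t" ..
    define B where "B = (\<Sum>k\<le>n. monom (c k) k)"
    have cf: "coeff B k = (if k \<le> n then c k else 0)" for k by (simp add: B_def coeff_sum)
    have "map_poly (%c. poly c t) B = P (%_. t)" for t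
    proof (rule poly_eqI)
      fix k
      have "P \<in> PP n" using A(2) P by blast
      then have dg: "degree (P (%_. t)) \<le> n" by (rule PP_degree)
      have ck: "poly (c k) t = coeff (P (%_. t)) k" using c by simp
      have "coeff (map_poly (%c. poly c t) B) k = poly (coeff B k) t" by (rule coeff_map_poly) simp
      also have "\<dots> = coeff (P (%_. t)) k" using dg by (cases "k \<le> n") (simp_all only: cf if_True if_False ck poly_0, simp add: coeff_eq_0)
      finally show "coeff (map_poly (%c. poly c t) B) k = coeff (P (%_. t)) k" .
    qed
    then show "\<exists>B :: real poly poly. \<forall>t. map_poly (%c. poly c t) B = P (%_. t)" by blast
  qed
  from bchoice[OF this] obtain Bf :: "((nat => real) => real poly) => real poly poly"
    where Bf: "\<forall>P\<in>\<A>. \<forall>t. map_poly (%c. poly c t) (Bf P) = P (%_. t)" ..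
  define B where "B = (\<Prod>P\<in>{P \<in> \<A>. Bf P ~= 0}. Bf P)"
  have "B ~= 0" using A(1) by (simp add: B_def)
  moreover have "poly2 B t (x $ i) = 0" if t: "0 < t" "K x t" for t x
  proof -
    obtain P where P: "P \<in> \<A>" "P (%_. t) ~= 0" "poly (P (%_. t)) (x $ i) = 0" using root[OF t] by blast
    have m: "map_poly (%c. poly c t) (Bf P) = P (%_. t)" using Bf P(1) by blast
    then have "Bf P ~= 0" using P(2) by auto
    moreover have "poly2 (Bf P) t (x $ i) = 0" unfolding poly2_map m by (rule P(3))
    ultimately show ?thesis using A(1) P(1) unfolding B_def poly2_def poly_prod by (intro prod_zero) auto
  qed
  ultimately show ?thesis by blast
qed

text \<open>Maximising the square of \<open>q\<close> on the points within distance sqrt t of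
  \<open>x0\<close> makes \<open>q\<close> non-zero on the selected fibre, and maximising the
  coordinates in turn leaves a single point, algebraic in t. Puiseux expansion of each coordinate
  along a null sequence of t yields the arc; membership in \<open>V\<close> and the sign conditions
  are inherited at the sampled parameters.\<close>

theorem curve_selection:
  fixes V :: "(real^'n) set"
  assumes V: "algebraic_set V" and q: "q \<in> polyfun" and g: "g \<in> polyfun"
    and acc: "!!\<epsilon>. 0 < \<epsilon> ==> \<exists>x\<in>V. dist x x0 < \<epsilon> & q x ~= 0 & 0 \<le> g x"
  shows "\<exists>\<gamma> s. (\<forall>i. \<gamma> i \<in> fps_alg & fps_nth (\<gamma> i) 0 = x0 $ i) & (\<forall>n::nat. 0 < s n) & s \<longlonglongrightarrow> 0 &
     (\<forall>n. (\<chi> i. eval_fps (\<gamma> i) (s n)) \<in> V & q (\<chi> i. eval_fps (\<gamma> i) (s n)) ~= 0 & 0 \<le> g (\<chi> i. eval_fps (\<gamma> i) (s n)))"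
proof -
  \<comment> \<open>The condition on \<open>q\<close> is left out here because it is open and would
    destroy compactness; it returns through the maximisation in \<open>K1\<close>.\<close>
  define K0 where "K0 x t \<longleftrightarrow> x \<in> V & (\<Sum>i\<in>UNIV. (x $ i - x0 $ i) * (x $ i - x0 $ i)) \<le> t & 0 \<le> g x" for x t
  have sq: "(\<Sum>i\<in>UNIV. (x $ i - x0 $ i) * (x $ i - x0 $ i)) = (dist x x0)\<^sup>2" for x
    by (simp add: dist_norm power2_norm_eq_inner inner_vec_def)
  have inV: "(%E :: 'n + nat => real. (\<chi> i. E (Inl i)) \<in> V) \<in> SA" by (rule SA_in_algebraic_set[OF V pf_var])
  have gpf: "(%E :: 'n + nat => real. g (\<chi> i. E (Inl i))) \<in> pf" by (rule polyfun_pf_subst[OF g pf_var])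
  have K0d: "definable_family K0" unfolding definable_family_def K0_def vec_lambda_beta
    by (intro SA_conj inV SA_le gpf pf_sum pf_mult pf_diff pf_var pf_const)
  have cp0: "compact {x. K0 x t}" and ne0: "\<exists>x. K0 x t & q x ~= 0" if t: "0 < t" for t
  proof -
    have "closed V" by (rule algebraic_set_closed[OF V])
    have "closed {x. 0 \<le> g x}" by (intro closed_Collect_le continuous_on_const polyfun_continuous[OF g])
    have eq: "(dist x x0)\<^sup>2 \<le> t \<longleftrightarrow> dist x x0 \<le> sqrt t" for x
      using t real_sqrt_le_iff[of "(dist x x0)\<^sup>2" t] by simp
    have "{x. K0 x t} = cball x0 (sqrt t) \<inter> (V \<inter> {x. 0 \<le> g x})"
      unfolding K0_def sq eq cball_def dist_commute[of x0] by blast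
    then show "compact {x. K0 x t}" using \<open>closed V\<close> \<open>closed {x. 0 \<le> g x}\<close> by (simp add: compact_Int_closed closed_Int)
    obtain x where "x \<in> V" "dist x x0 < sqrt t" "q x ~= 0" "0 \<le> g x" using acc[of "sqrt t"] t by auto
    then show "\<exists>x. K0 x t & q x ~= 0" unfolding K0_def sq eq by (intro exI[of _ x]) auto
  qed
  have q2: "(%x. q x * q x) \<in> polyfun" using q by (intro polyfun.pf_mult)
  define K1 where "K1 = maximizers (%x. q x * q x) K0"
  have K1d: "definable_family K1" unfolding K1_def by (rule definable_maximizers[OF K0d q2])
  have K1c: "compact {x. K1 x t}" "\<exists>x. K1 x t" if t: "0 < t" for t
  proof -
    have "\<exists>x. K0 x t" using ne0[OF t] by blast
    from maximizers_compact[of K0 t, OF cp0[OF t] this q2] show "compact {x. K1 x t}" "\<exists>x. K1 x t" unfolding K1_def .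
  qed
  \<comment> \<open>Further maximisations only shrink the fibres, so coordinates already made
    single-valued stay so.\<close>
  define KL where "KL is = foldr (%i. maximizers (%x. x $ i)) is K1" for "is"
  have KL: "definable_family (KL is) & (\<forall>t>0. compact {x. KL is x t} & (\<exists>x. KL is x t)) & (\<forall>x t. KL is x t --> K1 x t) &
      (\<forall>i\<in>set is. \<forall>x z t. KL is x t --> KL is z t --> x $ i = z $ i)" for "is"
  proof (induction "is")
    case Nil
    show ?case using K1d K1c by (simp add: KL_def)
  next
    case (Cons i js)
    have st: "KL (i # js) = maximizers (%x. x $ i) (KL js)" by (simp add: KL_def)
    have d: "definable_family (KL (i # js))" unfolding st using Cons.IH by (intro definable_maximizers polyfun.pf_coord) blast
    have c: "compact {x. KL (i # js) x t}" "\<exists>x. KL (i # js) x t" if "0 < t" for t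
      unfolding st using Cons.IH that maximizers_compact[of "KL js" t "%x. x $ i", OF _ _ polyfun.pf_coord] by blast+
    have m: "KL js x t" if "KL (i # js) x t" for x t using that by (simp add: st maximizers_def)
    have "x $ i = z $ i" if "KL (i # js) x t" "KL (i # js) z t" for x z t
      using that unfolding st maximizers_def by (intro antisym) blast+
    moreover have "x $ j = z $ j" if "j \<in> set js" "KL (i # js) x t" "KL (i # js) z t" for j t and x z :: "real^'n"
      using Cons.IH that(1) m[OF that(2)] m[OF that(3)] by blast
    ultimately have e: "\<forall>j\<in>set (i # js). \<forall>x z t. KL (i # js) x t --> KL (i # js) z t --> x $ j = z $ j"
      unfolding list.set by blast
    have "\<forall>x t. KL (i # js) x t --> K1 x t" using m Cons.IH by blast
    with d c e show ?case by blast
  qed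
  obtain "is" :: "'n list" where "is": "set is = UNIV" using finite_list[OF finite] by blast
  define K where "K = KL is"
  have Kd: "definable_family K" and Kne: "!!t. 0 < t ==> \<exists>x. K x t" and K1: "!!x t. K x t ==> K1 x t"
    and Ku: "!!i x z t. K x t ==> K z t ==> x $ i = z $ i"
    using KL[of "is"] "is" unfolding K_def by blast+
  define t where "t n = 1 / real (Suc n)" for n
  have t: "0 < t n" "t n \<le> 1" for n by (simp_all add: t_def)
  have tlim: "t \<longlonglongrightarrow> 0" unfolding t_def using LIMSEQ_inverse_real_of_nat by (simp add: inverse_eq_divide)
  have "\<forall>n. \<exists>x. K x (t n)" using Kne[OF t(1)] by blast
  from choice[OF this] obtain x where x: "\<forall>n. K (x n) (t n)" ..
  have x1: "x n \<in> V" "(dist (x n) x0)\<^sup>2 \<le> t n" "0 \<le> g (x n)" "q (x n) ~= 0" for n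
  proof -
    have k: "K1 (x n) (t n)" using x K1 by blast
    then show "x n \<in> V" "(dist (x n) x0)\<^sup>2 \<le> t n" "0 \<le> g (x n)" by (auto simp: K1_def maximizers_def K0_def sq)
    obtain z where z: "K0 z (t n)" "q z ~= 0" using ne0[OF t(1)] by blast
    have "q z * q z \<le> q (x n) * q (x n)" using k z by (auto simp: K1_def maximizers_def)
    moreover have "0 < q z * q z" using z(2) by (simp add: zero_less_mult_iff) linarith
    ultimately show "q (x n) ~= 0" by auto
  qed
  have xlim: "x \<longlonglongrightarrow> x0"
  proof (rule metric_tendsto_imp_tendsto)
    show "(%n. sqrt (t n)) \<longlonglongrightarrow> 0" using tendsto_real_sqrt[OF tlim] by simp
    show "\<forall>\<^sub>F n in sequentially. dist (x n) x0 \<le> dist (sqrt (t n)) 0"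
      using x1(2) t(1) by (intro always_eventually allI) (simp add: real_le_rsqrt less_imp_le)
  qed
  have xb: "\<bar>x n $ i\<bar> \<le> norm x0 + 1" for n i
  proof -
    have "(dist (x n) x0)\<^sup>2 \<le> 1\<^sup>2" unfolding power_one by (rule order_trans[OF x1(2) t(2)])
    then have "dist (x n) x0 \<le> 1" by (rule power2_le_imp_le) simp
    then have "norm (x n) \<le> norm x0 + 1" using norm_triangle_ineq2[of "x n" x0] by (simp add: dist_norm)
    then show ?thesis using component_le_norm_cart[of "x n" i] by linarith
  qed
  have "\<forall>i. \<exists>B :: real poly poly. B ~= 0 & (\<forall>t>0. \<forall>x. K x t --> poly2 B t (x $ i) = 0)"
    by (intro allI definable_coordinate_algebraic[OF Kd]) (rule Ku)
  from choice[OF this] obtain B :: "'n => real poly poly" where B: "\<forall>i. B i ~= 0 & (\<forall>t>0. \<forall>x. K x t --> poly2 (B i) t (x $ i) = 0)" ..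
  have Bz: "poly2 (B i) (t n) (x n $ i) = 0" for i n using B x t(1) by blast
  \<comment> \<open>Coordinates are treated one after another, each time passing to a subsequence
    and to the product of the two root exponents; \<open>fps_stretch\<close> rewrites both the old
    expansions and the new one.\<close>
  have "\<exists>M>0. \<exists>N. infinite N & (\<exists>Y. \<forall>i\<in>T. 0 < fps_conv_radius (Y i) & (\<forall>n\<in>N. x n $ i = eval_fps (Y i) (root M (t n))))" if "finite T" for T
    using that
  proof induction
    case empty
    show ?case by (intro exI[of _ 1] conjI exI[of _ UNIV]) auto
  next
    case (insert i T)
    then obtain M N Y where MN: "M > 0" "infinite N" and Y: "\<forall>j\<in>T. 0 < fps_conv_radius (Y j) & (\<forall>n\<in>N. x n $ j = eval_fps (Y j) (root M (t n)))" by blast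
    obtain M' N' Z where M': "M' > 0" "N' \<subseteq> N" "infinite N'" and Z: "0 < fps_conv_radius Z"
        "\<forall>n\<in>N'. ereal (root M' (t n)) < fps_conv_radius Z & x n $ i = eval_fps Z (root M' (t n))"
      using puiseux_sequence[OF B[rule_format, THEN conjunct1, of i] t(1) tlim, of "%n. x n $ i" "norm x0 + 1" N] xb MN(2) Bz by blast
    define W where "W j = (if j = i then fps_stretch M Z else fps_stretch M' (Y j))" for j
    have rt: "root (M * M') (t n) ^ M = root M' (t n)" "root (M * M') (t n) ^ M' = root M (t n)" for n
    proof -
      have e1: "root (M * M') (t n) = root M (root M' (t n))" by (rule real_root_mult_exp)
      have e2: "root (M * M') (t n) = root M' (root M (t n))" by (subst mult.commute) (rule real_root_mult_exp)
      show "root (M * M') (t n) ^ M = root M' (t n)" unfolding e1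
        by (rule real_root_pow_pos2[OF MN(1)]) (use t(1)[of n] in \<open>simp add: real_root_ge_zero\<close>)
      show "root (M * M') (t n) ^ M' = root M (t n)" unfolding e2
        by (rule real_root_pow_pos2[OF M'(1)]) (use t(1)[of n] in \<open>simp add: real_root_ge_zero\<close>)
    qed
    have ev: "\<forall>\<^sub>F n in sequentially. \<forall>j\<in>T. ereal (root M (t n)) < fps_conv_radius (Y j)"
    proof (rule eventually_ball_finite[OF insert.hyps(1)], rule ballI)
      fix j assume "j \<in> T"
      then obtain r where r: "0 < ereal r" "ereal r < fps_conv_radius (Y j)" using Y ereal_dense2 by blast
      have "(%n. root M (t n)) \<longlonglongrightarrow> 0" using tendsto_real_root[OF tlim, of M] by simp
      then have "\<forall>\<^sub>F n in sequentially. root M (t n) < r" using r(1) by (intro order_tendstoD(2)) auto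
      then show "\<forall>\<^sub>F n in sequentially. ereal (root M (t n)) < fps_conv_radius (Y j)"
        by eventually_elim (rule less_trans[OF _ r(2)], simp)
    qed
    then obtain n0 where n0: "\<forall>n\<ge>n0. \<forall>j\<in>T. ereal (root M (t n)) < fps_conv_radius (Y j)" by (auto simp: eventually_sequentially)
    define N'' where "N'' = N' \<inter> {n0..}"
    have "N' \<subseteq> N'' \<union> {..<n0}" by (auto simp: N''_def)
    then have inf: "infinite N''" using M'(3) finite_subset by fastforce
    have "0 < fps_conv_radius (W j) & (\<forall>n\<in>N''. x n $ j = eval_fps (W j) (root (M * M') (t n)))" if j: "j \<in> insert i T" for j
    proof (cases "j = i")
      case True
      have "x n $ i = eval_fps (fps_stretch M Z) (root (M * M') (t n))" if "n \<in> N''" for n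
      proof -
        have "ereal (norm (root (M * M') (t n) ^ M)) < fps_conv_radius Z"
          using Z(2) that t(1)[of n] unfolding rt by (simp add: N''_def real_root_ge_zero less_imp_le)
        from fps_stretch_eval[OF MN(1) this] show ?thesis using Z(2) that by (simp add: rt N''_def)
      qed
      then show ?thesis using True fps_stretch_radius[OF MN(1) Z(1)] by (simp add: W_def)
    next
      case False
      then have jT: "j \<in> T" using j by blast
      have "x n $ j = eval_fps (fps_stretch M' (Y j)) (root (M * M') (t n))" if "n \<in> N''" for n
      proof -
        have "ereal (norm (root (M * M') (t n) ^ M')) < fps_conv_radius (Y j)"
          using n0 that jT t(1)[of n] unfolding rt by (simp add: N''_def real_root_ge_zero less_imp_le)
        from fps_stretch_eval[OF M'(1) this] show ?thesis using Y jT that M'(2) by (auto simp: rt N''_def)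
      qed
      then show ?thesis using False fps_stretch_radius[OF M'(1)] Y jT by (simp add: W_def)
    qed
    then show ?case using inf MN(1) M'(1) by (intro exI[of _ "M * M'"] conjI exI[of _ N''] exI[of _ W]) auto
  qed
  from this[of UNIV, OF finite] obtain M N Y where M: "M > 0" "infinite N" and Y: "\<forall>i\<in>UNIV. 0 < fps_conv_radius (Y i) & (\<forall>n\<in>N. x n $ i = eval_fps (Y i) (root M (t n)))"
    by (elim exE conjE) (rule that; assumption)
  define e where "e = enumerate N"
  have e: "strict_mono e" "e n \<in> N" for n using M(2) by (auto simp: e_def strict_mono_enumerate enumerate_in_set)
  define s where "s n = root M (t (e n))" for n
  have s0: "0 < s n" "s n ^ M = t (e n)" for n using M(1) t(1)[of "e n"] by (simp_all add: s_def less_imp_le)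
  have te: "(%n. t (e n)) \<longlonglongrightarrow> 0" using LIMSEQ_subseq_LIMSEQ[OF tlim e(1)] by (simp add: o_def)
  have slim: "s \<longlonglongrightarrow> 0" unfolding s_def using tendsto_real_root[OF te, of M] by simp
  have xY: "eval_fps (Y i) (s n) = x (e n) $ i" for i n using Y e(2) by (simp add: s_def)
  then have xx: "(\<chi> i. eval_fps (Y i) (s n)) = x (e n)" for n by (simp add: vec_eq_iff)
  have "Y i \<in> fps_alg" for i
  proof (rule fps_alg_of_sequence[of "B i" M "Y i" s])
    show "poly2 (B i) (s n ^ M) (eval_fps (Y i) (s n)) = 0" for n unfolding s0 xY by (rule Bz)
  qed (use B M Y slim s0(1) in \<open>auto simp: less_imp_neq[symmetric]\<close>)
  moreover have "fps_nth (Y i) 0 = x0 $ i" for i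
  proof -
    have "isCont (eval_fps (Y i)) 0" by (rule has_fps_expansion_imp_continuous[OF eval_fps_has_fps_expansion]) (use Y in blast)
    then have "(%n. eval_fps (Y i) (s n)) \<longlonglongrightarrow> eval_fps (Y i) 0" using slim by (rule isCont_tendsto_compose)
    moreover have "(%n. x (e n) $ i) \<longlonglongrightarrow> x0 $ i"
      using tendsto_vec_nth[OF LIMSEQ_subseq_LIMSEQ[OF xlim e(1)], of i] by (simp add: o_def)
    ultimately show ?thesis using LIMSEQ_unique by (auto simp: xY eval_fps_at_0)
  qed
  ultimately show ?thesis using s0(1) slim x1 by (intro exI[of _ Y] exI[of _ s]) (simp add: xx)
qed

section \<open>Continuous rational functions along arcs\<close>

lemma has_fps_expansion_unique:
  fixes F G :: "real fps"
  assumes "f has_fps_expansion F" "f has_fps_expansion G"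
  shows "F = G"
proof -
  have "(%s. f s - f s) has_fps_expansion F - G" using assms by (rule has_fps_expansion_diff)
  then have "F - G = 0"
    by (rule fps_zero_of_sequence[where s = "%n. 1 / real (Suc n)"])
      (use LIMSEQ_inverse_real_of_nat in \<open>simp_all add: inverse_eq_divide\<close>)
  then show ?thesis by simp
qed

lemma has_fps_expansion_at_0:
  assumes "f has_fps_expansion F" shows "f 0 = fps_nth F 0"
proof -
  have "\<forall>\<^sub>F s in nhds 0. eval_fps F s = f s" using assms by (simp add: has_fps_expansion_def)
  from eventually_nhds_x_imp_x[OF this] show ?thesis by (simp add: eval_fps_at_0)
qed

lemma has_fps_expansion_eventually_eq:
  assumes "f has_fps_expansion F" "\<forall>\<^sub>F s in nhds 0. f s = g s"
  shows "g has_fps_expansion F"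
  unfolding has_fps_expansion_def
proof
  show "0 < fps_conv_radius F" using assms(1) by (simp add: has_fps_expansion_def)
  have "\<forall>\<^sub>F s in nhds 0. eval_fps F s = f s" using assms(1) by (simp add: has_fps_expansion_def)
  then show "\<forall>\<^sub>F s in nhds 0. eval_fps F s = g s" using assms(2) by eventually_elim simp
qed

lemma fps_alg_closed:
  "f \<in> fps_alg ==> g \<in> fps_alg ==> f + g \<in> fps_alg"
  "f \<in> fps_alg ==> g \<in> fps_alg ==> f * g \<in> fps_alg"
  "fps_const c \<in> fps_alg"
proof -
  show "f \<in> fps_alg ==> g \<in> fps_alg ==> f + g \<in> fps_alg" "f \<in> fps_alg ==> g \<in> fps_alg ==> f * g \<in> fps_alg"
    unfolding fps_alg_iff by (rule pp.algebraic_add, assumption+) (rule pp.algebraic_mult, assumption+)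
  have "fps_of_poly [:c:] \<in> pow_polys 1" unfolding pow_polys_1 by blast
  then show "fps_const c \<in> fps_alg" unfolding fps_alg_iff by (intro pp.algebraic_K) (simp add: fps_of_poly_const)
qed

locale nonsingular_variety =
  fixes V :: "(real^'n) set" and rk :: nat
  assumes irreducible: "irreducible_alg V" and rank: "!!x. x \<in> V ==> dim (ideal_gradients V x) = rk"
begin

lemma algebraic: "algebraic_set V" and nonempty: "V ~= {}"
  using irreducible by (auto simp: irreducible_alg_def)

lemma dense: "q \<in> polyfun ==> \<exists>x\<in>V. q x ~= 0 ==> x \<in> V ==> 0 < \<epsilon> ==> \<exists>z\<in>V. dist z x < \<epsilon> & q z ~= 0"
  by (rule polyfun_nonvanishing_dense[OF irreducible rank])

lemma zero_by_density:
  assumes w: "w \<in> polyfun" "\<exists>x\<in>V. w x ~= 0" and g: "continuous_on V g" and z: "!!x. x \<in> V ==> w x ~= 0 ==> g x = (0::real)" and x: "x \<in> V"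
  shows "g x = 0"
proof (rule ccontr)
  assume n: "g x ~= 0"
  then obtain d where d: "0 < d" "\<forall>y\<in>V. dist y x < d --> dist (g y) (g x) < \<bar>g x\<bar>"
    using g x unfolding continuous_on_iff by (meson zero_less_abs_iff)
  obtain y where "y \<in> V" "dist y x < d" "w y ~= 0" using dense[OF w x d(1)] by blast
  then show False using d(2) z[of y] by (auto simp: dist_real_def)
qed

lemma nonzero_mult: "p \<in> polyfun ==> q \<in> polyfun ==> \<exists>x\<in>V. p x ~= 0 ==> \<exists>x\<in>V. q x ~= 0 ==> \<exists>x\<in>V. p x * q x ~= 0"
  using irreducible_prime[OF irreducible, of p q] by blast

lemma nonzero_power: "q \<in> polyfun ==> \<exists>x\<in>V. q x ~= 0 ==> \<exists>x\<in>V. q x ^ n ~= 0"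
  by auto

section \<open>Fractions on the variety and continuous rational functions\<close>

definition cl :: "(real^'n => real) => (real^'n => real) => 'n rfrep set" where
  "cl p q = rf_class V (p, q)"

definition rep :: "(real^'n => real) => (real^'n => real) => bool" where
  "rep p q \<longleftrightarrow> p \<in> polyfun & q \<in> polyfun & (\<exists>x\<in>V. q x ~= 0)"

lemma rep_one: "p \<in> polyfun ==> rep p (%_. 1)"
  using nonempty by (auto simp: rep_def intro: polyfun.pf_const)

lemma rep_mult: "rep p q ==> rep p' q' ==> rep (%x. p x * p' x) (%x. q x * q' x)"
  unfolding rep_def using nonzero_mult[of q q'] by (auto intro: polyfun.pf_mult)

lemma rep_add: "rep p q ==> rep p' q' ==> rep (%x. p x * q' x + p' x * q x) (%x. q x * q' x)"
  unfolding rep_def using nonzero_mult[of q q'] by (auto intro!: polyfun.pf_mult polyfun.pf_add)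

lemma rep_power: "rep p q ==> rep (%x. p x ^ n) (%x. q x ^ n)"
  unfolding rep_def using nonzero_power[of q n] by (auto intro: polyfun_power)

lemma class_member: "(p', q') \<in> cl p q \<longleftrightarrow> rep p q & rep p' q' & (\<forall>x\<in>V. p x * q' x = p' x * q x)"
  by (auto simp: cl_def rf_class_def rf_rel_def rf_reps_def rep_def)

text \<open>Cancelling the middle denominator uses that the vanishing ideal is prime; on a reducible
  set the relation need not be transitive.\<close>

lemma rel_trans:
  assumes "rep p q" "rep p' q'" "rep p'' q''" "\<forall>x\<in>V. p x * q' x = p' x * q x" "\<forall>x\<in>V. p' x * q'' x = p'' x * q' x"
  shows "\<forall>x\<in>V. p x * q'' x = p'' x * q x"
proof -
  have "(%x. p x * q'' x - p'' x * q x) \<in> polyfun" using assms(1,3) by (auto simp: rep_def intro!: polyfun_diff polyfun.pf_mult)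
  moreover have "(p x * q'' x - p'' x * q x) * q' x = 0" if "x \<in> V" for x
  proof -
    have "(p x * q'' x - p'' x * q x) * q' x = (p x * q' x) * q'' x - (p'' x * q' x) * q x" by (simp add: algebra_simps)
    also have "\<dots> = 0" using assms(4,5) that by (simp flip: assms(5)[rule_format])
    finally show ?thesis .
  qed
  ultimately have "(\<forall>x\<in>V. p x * q'' x - p'' x * q x = 0) \<or> (\<forall>x\<in>V. q' x = 0)"
    using irreducible_prime[OF irreducible, of "%x. p x * q'' x - p'' x * q x" q'] assms(2) by (auto simp: rep_def)
  then show ?thesis using assms(2) by (auto simp: rep_def)
qed

lemma class_eq: "rep p q ==> rep p' q' ==> cl p q = cl p' q' \<longleftrightarrow> (\<forall>x\<in>V. p x * q' x = p' x * q x)"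
proof
  assume r: "rep p q" "rep p' q'" and e: "cl p q = cl p' q'"
  have "(p', q') \<in> cl p' q'" using r by (simp add: class_member)
  then show "\<forall>x\<in>V. p x * q' x = p' x * q x" unfolding e[symmetric] by (simp add: class_member)
next
  assume r: "rep p q" "rep p' q'" and e: "\<forall>x\<in>V. p x * q' x = p' x * q x"
  have e': "\<forall>x\<in>V. p' x * q x = p x * q' x" using e by simp
  have "z \<in> cl p q \<longleftrightarrow> z \<in> cl p' q'" for z
  proof (cases z)
    case (Pair a b)
    show ?thesis unfolding Pair class_member using r rel_trans[OF r(2,1) _ e'] rel_trans[OF r(1,2) _ e] by blast
  qed
  then show "cl p q = cl p' q'" by blast
qed

lemma rf_rep_class:
  assumes "rep p q"
  obtains p' q' where "rf_rep (cl p q) = (p', q')" "rep p' q'" "\<forall>x\<in>V. p x * q' x = p' x * q x"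
proof -
  have "(p, q) \<in> cl p q" using assms by (simp add: class_member)
  then have "rf_rep (cl p q) \<in> cl p q" unfolding rf_rep_def by (rule someI)
  then show ?thesis using that by (cases "rf_rep (cl p q)") (auto simp: class_member)
qed

lemma mult_class:
  assumes r: "rep p q" "rep p' q'"
  shows "rf_mult V (cl p q) (cl p' q') = cl (%x. p x * p' x) (%x. q x * q' x)"
proof -
  obtain a b where a: "rf_rep (cl p q) = (a, b)" "rep a b" "\<forall>x\<in>V. p x * b x = a x * q x" by (rule rf_rep_class[OF r(1)])
  obtain a' b' where a': "rf_rep (cl p' q') = (a', b')" "rep a' b'" "\<forall>x\<in>V. p' x * b' x = a' x * q' x" by (rule rf_rep_class[OF r(2)])
  have "rf_mult V (cl p q) (cl p' q') = cl (%x. a x * a' x) (%x. b x * b' x)" unfolding rf_mult_def a(1) a'(1) by (simp add: cl_def)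
  also have "\<dots> = cl (%x. p x * p' x) (%x. q x * q' x)"
  proof (rule iffD2[OF class_eq[OF rep_mult[OF a(2) a'(2)] rep_mult[OF r]]], rule ballI)
    fix x assume "x \<in> V"
    then have "p x * b x = a x * q x" "p' x * b' x = a' x * q' x" using a(3) a'(3) by auto
    then have "(a x * q x) * (a' x * q' x) = (p x * b x) * (p' x * b' x)" by simp
    then show "a x * a' x * (q x * q' x) = p x * p' x * (b x * b' x)" by (simp add: mult_ac)
  qed
  finally show ?thesis .
qed

lemma add_class:
  assumes r: "rep p q" "rep p' q'"
  shows "rf_add V (cl p q) (cl p' q') = cl (%x. p x * q' x + p' x * q x) (%x. q x * q' x)"
proof -
  obtain a b where a: "rf_rep (cl p q) = (a, b)" "rep a b" "\<forall>x\<in>V. p x * b x = a x * q x" by (rule rf_rep_class[OF r(1)])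
  obtain a' b' where a': "rf_rep (cl p' q') = (a', b')" "rep a' b'" "\<forall>x\<in>V. p' x * b' x = a' x * q' x" by (rule rf_rep_class[OF r(2)])
  have "rf_add V (cl p q) (cl p' q') = cl (%x. a x * b' x + a' x * b x) (%x. b x * b' x)" unfolding rf_add_def a(1) a'(1) by (simp add: cl_def)
  also have "\<dots> = cl (%x. p x * q' x + p' x * q x) (%x. q x * q' x)"
  proof (rule iffD2[OF class_eq[OF rep_add[OF a(2) a'(2)] rep_add[OF r]]], rule ballI)
    fix x assume "x \<in> V"
    then have e: "p x * b x = a x * q x" "p' x * b' x = a' x * q' x" using a(3) a'(3) by auto
    have "(a x * b' x + a' x * b x) * (q x * q' x) = (a x * q x) * (b' x * q' x) + (a' x * q' x) * (b x * q x)" by (simp add: algebra_simps)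
    also have "\<dots> = (p x * q' x + p' x * q x) * (b x * b' x)" unfolding e[symmetric] by (simp add: algebra_simps)
    finally show "(a x * b' x + a' x * b x) * (q x * q' x) = (p x * q' x + p' x * q x) * (b x * b' x)" .
  qed
  finally show ?thesis .
qed

abbreviation cp :: "(real^'n => real) => 'n rfrep set" where "cp p \<equiv> cl p (%_. 1)"

lemma coord_ring_eq: "coord_ring V = cp ` polyfun"
  by (auto simp: coord_ring_def cl_def)

lemma cp_eq: "p \<in> polyfun ==> p' \<in> polyfun ==> cp p = cp p' \<longleftrightarrow> (\<forall>x\<in>V. p x = p' x)"
  by (simp add: class_eq rep_one)

lemma cp_add: "p \<in> polyfun ==> p' \<in> polyfun ==> rf_add V (cp p) (cp p') = cp (%x. p x + p' x)"
  by (simp add: add_class rep_one)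

lemma cp_mult: "p \<in> polyfun ==> p' \<in> polyfun ==> rf_mult V (cp p) (cp p') = cp (%x. p x * p' x)"
  by (simp add: mult_class rep_one)

text \<open>By density the identity \<open>f x * q x = p x\<close> extends from the Zariski open set
  to all of \<open>V\<close>, for any representative. This removes both the open set and the choice
  of fraction from the definition.\<close>

lemma R0_class:
  assumes r: "rep p q"
  shows "cl p q \<in> R0 V \<longleftrightarrow> (\<exists>f. continuous_on V f & (\<forall>x\<in>V. f x * q x = p x))"
proof
  assume "cl p q \<in> R0 V"
  then obtain p0 q0 f W where e: "cl p q = cl p0 q0" and pq: "p0 \<in> polyfun" "q0 \<in> polyfun" and f: "continuous_on V f"
    and W: "algebraic_set W" "V - W ~= {}" "\<forall>x\<in>V - W. q0 x ~= 0 & f x = p0 x / q0 x"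
    unfolding R0_def cl_def by blast
  have r0: "rep p0 q0" using pq W(2,3) by (auto simp: rep_def)
  have eq: "\<forall>x\<in>V. p x * q0 x = p0 x * q x" using e class_eq[OF r r0] by simp
  obtain P where P: "P \<subseteq> polyfun" "W = zero_set P" using W(1) by (auto simp: algebraic_set_def)
  obtain w where w: "w \<in> P" "\<exists>x\<in>V. w x ~= 0" using W(2) P(2) by (auto simp: zero_set_def)
  have "f x * q x - p x = 0" if x: "x \<in> V" for x
  proof (rule zero_by_density[of w "%x. f x * q x - p x"])
    show "w \<in> polyfun" using w P by blast
    show "\<exists>x\<in>V. w x ~= 0" by (rule w(2))
    show "continuous_on V (%x. f x * q x - p x)" using r by (intro continuous_intros f polyfun_continuous) (auto simp: rep_def)
    show "f y * q y - p y = 0" if y: "y \<in> V" "w y ~= 0" for y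
    proof -
      have "y \<in> V - W" using y w(1) P(2) by (auto simp: zero_set_def)
      then have *: "q0 y ~= 0" "f y = p0 y / q0 y" using W(3) by auto
      have "f y * q y = (p0 y * q y) / q0 y" using * by simp
      also have "\<dots> = p y" using eq y(1) * by (simp flip: eq[rule_format])
      finally show ?thesis by simp
    qed
  qed (rule x)
  then show "\<exists>f. continuous_on V f & (\<forall>x\<in>V. f x * q x = p x)" using f by (intro exI[of _ f]) simp
next
  assume "\<exists>f. continuous_on V f & (\<forall>x\<in>V. f x * q x = p x)"
  then obtain f where f: "continuous_on V f" "\<forall>x\<in>V. f x * q x = p x" by blast
  have q: "p \<in> polyfun" "q \<in> polyfun" "\<exists>x\<in>V. q x ~= 0" using r by (auto simp: rep_def)
  have "algebraic_set (zero_set {q})" unfolding algebraic_set_def using q by (intro exI[of _ "{q}"]) auto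
  moreover have "V - zero_set {q} ~= {}" using q(3) by (auto simp: zero_set_def)
  moreover have "\<forall>x\<in>V - zero_set {q}. q x ~= 0 & f x = p x / q x" using f(2) by (auto simp: zero_set_def field_simps)
  ultimately show "cl p q \<in> R0 V" unfolding R0_def cl_def using q f(1) by blast
qed

lemma R0_cases:
  assumes "C \<in> R0 V"
  obtains p q f where "C = cl p q" "rep p q" "continuous_on V f" "\<forall>x\<in>V. f x * q x = p x"
proof -
  obtain p q where C: "C = cl p q" "p \<in> polyfun" "q \<in> polyfun" "\<exists>x\<in>V. q x ~= 0"
    using assms unfolding R0_def cl_def by blast
  then have "rep p q" by (simp add: rep_def)
  then show ?thesis using R0_class assms C(1) that by blast
qed

text \<open>The continuous function of a class in \<open>R0 V\<close>, unique on \<open>V\<close> by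
  density; outside \<open>V\<close> its values are arbitrary.\<close>

definition fn :: "'n rfrep set => real^'n => real" where
  "fn C = (SOME f. continuous_on V f & (\<exists>p q. C = cl p q & rep p q & (\<forall>x\<in>V. f x * q x = p x)))"

lemma fn_continuous: "C \<in> R0 V ==> continuous_on V (fn C)"
  and fn_ex: "C \<in> R0 V ==> \<exists>p q. C = cl p q & rep p q & (\<forall>x\<in>V. fn C x * q x = p x)"
proof -
  assume "C \<in> R0 V"
  then obtain p q f where "C = cl p q" "rep p q" "continuous_on V f" "\<forall>x\<in>V. f x * q x = p x" by (rule R0_cases)
  then have "\<exists>f. continuous_on V f & (\<exists>p q. C = cl p q & rep p q & (\<forall>x\<in>V. f x * q x = p x))" by blast
  from someI_ex[OF this]
  show "continuous_on V (fn C)" "\<exists>p q. C = cl p q & rep p q & (\<forall>x\<in>V. fn C x * q x = p x)" unfolding fn_def by blast+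
qed

lemma fn_unique:
  assumes f: "continuous_on V f" "continuous_on V g" and q: "q \<in> polyfun" "\<exists>x\<in>V. q x ~= 0" and e: "!!x. x \<in> V ==> f x * q x = g x * q x"
    and x: "x \<in> V"
  shows "f x = (g x :: real)"
proof -
  have "f x - g x = 0"
    by (rule zero_by_density[OF q _ _ x, of "%x. f x - g x"]) (use f e in \<open>auto intro: continuous_intros\<close>)
  then show ?thesis by simp
qed

lemma fn_class:
  assumes C: "cl p q \<in> R0 V" and r: "rep p q" and x: "x \<in> V"
  shows "fn (cl p q) x * q x = p x"
proof -
  obtain p0 q0 where 0: "cl p q = cl p0 q0" "rep p0 q0" "\<forall>x\<in>V. fn (cl p q) x * q0 x = p0 x" using fn_ex[OF C] by blast
  have eq: "\<forall>x\<in>V. p x * q0 x = p0 x * q x" using 0(1) class_eq[OF r 0(2)] by simp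
  show ?thesis
  proof (rule fn_unique[of "%x. fn (cl p q) x * q x" p q0])
    show "continuous_on V (%x. fn (cl p q) x * q x)" using r by (intro continuous_intros fn_continuous[OF C] polyfun_continuous) (simp add: rep_def)
    show "continuous_on V p" using r by (intro polyfun_continuous) (simp add: rep_def)
    fix y assume y: "y \<in> V"
    have "fn (cl p q) y * q y * q0 y = (fn (cl p q) y * q0 y) * q y" by simp
    also have "\<dots> = p y * q0 y" using 0(3) eq y by simp
    finally show "fn (cl p q) y * q y * q0 y = p y * q0 y" .
  qed (use 0(2) x in \<open>auto simp: rep_def\<close>)
qed

lemma fn_eqI:
  assumes r: "rep p q" and f: "continuous_on V f" "!!x. x \<in> V ==> f x * q x = p x"
  shows "cl p q \<in> R0 V" "x \<in> V ==> fn (cl p q) x = f x"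
proof -
  show C: "cl p q \<in> R0 V" using R0_class[OF r] f by blast
  assume x: "x \<in> V"
  show "fn (cl p q) x = f x"
    by (rule fn_unique[OF fn_continuous[OF C] f(1) _ _ _ x, of q]) (use r f(2) fn_class[OF C r] in \<open>auto simp: rep_def\<close>)
qed

lemma R0_mult:
  assumes C: "C \<in> R0 V" "D \<in> R0 V"
  shows "rf_mult V C D \<in> R0 V" "x \<in> V ==> fn (rf_mult V C D) x = fn C x * fn D x"
proof -
  obtain p q where p: "C = cl p q" "rep p q" "\<forall>x\<in>V. fn C x * q x = p x" using fn_ex[OF C(1)] by blast
  obtain p' q' where p': "D = cl p' q'" "rep p' q'" "\<forall>x\<in>V. fn D x * q' x = p' x" using fn_ex[OF C(2)] by blast
  have e: "rf_mult V C D = cl (%x. p x * p' x) (%x. q x * q' x)" unfolding p(1) p'(1) by (rule mult_class[OF p(2) p'(2)])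
  have c: "continuous_on V (%x. fn C x * fn D x)" by (intro continuous_intros fn_continuous C)
  have *: "(fn C x * fn D x) * (q x * q' x) = p x * p' x" if "x \<in> V" for x using p(3) p'(3) that by (simp add: mult_ac flip: p(3)[rule_format] p'(3)[rule_format])
  show "rf_mult V C D \<in> R0 V" "x \<in> V ==> fn (rf_mult V C D) x = fn C x * fn D x"
    unfolding e using fn_eqI[OF rep_mult[OF p(2) p'(2)] c *] by blast+
qed

lemma R0_add:
  assumes C: "C \<in> R0 V" "D \<in> R0 V"
  shows "rf_add V C D \<in> R0 V" "x \<in> V ==> fn (rf_add V C D) x = fn C x + fn D x"
proof -
  obtain p q where p: "C = cl p q" "rep p q" "\<forall>x\<in>V. fn C x * q x = p x" using fn_ex[OF C(1)] by blast
  obtain p' q' where p': "D = cl p' q'" "rep p' q'" "\<forall>x\<in>V. fn D x * q' x = p' x" using fn_ex[OF C(2)] by blast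
  have e: "rf_add V C D = cl (%x. p x * q' x + p' x * q x) (%x. q x * q' x)" unfolding p(1) p'(1) by (rule add_class[OF p(2) p'(2)])
  have c: "continuous_on V (%x. fn C x + fn D x)" by (intro continuous_intros fn_continuous C)
  have *: "(fn C x + fn D x) * (q x * q' x) = p x * q' x + p' x * q x" if "x \<in> V" for x
    using that by (simp add: algebra_simps flip: p(3)[rule_format] p'(3)[rule_format])
  show "rf_add V C D \<in> R0 V" "x \<in> V ==> fn (rf_add V C D) x = fn C x + fn D x"
    unfolding e using fn_eqI[OF rep_add[OF p(2) p'(2)] c *] by blast+
qed

lemma cp_R0:
  assumes p: "p \<in> polyfun" shows "cp p \<in> R0 V" "x \<in> V ==> fn (cp p) x = p x"
  using fn_eqI[OF rep_one[OF p] polyfun_continuous[OF p, of V]] by auto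

section \<open>Arcs, described by their values on polynomials\<close>

definition arc :: "((real^'n => real) => real fps) => bool" where
  "arc \<Phi> \<longleftrightarrow> (\<forall>p\<in>polyfun. \<Phi> p \<in> fps_alg) & (\<forall>c. \<Phi> (%_. c) = fps_const c) &
    (\<forall>p\<in>polyfun. \<forall>q\<in>polyfun. \<Phi> (%x. p x + q x) = \<Phi> p + \<Phi> q & \<Phi> (%x. p x * q x) = \<Phi> p * \<Phi> q &
      ((\<forall>x\<in>V. p x = q x) --> \<Phi> p = \<Phi> q))"

lemma arc_simps:
  assumes "arc \<Phi>"
  shows "p \<in> polyfun ==> \<Phi> p \<in> fps_alg" "\<Phi> (%_. c) = fps_const c"
    "p \<in> polyfun ==> q \<in> polyfun ==> \<Phi> (%x. p x + q x) = \<Phi> p + \<Phi> q"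
    "p \<in> polyfun ==> q \<in> polyfun ==> \<Phi> (%x. p x * q x) = \<Phi> p * \<Phi> q"
    "p \<in> polyfun ==> q \<in> polyfun ==> (!!x. x \<in> V ==> p x = q x) ==> \<Phi> p = \<Phi> q"
  using assms unfolding arc_def by blast+

text \<open>An algebraic arc converges to an actual curve, which stays in \<open>V\<close> on both
  sides of 0 since finitely many equations hold as identities of series. Values of functions along
  it then replace formal manipulations.\<close>

lemma arc_curve:
  assumes a: "arc \<Phi>"
  shows "\<exists>c. (\<forall>p\<in>polyfun. (%s. p (c s)) has_fps_expansion \<Phi> p) & (\<forall>\<^sub>F s in nhds (0::real). c s \<in> V) &
    c 0 \<in> V & (c \<longlongrightarrow> c 0) (at 0)"
proof -
  define c where "c s = (\<chi> i. eval_fps (\<Phi> (%x. x $ i)) s)" for s :: real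
  have ex: "(%s. p (c s)) has_fps_expansion \<Phi> p" if "p \<in> polyfun" for p
    using that
  proof induction
    case (pf_const k)
    show ?case by (simp add: arc_simps(2)[OF a])
  next
    case (pf_coord i)
    have "0 < fps_conv_radius (\<Phi> (%x. x $ i))" by (intro fps_alg_conv_radius arc_simps(1)[OF a] polyfun.pf_coord)
    then have "eval_fps (\<Phi> (%x. x $ i)) has_fps_expansion \<Phi> (%x. x $ i)" by (rule eval_fps_has_fps_expansion)
    then show ?case by (simp add: c_def)
  next
    case (pf_add p q)
    show ?case unfolding arc_simps(3)[OF a pf_add.hyps] by (rule has_fps_expansion_add[OF pf_add.IH])
  next
    case (pf_mult p q)
    show ?case unfolding arc_simps(4)[OF a pf_mult.hyps] by (rule has_fps_expansion_mult[OF pf_mult.IH])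
  qed
  obtain F where F: "finite F" "F \<subseteq> polyfun" "V = zero_set F" using algebraic_set_finite[OF algebraic] by blast
  have "\<forall>\<^sub>F s in nhds 0. \<forall>p\<in>F. p (c s) = 0"
  proof (rule eventually_ball_finite[OF F(1)], rule ballI)
    fix p assume p: "p \<in> F"
    then have pp: "p \<in> polyfun" using F by blast
    have "\<Phi> p = \<Phi> (%_. 0)" by (rule arc_simps(5)[OF a pp polyfun.pf_const]) (use p F(3) in \<open>auto simp: zero_set_def\<close>)
    then have "\<Phi> p = 0" by (simp add: arc_simps(2)[OF a])
    then have "\<forall>\<^sub>F s in nhds 0. eval_fps 0 s = p (c s)" using ex[OF pp] by (simp add: has_fps_expansion_def)
    then show "\<forall>\<^sub>F s in nhds 0. p (c s) = 0" by eventually_elim simp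
  qed
  then have inV: "\<forall>\<^sub>F s in nhds 0. c s \<in> V" by eventually_elim (simp add: F(3) zero_set_def)
  have "c 0 \<in> V" by (rule eventually_nhds_x_imp_x[OF inV])
  moreover have "(c \<longlongrightarrow> c 0) (at 0)"
  proof (rule vec_tendstoI)
    fix i
    have "continuous (at 0) (%s. c s $ i)" by (rule has_fps_expansion_imp_continuous[OF ex[OF polyfun.pf_coord]])
    then show "((%s. c s $ i) \<longlongrightarrow> c 0 $ i) (at 0)" by (simp add: isCont_def)
  qed
  ultimately show ?thesis using ex inV by (intro exI[of _ c] conjI ballI) simp_all
qed

text \<open>The field is non-degenerate for \<open>q\<close> at the starting point of the arc, so
  some derivative has a series with non-zero constant term; the least index with a non-zero series
  may be smaller.\<close>

lemma arc_transversal: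
  assumes a: "arc \<Phi>" and q: "q \<in> polyfun" "\<exists>x\<in>V. q x ~= 0"
  obtains X k where "tangent_field V X" "!!i p. p \<in> polyfun ==> (dv X ^^ i) p \<in> polyfun"
    "\<Phi> ((dv X ^^ k) q) ~= 0" "!!i. i < k ==> \<Phi> ((dv X ^^ i) q) = 0"
proof -
  from arc_curve[OF a] obtain c where c0: "\<forall>p\<in>polyfun. (%s. p (c s)) has_fps_expansion \<Phi> p" "c (0::real) \<in> V"
    by (elim exE conjE) (rule that; assumption)
  note c = c0(1)[THEN bspec] c0(2)
  obtain X k0 where X: "tangent_field V X" "(dv X ^^ k0) q (c 0) ~= 0" using nondegenerate_direction[OF irreducible rank c(2) q] by blast
  have Xpf: "!!i. (%x. X x $ i) \<in> polyfun" using X by (simp add: tangent_field_def)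
  have dp: "(dv X ^^ i) p \<in> polyfun" if "p \<in> polyfun" for i p by (rule dv_pow_polyfun[OF Xpf that])
  have ne: "\<Phi> ((dv X ^^ k0) q) ~= 0"
  proof
    assume "\<Phi> ((dv X ^^ k0) q) = 0"
    then have "(dv X ^^ k0) q (c 0) = 0" using has_fps_expansion_at_0[OF c(1)[OF dp[OF q(1), of k0]]] by simp
    then show False using X(2) by simp
  qed
  define k where "k = (LEAST k. \<Phi> ((dv X ^^ k) q) ~= 0)"
  have "\<Phi> ((dv X ^^ k) q) ~= 0" unfolding k_def by (rule LeastI[of _ k0]) (rule ne)
  moreover have "\<Phi> ((dv X ^^ i) q) = 0" if "i < k" for i using not_less_Least[OF that[unfolded k_def]] by simp
  ultimately show ?thesis using that X(1) dp by blast
qed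

lemma quotient_identity:
  assumes X: "tangent_field V X" and r: "rep p q" and C: "cl p q \<in> R0 V" and x: "x \<in> V" and z: "!!i. i < k ==> (dv X ^^ i) q x = 0"
  shows "fn (cl p q) x * (dv X ^^ k) q x = (dv X ^^ k) p x"
proof (rule quotient_along_trajectory[OF algebraic X x])
  show "fn (cl p q) y * q y = p y" if "y \<in> V" for y by (rule fn_class[OF C r that])
qed (use r z fn_continuous[OF C] in \<open>auto simp: rep_def\<close>)

text \<open>The lower derivatives vanish at every point of the curve near 0, so
  \<open>quotient_identity\<close> holds there and the function becomes the quotient of the series
  of \<open>b\<close> by that of \<open>u\<close>. Continuity bounds this quotient, hence it is a
  power series, and algebraic by division.\<close>

lemma arc_composition:
  assumes a: "arc \<Phi>" and c: "!!p. p \<in> polyfun ==> (%s. p (c s)) has_fps_expansion \<Phi> p" "\<forall>\<^sub>F s in nhds (0::real). c s \<in> V"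
    "c 0 \<in> V" "(c \<longlongrightarrow> c 0) (at 0)" and C: "C \<in> R0 V"
  shows "\<exists>Y\<in>fps_alg. (%s. fn C (c s)) has_fps_expansion Y"
proof -
  obtain p q where p: "C = cl p q" "rep p q" by (rule R0_cases[OF C])
  have q: "q \<in> polyfun" "\<exists>x\<in>V. q x ~= 0" and pp: "p \<in> polyfun" using p(2) by (auto simp: rep_def)
  obtain X k where X: "tangent_field V X" "!!i p. p \<in> polyfun ==> (dv X ^^ i) p \<in> polyfun"
    "\<Phi> ((dv X ^^ k) q) ~= 0" "!!i. i < k ==> \<Phi> ((dv X ^^ i) q) = 0" by (rule arc_transversal[OF a q]) blast
  define u where "u = (dv X ^^ k) q"
  define b where "b = (dv X ^^ k) p"
  have ub: "u \<in> polyfun" "b \<in> polyfun" using X(2) q pp by (auto simp: u_def b_def)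
  have "\<forall>\<^sub>F s in nhds 0. \<forall>i\<in>{..<k}. (dv X ^^ i) q (c s) = 0"
  proof (rule eventually_ball_finite, simp, rule ballI)
    fix i assume "i \<in> {..<k}"
    then have "\<forall>\<^sub>F s in nhds 0. eval_fps 0 s = (dv X ^^ i) q (c s)" using c(1)[OF X(2)[OF q(1)], of i] X(4)[of i] by (simp add: has_fps_expansion_def)
    then show "\<forall>\<^sub>F s in nhds 0. (dv X ^^ i) q (c s) = 0" by eventually_elim simp
  qed
  then have id: "\<forall>\<^sub>F s in nhds 0. fn C (c s) * u (c s) = b (c s)"
    using c(2)
  proof eventually_elim
    case (elim s)
    show ?case unfolding u_def b_def p(1) by (rule quotient_identity[OF X(1) p(2)]) (use elim C p in auto)
  qed
  have fl: "((%s. fn C (c s)) \<longlongrightarrow> fn C (c 0)) (at 0)"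
  proof -
    have "\<forall>\<^sub>F s in at 0. c s \<in> V" using c(2) by (simp add: eventually_nhds_conv_at)
    then show ?thesis using fn_continuous[OF C] c(3,4) by (intro continuous_on_tendsto_compose[of V "fn C" c])
  qed
  define K where "K = \<bar>fn C (c 0)\<bar> + 1"
  have "((%s. \<bar>fn C (c s)\<bar>) \<longlongrightarrow> \<bar>fn C (c 0)\<bar>) (at 0)" by (intro tendsto_intros fl)
  then have "\<forall>\<^sub>F s in at 0. \<bar>fn C (c s)\<bar> < K" by (rule order_tendstoD(2)) (simp add: K_def)
  moreover have idat: "\<forall>\<^sub>F s in at 0. fn C (c s) * u (c s) = b (c s)" using id by (simp add: eventually_nhds_conv_at)
  ultimately have bd: "\<forall>\<^sub>F s in at 0. norm (b (c s)) \<le> K * norm (u (c s))"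
  proof eventually_elim
    case (elim s)
    have "norm (b (c s)) = \<bar>fn C (c s)\<bar> * \<bar>u (c s)\<bar>" by (simp flip: elim(2) add: abs_mult)
    also have "\<dots> \<le> K * \<bar>u (c s)\<bar>" using elim(1) by (intro mult_right_mono) auto
    finally show ?case by simp
  qed
  then obtain d where d: "0 < d" "\<forall>s. s ~= 0 & dist s 0 < d --> norm (b (c s)) \<le> K * norm (u (c s))" unfolding eventually_at by auto
  define sq where "sq n = d / 2 * (1 / real (Suc n))" for n
  have sq: "0 < sq n" "sq n < d" for n
  proof -
    show "0 < sq n" using d(1) by (simp add: sq_def)
    have "d / 2 * (1 / real (Suc n)) \<le> d / 2 * 1" using d(1) by (intro mult_left_mono) auto
    then show "sq n < d" using d(1) unfolding sq_def by linarith
  qed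
  have "(%n. d / 2 * (1 / real (Suc n))) \<longlonglongrightarrow> d / 2 * 0"
    by (intro tendsto_mult tendsto_const) (use LIMSEQ_inverse_real_of_nat in \<open>simp add: inverse_eq_divide\<close>)
  then have sq0: "sq \<longlonglongrightarrow> 0" unfolding sq_def[abs_def] mult_zero_right .
  have "\<exists>Y. fps_conv_radius Y > 0 & \<Phi> u * Y = \<Phi> b"
  proof (rule fps_quotient_of_bounded[OF c(1)[OF ub(2)] c(1)[OF ub(1)] _ sq0])
    show "\<Phi> u ~= 0" using X(3) by (simp add: u_def)
    show "sq n ~= 0" for n using sq(1)[of n] by simp
    show "norm (b (c (sq n))) \<le> K * norm (u (c (sq n)))" for n
      using d(2)[rule_format, of "sq n"] sq[of n] by (simp add: dist_real_def)
  qed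
  then obtain Y where Y: "fps_conv_radius Y > 0" "\<Phi> u * Y = \<Phi> b" by blast
  have U0: "\<Phi> u ~= 0" using X(3) by (simp add: u_def)
  have "Y \<in> fps_alg" unfolding fps_alg_iff
  proof (rule pp.algebraic_divide[of 1 "\<Phi> u"])
    show "pp.algebraic 1 (\<Phi> u)" "pp.algebraic 1 (\<Phi> u * Y)" using arc_simps(1)[OF a ub(1)] arc_simps(1)[OF a ub(2)] unfolding Y(2) fps_alg_iff .
  qed (rule U0)
  moreover have "(%s. fn C (c s)) has_fps_expansion Y"
  proof (rule has_fps_expansion_eventually_eq)
    show Yx: "eval_fps Y has_fps_expansion Y" using Y(1) by (rule eval_fps_has_fps_expansion)
    have "(%s. u (c s) * eval_fps Y s) has_fps_expansion \<Phi> b" unfolding Y(2)[symmetric] by (rule has_fps_expansion_mult[OF c(1)[OF ub(1)] Yx])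
    then have "\<forall>\<^sub>F s in nhds 0. eval_fps (\<Phi> b) s = u (c s) * eval_fps Y s" by (simp add: has_fps_expansion_def)
    moreover have "\<forall>\<^sub>F s in nhds 0. eval_fps (\<Phi> b) s = b (c s)" using c(1)[OF ub(2)] by (simp add: has_fps_expansion_def)
    ultimately have "\<forall>\<^sub>F s in nhds 0. u (c s) * eval_fps Y s = u (c s) * fn C (c s)" using id by eventually_elim (metis mult.commute)
    then have 1: "\<forall>\<^sub>F s in at 0. u (c s) * eval_fps Y s = u (c s) * fn C (c s)" by (simp add: eventually_nhds_conv_at)
    have lt: "fps_nth (\<Phi> u) i = 0" if "i < subdegree (\<Phi> u)" for i using that by (rule nth_less_subdegree_zero)
    have "((%s. u (c s) / s ^ subdegree (\<Phi> u)) \<longlongrightarrow> fps_nth (\<Phi> u) (subdegree (\<Phi> u))) (at 0)"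
      by (rule has_fps_expansion_lim[OF c(1)[OF ub(1)] lt])
    moreover have "fps_nth (\<Phi> u) (subdegree (\<Phi> u)) ~= 0" using U0 by simp
    ultimately have 2: "\<forall>\<^sub>F s in at 0. u (c s) / s ^ subdegree (\<Phi> u) ~= 0" by (rule tendsto_imp_eventually_ne)
    have ev: "\<forall>\<^sub>F s in at 0. eval_fps Y s = fn C (c s)" using 1 2 by eventually_elim auto
    \<comment> \<open>The quotient identifies the values only for \<open>s\<close> other than 0; the
      value at 0 follows by continuity of both sides.\<close>
    have "((%s. eval_fps Y s) \<longlongrightarrow> eval_fps Y 0) (at 0)" using has_fps_expansion_imp_continuous[OF Yx, of UNIV] by (simp add: isCont_def)
    then have "((%s. fn C (c s)) \<longlongrightarrow> eval_fps Y 0) (at 0)" using ev by (rule Lim_transform_eventually)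
    then have "eval_fps Y 0 = fn C (c 0)" using fl by (rule tendsto_unique[OF trivial_limit_at])
    then show "\<forall>\<^sub>F s in nhds 0. eval_fps Y s = fn C (c s)" using ev by (simp add: eventually_nhds_conv_at)
  qed
  ultimately show ?thesis by blast
qed

theorem R0_extension:
  assumes a: "arc \<Phi>"
  shows "\<exists>\<Psi>. (\<forall>C\<in>R0 V. \<Psi> C \<in> fps_alg) & (\<forall>C\<in>R0 V. \<forall>D\<in>R0 V. \<Psi> (rf_add V C D) = \<Psi> C + \<Psi> D & \<Psi> (rf_mult V C D) = \<Psi> C * \<Psi> D) &
     (\<forall>p\<in>polyfun. \<Psi> (cp p) = \<Phi> p)"
proof -
  from arc_curve[OF a] obtain c where c0: "\<forall>p\<in>polyfun. (%s. p (c s)) has_fps_expansion \<Phi> p" "\<forall>\<^sub>F s in nhds (0::real). c s \<in> V"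
    "c 0 \<in> V" "(c \<longlongrightarrow> c 0) (at 0)" by (elim exE conjE) (rule that; assumption)
  note c = c0(1)[THEN bspec] c0(2-4)
  have "\<forall>C\<in>R0 V. \<exists>Y. Y \<in> fps_alg & (%s. fn C (c s)) has_fps_expansion Y" using arc_composition[OF a c] by blast
  from bchoice[OF this] obtain \<Psi> where P: "\<forall>C\<in>R0 V. \<Psi> C \<in> fps_alg & (%s. fn C (c s)) has_fps_expansion \<Psi> C" ..
  have "\<Psi> (rf_add V C D) = \<Psi> C + \<Psi> D" if CD: "C \<in> R0 V" "D \<in> R0 V" for C D
  proof (rule has_fps_expansion_unique)
    show "(%s. fn (rf_add V C D) (c s)) has_fps_expansion \<Psi> (rf_add V C D)" using P R0_add(1)[OF CD] by blast
    have "(%s. fn C (c s) + fn D (c s)) has_fps_expansion \<Psi> C + \<Psi> D" using P CD by (intro has_fps_expansion_add) auto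
    then show "(%s. fn (rf_add V C D) (c s)) has_fps_expansion \<Psi> C + \<Psi> D"
      by (rule has_fps_expansion_eventually_eq) (use c(2) in eventually_elim, simp add: R0_add(2)[OF CD])
  qed
  moreover have "\<Psi> (rf_mult V C D) = \<Psi> C * \<Psi> D" if CD: "C \<in> R0 V" "D \<in> R0 V" for C D
  proof (rule has_fps_expansion_unique)
    show "(%s. fn (rf_mult V C D) (c s)) has_fps_expansion \<Psi> (rf_mult V C D)" using P R0_mult(1)[OF CD] by blast
    have "(%s. fn C (c s) * fn D (c s)) has_fps_expansion \<Psi> C * \<Psi> D" using P CD by (intro has_fps_expansion_mult) auto
    then show "(%s. fn (rf_mult V C D) (c s)) has_fps_expansion \<Psi> C * \<Psi> D"
      by (rule has_fps_expansion_eventually_eq) (use c(2) in eventually_elim, simp add: R0_mult(2)[OF CD])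
  qed
  moreover have "\<Psi> (cp p) = \<Phi> p" if p: "p \<in> polyfun" for p
  proof (rule has_fps_expansion_unique)
    show "(%s. fn (cp p) (c s)) has_fps_expansion \<Psi> (cp p)" using P cp_R0(1)[OF p] by blast
    show "(%s. fn (cp p) (c s)) has_fps_expansion \<Phi> p"
      by (rule has_fps_expansion_eventually_eq[OF c(1)[OF p]]) (use c(2) in eventually_elim, simp add: cp_R0(2)[OF p])
  qed
  ultimately show ?thesis using P by (intro exI[of _ \<Psi>]) blast
qed

end

section \<open>Puiseux series\<close>

text \<open>The Puiseux series F(t^(1/m)). Computations with Puiseux series are moved to power
  series by choosing a common \<open>m\<close>.\<close>

definition pu_of_fps :: "nat => real fps => rat => real" where
  "pu_of_fps m F r = (if \<exists>i::nat. r = of_nat i / of_nat m then fps_nth F (nat \<lfloor>r * of_nat m\<rfloor>) else 0)"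

lemma pu_of_fps_nth: "0 < m ==> pu_of_fps m F (of_nat i / of_nat m) = fps_nth F i"
  unfolding pu_of_fps_def by auto

lemma pu_of_fps_other: "(!!i::nat. r ~= of_nat i / of_nat m) ==> pu_of_fps m F r = 0"
  unfolding pu_of_fps_def by auto

lemma pu_of_fps_cases:
  assumes "!!i. r = of_nat i / of_nat m ==> P" "(!!i::nat. r ~= of_nat i / of_nat m) ==> P"
  shows P
  using assms by blast

lemma pu_of_fps_inj: "0 < m ==> pu_of_fps m F = pu_of_fps m G ==> F = G"
  by (rule fps_ext) (metis pu_of_fps_nth)

lemma pu_of_fps_add: "0 < m ==> pu_of_fps m (F + G) = (%r. pu_of_fps m F r + pu_of_fps m G r)"
  by (rule ext) (simp add: pu_of_fps_def)

lemma pu_of_fps_0: "pu_of_fps m 0 = (%_. 0)"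
  by (rule ext) (simp add: pu_of_fps_def)

lemma pu_of_fps_sum: "0 < m ==> pu_of_fps m (\<Sum>k\<in>I. F k) r = (\<Sum>k\<in>I. pu_of_fps m (F k) r)"
  by (induction I rule: infinite_finite_induct) (simp_all add: pu_of_fps_0 pu_of_fps_add)

lemma pu_of_fps_const: "0 < m ==> pu_of_fps m (fps_const a) = pu_const a"
proof (rule ext)
  fix r :: rat assume m: "0 < m"
  show "pu_of_fps m (fps_const a) r = pu_const a r"
  proof (rule pu_of_fps_cases[of r m])
    fix i assume r: "r = of_nat i / of_nat m"
    have "pu_of_fps m (fps_const a) r = fps_nth (fps_const a) i" unfolding r by (rule pu_of_fps_nth[OF m])
    then show ?thesis using m by (cases i) (simp_all add: pu_const_def r)
  next
    assume o: "!!i::nat. r ~= of_nat i / of_nat m"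
    have "r ~= 0" using o[of 0] by simp
    then show ?thesis using pu_of_fps_other[OF o] by (simp add: pu_const_def)
  qed
qed

lemma pu_of_fps_mult:
  assumes m: "0 < m"
  shows "pu_of_fps m (F * G) = pu_mult (pu_of_fps m F) (pu_of_fps m G)"
proof (rule ext)
  fix r :: rat
  let ?S = "{s. 0 \<le> s & s \<le> r & pu_of_fps m F s ~= 0}"
  have form: "\<exists>j::nat. s = of_nat j / of_nat m" if "pu_of_fps m F s ~= 0" for s
    using that by (auto simp: pu_of_fps_def split: if_splits)
  have m0: "(of_nat m :: rat) > 0" using m by simp
  show "pu_of_fps m (F * G) r = pu_mult (pu_of_fps m F) (pu_of_fps m G) r"
  proof (rule pu_of_fps_cases[of r m])
    fix i assume r: "r = of_nat i / of_nat m"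
    have S: "?S = (%j::nat. of_nat j / of_nat m) ` {j. j \<le> i & fps_nth F j ~= 0}"
    proof (intro equalityI subsetI)
      fix s assume s: "s \<in> ?S"
      then obtain j :: nat where j: "s = of_nat j / of_nat m" using form by blast
      have "(of_nat j :: rat) \<le> of_nat i" using s m0 unfolding j r by (simp add: divide_le_cancel)
      moreover have "fps_nth F j ~= 0" using s unfolding j by (simp add: pu_of_fps_nth[OF m])
      ultimately show "s \<in> (%j::nat. of_nat j / of_nat m) ` {j. j \<le> i & fps_nth F j ~= 0}" using j by auto
    next
      fix s assume "s \<in> (%j::nat. of_nat j / of_nat m :: rat) ` {j. j \<le> i & fps_nth F j ~= 0}"
      then obtain j where j: "s = of_nat j / of_nat m" "j \<le> i" "fps_nth F j ~= 0" by blast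
      then show "s \<in> ?S" using m0 unfolding j(1) r by (simp add: pu_of_fps_nth[OF m] divide_le_cancel)
    qed
    have inj: "inj_on (%j::nat. of_nat j / of_nat m :: rat) A" for A using m by (auto simp: inj_on_def)
    have "pu_mult (pu_of_fps m F) (pu_of_fps m G) r = (\<Sum>j\<in>{j. j \<le> i & fps_nth F j ~= 0}. fps_nth F j * pu_of_fps m G (r - of_nat j / of_nat m))"
      unfolding pu_mult_def S sum.reindex[OF inj] o_def by (simp add: pu_of_fps_nth[OF m])
    also have "\<dots> = (\<Sum>j\<in>{j. j \<le> i & fps_nth F j ~= 0}. fps_nth F j * fps_nth G (i - j))"
    proof (rule sum.cong[OF refl])
      fix j assume "j \<in> {j. j \<le> i & fps_nth F j ~= 0}"
      then have "r - of_nat j / of_nat m = of_nat (i - j) / of_nat m" by (simp add: r of_nat_diff diff_divide_distrib)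
      then show "fps_nth F j * pu_of_fps m G (r - of_nat j / of_nat m) = fps_nth F j * fps_nth G (i - j)"
        by (simp only: pu_of_fps_nth[OF m])
    qed
    also have "\<dots> = (\<Sum>j=0..i. fps_nth F j * fps_nth G (i - j))"
      by (rule sum.mono_neutral_left) auto
    finally show ?thesis unfolding r by (simp add: pu_of_fps_nth[OF m] fps_mult_nth)
  next
    assume o: "!!i::nat. r ~= of_nat i / of_nat m"
    have "pu_of_fps m F s * pu_of_fps m G (r - s) = 0" if s: "s \<in> ?S" for s
    proof -
      obtain j :: nat where j: "s = of_nat j / of_nat m" using form s by blast
      have "r - s ~= of_nat i / of_nat m" for i :: nat
      proof
        assume "r - s = of_nat i / of_nat m"
        then have "r = of_nat (i + j) / of_nat m" unfolding j by (simp add: add_divide_distrib diff_eq_eq)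
        then show False using o by blast
      qed
      then show ?thesis by (simp add: pu_of_fps_other)
    qed
    then show ?thesis unfolding pu_mult_def pu_of_fps_other[OF o] by (intro sum.neutral[symmetric]) blast
  qed
qed

lemma pu_of_fps_stretch:
  assumes m: "0 < m" and k: "0 < k"
  shows "pu_of_fps (m * k) (fps_stretch k F) = pu_of_fps m F"
proof (rule ext)
  fix r :: rat
  have mk: "0 < m * k" using m k by simp
  show "pu_of_fps (m * k) (fps_stretch k F) r = pu_of_fps m F r"
  proof (rule pu_of_fps_cases[of r m])
    fix i assume r: "r = of_nat i / of_nat m"
    have r2: "r = of_nat (i * k) / of_nat (m * k)" unfolding r using m k by (simp add: field_simps)
    have "pu_of_fps (m * k) (fps_stretch k F) r = fps_nth (fps_stretch k F) (i * k)" unfolding r2 by (rule pu_of_fps_nth[OF mk])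
    also have "\<dots> = fps_nth F i" using k by (simp add: fps_stretch_def)
    finally show ?thesis unfolding r by (simp add: pu_of_fps_nth[OF m])
  next
    assume o: "!!i::nat. r ~= of_nat i / of_nat m"
    have "pu_of_fps (m * k) (fps_stretch k F) r = 0"
    proof (rule pu_of_fps_cases[of r "m * k"])
      fix i assume r: "r = of_nat i / of_nat (m * k)"
      have "\<not> k dvd i"
      proof
        assume "k dvd i"
        then obtain j where "i = k * j" ..
        then have "r = of_nat j / of_nat m" unfolding r using m k by (simp add: field_simps)
        then show False using o by blast
      qed
      then show ?thesis unfolding r pu_of_fps_nth[OF mk] by (simp add: fps_stretch_def)
    qed (rule pu_of_fps_other)
    then show ?thesis using pu_of_fps_other[OF o] by simp
  qed
qed

lemma fps_stretch_poly:
  assumes m: "0 < m"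
  shows "fps_of_poly (pcompose a (monom 1 m)) = fps_stretch m (fps_of_poly a)"
proof (induction a)
  case 0
  show ?case by (rule fps_ext) (simp add: fps_stretch_def)
next
  case (pCons a p)
  show ?case
  proof (rule fps_ext)
    fix n
    have "fps_nth (fps_of_poly (pcompose (pCons a p) (monom 1 m))) n = fps_nth (fps_const a + fps_X ^ m * fps_stretch m (fps_of_poly p)) n"
      by (simp only: pcompose_pCons fps_of_poly_add fps_of_poly_mult fps_of_poly_const fps_of_poly_monom pCons.IH fps_const_1_eq_1 mult_1)
    also have "\<dots> = fps_nth (fps_stretch m (fps_of_poly (pCons a p))) n"
    proof (cases "n < m")
      case True
      then show ?thesis using m by (cases "n = 0") (auto simp: fps_X_power_mult_nth fps_stretch_def dest: dvd_imp_le)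
    next
      case False
      then obtain l where n: "n = m + l" using le_Suc_ex not_less by blast
      show ?thesis
      proof (cases "m dvd l")
        case True
        then obtain j where "l = m * j" ..
        moreover have "(m + m * j) div m = Suc j" using m by simp
        ultimately show ?thesis using m by (simp add: n fps_X_power_mult_nth fps_stretch_def)
      next
        case nd: False
        then show ?thesis using m by (auto simp: n fps_X_power_mult_nth fps_stretch_def)
      qed
    qed
    finally show "fps_nth (fps_of_poly (pcompose (pCons a p) (monom 1 m))) n = fps_nth (fps_stretch m (fps_of_poly (pCons a p))) n" .
  qed
qed

lemma pu_of_poly_eq:
  assumes m: "0 < m"
  shows "pu_of_poly a = pu_of_fps m (fps_of_poly (pcompose a (monom 1 m)))"
proof -
  have "pu_of_poly a = pu_of_fps 1 (fps_of_poly a)"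
    by (rule ext) (simp add: pu_of_poly_def pu_of_fps_def)
  then show ?thesis using pu_of_fps_stretch[of 1 m "fps_of_poly a"] m by (simp add: fps_stretch_poly)
qed

lemma pu_pow_of_fps: "0 < m ==> pu_pow (pu_of_fps m F) k = pu_of_fps m (F ^ k)"
proof (induction k)
  case 0
  show ?case using pu_of_fps_const[OF 0, of 1] by (simp add: pu_pow_def)
next
  case (Suc k)
  have "pu_pow (pu_of_fps m F) (Suc k) = pu_mult (pu_of_fps m F) (pu_pow (pu_of_fps m F) k)" by (simp add: pu_pow_def)
  then show ?case using Suc pu_of_fps_mult[OF Suc.prems, of F "F ^ k"] by simp
qed

lemma puiseux_form: "c \<in> puiseux \<longleftrightarrow> (\<exists>m>0. \<exists>F. c = pu_of_fps m F)"
proof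
  assume "c \<in> puiseux"
  then obtain m :: nat where m: "0 < m" "\<forall>r. c r ~= 0 --> (\<exists>i::nat. r = of_nat i / of_nat m)" by (auto simp: puiseux_def)
  have "c = pu_of_fps m (Abs_fps (%i. c (of_nat i / of_nat m)))"
  proof (rule ext)
    fix r show "c r = pu_of_fps m (Abs_fps (%i. c (of_nat i / of_nat m))) r"
    proof (rule pu_of_fps_cases[of r m])
      fix i assume r: "r = of_nat i / of_nat m"
      show ?thesis unfolding r pu_of_fps_nth[OF m(1)] by simp
    next
      assume o: "!!i::nat. r ~= of_nat i / of_nat m"
      then have "c r = 0" using m(2) by blast
      then show ?thesis using pu_of_fps_other[OF o] by simp
    qed
  qed
  then show "\<exists>m>0. \<exists>F. c = pu_of_fps m F" using m(1) by blast
next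
  assume "\<exists>m>0. \<exists>F. c = pu_of_fps m F"
  then obtain m F where "0 < m" "c = pu_of_fps m F" by blast
  then show "c \<in> puiseux" unfolding puiseux_def
    by (intro CollectI exI[of _ m]) (auto simp: pu_of_fps_def split: if_splits)
qed

text \<open>Under t = s^m polynomial coefficients in t become elements of
  \<open>pow_polys m\<close>, so algebraicity of the Puiseux series is algebraicity of
  \<open>F\<close> over that ring.\<close>

lemma pu_of_fps_algebraic:
  assumes m: "0 < m"
  shows "pu_of_fps m F \<in> puiseux_alg \<longleftrightarrow> F \<in> fps_alg"
proof -
  let ?c = "%a. fps_of_poly (pcompose a (monom 1 m)) :: real fps"
  have c0: "?c a = 0 \<longleftrightarrow> a = 0" for a
  proof -
    have "0 < degree (monom (1::real) m)" using m by (simp add: degree_monom_eq)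
    then have "pcompose a (monom 1 m) = 0 \<longleftrightarrow> a = 0" by (metis pcompose_0 pcompose_eq_0)
    then show ?thesis by simp
  qed
  have sum_eq: "(\<Sum>k\<le>N. pu_mult (pu_of_poly (a k)) (pu_pow (pu_of_fps m F) k) r) = pu_of_fps m (\<Sum>k\<le>N. ?c (a k) * F ^ k) r" for N a r
    unfolding pu_of_fps_sum[OF m] by (simp add: pu_of_poly_eq[OF m] pu_pow_of_fps[OF m] pu_of_fps_mult[OF m])
  have zero: "(\<forall>r. pu_of_fps m G r = 0) \<longleftrightarrow> G = 0" for G
  proof
    assume "\<forall>r. pu_of_fps m G r = 0"
    then have "pu_of_fps m G = pu_of_fps m 0" by (simp add: pu_of_fps_0 fun_eq_iff)
    then show "G = 0" by (rule pu_of_fps_inj[OF m])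
  qed (simp add: pu_of_fps_0)
  have pu: "pu_of_fps m F \<in> puiseux" using puiseux_form m by blast
  have "pu_of_fps m F \<in> puiseux_alg \<longleftrightarrow> (\<exists>N a. (\<exists>k\<le>N. a k ~= 0) & (\<Sum>k\<le>N. ?c (a k) * F ^ k) = 0)"
    using pu by (simp add: puiseux_alg_def sum_eq zero)
  also have "\<dots> \<longleftrightarrow> pp.algebraic m F"
  proof
    assume "\<exists>N a. (\<exists>k\<le>N. a k ~= 0) & (\<Sum>k\<le>N. ?c (a k) * F ^ k) = 0"
    then obtain N and a :: "nat => real poly" where a: "\<exists>k\<le>N. a k ~= 0" "(\<Sum>k\<le>N. ?c (a k) * F ^ k) = 0" by blast
    show "pp.algebraic m F" unfolding pp.algebraic_def
      by (rule exI[of _ N], rule exI[of _ "%k. ?c (a k)"]) (use a c0 in \<open>auto simp: pow_polys_def\<close>)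
  next
    assume "pp.algebraic m F"
    then obtain N c where c: "\<forall>k. c k \<in> pow_polys m" "\<exists>k\<le>N. c k ~= 0" "(\<Sum>k\<le>N. c k * F ^ k) = 0"
      unfolding pp.algebraic_def by blast
    have "\<forall>k. \<exists>a. c k = ?c a" using c(1) by (auto simp: pow_polys_def)
    from choice[OF this] obtain a where a: "\<forall>k. c k = ?c (a k)" ..
    have "\<exists>k\<le>N. a k ~= 0" using c(2) a c0 by auto
    moreover have "(\<Sum>k\<le>N. ?c (a k) * F ^ k) = 0" using c(3) a by simp
    ultimately show "\<exists>N a. (\<exists>k\<le>N. a k ~= 0) & (\<Sum>k\<le>N. ?c (a k) * F ^ k) = 0" by blast
  qed
  also have "\<dots> \<longleftrightarrow> F \<in> fps_alg" unfolding fps_alg_iff using algebraic_pow_polys_1 pow_polys_algebraic m by blast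
  finally show ?thesis .
qed

lemma puiseux_common_denominator:
  assumes "finite T" "!!i. i \<in> T ==> c i \<in> puiseux"
  shows "\<exists>m>0. \<forall>i\<in>T. \<exists>F. c i = pu_of_fps m F"
  using assms
proof (induction T rule: finite_induct)
  case empty
  show ?case by (intro exI[of _ 1]) simp
next
  case (insert i T)
  then obtain m where m: "0 < m" "\<forall>i\<in>T. \<exists>F. c i = pu_of_fps m F" by blast
  obtain k G where k: "0 < k" "c i = pu_of_fps k G" using insert.prems[of i] puiseux_form by blast
  have "\<exists>F. c j = pu_of_fps (m * k) F" if "j \<in> insert i T" for j
  proof (cases "j = i")
    case True
    then show ?thesis using pu_of_fps_stretch[OF k(1) m(1), of G] k(2) by (metis mult.commute)
  next
    case False
    then obtain F where "c j = pu_of_fps m F" using m(2) \<open>j \<in> insert i T\<close> by blast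
    then show ?thesis using pu_of_fps_stretch[OF m(1) k(1), of F] by metis
  qed
  then show ?case using m(1) k(1) by (intro exI[of _ "m * k"]) auto
qed

lemma pu_mult_integral:
  assumes c: "c \<in> puiseux" and d: "d \<in> puiseux" and z: "pu_mult c d = (%_. 0)"
  shows "c = (%_. 0) \<or> d = (%_. 0)"
proof -
  obtain m where m: "0 < m" "\<forall>x\<in>{c, d}. \<exists>F. x = pu_of_fps m F"
    using puiseux_common_denominator[of "{c, d}" "%x. x"] c d by auto
  then obtain F G where FG: "c = pu_of_fps m F" "d = pu_of_fps m G" by auto
  have "pu_of_fps m (F * G) = pu_of_fps m 0" using z by (simp add: FG pu_of_fps_mult[OF m(1)] pu_of_fps_0)
  then have "F * G = 0" by (rule pu_of_fps_inj[OF m(1)])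
  then show ?thesis unfolding FG by (auto simp: pu_of_fps_0)
qed

lemma pu_mult_cancel:
  assumes c: "c \<in> puiseux" "c ~= (%_. 0)" and d: "d \<in> puiseux" "d' \<in> puiseux" and z: "pu_mult c d = pu_mult c d'"
  shows "d = d'"
proof -
  obtain m where m: "0 < m" "\<forall>x\<in>{c, d, d'}. \<exists>F. x = pu_of_fps m F"
    using puiseux_common_denominator[of "{c, d, d'}" "%x. x"] c d by auto
  then obtain F G G' where FG: "c = pu_of_fps m F" "d = pu_of_fps m G" "d' = pu_of_fps m G'" by auto
  have "pu_of_fps m (F * G) = pu_of_fps m (F * G')" using z by (simp add: FG pu_of_fps_mult[OF m(1)])
  then have "F * G = F * G'" by (rule pu_of_fps_inj[OF m(1)])
  moreover have "F ~= 0" using c(2) by (auto simp: FG pu_of_fps_0)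
  ultimately show ?thesis by (simp add: FG)
qed

section \<open>The substitution property\<close>

context nonsingular_variety
begin

lemma R0_power:
  assumes r: "rep a q" and C: "cl a q \<in> R0 V"
  shows "cl (%x. a x ^ m) (%x. q x ^ m) \<in> R0 V"
proof (rule fn_eqI(1)[OF rep_power[OF r]])
  show "continuous_on V (%x. fn (cl a q) x ^ m)" by (intro continuous_intros fn_continuous C)
  show "fn (cl a q) x ^ m * q x ^ m = a x ^ m" if "x \<in> V" for x
    using fn_class[OF C r that] by (simp flip: power_mult_distrib)
qed

text \<open>The Lojasiewicz inequality is what makes the quotient by \<open>h\<close> continuous.\<close>

lemma R0_power_multiple:
  assumes r: "rep a q" and C: "cl a q \<in> R0 V" and h: "h \<in> polyfun" "\<exists>x\<in>V. h x ~= 0" "!!x. x \<in> V ==> 0 \<le> h x"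
    and hz: "!!x. x \<in> V ==> h x = 0 ==> fn (cl a q) x = 0"
  shows "\<exists>m. \<exists>G\<in>R0 V. rf_mult V (cp h) G = cl (%x. a x ^ Suc m) (%x. q x ^ Suc m)"
proof -
  define F where "F = fn (cl a q)"
  have F: "continuous_on V F" "!!x. x \<in> V ==> F x * q x = a x"
    unfolding F_def using fn_continuous[OF C] fn_class[OF C r] by auto
  have aq: "a \<in> polyfun" "q \<in> polyfun" "\<exists>x\<in>V. q x ~= 0" using r by (auto simp: rep_def)
  have "\<exists>D\<ge>1. \<forall>w\<in>V. F w = 0 --> (\<exists>K \<epsilon>. 0 < \<epsilon> & 0 \<le> K & (\<forall>x\<in>V. dist x w < \<epsilon> --> \<bar>F x\<bar> ^ D \<le> K * h x))"
  proof (rule lojasiewicz_inequality[OF algebraic aq(1,2) h(1) F])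
    show "\<exists>z\<in>V. dist z x < \<epsilon> & q z ~= 0" if "x \<in> V" "0 < \<epsilon>" for x \<epsilon> by (rule dense[OF aq(2,3) that])
    show "F x = 0" if "x \<in> V" "h x = 0" for x unfolding F_def by (rule hz[OF that])
  qed (use h(3) in auto)
  then obtain D where D: "\<forall>w\<in>V. F w = 0 --> (\<exists>K \<epsilon>. 0 < \<epsilon> & 0 \<le> K & (\<forall>x\<in>V. dist x w < \<epsilon> --> \<bar>F x\<bar> ^ D \<le> K * h x))" by blast
  \<comment> \<open>On the zero set of \<open>h\<close> the value 0 is the right one: the extra
    factor \<open>F x\<close> beyond the exponent \<open>D\<close> of the inequality makes the
    quotient tend to zero there.\<close>
  define g where "g x = (if h x = 0 then 0 else F x ^ Suc D / h x)" for x
  have "continuous_on V g" unfolding continuous_on_def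
  proof
    fix w assume w: "w \<in> V"
    have Fl: "(F \<longlongrightarrow> F w) (at w within V)" using F(1) w by (simp add: continuous_on_def)
    have hl: "(h \<longlongrightarrow> h w) (at w within V)" using polyfun_continuous[OF h(1), of V] w by (simp add: continuous_on_def)
    show "(g \<longlongrightarrow> g w) (at w within V)"
    proof (cases "h w = 0")
      case False
      have "((%x. F x ^ Suc D / h x) \<longlongrightarrow> F w ^ Suc D / h w) (at w within V)" by (intro tendsto_divide tendsto_power Fl hl False)
      moreover have "\<forall>\<^sub>F x in at w within V. h x ~= 0" using hl False by (rule tendsto_imp_eventually_ne)
      then have "\<forall>\<^sub>F x in at w within V. F x ^ Suc D / h x = g x" by eventually_elim (simp add: g_def)
      ultimately have "(g \<longlongrightarrow> F w ^ Suc D / h w) (at w within V)" by (rule Lim_transform_eventually)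
      then show ?thesis using False by (simp add: g_def)
    next
      case True
      then have Fw: "F w = 0" unfolding F_def by (rule hz[OF w])
      obtain K \<epsilon> where K: "0 < \<epsilon>" "\<forall>x\<in>V. dist x w < \<epsilon> --> \<bar>F x\<bar> ^ D \<le> K * h x" using D w Fw by blast
      have "\<forall>\<^sub>F x in at w within V. norm (g x) \<le> \<bar>K\<bar> * \<bar>F x\<bar>" unfolding eventually_at
      proof (rule exI[of _ \<epsilon>], intro conjI ballI impI K(1))
        fix x assume x: "x \<in> V" "x ~= w & dist x w < \<epsilon>"
        show "norm (g x) \<le> \<bar>K\<bar> * \<bar>F x\<bar>"
        proof (cases "h x = 0")
          case False
          have hp: "0 < h x" using h(3)[OF x(1)] False by simp
          have "\<bar>F x\<bar> ^ D \<le> \<bar>K\<bar> * h x" using K(2) x hp by (meson abs_ge_self less_imp_le mult_right_mono order_trans)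
          then have "\<bar>F x\<bar> ^ D / h x \<le> \<bar>K\<bar>" using hp by (simp add: divide_le_eq)
          then have "\<bar>F x\<bar> * (\<bar>F x\<bar> ^ D / h x) \<le> \<bar>F x\<bar> * \<bar>K\<bar>" by (intro mult_left_mono) auto
          moreover have "norm (g x) = \<bar>F x\<bar> * (\<bar>F x\<bar> ^ D / h x)" using hp False by (simp add: g_def abs_mult power_abs)
          ultimately show ?thesis by (simp only: mult.commute)
        qed (simp add: g_def)
      qed
      moreover have "((%x. \<bar>K\<bar> * \<bar>F x\<bar>) \<longlongrightarrow> \<bar>K\<bar> * \<bar>F w\<bar>) (at w within V)" by (intro tendsto_intros Fl)
      then have "((%x. \<bar>K\<bar> * \<bar>F x\<bar>) \<longlongrightarrow> 0) (at w within V)" using Fw by simp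
      ultimately have "(g \<longlongrightarrow> 0) (at w within V)" by (rule Lim_null_comparison)
      then show ?thesis using True by (simp add: g_def)
    qed
  qed
  moreover have rG: "rep (%x. a x ^ Suc D) (%x. q x ^ Suc D * h x)"
    using nonzero_mult[OF polyfun_power[OF aq(2)] h(1) nonzero_power[OF aq(2,3)] h(2), of "Suc D"] aq h(1)
    unfolding rep_def by (intro conjI polyfun_power polyfun.pf_mult)
  moreover have "g x * (q x ^ Suc D * h x) = a x ^ Suc D" if x: "x \<in> V" for x
  proof (cases "h x = 0")
    case True
    then have "F x = 0" unfolding F_def by (rule hz[OF x])
    then have "a x = 0" using F(2)[OF x] by simp
    then show ?thesis using True by simp
  next
    case False
    then have "g x * (q x ^ Suc D * h x) = (F x * q x) ^ Suc D" by (simp add: g_def power_mult_distrib)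
    then show ?thesis using F(2)[OF x] by simp
  qed
  ultimately have "cl (%x. a x ^ Suc D) (%x. q x ^ Suc D * h x) \<in> R0 V" by (intro fn_eqI(1)) auto
  moreover have "rf_mult V (cp h) (cl (%x. a x ^ Suc D) (%x. q x ^ Suc D * h x)) = cl (%x. a x ^ Suc D) (%x. q x ^ Suc D)"
    unfolding mult_class[OF rep_one[OF h(1)] rG]
    by (rule iffD2[OF class_eq[OF rep_mult[OF rep_one[OF h(1)] rG] rep_power[OF r]]]) (simp add: mult_ac)
  ultimately show ?thesis by blast
qed

text \<open>An arbitrary extension is not known to be evaluation along a curve, so the quotient
  identity, valid where the lower derivatives vanish, has to be turned into ring relations. Only a
  few laws of \<open>S\<close> are assumed, so that series and Puiseux series are covered alike;
  with no neutral law for zero among them, the conclusion keeps the zero summand.\<close>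

lemma R0_determined:
  fixes S :: "'b ring" (structure)
  assumes int: "!!x y. x \<in> carrier S ==> y \<in> carrier S ==> x \<otimes>\<^bsub>S\<^esub> y = \<zero>\<^bsub>S\<^esub> ==> x = \<zero>\<^bsub>S\<^esub> \<or> y = \<zero>\<^bsub>S\<^esub>"
    and zl: "!!y. y \<in> carrier S ==> \<zero>\<^bsub>S\<^esub> \<otimes>\<^bsub>S\<^esub> y = \<zero>\<^bsub>S\<^esub>" and zz: "\<zero>\<^bsub>S\<^esub> \<oplus>\<^bsub>S\<^esub> \<zero>\<^bsub>S\<^esub> = \<zero>\<^bsub>S\<^esub>"
    and car: "!!C. C \<in> R0 V ==> \<psi> C \<in> carrier S"
    and add: "!!C D. C \<in> R0 V ==> D \<in> R0 V ==> \<psi> (rf_add V C D) = \<psi> C \<oplus>\<^bsub>S\<^esub> \<psi> D"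
    and mult: "!!C D. C \<in> R0 V ==> D \<in> R0 V ==> \<psi> (rf_mult V C D) = \<psi> C \<otimes>\<^bsub>S\<^esub> \<psi> D"
    and zero: "\<psi> (cp (%_. 0)) = \<zero>\<^bsub>S\<^esub>"
    and X: "tangent_field V X" "!!i p. p \<in> polyfun ==> (dv X ^^ i) p \<in> polyfun"
    and r: "rep p q" and C: "cl p q \<in> R0 V" and z: "!!i. i < k ==> \<psi> (cp ((dv X ^^ i) q)) = \<zero>\<^bsub>S\<^esub>"
  shows "\<psi> (cp ((dv X ^^ k) q)) \<otimes>\<^bsub>S\<^esub> \<psi> (cl p q) = \<zero>\<^bsub>S\<^esub> \<oplus>\<^bsub>S\<^esub> \<psi> (cp ((dv X ^^ k) p))"
proof -
  define u where "u = (dv X ^^ k) q"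
  define b where "b = (dv X ^^ k) p"
  define g where "g i = (dv X ^^ i) q" for i
  have pq: "p \<in> polyfun" "q \<in> polyfun" "\<exists>x\<in>V. q x ~= 0" using r by (auto simp: rep_def)
  have pf: "u \<in> polyfun" "b \<in> polyfun" "!!i. g i \<in> polyfun" using X(2) pq by (auto simp: u_def b_def g_def)
  have 0: "\<zero>\<^bsub>S\<^esub> \<in> carrier S" using car[OF cp_R0(1)[OF polyfun.pf_const]] zero by metis
  \<comment> \<open>Numerator over \<open>q\<close> of the function \<open>F\<close> that measures
    the failure of the quotient identity.\<close>
  define a where "a x = p x * u x - b x * q x" for x
  have apf: "a \<in> polyfun" unfolding a_def by (intro polyfun_diff polyfun.pf_mult pq pf)
  have ra: "rep a q" using apf pq by (simp add: rep_def)
  define F where "F x = fn (cl p q) x * u x - b x" for x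
  have Fc: "continuous_on V F" unfolding F_def by (intro continuous_intros fn_continuous C polyfun_continuous pf)
  have Fq: "F x * q x = a x" if "x \<in> V" for x
  proof -
    have "F x * q x = (fn (cl p q) x * q x) * u x - b x * q x" by (simp add: F_def algebra_simps)
    then show ?thesis unfolding fn_class[OF C r that] a_def .
  qed
  have FC: "cl a q \<in> R0 V" and Ffn: "!!x. x \<in> V ==> fn (cl a q) x = F x"
    using fn_eqI[OF ra Fc] Fq by blast+
  \<comment> \<open>Over the reals one sum of squares encodes the simultaneous vanishing of all
    lower derivatives; like each of them, it is sent to zero by \<open>\<psi>\<close>.\<close>
  define h where "h x = (\<Sum>i<k. g i x * g i x)" for x
  have hpf: "(%x. \<Sum>i<j. g i x * g i x) \<in> polyfun" for j by (intro polyfun_sum polyfun.pf_mult pf)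
  have "\<psi> (cp (%x. \<Sum>i<j. g i x * g i x)) = \<zero>\<^bsub>S\<^esub>" if "j \<le> k" for j
    using that
  proof (induction j)
    case 0
    show ?case using zero by simp
  next
    case (Suc j)
    have gg: "(%x. g j x * g j x) \<in> polyfun" by (intro polyfun.pf_mult pf)
    have "cp (%x. \<Sum>i<Suc j. g i x * g i x) = rf_add V (cp (%x. \<Sum>i<j. g i x * g i x)) (cp (%x. g j x * g j x))"
      unfolding cp_add[OF hpf gg] by simp
    moreover have "\<psi> (cp (%x. g j x * g j x)) = \<zero>\<^bsub>S\<^esub>"
    proof -
      have "\<psi> (cp (%x. g j x * g j x)) = \<psi> (cp (g j)) \<otimes>\<^bsub>S\<^esub> \<psi> (cp (g j))"
        unfolding cp_mult[OF pf(3) pf(3), symmetric] by (intro mult cp_R0 pf)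
      moreover have "\<psi> (cp (g j)) = \<zero>\<^bsub>S\<^esub>" unfolding g_def by (rule z) (use Suc.prems in simp)
      ultimately show ?thesis using zl[OF 0] by simp
    qed
    ultimately show ?case using add[OF cp_R0(1)[OF hpf] cp_R0(1)[OF gg], of j] Suc zz by simp
  qed
  then have hz: "\<psi> (cp h) = \<zero>\<^bsub>S\<^esub>" unfolding h_def[abs_def] by simp
  have hp: "h \<in> polyfun" unfolding h_def[abs_def] by (rule hpf)
  have hF: "fn (cl a q) x = 0" if x: "x \<in> V" "h x = 0" for x
  proof -
    have "g i x = 0" if "i < k" for i
    proof -
      have "\<forall>i\<in>{..<k}. g i x * g i x = 0" using x(2) unfolding h_def by (subst (asm) sum_nonneg_eq_0_iff) auto
      then show ?thesis using that by simp
    qed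
    then have "fn (cl p q) x * u x = b x" unfolding u_def b_def g_def by (intro quotient_identity[OF X(1) r C x(1)])
    then show ?thesis using Ffn[OF x(1)] by (simp add: F_def)
  qed
  have "\<psi> (cl a q) = \<zero>\<^bsub>S\<^esub>"
  proof (cases "\<exists>x\<in>V. h x ~= 0")
    \<comment> \<open>If \<open>h\<close> vanishes on all of \<open>V\<close>, for instance when
      \<open>k = 0\<close>, the quotient identity holds everywhere and the class is zero.\<close>
    case False
    have "a x = 0" if "x \<in> V" for x using hF[OF that] False that Ffn[OF that] Fq[OF that] by auto
    then have "cl a q = cp (%_. 0)" by (intro iffD2[OF class_eq[OF ra rep_one[OF polyfun.pf_const]]]) simp
    then show ?thesis using zero by simp
  next
    case True
    have h0: "0 \<le> h x" for x unfolding h_def by (intro sum_nonneg) simp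
    obtain m G where G: "G \<in> R0 V" "rf_mult V (cp h) G = cl (%x. a x ^ Suc m) (%x. q x ^ Suc m)"
      using R0_power_multiple[OF ra FC hp True h0 hF] by blast
    have "\<psi> (cl (%x. a x ^ Suc m) (%x. q x ^ Suc m)) = \<zero>\<^bsub>S\<^esub>"
      using mult[OF cp_R0(1)[OF hp] G(1)] zl[OF car[OF G(1)]] by (simp only: G(2) hz)
    then show ?thesis
    proof (induction m)
      case 0
      then show ?case by simp
    next
      case (Suc m)
      have "cl (%x. a x ^ Suc (Suc m)) (%x. q x ^ Suc (Suc m)) = rf_mult V (cl a q) (cl (%x. a x ^ Suc m) (%x. q x ^ Suc m))"
        unfolding mult_class[OF ra rep_power[OF ra, of "Suc m"]] by simp
      then have "\<psi> (cl a q) \<otimes>\<^bsub>S\<^esub> \<psi> (cl (%x. a x ^ Suc m) (%x. q x ^ Suc m)) = \<zero>\<^bsub>S\<^esub>"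
        using Suc.prems mult[OF FC R0_power[OF ra FC, of "Suc m"]] by (simp only:)
      from int[OF car[OF FC] car[OF R0_power[OF ra FC]] this] show ?case using Suc.IH by blast
    qed
  qed
  moreover have "rf_mult V (cp u) (cl p q) = rf_add V (cl a q) (cp b)"
    unfolding mult_class[OF rep_one[OF pf(1)] r] add_class[OF ra rep_one[OF pf(2)]]
    by (rule iffD2[OF class_eq[OF rep_mult[OF rep_one[OF pf(1)] r] rep_add[OF ra rep_one[OF pf(2)]]]]) (simp add: a_def algebra_simps)
  ultimately show ?thesis using mult[OF cp_R0(1)[OF pf(1)] C] add[OF FC cp_R0(1)[OF pf(2)]] by (simp only: u_def b_def)
qed

section \<open>Extension of arcs: uniqueness and existence\<close>

lemma ring_hom_iff:
  "h \<in> ring_hom ((ratfun_ring V)\<lparr>carrier := B\<rparr>) S \<longleftrightarrow> (\<forall>C\<in>B. h C \<in> carrier S) &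
     (\<forall>C\<in>B. \<forall>D\<in>B. h (rf_mult V C D) = h C \<otimes>\<^bsub>S\<^esub> h D & h (rf_add V C D) = h C \<oplus>\<^bsub>S\<^esub> h D) & h (cp (%_. 1)) = \<one>\<^bsub>S\<^esub>"
  unfolding ring_hom_def ratfun_ring_def cl_def by auto

lemma rf_const_eq: "rf_const V c = cp (%_. c)"
  by (simp add: rf_const_def cl_def)

text \<open>Two extensions satisfy the same linear equation for the image of \<open>C\<close>, whose
  coefficient, the image of the first derivative of \<open>q\<close> that survives on the arc, is
  non-zero and can be cancelled.\<close>

lemma extension_unique:
  fixes S :: "'b ring" (structure)
  assumes int: "!!x y. x \<in> carrier S ==> y \<in> carrier S ==> x \<otimes>\<^bsub>S\<^esub> y = \<zero>\<^bsub>S\<^esub> ==> x = \<zero>\<^bsub>S\<^esub> \<or> y = \<zero>\<^bsub>S\<^esub>"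
    and cancel: "!!x y y'. x \<in> carrier S ==> x ~= \<zero>\<^bsub>S\<^esub> ==> y \<in> carrier S ==> y' \<in> carrier S ==> x \<otimes>\<^bsub>S\<^esub> y = x \<otimes>\<^bsub>S\<^esub> y' ==> y = y'"
    and zl: "!!y. y \<in> carrier S ==> \<zero>\<^bsub>S\<^esub> \<otimes>\<^bsub>S\<^esub> y = \<zero>\<^bsub>S\<^esub>" and zz: "\<zero>\<^bsub>S\<^esub> \<oplus>\<^bsub>S\<^esub> \<zero>\<^bsub>S\<^esub> = \<zero>\<^bsub>S\<^esub>"
    and a: "arc \<Phi>" and \<phi>: "!!p. p \<in> polyfun ==> \<phi> (cp p) = \<zero>\<^bsub>S\<^esub> \<longleftrightarrow> \<Phi> p = 0"
    and h: "\<psi> \<in> ring_hom ((ratfun_ring V)\<lparr>carrier := R0 V\<rparr>) S" "\<psi>' \<in> ring_hom ((ratfun_ring V)\<lparr>carrier := R0 V\<rparr>) S"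
    and e: "!!p. p \<in> polyfun ==> \<psi> (cp p) = \<phi> (cp p)" "!!p. p \<in> polyfun ==> \<psi>' (cp p) = \<phi> (cp p)"
    and C: "C \<in> R0 V"
  shows "\<psi> C = \<psi>' C"
proof -
  obtain p q where p: "C = cl p q" "rep p q" by (rule R0_cases[OF C])
  have q: "q \<in> polyfun" "\<exists>x\<in>V. q x ~= 0" and pp: "p \<in> polyfun" using p(2) by (auto simp: rep_def)
  obtain X k where X: "tangent_field V X" "!!i p. p \<in> polyfun ==> (dv X ^^ i) p \<in> polyfun"
    "\<Phi> ((dv X ^^ k) q) ~= 0" "!!i. i < k ==> \<Phi> ((dv X ^^ i) q) = 0" by (rule arc_transversal[OF a q]) blast
  have 0: "\<phi> (cp (%_. 0)) = \<zero>\<^bsub>S\<^esub>" using \<phi>[OF polyfun.pf_const, of 0] arc_simps(2)[OF a, of 0] by simp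
  have det: "\<phi> (cp ((dv X ^^ k) q)) \<otimes>\<^bsub>S\<^esub> \<xi> C = \<zero>\<^bsub>S\<^esub> \<oplus>\<^bsub>S\<^esub> \<phi> (cp ((dv X ^^ k) p))"
    if \<xi>: "\<xi> \<in> ring_hom ((ratfun_ring V)\<lparr>carrier := R0 V\<rparr>) S" "!!p. p \<in> polyfun ==> \<xi> (cp p) = \<phi> (cp p)" for \<xi>
  proof -
    have "\<xi> (cp ((dv X ^^ k) q)) \<otimes>\<^bsub>S\<^esub> \<xi> (cl p q) = \<zero>\<^bsub>S\<^esub> \<oplus>\<^bsub>S\<^esub> \<xi> (cp ((dv X ^^ k) p))"
    proof (rule R0_determined[where \<psi> = \<xi> and S = S, OF int zl zz _ _ _ _ X(1,2) p(2)])
      show "cl p q \<in> R0 V" using C p(1) by simp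
      show "\<xi> (cp (%_. 0)) = \<zero>\<^bsub>S\<^esub>" using \<xi>(2)[OF polyfun.pf_const] 0 by simp
      show "\<xi> (cp ((dv X ^^ i) q)) = \<zero>\<^bsub>S\<^esub>" if "i < k" for i
        using \<xi>(2)[OF X(2)[OF q(1)]] \<phi>[OF X(2)[OF q(1)]] X(4)[OF that] by simp
    qed (use \<xi>(1) in \<open>simp_all add: ring_hom_iff\<close>)
    then show ?thesis using \<xi>(2)[OF X(2)[OF q(1)]] \<xi>(2)[OF X(2)[OF pp]] p(1) by simp
  qed
  have car: "\<phi> (cp p) \<in> carrier S" if "p \<in> polyfun" for p
    using h(1) cp_R0(1)[OF that] unfolding e(1)[OF that, symmetric] ring_hom_iff by blast
  have d: "\<phi> (cp ((dv X ^^ k) q)) \<otimes>\<^bsub>S\<^esub> \<psi> C = \<zero>\<^bsub>S\<^esub> \<oplus>\<^bsub>S\<^esub> \<phi> (cp ((dv X ^^ k) p))" by (rule det[OF h(1)]) (rule e(1))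
  have d': "\<phi> (cp ((dv X ^^ k) q)) \<otimes>\<^bsub>S\<^esub> \<psi>' C = \<zero>\<^bsub>S\<^esub> \<oplus>\<^bsub>S\<^esub> \<phi> (cp ((dv X ^^ k) p))" by (rule det[OF h(2)]) (rule e(2))
  show ?thesis
  proof (rule cancel[of "\<phi> (cp ((dv X ^^ k) q))"])
    show "\<phi> (cp ((dv X ^^ k) q)) \<in> carrier S" by (intro car X(2) q(1))
    show "\<phi> (cp ((dv X ^^ k) q)) ~= \<zero>\<^bsub>S\<^esub>" using \<phi>[OF X(2)[OF q(1)]] X(3) by simp
    show "\<psi> C \<in> carrier S" "\<psi>' C \<in> carrier S" using h C unfolding ring_hom_iff by blast+
    show "\<phi> (cp ((dv X ^^ k) q)) \<otimes>\<^bsub>S\<^esub> \<psi> C = \<phi> (cp ((dv X ^^ k) q)) \<otimes>\<^bsub>S\<^esub> \<psi>' C"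
      unfolding d d' ..
  qed
qed

theorem formal_arcs: "subst_formal_arcs V (R0 V)"
  unfolding subst_formal_arcs_def subst_property_def
proof (intro allI impI, elim conjE)
  fix \<phi> assume \<phi>: "\<phi> \<in> ring_hom ((ratfun_ring V)\<lparr>carrier := coord_ring V\<rparr>) fps_alg_ring" and k: "\<forall>c. \<phi> (rf_const V c) = fps_const c"
  have A: "cp p \<in> coord_ring V" if "p \<in> polyfun" for p using that by (simp add: coord_ring_eq)
  have hom: "\<phi> (cp p) \<in> fps_alg" "\<phi> (cp (%x. p x + q x)) = \<phi> (cp p) + \<phi> (cp q)" "\<phi> (cp (%x. p x * q x)) = \<phi> (cp p) * \<phi> (cp q)"
    if "p \<in> polyfun" "q \<in> polyfun" for p q
    using \<phi> A[OF that(1)] A[OF that(2)] unfolding ring_hom_iff cp_add[OF that, symmetric] cp_mult[OF that, symmetric]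
    by (simp_all add: fps_alg_ring_def)
  have a: "arc (%p. \<phi> (cp p))" unfolding arc_def
  proof (intro conjI ballI allI impI)
    show "\<phi> (cp (%_. c)) = fps_const c" for c using k by (simp add: rf_const_eq)
    show "\<phi> (cp p) = \<phi> (cp q)" if "p \<in> polyfun" "q \<in> polyfun" "\<forall>x\<in>V. p x = q x" for p q
      using cp_eq[OF that(1,2)] that(3) by simp
  qed (use hom in blast)+
  from R0_extension[OF a] obtain \<Psi> where P: "\<forall>C\<in>R0 V. \<Psi> C \<in> fps_alg"
    "\<forall>C\<in>R0 V. \<forall>D\<in>R0 V. \<Psi> (rf_add V C D) = \<Psi> C + \<Psi> D & \<Psi> (rf_mult V C D) = \<Psi> C * \<Psi> D"
    "\<forall>p\<in>polyfun. \<Psi> (cp p) = \<phi> (cp p)" by (elim exE conjE) (rule that; assumption)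
  have "\<Psi> (cp (%_. 1)) = 1" using P(3) polyfun.pf_const[of 1] k by (auto simp flip: rf_const_eq)
  then have Ph: "\<Psi> \<in> ring_hom ((ratfun_ring V)\<lparr>carrier := R0 V\<rparr>) fps_alg_ring"
    unfolding ring_hom_iff using P by (simp add: fps_alg_ring_def)
  show "\<exists>\<psi>\<in>ring_hom ((ratfun_ring V)\<lparr>carrier := R0 V\<rparr>) fps_alg_ring. (\<forall>a\<in>coord_ring V. \<psi> a = \<phi> a) &
     (\<forall>\<psi>'\<in>ring_hom ((ratfun_ring V)\<lparr>carrier := R0 V\<rparr>) fps_alg_ring. (\<forall>a\<in>coord_ring V. \<psi>' a = \<phi> a) --> (\<forall>b\<in>R0 V. \<psi>' b = \<psi> b))"
  proof (rule bexI[OF _ Ph], intro conjI ballI impI)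
    show "\<Psi> a = \<phi> a" if "a \<in> coord_ring V" for a using that P(3) by (auto simp: coord_ring_eq)
    fix \<psi>' b assume h: "\<psi>' \<in> ring_hom ((ratfun_ring V)\<lparr>carrier := R0 V\<rparr>) fps_alg_ring" "\<forall>a\<in>coord_ring V. \<psi>' a = \<phi> a" "b \<in> R0 V"
    show "\<psi>' b = \<Psi> b"
      by (rule extension_unique[where S = fps_alg_ring and \<phi> = \<phi>, OF _ _ _ _ a _ h(1) Ph _ _ h(3)])
        (use h(2) A P(3) in \<open>simp_all add: fps_alg_ring_def\<close>)
  qed
qed

text \<open>The finitely many coordinates have a common denominator \<open>m\<close>, so the given
  homomorphism factors through power series in the m-th root and the extension comes from the formal
  case. Uniqueness is against arbitrary extensions into Puiseux series, whose denominators are not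
  controlled, hence the argument in an abstract ring.\<close>

theorem puiseux_arcs: "subst_puiseux_arcs V (R0 V)"
  unfolding subst_puiseux_arcs_def subst_property_def
proof (intro allI impI, elim conjE)
  fix \<phi> assume \<phi>: "\<phi> \<in> ring_hom ((ratfun_ring V)\<lparr>carrier := coord_ring V\<rparr>) puiseux_alg_ring" and k: "\<forall>c. \<phi> (rf_const V c) = pu_const c"
  have A: "cp p \<in> coord_ring V" if "p \<in> polyfun" for p using that by (simp add: coord_ring_eq)
  have hom: "\<phi> (cp p) \<in> puiseux_alg" "\<phi> (cp (%x. p x + q x)) = (%r. \<phi> (cp p) r + \<phi> (cp q) r)" "\<phi> (cp (%x. p x * q x)) = pu_mult (\<phi> (cp p)) (\<phi> (cp q))"
    if "p \<in> polyfun" "q \<in> polyfun" for p q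
    using \<phi> A[OF that(1)] A[OF that(2)] unfolding ring_hom_iff cp_add[OF that, symmetric] cp_mult[OF that, symmetric]
    by (simp_all add: puiseux_alg_ring_def)
  have pa: "c \<in> puiseux" if "c \<in> puiseux_alg" for c using that by (simp add: puiseux_alg_def)
  have "\<exists>m>0. \<forall>i\<in>UNIV. \<exists>F. \<phi> (cp (%x. x $ i)) = pu_of_fps m F"
    by (rule puiseux_common_denominator[OF finite]) (rule pa[OF hom(1)[OF polyfun.pf_coord polyfun.pf_coord]])
  then obtain m where m: "0 < m" "\<forall>i\<in>UNIV. \<exists>F. \<phi> (cp (%x. x $ i)) = pu_of_fps m F" by blast
  have "\<exists>F. \<phi> (cp p) = pu_of_fps m F" if "p \<in> polyfun" for p
    using that
  proof induction
    case (pf_const c)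
    show ?case using k pu_of_fps_const[OF m(1), of c] by (metis rf_const_eq)
  next
    case (pf_coord i)
    show ?case using m(2) by blast
  next
    case (pf_add p q)
    then obtain F G where "\<phi> (cp p) = pu_of_fps m F" "\<phi> (cp q) = pu_of_fps m G" by blast
    then show ?case using hom(2)[OF pf_add.hyps] pu_of_fps_add[OF m(1), of F G] by (intro exI[of _ "F + G"]) simp
  next
    case (pf_mult p q)
    then obtain F G where "\<phi> (cp p) = pu_of_fps m F" "\<phi> (cp q) = pu_of_fps m G" by blast
    then show ?case using hom(3)[OF pf_mult.hyps] pu_of_fps_mult[OF m(1), of F G] by (intro exI[of _ "F * G"]) simp
  qed
  then have "\<forall>p\<in>polyfun. \<exists>F. \<phi> (cp p) = pu_of_fps m F" by blast
  from bchoice[OF this] obtain \<Phi> where F0: "\<forall>p\<in>polyfun. \<phi> (cp p) = pu_of_fps m (\<Phi> p)" ..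
  note F = F0[THEN bspec]
  note inj = pu_of_fps_inj[OF m(1)]
  have a: "arc \<Phi>" unfolding arc_def
  proof (intro conjI ballI allI impI)
    show "\<Phi> p \<in> fps_alg" if "p \<in> polyfun" for p using hom(1)[OF that that] unfolding F[OF that] pu_of_fps_algebraic[OF m(1)] .
    show "\<Phi> (%_. c) = fps_const c" for c
      by (rule inj) (use F[OF polyfun.pf_const] k pu_of_fps_const[OF m(1)] in \<open>simp flip: rf_const_eq\<close>)
    show "\<Phi> (%x. p x + q x) = \<Phi> p + \<Phi> q" if "p \<in> polyfun" "q \<in> polyfun" for p q
      by (rule inj) (use hom(2)[OF that] F[OF that(1)] F[OF that(2)] F[OF polyfun.pf_add[OF that]] pu_of_fps_add[OF m(1)] in simp)
    show "\<Phi> (%x. p x * q x) = \<Phi> p * \<Phi> q" if "p \<in> polyfun" "q \<in> polyfun" for p q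
      by (rule inj) (use hom(3)[OF that] F[OF that(1)] F[OF that(2)] F[OF polyfun.pf_mult[OF that]] pu_of_fps_mult[OF m(1)] in simp)
    show "\<Phi> p = \<Phi> q" if "p \<in> polyfun" "q \<in> polyfun" "\<forall>x\<in>V. p x = q x" for p q
      by (rule inj) (use cp_eq[OF that(1,2)] that(3) F[OF that(1)] F[OF that(2)] in simp)
  qed
  from R0_extension[OF a] obtain \<Psi> where P: "\<forall>C\<in>R0 V. \<Psi> C \<in> fps_alg"
    "\<forall>C\<in>R0 V. \<forall>D\<in>R0 V. \<Psi> (rf_add V C D) = \<Psi> C + \<Psi> D & \<Psi> (rf_mult V C D) = \<Psi> C * \<Psi> D"
    "\<forall>p\<in>polyfun. \<Psi> (cp p) = \<Phi> p" by (elim exE conjE) (rule that; assumption)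
  define \<psi> where "\<psi> C = pu_of_fps m (\<Psi> C)" for C
  have ext: "\<psi> (cp p) = \<phi> (cp p)" if "p \<in> polyfun" for p using P(3) F[OF that] that by (simp add: \<psi>_def)
  have one: "\<psi> (cp (%_. 1)) = pu_const 1" using ext[OF polyfun.pf_const, of 1] k by (simp flip: rf_const_eq)
  have Ph: "\<psi> \<in> ring_hom ((ratfun_ring V)\<lparr>carrier := R0 V\<rparr>) puiseux_alg_ring"
    unfolding ring_hom_iff using P one
    by (simp add: puiseux_alg_ring_def \<psi>_def pu_of_fps_algebraic[OF m(1)] pu_of_fps_mult[OF m(1)] pu_of_fps_add[OF m(1)])
  show "\<exists>\<psi>\<in>ring_hom ((ratfun_ring V)\<lparr>carrier := R0 V\<rparr>) puiseux_alg_ring. (\<forall>a\<in>coord_ring V. \<psi> a = \<phi> a) &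
     (\<forall>\<psi>'\<in>ring_hom ((ratfun_ring V)\<lparr>carrier := R0 V\<rparr>) puiseux_alg_ring. (\<forall>a\<in>coord_ring V. \<psi>' a = \<phi> a) --> (\<forall>b\<in>R0 V. \<psi>' b = \<psi> b))"
  proof (rule bexI[OF _ Ph], intro conjI ballI impI)
    show "\<psi> a = \<phi> a" if "a \<in> coord_ring V" for a using that ext by (auto simp: coord_ring_eq)
    fix \<psi>' b assume h: "\<psi>' \<in> ring_hom ((ratfun_ring V)\<lparr>carrier := R0 V\<rparr>) puiseux_alg_ring" "\<forall>a\<in>coord_ring V. \<psi>' a = \<phi> a" "b \<in> R0 V"
    show "\<psi>' b = \<psi> b"
    proof (rule extension_unique[where S = puiseux_alg_ring and \<phi> = \<phi>, OF _ _ _ _ a _ h(1) Ph _ _ h(3)])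
      show "x = \<zero>\<^bsub>puiseux_alg_ring\<^esub> \<or> y = \<zero>\<^bsub>puiseux_alg_ring\<^esub>"
        if "x \<in> carrier puiseux_alg_ring" "y \<in> carrier puiseux_alg_ring" "x \<otimes>\<^bsub>puiseux_alg_ring\<^esub> y = \<zero>\<^bsub>puiseux_alg_ring\<^esub>" for x y
        using pu_mult_integral[of x y] that pa by (simp add: puiseux_alg_ring_def)
      show "y = y'" if "x \<in> carrier puiseux_alg_ring" "x ~= \<zero>\<^bsub>puiseux_alg_ring\<^esub>" "y \<in> carrier puiseux_alg_ring" "y' \<in> carrier puiseux_alg_ring"
          "x \<otimes>\<^bsub>puiseux_alg_ring\<^esub> y = x \<otimes>\<^bsub>puiseux_alg_ring\<^esub> y'" for x y y'
        using pu_mult_cancel[of x y y'] that pa by (simp add: puiseux_alg_ring_def)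
      show "\<phi> (cp p) = \<zero>\<^bsub>puiseux_alg_ring\<^esub> \<longleftrightarrow> \<Phi> p = 0" if "p \<in> polyfun" for p
        unfolding F[OF that] using inj[of "\<Phi> p" 0] by (auto simp: puiseux_alg_ring_def pu_of_fps_0)
    qed (use h(2) A ext in \<open>simp_all add: puiseux_alg_ring_def pu_mult_def\<close>)
  qed
qed

end

section \<open>Maximality\<close>

context nonsingular_variety
begin

lemma ring_hom_of_arc:
  assumes a: "arc \<Phi>"
  shows "\<exists>\<phi>\<in>ring_hom ((ratfun_ring V)\<lparr>carrier := coord_ring V\<rparr>) fps_alg_ring. (\<forall>c. \<phi> (rf_const V c) = fps_const c) & (\<forall>p\<in>polyfun. \<phi> (cp p) = \<Phi> p)"
proof -
  \<comment> \<open>The choice is harmless because an arc takes equal values on polynomials that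
    agree on \<open>V\<close>.\<close>
  define \<phi> where "\<phi> C = \<Phi> (SOME p. p \<in> polyfun & C = cp p)" for C
  have \<phi>: "\<phi> (cp p) = \<Phi> p" if p: "p \<in> polyfun" for p
  proof -
    define p' where "p' = (SOME p'. p' \<in> polyfun & cp p = cp p')"
    have "p' \<in> polyfun & cp p = cp p'" unfolding p'_def by (rule someI[of _ p]) (use p in simp)
    then have p': "p' \<in> polyfun" "cp p = cp p'" by blast+
    have "\<forall>x\<in>V. p x = p' x" using cp_eq[OF p p'(1)] p'(2) by blast
    then have "\<Phi> p' = \<Phi> p" by (intro arc_simps(5)[OF a p'(1) p]) simp
    then show ?thesis by (simp add: \<phi>_def p'_def)
  qed
  have "\<phi> \<in> ring_hom ((ratfun_ring V)\<lparr>carrier := coord_ring V\<rparr>) fps_alg_ring"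
    unfolding ring_hom_iff
  proof (intro conjI ballI)
    fix C D assume "C \<in> coord_ring V" "D \<in> coord_ring V"
    then obtain p q where pq: "C = cp p" "p \<in> polyfun" "D = cp q" "q \<in> polyfun" by (auto simp: coord_ring_eq)
    show "\<phi> (rf_mult V C D) = \<phi> C \<otimes>\<^bsub>fps_alg_ring\<^esub> \<phi> D"
      unfolding pq(1,3) cp_mult[OF pq(2,4)] \<phi>[OF polyfun.pf_mult[OF pq(2,4)]] \<phi>[OF pq(2)] \<phi>[OF pq(4)] arc_simps(4)[OF a pq(2,4)] by (simp add: fps_alg_ring_def)
    show "\<phi> (rf_add V C D) = \<phi> C \<oplus>\<^bsub>fps_alg_ring\<^esub> \<phi> D"
      unfolding pq(1,3) cp_add[OF pq(2,4)] \<phi>[OF polyfun.pf_add[OF pq(2,4)]] \<phi>[OF pq(2)] \<phi>[OF pq(4)] arc_simps(3)[OF a pq(2,4)] by (simp add: fps_alg_ring_def)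
  next
    show "\<phi> C \<in> carrier fps_alg_ring" if "C \<in> coord_ring V" for C
      using that \<phi> arc_simps(1)[OF a] by (auto simp: coord_ring_eq fps_alg_ring_def)
    show "\<phi> (cp (%_. 1)) = \<one>\<^bsub>fps_alg_ring\<^esub>" unfolding \<phi>[OF polyfun.pf_const] arc_simps(2)[OF a] by (simp add: fps_alg_ring_def)
  qed
  moreover have "\<phi> (rf_const V c) = fps_const c" for c unfolding rf_const_eq \<phi>[OF polyfun.pf_const] by (rule arc_simps(2)[OF a])
  ultimately show ?thesis using \<phi> by blast
qed

text \<open>Relations on \<open>V\<close> hold along the curve at the parameters \<open>s n\<close>;
  since these tend to 0, they are identities of series.\<close>

lemma arc_of_curve:
  assumes \<gamma>: "!!i. \<gamma> i \<in> fps_alg" and s: "s \<longlonglongrightarrow> 0" "!!n. s n ~= 0" "!!n. (\<chi> i. eval_fps (\<gamma> i) (s n)) \<in> V"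
  shows "\<exists>\<Phi>. arc \<Phi> & (\<forall>p\<in>polyfun. (%t. p (\<chi> i. eval_fps (\<gamma> i) t)) has_fps_expansion \<Phi> p)"
proof -
  define c where "c t = (\<chi> i. eval_fps (\<gamma> i) t)" for t :: real
  have "\<exists>Y. Y \<in> fps_alg & (%t. p (c t)) has_fps_expansion Y" if "p \<in> polyfun" for p
    using that
  proof induction
    case (pf_const k)
    show ?case by (intro exI[of _ "fps_const k"] conjI fps_alg_closed has_fps_expansion_const)
  next
    case (pf_coord i)
    have "eval_fps (\<gamma> i) has_fps_expansion \<gamma> i" by (intro eval_fps_has_fps_expansion fps_alg_conv_radius \<gamma>)
    then show ?case using \<gamma>[of i] by (intro exI[of _ "\<gamma> i"]) (simp add: c_def)
  next
    case (pf_add p q)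
    then obtain Y Z where "Y \<in> fps_alg" "(%t. p (c t)) has_fps_expansion Y" "Z \<in> fps_alg" "(%t. q (c t)) has_fps_expansion Z" by blast
    then show ?case by (intro exI[of _ "Y + Z"] conjI fps_alg_closed has_fps_expansion_add)
  next
    case (pf_mult p q)
    then obtain Y Z where "Y \<in> fps_alg" "(%t. p (c t)) has_fps_expansion Y" "Z \<in> fps_alg" "(%t. q (c t)) has_fps_expansion Z" by blast
    then show ?case by (intro exI[of _ "Y * Z"] conjI fps_alg_closed has_fps_expansion_mult)
  qed
  then have "\<forall>p\<in>polyfun. \<exists>Y. Y \<in> fps_alg & (%t. p (c t)) has_fps_expansion Y" by blast
  from bchoice[OF this] obtain \<Phi> where P0: "\<forall>p\<in>polyfun. \<Phi> p \<in> fps_alg & (%t. p (c t)) has_fps_expansion \<Phi> p" ..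
  note P = P0[THEN bspec, THEN conjunct1] P0[THEN bspec, THEN conjunct2]
  have "arc \<Phi>" unfolding arc_def
  proof (intro conjI ballI allI impI)
    show "\<Phi> p \<in> fps_alg" if "p \<in> polyfun" for p by (rule P(1)[OF that])
    show "\<Phi> (%_. k) = fps_const k" for k
      by (rule has_fps_expansion_unique[OF P(2)[OF polyfun.pf_const]]) (rule has_fps_expansion_const)
    fix p q :: "real^'n => real" assume pq: "p \<in> polyfun" "q \<in> polyfun"
    show "\<Phi> (%x. p x + q x) = \<Phi> p + \<Phi> q"
      by (rule has_fps_expansion_unique[OF P(2)[OF polyfun.pf_add[OF pq]]]) (intro has_fps_expansion_add P(2) pq)
    show "\<Phi> (%x. p x * q x) = \<Phi> p * \<Phi> q"
      by (rule has_fps_expansion_unique[OF P(2)[OF polyfun.pf_mult[OF pq]]]) (intro has_fps_expansion_mult P(2) pq)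
    assume e: "\<forall>x\<in>V. p x = q x"
    have "(%t. p (c t) - q (c t)) has_fps_expansion \<Phi> p - \<Phi> q" by (intro has_fps_expansion_diff P(2) pq)
    then have "\<Phi> p - \<Phi> q = 0" by (rule fps_zero_of_sequence[OF _ s(1,2)]) (use e s(3) in \<open>simp add: c_def\<close>)
    then show "\<Phi> p = \<Phi> q" by simp
  qed
  then show ?thesis using P(2) unfolding c_def by blast
qed

text \<open>The candidate \<open>F\<close> for the continuous function is read off from the
  extensions of constant arcs. Composing the extension along any arc with evaluation at 0 gives an
  extension of the constant arc at its starting point, so by uniqueness the limit of
  \<open>F\<close> along the sampled points of an arc is its value at the start.\<close>

theorem R0_maximal:
  assumes sub: "subring B (ratfun_ring V)" and AB: "coord_ring V \<subseteq> B" and subst: "subst_formal_arcs V B"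
  shows "B \<subseteq> R0 V"
proof
  fix C assume C: "C \<in> B"
  have "C \<in> carrier (ratfun_ring V)" using subringE(1)[OF sub] C by blast
  then obtain p q where Cpq: "C = cl p q" and r: "rep p q"
    by (auto simp: ratfun_ring_def quotient_def cl_def rf_class_def rep_def rf_reps_def)
  have pq: "p \<in> polyfun" "q \<in> polyfun" "\<exists>x\<in>V. q x ~= 0" using r by (auto simp: rep_def)
  let ?H = "ring_hom ((ratfun_ring V)\<lparr>carrier := B\<rparr>) fps_alg_ring"
  have cpB: "cp f \<in> B" if "f \<in> polyfun" for f using AB that by (auto simp: coord_ring_eq)
  have ext: "\<exists>\<psi>\<in>?H. (\<forall>f\<in>polyfun. \<psi> (cp f) = \<Phi> f) & (\<forall>\<psi>'\<in>?H. (\<forall>f\<in>polyfun. \<psi>' (cp f) = \<Phi> f) --> \<psi>' C = \<psi> C)" if a: "arc \<Phi>" for \<Phi>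
  proof -
    obtain \<phi> where \<phi>: "\<phi> \<in> ring_hom ((ratfun_ring V)\<lparr>carrier := coord_ring V\<rparr>) fps_alg_ring" "\<forall>c. \<phi> (rf_const V c) = fps_const c" "\<forall>f\<in>polyfun. \<phi> (cp f) = \<Phi> f"
      using ring_hom_of_arc[OF a] by blast
    obtain \<psi> where \<psi>: "\<psi> \<in> ?H" "\<forall>a\<in>coord_ring V. \<psi> a = \<phi> a" "\<forall>\<psi>'\<in>?H. (\<forall>a\<in>coord_ring V. \<psi>' a = \<phi> a) --> (\<forall>b\<in>B. \<psi>' b = \<psi> b)"
      using subst[unfolded subst_formal_arcs_def subst_property_def, rule_format, of \<phi>] \<phi>(1,2) by blast
    have "\<forall>f\<in>polyfun. \<psi> (cp f) = \<Phi> f" using \<psi>(2) \<phi>(3) by (simp add: coord_ring_eq)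
    moreover have "\<psi>' C = \<psi> C" if "\<psi>' \<in> ?H" "\<forall>f\<in>polyfun. \<psi>' (cp f) = \<Phi> f" for \<psi>'
    proof -
      have "\<forall>a\<in>coord_ring V. \<psi>' a = \<phi> a" using that(2) \<phi>(3) by (auto simp: coord_ring_eq)
      then show ?thesis using \<psi>(3) that(1) C by blast
    qed
    ultimately show ?thesis using \<psi>(1) by blast
  qed
  have quot: "\<Phi> q * \<psi> C = \<Phi> p" if \<psi>: "\<psi> \<in> ?H" "\<forall>f\<in>polyfun. \<psi> (cp f) = \<Phi> f" for \<psi> \<Phi>
  proof -
    have "rf_mult V (cp q) C = cp p" unfolding Cpq mult_class[OF rep_one[OF pq(2)] r]
      by (rule iffD2[OF class_eq[OF rep_mult[OF rep_one[OF pq(2)] r] rep_one[OF pq(1)]]]) (simp add: mult_ac)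
    moreover have "\<psi> (rf_mult V (cp q) C) = \<psi> (cp q) * \<psi> C" using \<psi>(1) cpB[OF pq(2)] C unfolding ring_hom_iff by (simp add: fps_alg_ring_def)
    ultimately show ?thesis using \<psi>(2) pq by simp
  qed
  have carc: "arc (%f. fps_const (f x))" if "x \<in> V" for x unfolding arc_def using that by (auto simp: fps_alg_closed)
  have "\<forall>x\<in>V. \<exists>\<psi>. \<psi> \<in> ?H & (\<forall>f\<in>polyfun. \<psi> (cp f) = fps_const (f x)) & (\<forall>\<psi>'\<in>?H. (\<forall>f\<in>polyfun. \<psi>' (cp f) = fps_const (f x)) --> \<psi>' C = \<psi> C)"
    using ext[OF carc] by blast
  from bchoice[OF this] obtain \<eta> where \<eta>: "\<forall>x\<in>V. \<eta> x \<in> ?H & (\<forall>f\<in>polyfun. \<eta> x (cp f) = fps_const (f x)) & (\<forall>\<psi>'\<in>?H. (\<forall>f\<in>polyfun. \<psi>' (cp f) = fps_const (f x)) --> \<psi>' C = \<eta> x C)" ..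
  define F where "F x = fps_nth (\<eta> x C) 0" for x
  have Fq: "F x * q x = p x" if x: "x \<in> V" for x
  proof -
    have "fps_const (q x) * \<eta> x C = fps_const (p x)" using quot[of "\<eta> x" "%f. fps_const (f x)"] \<eta> x by blast
    then have "fps_nth (fps_const (q x) * \<eta> x C) 0 = p x" by simp
    then show ?thesis by (simp add: F_def mult.commute)
  qed
  have val: "fps_nth (\<psi> C) 0 = F x" if \<psi>: "\<psi> \<in> ?H" "\<forall>f\<in>polyfun. \<psi> (cp f) = \<Phi> f" and x: "x \<in> V" "!!f. f \<in> polyfun ==> fps_nth (\<Phi> f) 0 = f x" for \<psi> \<Phi> x
  proof -
    define \<theta> where "\<theta> D = fps_const (fps_nth (\<psi> D) 0)" for D
    have "\<theta> \<in> ?H" using \<psi>(1) unfolding ring_hom_iff \<theta>_def by (simp add: fps_alg_ring_def fps_alg_closed)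
    moreover have "\<forall>f\<in>polyfun. \<theta> (cp f) = fps_const (f x)" using \<psi>(2) x(2) by (simp add: \<theta>_def)
    ultimately have "\<theta> C = \<eta> x C" using \<eta> x(1) by blast
    then have "fps_nth (\<theta> C) 0 = F x" by (simp add: F_def)
    then show ?thesis by (simp add: \<theta>_def)
  qed
  \<comment> \<open>Applied twice: with the constant 1 for \<open>g\<close> to leave the zero set of
    \<open>q\<close>, and with the polynomial \<open>g\<close> below to follow a
    discontinuity.\<close>
  have seq: "\<exists>z. (\<forall>n::nat. z n \<in> V & q (z n) ~= 0 & 0 \<le> g (z n)) & z \<longlonglongrightarrow> y & (%n. F (z n)) \<longlonglongrightarrow> F y"
    if y: "y \<in> V" and g: "g \<in> polyfun" and acc: "!!\<epsilon>. 0 < \<epsilon> ==> \<exists>x\<in>V. dist x y < \<epsilon> & q x ~= 0 & 0 \<le> g x" for y g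
  proof -
    have "\<exists>\<gamma> s. (\<forall>i. \<gamma> i \<in> fps_alg & fps_nth (\<gamma> i) 0 = y $ i) & (\<forall>n::nat. 0 < s n) & s \<longlonglongrightarrow> 0 &
     (\<forall>n. (\<chi> i. eval_fps (\<gamma> i) (s n)) \<in> V & q (\<chi> i. eval_fps (\<gamma> i) (s n)) ~= 0 & 0 \<le> g (\<chi> i. eval_fps (\<gamma> i) (s n)))"
      by (rule curve_selection[OF algebraic pq(2) g]) (rule acc)
    then obtain \<gamma> s where \<gamma>: "\<forall>i. \<gamma> i \<in> fps_alg & fps_nth (\<gamma> i) 0 = y $ i" and s: "\<forall>n::nat. 0 < s n" "s \<longlonglongrightarrow> 0"
      "\<forall>n. (\<chi> i. eval_fps (\<gamma> i) (s n)) \<in> V & q (\<chi> i. eval_fps (\<gamma> i) (s n)) ~= 0 & 0 \<le> g (\<chi> i. eval_fps (\<gamma> i) (s n))"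
      by (elim exE conjE) (rule that; assumption)
    define c where "c t = (\<chi> i. eval_fps (\<gamma> i) t)" for t :: real
    have s0: "s n ~= 0" for n using s(1)[rule_format, of n] by simp
    have "\<exists>\<Phi>. arc \<Phi> & (\<forall>f\<in>polyfun. (%t. f (\<chi> i. eval_fps (\<gamma> i) t)) has_fps_expansion \<Phi> f)"
      by (rule arc_of_curve[OF _ s(2) s0]) (use \<gamma> s(3) in blast)+
    then obtain \<Phi> where a: "arc \<Phi>" and P0: "\<forall>f\<in>polyfun. (%t. f (c t)) has_fps_expansion \<Phi> f" unfolding c_def by blast
    note P = P0[THEN bspec]
    have c0: "c 0 = y" using \<gamma> by (simp add: c_def eval_fps_at_0 vec_eq_iff)
    obtain \<psi> where \<psi>: "\<psi> \<in> ?H" "\<forall>f\<in>polyfun. \<psi> (cp f) = \<Phi> f" using ext[OF a] by blast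
    have v: "fps_nth (\<psi> C) 0 = F y"
      by (rule val[OF \<psi> y]) (use has_fps_expansion_at_0[OF P] c0 in simp)
    have "\<psi> C \<in> fps_alg" using \<psi>(1) C unfolding ring_hom_iff by (simp add: fps_alg_ring_def)
    then have E: "eval_fps (\<psi> C) has_fps_expansion \<psi> C" by (intro eval_fps_has_fps_expansion fps_alg_conv_radius)
    have "(%t. q (c t) * eval_fps (\<psi> C) t) has_fps_expansion \<Phi> p"
      unfolding quot[OF \<psi>, symmetric] by (rule has_fps_expansion_mult[OF P[OF pq(2)] E])
    then have "\<forall>\<^sub>F t in nhds 0. eval_fps (\<Phi> p) t = q (c t) * eval_fps (\<psi> C) t" by (simp add: has_fps_expansion_def)
    moreover have "\<forall>\<^sub>F t in nhds 0. eval_fps (\<Phi> p) t = p (c t)" using P[OF pq(1)] by (simp add: has_fps_expansion_def)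
    ultimately have "\<forall>\<^sub>F t in nhds 0. p (c t) = q (c t) * eval_fps (\<psi> C) t" by eventually_elim simp
    then have "\<forall>\<^sub>F n in sequentially. p (c (s n)) = q (c (s n)) * eval_fps (\<psi> C) (s n)" using s(2) by (rule eventually_compose_filterlim)
    then have ev: "\<forall>\<^sub>F n in sequentially. eval_fps (\<psi> C) (s n) = F (c (s n))"
    proof eventually_elim
      case (elim n)
      have n: "c (s n) \<in> V" "q (c (s n)) ~= 0" using s(3) by (auto simp: c_def)
      have "q (c (s n)) * eval_fps (\<psi> C) (s n) = q (c (s n)) * F (c (s n))" using elim Fq[OF n(1)] by (metis mult.commute)
      then show ?case using n(2) by simp
    qed
    have "isCont (eval_fps (\<psi> C)) 0" using has_fps_expansion_imp_continuous[OF E, of UNIV] by simp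
    then have "(%n. eval_fps (\<psi> C) (s n)) \<longlonglongrightarrow> eval_fps (\<psi> C) 0" using s(2) by (rule isCont_tendsto_compose)
    then have "(%n. F (c (s n))) \<longlonglongrightarrow> eval_fps (\<psi> C) 0" using ev by (rule Lim_transform_eventually)
    then have l1: "(%n. F (c (s n))) \<longlonglongrightarrow> F y" using v by (simp add: eval_fps_at_0)
    have l2: "(%n. c (s n)) \<longlonglongrightarrow> y"
    proof (rule vec_tendstoI)
      fix i
      have "isCont (%t. c t $ i) 0" using has_fps_expansion_imp_continuous[OF P[OF polyfun.pf_coord], of UNIV] by simp
      then have "(%n. c (s n) $ i) \<longlonglongrightarrow> c 0 $ i" using s(2) by (rule isCont_tendsto_compose)
      then show "(%n. c (s n) $ i) \<longlonglongrightarrow> y $ i" by (simp add: c0)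
    qed
    have "\<forall>n. c (s n) \<in> V & q (c (s n)) ~= 0 & 0 \<le> g (c (s n))" using s(3) by (simp add: c_def)
    with l1 l2 show ?thesis by (intro exI[of _ "%n. c (s n)"] conjI)
  qed
  have "continuous_on V F"
  proof (rule ccontr)
    assume "\<not> continuous_on V F"
    then obtain y \<epsilon> where y: "y \<in> V" and e: "0 < \<epsilon>" and disc: "\<not> (\<exists>d>0. \<forall>x\<in>V. dist x y < d --> dist (F x) (F y) < \<epsilon>)"
      unfolding continuous_on_iff by blast
    have bad: "\<exists>x\<in>V. dist x y < d & \<epsilon> \<le> \<bar>F x - F y\<bar>" if d: "0 < d" for d
    proof (rule ccontr)
      assume "\<not> ?thesis"
      then have "\<forall>x\<in>V. dist x y < d --> dist (F x) (F y) < \<epsilon>" by (auto simp: dist_real_def not_le)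
      then show False using disc d by blast
    qed
    \<comment> \<open>Where \<open>q x\<close> is non-zero, \<open>0 \<le> g x\<close> says that
      \<open>F x\<close> differs from \<open>F y\<close> by at least \<open>\<epsilon> / 2\<close>.
      Clearing the denominator makes the condition polynomial, as curve selection demands.\<close>
    define g where "g x = (p x - F y * q x)\<^sup>2 - (\<epsilon> / 2)\<^sup>2 * (q x)\<^sup>2" for x
    have gpf: "g \<in> polyfun" unfolding g_def by (intro polyfun_diff polyfun_power polyfun.pf_mult polyfun.pf_const pq)
    have geq: "0 \<le> g x \<longleftrightarrow> \<epsilon> / 2 \<le> \<bar>F x - F y\<bar>" if x: "x \<in> V" "q x ~= 0" for x
    proof -
      have "g x = (q x)\<^sup>2 * ((F x - F y)\<^sup>2 - (\<epsilon> / 2)\<^sup>2)" unfolding g_def Fq[OF x(1), symmetric] by (simp add: power2_eq_square algebra_simps)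
      moreover have "0 < (q x)\<^sup>2" using x(2) by simp
      ultimately have "0 \<le> g x \<longleftrightarrow> (\<epsilon> / 2)\<^sup>2 \<le> (F x - F y)\<^sup>2" by (simp add: zero_le_mult_iff)
      also have "\<dots> \<longleftrightarrow> \<bar>\<epsilon> / 2\<bar> \<le> \<bar>F x - F y\<bar>" by (rule abs_le_square_iff[symmetric])
      finally show ?thesis using e by simp
    qed
    \<comment> \<open>A bad point \<open>x\<close> may satisfy \<open>q x = 0\<close>, where
      \<open>F x\<close> is not determined by the fraction. A nearby point with non-zero
      \<open>q\<close> has almost the same value, which is why \<open>g\<close> uses half of
      \<open>\<epsilon>\<close>.\<close>
    have acc: "\<exists>x\<in>V. dist x y < d & q x ~= 0 & 0 \<le> g x" if d: "0 < d" for d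
    proof -
      obtain x where x: "x \<in> V" "dist x y < d / 2" "\<epsilon> \<le> \<bar>F x - F y\<bar>" using bad[of "d / 2"] d by auto
      have "\<exists>z. (\<forall>n::nat. z n \<in> V & q (z n) ~= 0 & 0 \<le> (1::real)) & z \<longlonglongrightarrow> x & (%n. F (z n)) \<longlonglongrightarrow> F x"
        by (rule seq[OF x(1) polyfun.pf_const]) (use dense[OF pq(2,3) x(1)] in auto)
      then obtain z where z: "\<forall>n::nat. z n \<in> V & q (z n) ~= 0" "z \<longlonglongrightarrow> x" "(%n. F (z n)) \<longlonglongrightarrow> F x" by blast
      have "\<forall>\<^sub>F n in sequentially. dist (z n) x < d / 2" using z(2) d by (intro tendstoD) auto
      moreover have "\<forall>\<^sub>F n in sequentially. dist (F (z n)) (F x) < \<epsilon> / 2" using z(3) e by (intro tendstoD) auto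
      ultimately have "\<forall>\<^sub>F n in sequentially. dist (z n) x < d / 2 & dist (F (z n)) (F x) < \<epsilon> / 2" by eventually_elim simp
      then obtain n where n: "dist (z n) x < d / 2" "dist (F (z n)) (F x) < \<epsilon> / 2" using eventually_happens'[OF sequentially_bot] by blast
      have zn: "z n \<in> V" "q (z n) ~= 0" using z(1) by auto
      have "dist (z n) y < d" using n(1) x(2) dist_triangle[of "z n" y x] by linarith
      moreover have "\<epsilon> / 2 \<le> \<bar>F (z n) - F y\<bar>" using n(2) x(3) unfolding dist_real_def by linarith
      ultimately show ?thesis using zn geq[OF zn] by blast
    qed
    obtain z where z: "\<forall>n::nat. z n \<in> V & q (z n) ~= 0 & 0 \<le> g (z n)" "(%n. F (z n)) \<longlonglongrightarrow> F y"
      using seq[OF y gpf acc] by blast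
    have "\<forall>\<^sub>F n in sequentially. dist (F (z n)) (F y) < \<epsilon> / 2" using z(2) e by (intro tendstoD) auto
    then obtain n where "dist (F (z n)) (F y) < \<epsilon> / 2" using eventually_happens'[OF sequentially_bot] by blast
    moreover have "\<epsilon> / 2 \<le> \<bar>F (z n) - F y\<bar>" using geq[of "z n"] z(1) by blast
    ultimately show False by (simp add: dist_real_def)
  qed
  then show "C \<in> R0 V" unfolding Cpq by (rule fn_eqI(1)[OF r _ Fq])
qed

end

theorem theorem3p5:
  fixes V :: "(real^'n) set"
  assumes "irreducible_alg V" and "nonsingular_alg V"
  shows "subst_formal_arcs V (R0 V) \<and> subst_puiseux_arcs V (R0 V) \<and>
         (\<forall>B. subring B (ratfun_ring V) \<and> coord_ring V \<subseteq> B \<and>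
              subst_formal_arcs V B \<and> subst_puiseux_arcs V B \<longrightarrow> B \<subseteq> R0 V)"
proof -
  interpret nonsingular_variety V "CARD('n) - alg_dim V"
    by unfold_locales (use assms in \<open>simp_all add: nonsingular_alg_def dim_span\<close>)
  show ?thesis using formal_arcs puiseux_arcs R0_maximal by blast
qed

end
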